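(* There is an absolute constant $C>0$ such that the following holds. For any $\mu>0$, $\delta\in(0,1)$ and integer $n\ge2$, let $s := \lceil C(\log n)^2(\log n+\log(1+\mu)+\log(1/\delta))\rceil$. There is an efficient (polynomial-time) randomized tester $T$, taking as input a vector $y\in\mathbb{N}^n$ (and the parameters $\mu,\delta,n$), such that: (i) if $y\sim\mathrm{Poi}(s\mu)^n$, then $T$ outputs accept with probability at least $1-\delta$; (ii) for any $\lambda_1,\dots,\lambda_n\ge0$ with $d_{TV}\big(\mathrm{Poi}(\mu)^n,\mathrm{Perm}(\mathrm{Poi}(\lambda_1),\dots,\mathrm{Poi}(\lambda_n))\big)\ge1/2$, if $y\sim\mathrm{Perm}(\mathrm{Poi}(s\lambda_1),\dots,\mathrm{Poi}(s\lambda_n))$, then $T$ outputs reject with probability at least $1-\delta$.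
   Context: $\mathrm{Poi}(\lambda)$ is the Poisson distribution with mean $\lambda$ on $\mathbb{N}=\{0,1,\dots\}$, and $\mathrm{Poi}(\lambda)^n$ is the product of $n$ independent copies. For distributions $\mathbf{p}_1,\dots,\mathbf{p}_n$, $\mathrm{Perm}(\mathbf{p}_1,\dots,\mathbf{p}_n)$ is the distribution of $(\mathbf{x}_1,\dots,\mathbf{x}_n)$ obtained by drawing a uniformly random permutation $(\mathbf{i}_1,\dots,\mathbf{i}_n)$ of $[n]$ and then independently sampling $\mathbf{x}_j\sim\mathbf{p}_{\mathbf{i}_j}$ for each $j\in[n]$. $d_{TV}(\mathbf{p},\mathbf{q})=\frac12\sum_x|\mathbf{p}(x)-\mathbf{q}(x)|$ is total variation distance. *)

theory Defs
  imports "HOL-Probability.Probability" "HOL-Library.Log_Nat" "HOL-Combinatorics.Permutations"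
begin

section \<open>Distributions\<close>

text \<open>The library constant \<^const>\<open>poisson_pmf\<close> is only specified for a positive rate; rate 0 is the
  point mass at 0.\<close>

definition Poi :: "real \<Rightarrow> nat pmf" where
  "Poi r = (if r > 0 then poisson_pmf r else return_pmf 0)"

lemma pmf_Poi: "r \<ge> 0 \<Longrightarrow> pmf (Poi r) k = r ^ k / fact k * exp (- r)"
  by (cases "r = 0"; cases k) (auto simp: Poi_def)

text \<open>A vector in \<open>\<nat>\<^sup>n\<close> is a function on \<^typ>\<open>nat\<close> that is 0 outside the index set \<^term>\<open>{..<n}\<close>.\<close>

definition Prod_dist :: "nat \<Rightarrow> (nat \<Rightarrow> nat pmf) \<Rightarrow> (nat \<Rightarrow> nat) pmf" where
  "Prod_dist n p = Pi_pmf {..<n} 0 p"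

definition Perm_dist :: "nat \<Rightarrow> (nat \<Rightarrow> nat pmf) \<Rightarrow> (nat \<Rightarrow> nat) pmf" where
  "Perm_dist n p =
     bind_pmf (pmf_of_set {\<pi>. \<pi> permutes {..<n}}) (\<lambda>\<pi>. Prod_dist n (\<lambda>j. p (\<pi> j)))"

definition d_TV :: "'a pmf \<Rightarrow> 'a pmf \<Rightarrow> real" where
  "d_TV p q = (1 / 2) * (\<Sum>\<^sub>\<infinity>x. \<bar>pmf p x - pmf q x\<bar>)"


section \<open>Randomized algorithms with logarithmic cost\<close>

text \<open>
  Polynomial time refers to a probabilistic random access machine, presented as a while language, with
  the logarithmic cost criterion: every operation on integers is charged the bit lengths of the
  integers involved, so that polynomial time is the same as on a Turing machine. The memory consists of
  integer arrays (a program mentions only finitely many names). Real numbers never occur as values. A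
  real parameter is presented through its binary expansion: \<open>Digits x e\<close> yields \<open>\<lfloor>2\<^sup>k x\<rfloor>\<close> for the value
  \<open>k\<close> of \<open>e\<close>, at a cost of at least \<open>k\<close>.
\<close>

type_synonym memory = "string \<Rightarrow> int \<Rightarrow> int"
type_synonym reals = "string \<Rightarrow> real"

datatype expr =
    Lit int
  | Cell string expr
  | Digits string expr
  | Plus expr expr
  | Minus expr expr
  | Times expr expr
  | Quot expr expr
  | Less expr expr

datatype prog =
    Skip
  | Store string expr expr  \<comment> \<open>array name, index, new value\<close>
  | Flip string expr        \<comment> \<open>store the outcome of a fair coin flip\<close>
  | Seq prog prog
  | Cond expr prog prog
  | Loop expr prog

primrec eval :: "reals \<Rightarrow> memory \<Rightarrow> expr \<Rightarrow> int" where
  "eval \<rho> \<sigma> (Lit z) = z"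
| "eval \<rho> \<sigma> (Cell x e) = \<sigma> x (eval \<rho> \<sigma> e)"
| "eval \<rho> \<sigma> (Digits x e) = \<lfloor>2 ^ nat (eval \<rho> \<sigma> e) * \<rho> x\<rfloor>"
| "eval \<rho> \<sigma> (Plus a b) = eval \<rho> \<sigma> a + eval \<rho> \<sigma> b"
| "eval \<rho> \<sigma> (Minus a b) = eval \<rho> \<sigma> a - eval \<rho> \<sigma> b"
| "eval \<rho> \<sigma> (Times a b) = eval \<rho> \<sigma> a * eval \<rho> \<sigma> b"
| "eval \<rho> \<sigma> (Quot a b) = eval \<rho> \<sigma> a div eval \<rho> \<sigma> b"
| "eval \<rho> \<sigma> (Less a b) = (if eval \<rho> \<sigma> a < eval \<rho> \<sigma> b then 1 else 0)"

definition bits :: "int \<Rightarrow> nat" where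
  "bits z = nat (bitlen \<bar>z\<bar>)"

primrec cost :: "reals \<Rightarrow> memory \<Rightarrow> expr \<Rightarrow> nat" where
  "cost \<rho> \<sigma> (Lit z) = 1 + bits z"
| "cost \<rho> \<sigma> (Cell x e) =
     cost \<rho> \<sigma> e + 1 + bits (eval \<rho> \<sigma> e) + bits (\<sigma> x (eval \<rho> \<sigma> e))"
| "cost \<rho> \<sigma> (Digits x e) =
     cost \<rho> \<sigma> e + 1 + bits (eval \<rho> \<sigma> e) + nat (eval \<rho> \<sigma> e) + bits (eval \<rho> \<sigma> (Digits x e))"
| "cost \<rho> \<sigma> (Plus a b) =
     cost \<rho> \<sigma> a + cost \<rho> \<sigma> b + 1 + bits (eval \<rho> \<sigma> a) + bits (eval \<rho> \<sigma> b)"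
| "cost \<rho> \<sigma> (Minus a b) =
     cost \<rho> \<sigma> a + cost \<rho> \<sigma> b + 1 + bits (eval \<rho> \<sigma> a) + bits (eval \<rho> \<sigma> b)"
| "cost \<rho> \<sigma> (Times a b) =
     cost \<rho> \<sigma> a + cost \<rho> \<sigma> b + 1 + bits (eval \<rho> \<sigma> a) + bits (eval \<rho> \<sigma> b)"
| "cost \<rho> \<sigma> (Quot a b) =
     cost \<rho> \<sigma> a + cost \<rho> \<sigma> b + 1 + bits (eval \<rho> \<sigma> a) + bits (eval \<rho> \<sigma> b)"
| "cost \<rho> \<sigma> (Less a b) =
     cost \<rho> \<sigma> a + cost \<rho> \<sigma> b + 1 + bits (eval \<rho> \<sigma> a) + bits (eval \<rho> \<sigma> b)"

definition upd :: "memory \<Rightarrow> string \<Rightarrow> int \<Rightarrow> int \<Rightarrow> memory" where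
  "upd \<sigma> x i z = \<sigma>(x := (\<sigma> x)(i := z))"

partial_function (spmf) while_spmf :: "('a \<Rightarrow> bool) \<Rightarrow> ('a \<Rightarrow> 'a spmf) \<Rightarrow> 'a \<Rightarrow> 'a spmf" where
  "while_spmf b f u = (if b u then bind_spmf (f u) (while_spmf b f) else return_spmf u)"

text \<open>A configuration is a memory with the time consumed so far; diverging runs account for the mass
  missing in the resulting subprobability distribution. In a loop, the last (failing) evaluation of
  the guard is charged upon exit.\<close>

primrec exec :: "reals \<Rightarrow> prog \<Rightarrow> memory \<times> nat \<Rightarrow> (memory \<times> nat) spmf" where
  "exec \<rho> Skip = (\<lambda>(\<sigma>, t). return_spmf (\<sigma>, t + 1))"
| "exec \<rho> (Store x i e) = (\<lambda>(\<sigma>, t). return_spmf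
     (upd \<sigma> x (eval \<rho> \<sigma> i) (eval \<rho> \<sigma> e),
      t + cost \<rho> \<sigma> i + cost \<rho> \<sigma> e + 1 + bits (eval \<rho> \<sigma> i) + bits (eval \<rho> \<sigma> e)))"
| "exec \<rho> (Flip x i) = (\<lambda>(\<sigma>, t). map_spmf
     (\<lambda>h. (upd \<sigma> x (eval \<rho> \<sigma> i) (if h then 1 else 0),
           t + cost \<rho> \<sigma> i + 1 + bits (eval \<rho> \<sigma> i)))
     (spmf_of_pmf (bernoulli_pmf (1 / 2))))"
| "exec \<rho> (Seq p q) = (\<lambda>u. bind_spmf (exec \<rho> p u) (exec \<rho> q))"
| "exec \<rho> (Cond e p q) = (\<lambda>(\<sigma>, t).
     if eval \<rho> \<sigma> e \<noteq> 0 then exec \<rho> p (\<sigma>, t + 1 + cost \<rho> \<sigma> e)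
     else exec \<rho> q (\<sigma>, t + 1 + cost \<rho> \<sigma> e))"
| "exec \<rho> (Loop e p) = (\<lambda>u. map_spmf (\<lambda>(\<sigma>, t). (\<sigma>, t + 1 + cost \<rho> \<sigma> e))
     (while_spmf (\<lambda>(\<sigma>, t). eval \<rho> \<sigma> e \<noteq> 0)
        (\<lambda>(\<sigma>, t). exec \<rho> p (\<sigma>, t + 1 + cost \<rho> \<sigma> e)) u))"


section \<open>Testers\<close>

text \<open>
  The number \<open>s\<close> is determined by \<open>\<mu>\<close>, \<open>\<delta>\<close>, \<open>n\<close> and the absolute constant, but being the ceiling of a
  real number, it depends discontinuously on \<open>\<mu>\<close> and \<open>\<delta>\<close> and cannot be computed in general from finitely many
  of their binary digits. Therefore it is part of the input (but not of \<open>input_size\<close> below).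
\<close>

definition input_reals :: "real \<Rightarrow> real \<Rightarrow> reals" where
  "input_reals \<mu> \<delta> = (\<lambda>_. 0)(''mu'' := \<mu>, ''delta'' := \<delta>)"

definition input_memory :: "nat \<Rightarrow> nat \<Rightarrow> (nat \<Rightarrow> nat) \<Rightarrow> memory" where
  "input_memory n s y = (\<lambda>_ _. 0)
     (''n'' := (\<lambda>_. 0)(0 := int n),
      ''s'' := (\<lambda>_. 0)(0 := int s),
      ''y'' := (\<lambda>i. if 0 \<le> i \<and> i < int n then int (y (nat i)) else 0))"

definition run :: "prog \<Rightarrow> real \<Rightarrow> real \<Rightarrow> nat \<Rightarrow> nat \<Rightarrow> (nat \<Rightarrow> nat) \<Rightarrow> (memory \<times> nat) spmf" where
  "run T \<mu> \<delta> n s y = exec (input_reals \<mu> \<delta>) T (input_memory n s y, 0)"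

text \<open>Worst-case time bound over all outcomes of the coin flips.\<close>

definition runs_within ::
    "prog \<Rightarrow> real \<Rightarrow> real \<Rightarrow> nat \<Rightarrow> nat \<Rightarrow> (nat \<Rightarrow> nat) \<Rightarrow> real \<Rightarrow> bool" where
  "runs_within T \<mu> \<delta> n s y B \<longleftrightarrow>
     lossless_spmf (run T \<mu> \<delta> n s y) \<and> (\<forall>(\<sigma>, t) \<in> set_spmf (run T \<mu> \<delta> n s y). real t \<le> B)"

definition input_size :: "real \<Rightarrow> real \<Rightarrow> nat \<Rightarrow> (nat \<Rightarrow> nat) \<Rightarrow> real" where
  "input_size \<mu> \<delta> n y = real n + (\<Sum>i<n. real (bits (int (y i)))) + log 2 (1 + \<mu>) + log 2 (1 / \<delta>)"

text \<open>The answer is \<^const>\<open>True\<close> for accept and \<^const>\<open>False\<close> for reject.\<close>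

definition answer :: "prog \<Rightarrow> real \<Rightarrow> real \<Rightarrow> nat \<Rightarrow> nat \<Rightarrow> (nat \<Rightarrow> nat) \<Rightarrow> bool spmf" where
  "answer T \<mu> \<delta> n s y = map_spmf (\<lambda>(\<sigma>, t). \<sigma> ''accept'' 0 \<noteq> 0) (run T \<mu> \<delta> n s y)"

definition answer_on ::
    "prog \<Rightarrow> real \<Rightarrow> real \<Rightarrow> nat \<Rightarrow> nat \<Rightarrow> (nat \<Rightarrow> nat) pmf \<Rightarrow> bool spmf" where
  "answer_on T \<mu> \<delta> n s D = bind_spmf (spmf_of_pmf D) (answer T \<mu> \<delta> n s)"

end

theory Submission
  imports Defs
begin

text \<open>The tester is deterministic. With \<open>\<eta>\<close> of order \<open>1 / (log n)\<^sup>2\<close>, it first checks that every \<open>y j / s\<close>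
  is within about \<open>sqrt (\<mu> \<eta>) + \<eta>\<close> of \<open>\<mu>\<close>. If \<open>\<mu>\<close> is large compared with \<open>\<eta>\<close>, it then compares the sum of
  the counts and the sum of their second Charlier polynomials, an unbiased estimate of the sum of
  \<open>(\<lambda>\<^sub>j - \<mu>)\<^sup>2\<close>, with their values for \<open>\<mu>\<close>. Otherwise it thins each count by \<open>1 / s\<close>, in conditional
  expectation, to estimate without bias the expected number of coordinates equal to \<open>x\<close>, for all \<open>x\<close> up to
  \<open>log n\<close>. Since \<open>s \<eta>\<close> exceeds \<open>log n + log (1 / \<delta>)\<close>, Chernoff bounds show that the null hypothesis
  passes, and that rates which pass with probability above \<open>\<delta>\<close> have moments close to those of \<open>\<mu>\<close>.

  Such rates cannot be far from \<open>\<mu>\<close> in total variation. By the chain rule for relative entropy, bounded by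
  the chi-square divergence at every step, revealing a random permutation coordinate by coordinate costs
  the divergence of the mixture of the unused distributions. On average over the unused set, this splits
  into \<open>n\<close> times the divergence of the overall mixture, which the moments control, and a harmonic sum of
  order \<open>log n\<close> times the mean divergence of a single distribution, which the coordinatewise test
  controls.\<close>

section \<open>Expectations under products and random permutations\<close>

text \<open>The two regimes come from the choice of the reference measure. Relative to
  \<open>Poi \<mu>\<close> the densities of two Poisson laws of rates a and b have inner product exp
  ((a - \<mu>) (b - \<mu>) / \<mu>), which is close to 1 only while the rates are within a small
  multiple of sqrt \<mu> of \<mu>. The coordinatewise test guarantees this if \<mu> is large
  compared with \<eta>. Otherwise it still forces all rates to be of order \<eta>, so that the mass
  at x decays like a power of \<eta> and about log n degrees suffice. For small rates the expected
  counts are normalized by the expected number of zeros. This keeps exp (- \<mu>) out of the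
  statistics, which become rational in the approximate rate and can be compared by integer
  arithmetic. The price is that the deviations of up to log n degrees, each of size sqrt (n \<eta>),
  add up in the normalization; their squared sum divided by n is (log n)^2 \<eta>, hence the size of
  \<eta>. The product s \<eta> is the exponent of every Chernoff bound; it has to pay for a union
  bound over O(n) events and for \<delta>.\<close>

lemma expectation_bind_pmf_bounded:
  fixes f :: "'a \<Rightarrow> real"
  assumes "\<And>x. \<bar>f x\<bar> \<le> B"
  shows "measure_pmf.expectation (bind_pmf p q) f
       = measure_pmf.expectation p (\<lambda>x. measure_pmf.expectation (q x) f)"
  unfolding measure_pmf_bind
  by (rule integral_bind[where K = "count_space UNIV" and B = B and B' = 1])
     (use assms in \<open>auto simp: measure_pmf.emeasure_space_1 measure_pmf_in_subprob_algebra\<close>)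

lemma integrable_pmf_bounded:
  fixes f :: "'a \<Rightarrow> real"
  assumes "\<And>x. \<bar>f x\<bar> \<le> B"
  shows "integrable (measure_pmf p) f"
  by (rule measure_pmf.integrable_const_bound[of _ B]) (use assms in auto)

lemma abs_expectation_pmf_le:
  fixes f :: "'a \<Rightarrow> real"
  assumes "\<And>x. \<bar>f x\<bar> \<le> B"
  shows "\<bar>measure_pmf.expectation p f\<bar> \<le> B"
proof -
  have "\<bar>measure_pmf.expectation p f\<bar> \<le> measure_pmf.expectation p (\<lambda>x. \<bar>f x\<bar>)"
    by (rule integral_abs_bound)
  also have "\<dots> \<le> measure_pmf.expectation p (\<lambda>x. B)"
    by (intro integral_mono integrable_pmf_bounded[where B = "\<bar>B\<bar>"])
        (use order_trans[OF assms abs_ge_self] assms in auto)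
  finally show ?thesis by simp
qed

lemma expectation_Prod_dist_Suc:
  fixes f :: "(nat \<Rightarrow> nat) \<Rightarrow> real"
  assumes "\<And>x. \<bar>f x\<bar> \<le> B"
  shows "measure_pmf.expectation (Prod_dist (Suc n) p) f =
    measure_pmf.expectation (p n) (\<lambda>z. measure_pmf.expectation (Prod_dist n p) (\<lambda>y. f (y(n := z))))"
proof -
  have "Prod_dist (Suc n) p =
      bind_pmf (p n) (\<lambda>z. bind_pmf (Prod_dist n p) (\<lambda>y. return_pmf (y(n := z))))"
    unfolding Prod_dist_def lessThan_Suc by (rule Pi_pmf_insert') auto
  also have "measure_pmf.expectation \<dots> f =
      measure_pmf.expectation (p n) (\<lambda>z. measure_pmf.expectation
          (bind_pmf (Prod_dist n p) (\<lambda>y. return_pmf (y(n := z)))) f)"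
    by (rule expectation_bind_pmf_bounded[OF assms])
  also have "\<dots> = measure_pmf.expectation (p n) (\<lambda>z. measure_pmf.expectation (Prod_dist n p)
      (\<lambda>y. f (y(n := z))))"
    by (subst expectation_bind_pmf_bounded[OF assms]) simp
  finally show ?thesis .
qed

lemma Prod_dist_cong: "(\<And>i. i < n \<Longrightarrow> p i = q i) \<Longrightarrow> Prod_dist n p = Prod_dist n q"
  unfolding Prod_dist_def by (rule Pi_pmf_cong) auto

lemma finite_permutes_lessThan: "finite {\<pi>. \<pi> permutes {..<n::nat}}"
  by (simp add: finite_permutations)

lemma expectation_Perm_dist:
  fixes f :: "(nat \<Rightarrow> nat) \<Rightarrow> real"
  assumes "\<And>x. \<bar>f x\<bar> \<le> B"
  shows "measure_pmf.expectation (Perm_dist n p) f =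
    (\<Sum>\<pi> | \<pi> permutes {..<n}. measure_pmf.expectation (Prod_dist n (\<lambda>j. p (\<pi> j))) f) / fact n"
  unfolding Perm_dist_def
  by (subst expectation_bind_pmf_bounded[OF assms], subst integral_pmf_of_set)
     (auto simp: finite_permutes_lessThan card_permutations intro!: exI[of _ id] permutes_id)

text \<open>The last coordinate is drawn from a uniformly random \<open>p b\<close>, the others form a random permutation of
  the remaining distributions, which the transposition moves to the indices below \<open>n\<close>.\<close>

lemma expectation_Perm_dist_Suc:
  fixes f :: "(nat \<Rightarrow> nat) \<Rightarrow> real"
  assumes "\<And>x. \<bar>f x\<bar> \<le> B"
  shows "measure_pmf.expectation (Perm_dist (Suc n) p) f =
    (\<Sum>b\<le>n. measure_pmf.expectation (p b)
       (\<lambda>z. measure_pmf.expectation (Perm_dist n (p \<circ> Transposition.transpose n b)) (\<lambda>y. f (y(n := z))))) /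
           Suc n"
proof -
  define h where "h = (\<lambda>\<pi>. measure_pmf.expectation (Prod_dist (Suc n) (\<lambda>j. p (\<pi> j))) f)"
  have "measure_pmf.expectation (Perm_dist (Suc n) p) f = (\<Sum>\<pi> | \<pi> permutes {..<Suc n}. h \<pi>) / fact (Suc n)"
    unfolding h_def by (rule expectation_Perm_dist[OF assms])
  also have "(\<Sum>\<pi> | \<pi> permutes {..<Suc n}. h \<pi>) =
      (\<Sum>b\<in>insert n {..<n}. \<Sum>q | q permutes {..<n}. h (Transposition.transpose n b \<circ> q))"
    unfolding lessThan_Suc by (rule sum_over_permutations_insert) auto
  also have "insert n {..<n} = {..n}" by auto
  also have "(\<Sum>b\<le>n. \<Sum>q | q permutes {..<n}. h (Transposition.transpose n b \<circ> q)) =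
    (\<Sum>b\<le>n. fact n * measure_pmf.expectation (p b)
       (\<lambda>z. measure_pmf.expectation (Perm_dist n (p \<circ> Transposition.transpose n b)) (\<lambda>y. f (y(n := z)))))"
  proof (rule sum.cong[OF refl])
    fix b assume "b \<in> {..n}"
    have bd: "\<bar>measure_pmf.expectation r (\<lambda>y. f (y(n := z)))\<bar> \<le> B" for r z
      by (rule abs_expectation_pmf_le) (rule assms)
    have "h (Transposition.transpose n b \<circ> q) = measure_pmf.expectation (p b)
        (\<lambda>z. measure_pmf.expectation (Prod_dist n (\<lambda>j. (p \<circ> Transposition.transpose n b) (q j)))
        (\<lambda>y. f (y(n := z))))"
      if "q permutes {..<n}" for q
    proof -
      have "q n = n" using that by (simp add: permutes_def)
      then show ?thesis unfolding h_def by (subst expectation_Prod_dist_Suc[OF assms]) (simp add: o_def)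
    qed
    then have "(\<Sum>q | q permutes {..<n}. h (Transposition.transpose n b \<circ> q)) =
        (\<Sum>q | q permutes {..<n}. measure_pmf.expectation (p b)
            (\<lambda>z. measure_pmf.expectation (Prod_dist n (\<lambda>j. (p \<circ> Transposition.transpose n b) (q j)))
            (\<lambda>y. f (y(n := z)))))"
      by (intro sum.cong) auto
    also have "\<dots> = measure_pmf.expectation (p b) (\<lambda>z. \<Sum>q | q permutes {..<n}. measure_pmf.expectation
        (Prod_dist n (\<lambda>j. (p \<circ> Transposition.transpose n b) (q j))) (\<lambda>y. f (y(n := z))))"
      by (subst Bochner_Integration.integral_sum) (auto intro!: integrable_pmf_bounded bd)
    also have "\<dots> = measure_pmf.expectation (p b) (\<lambda>z. fact n * measure_pmf.expectation
        (Perm_dist n (p \<circ> Transposition.transpose n b)) (\<lambda>y. f (y(n := z))))"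
      by (subst expectation_Perm_dist[where B = B]) (auto simp: assms)
    finally show "(\<Sum>q | q permutes {..<n}. h (Transposition.transpose n b \<circ> q)) =
      fact n * measure_pmf.expectation (p b)
       (\<lambda>z. measure_pmf.expectation (Perm_dist n (p \<circ> Transposition.transpose n b)) (\<lambda>y. f (y(n := z))))"
      by simp
  qed
  also have "\<dots> / fact (Suc n) = (\<Sum>b\<le>n. measure_pmf.expectation (p b)
       (\<lambda>z. measure_pmf.expectation (Perm_dist n (p \<circ> Transposition.transpose n b)) (\<lambda>y. f (y(n := z))))) /
           Suc n"
    by (simp add: sum_distrib_left[symmetric] field_simps del: of_nat_Suc)
  finally show ?thesis .
qed

section \<open>Relative entropy of a random permutation\<close>

text \<open>Young's inequality \<open>r * h \<le> exp h - r + r * ln r\<close>, weakened by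
  \<open>ln r \<le> r - 1\<close>. This last step is what replaces entropy by chi-square.\<close>

lemma mult_le_exp_plus_square:
  fixes r h :: real
  assumes "r \<ge> 0"
  shows "r * h \<le> exp h - 2 * r + r\<^sup>2"
proof (cases "r = 0")
  case False
  then have r: "r > 0" using assms by simp
  have "1 + (h - ln r) \<le> exp (h - ln r)" by (rule exp_ge_add_one_self)
  also have "\<dots> = exp h / r" using r by (simp add: exp_diff)
  finally have "h \<le> exp h / r - 1 + ln r" by simp
  also have "\<dots> \<le> exp h / r - 1 + (r - 1)" using ln_le_minus_one[OF r] by simp
  finally have "r * h \<le> r * (exp h / r - 1 + (r - 1))" using r by (intro mult_left_mono) auto
  also have "\<dots> = exp h - 2 * r + r\<^sup>2" using r by (simp add: field_simps power2_eq_square)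
  finally show ?thesis .
qed auto

lemma expectation_exp_pos:
  fixes h :: "'a \<Rightarrow> real"
  assumes "\<And>x. \<bar>h x\<bar> \<le> B"
  shows "exp (- B) \<le> measure_pmf.expectation q (\<lambda>x. exp (h x))"
    and "measure_pmf.expectation q (\<lambda>x. exp (h x)) \<le> exp B"
    and "0 < measure_pmf.expectation q (\<lambda>x. exp (h x))"
    and "\<bar>ln (measure_pmf.expectation q (\<lambda>x. exp (h x)))\<bar> \<le> B"
    and "integrable (measure_pmf q) (\<lambda>x. exp (h x))"
proof -
  have b: "- B \<le> h x" "h x \<le> B" for x using assms[of x] by auto
  show i: "integrable (measure_pmf q) (\<lambda>x. exp (h x))"
    by (rule integrable_pmf_bounded[of _ "exp B"]) (use b in auto)
  have "measure_pmf.expectation q (\<lambda>x. exp (- B)) \<le> measure_pmf.expectation q (\<lambda>x. exp (h x))"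
    by (rule integral_mono) (use i b in auto)
  then show 1: "exp (- B) \<le> measure_pmf.expectation q (\<lambda>x. exp (h x))" by simp
  have "measure_pmf.expectation q (\<lambda>x. exp (h x)) \<le> measure_pmf.expectation q (\<lambda>x. exp B)"
    by (rule integral_mono) (use i b in auto)
  then show 2: "measure_pmf.expectation q (\<lambda>x. exp (h x)) \<le> exp B" by simp
  show 3: "0 < measure_pmf.expectation q (\<lambda>x. exp (h x))"
    using 1 exp_gt_zero[of "-B"] by linarith
  have "ln (exp (- B)) \<le> ln (measure_pmf.expectation q (\<lambda>x. exp (h x)))"
    using 1 3 by (subst ln_le_cancel_iff) auto
  moreover have "ln (measure_pmf.expectation q (\<lambda>x. exp (h x))) \<le> ln (exp B)"
    using 2 3 by (subst ln_le_cancel_iff) auto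
  ultimately show "\<bar>ln (measure_pmf.expectation q (\<lambda>x. exp (h x)))\<bar> \<le> B" by simp
qed

text \<open>The Donsker--Varadhan inequality for a density \<open>R\<close> with respect to \<open>q\<close>, with the relative entropy
  replaced by the larger chi-square divergence.\<close>

lemma expectation_density_le:
  fixes h R :: "'a \<Rightarrow> real"
  assumes h: "\<And>x. \<bar>h x\<bar> \<le> B" and R: "\<And>x. R x \<ge> 0"
    and i: "integrable (measure_pmf q) R" "integrable (measure_pmf q) (\<lambda>x. (R x)\<^sup>2)"
    and one: "measure_pmf.expectation q R = 1"
  shows "measure_pmf.expectation q (\<lambda>x. R x * h x)
    \<le> ln (measure_pmf.expectation q (\<lambda>x. exp (h x))) + measure_pmf.expectation q (\<lambda>x. (R x)\<^sup>2) - 1"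
proof -
  define Z where "Z = measure_pmf.expectation q (\<lambda>x. exp (h x))"
  note e = expectation_exp_pos[where h = h and q = q, OF h]
  have Z: "Z > 0" using e(3) by (simp add: Z_def)
  have iRh: "integrable (measure_pmf q) (\<lambda>x. R x * h x)"
  proof (rule Bochner_Integration.integrable_bound[of _ "\<lambda>x. B * R x"])
    show "AE x in measure_pmf q. norm (R x * h x) \<le> norm (B * R x)"
    proof (rule AE_I2)
      fix x
      have "\<bar>h x\<bar> \<le> \<bar>B\<bar>" using h[of x] by linarith
      then have "R x * \<bar>h x\<bar> \<le> R x * \<bar>B\<bar>" using R[of x] by (intro mult_left_mono) auto
      then show "norm (R x * h x) \<le> norm (B * R x)" using R[of x] by (simp add: abs_mult mult.commute)
    qed
  qed (use i in auto)
  \<comment> \<open>Shifting \<open>h\<close> by \<open>ln Z\<close> gives its exponential mean 1;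
    as \<open>R\<close> has mean 1, the shift contributes exactly \<open>ln Z\<close>.\<close>
  have "measure_pmf.expectation q (\<lambda>x. R x * h x - ln Z * R x)
      \<le> measure_pmf.expectation q (\<lambda>x. exp (h x) / Z - 2 * R x + (R x)\<^sup>2)"
  proof (rule integral_mono)
    show "integrable (measure_pmf q) (\<lambda>x. R x * h x - ln Z * R x)" using iRh i by auto
    show "integrable (measure_pmf q) (\<lambda>x. exp (h x) / Z - 2 * R x + (R x)\<^sup>2)" using e(5) i by auto
    fix x
    show "R x * h x - ln Z * R x \<le> exp (h x) / Z - 2 * R x + (R x)\<^sup>2"
      using mult_le_exp_plus_square[OF R[of x], of "h x - ln Z"] Z by (simp add: exp_diff algebra_simps)
  qed
  also have "\<dots> = 1 - 2 + measure_pmf.expectation q (\<lambda>x. (R x)\<^sup>2)"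
    using e(5) i one Z by (simp add: Z_def)
  finally show ?thesis using iRh i one by (simp add: Z_def)
qed

text \<open>If the coordinates of a random permutation are revealed one by one, then the step with \<open>k\<close> unused
  distributions draws from the uniform mixture over a random \<open>k\<close>-subset \<open>S\<close>. For densities \<open>r i\<close> and
  \<open>g i j\<close> the mean of \<open>r i * r j\<close>, the chi-square divergence of this mixture is
  \<open>(\<Sum>i\<in>S. \<Sum>j\<in>S. g i j) / k\<^sup>2 - 1\<close>. Its average over \<open>S\<close>, summed over \<open>k\<close>, gives the following formula.\<close>

definition perm_divergence :: "nat \<Rightarrow> (nat \<Rightarrow> nat \<Rightarrow> real) \<Rightarrow> real" where
  "perm_divergence n g =
     harm n * (\<Sum>i<n. g i i) / n
     + (n - harm n) * ((\<Sum>i<n. \<Sum>j<n. g i j) - (\<Sum>i<n. g i i)) / (real n * (real n - 1)) - n"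

lemma bij_betw_transpose_lessThan:
  assumes "b \<le> (n::nat)"
  shows "bij_betw (Transposition.transpose n b) {..<n} ({..n} - {b})"
proof -
  have "bij_betw (Transposition.transpose n b) {..n} {..n}"
    using assms by (intro permutes_imp_bij permutes_swap_id) auto
  then have "bij_betw (Transposition.transpose n b) ({..n} - {n}) ({..n} - {b})"
    using assms by (intro bij_betw_DiffI) (auto simp: bij_betw_def)
  moreover have "{..n} - {n} = {..<n}" by auto
  ultimately show ?thesis by simp
qed

text \<open>The recursion of the chain rule: the first revealed coordinate costs the divergence of
  the full mixture, and then a uniformly chosen \<open>b\<close> is removed. Summed over
  \<open>b\<close>, each diagonal entry survives \<open>n\<close> times and each off-diagonal entry
  \<open>n - 1\<close> times, which is what the two coefficients of the closed form
  reproduce.\<close>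

lemma perm_divergence_Suc:
  "(\<Sum>b\<le>n. perm_divergence n (\<lambda>i j. g (Transposition.transpose n b i) (Transposition.transpose n b j))) / Suc n
     + (\<Sum>i\<le>n. \<Sum>j\<le>n. g i j) / (Suc n)\<^sup>2 - 1 = perm_divergence (Suc n) g"
proof -
  define T where "T = (\<Sum>i\<le>n. g i i)"
  define TT where "TT = (\<Sum>i\<le>n. \<Sum>j\<le>n. g i j)"
  define D where "D = (\<lambda>b. \<Sum>i<n. g (Transposition.transpose n b i) (Transposition.transpose n b i))"
  define E where "E = (\<lambda>b. \<Sum>i<n. \<Sum>j<n. g (Transposition.transpose n b i) (Transposition.transpose n b j))"
  have D: "D b = T - g b b" if "b \<le> n" for b
  proof -
    have "D b = (\<Sum>i\<in>{..n} - {b}. g i i)"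
      unfolding D_def by (rule sum.reindex_bij_betw[OF bij_betw_transpose_lessThan[OF that], of "\<lambda>i. g i i"])
    then show ?thesis using that by (simp add: T_def sum_diff1)
  qed
  have E: "E b = TT - (\<Sum>j\<le>n. g b j) - (\<Sum>i\<le>n. g i b) + g b b" if "b \<le> n" for b
  proof -
    have "E b = (\<Sum>i<n. \<Sum>j\<in>{..n} - {b}. g (Transposition.transpose n b i) j)"
      unfolding E_def
      by (intro sum.cong refl sum.reindex_bij_betw[OF bij_betw_transpose_lessThan[OF that]])
    also have "\<dots> = (\<Sum>i\<in>{..n} - {b}. \<Sum>j\<in>{..n} - {b}. g i j)"
      by (rule sum.reindex_bij_betw[OF bij_betw_transpose_lessThan[OF that], of "\<lambda>i. \<Sum>j\<in>{..n} - {b}. g i j"])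
    also have "\<dots> = TT - (\<Sum>j\<le>n. g b j) - (\<Sum>i\<le>n. g i b) + g b b"
      using that by (simp add: TT_def sum_diff1 sum_subtractf)
    finally show ?thesis .
  qed
  have SD: "(\<Sum>b\<le>n. D b) = n * T"
  proof -
    have "(\<Sum>b\<le>n. D b) = (\<Sum>b\<le>n. T - g b b)" using D by (intro sum.cong) auto
    also have "\<dots> = n * T" by (simp add: sum_subtractf T_def[symmetric] algebra_simps)
    finally show ?thesis .
  qed
  have SE: "(\<Sum>b\<le>n. E b) = (real n - 1) * TT + T"
  proof -
    have "(\<Sum>b\<le>n. E b) = (\<Sum>b\<le>n. TT - (\<Sum>j\<le>n. g b j) - (\<Sum>i\<le>n. g i b) + g b b)" using E by simp
    also have "\<dots> = (Suc n) * TT - TT - (\<Sum>b\<le>n. \<Sum>i\<le>n. g i b) + T"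
      by (simp add: sum_subtractf sum.distrib TT_def T_def)
    also have "(\<Sum>b\<le>n. \<Sum>i\<le>n. g i b) = TT" unfolding TT_def by (rule sum.swap)
    finally show ?thesis by (simp add: algebra_simps)
  qed
  have "(\<Sum>b\<le>n. perm_divergence n (\<lambda>i j. g (Transposition.transpose n b i) (Transposition.transpose n b j)))
    = (\<Sum>b\<le>n. harm n * D b / n + (n - harm n) * (E b - D b) / (real n * (real n - 1)) - n)"
    by (simp add: perm_divergence_def D_def E_def)
  also have "\<dots> = harm n * (\<Sum>b\<le>n. D b) / n + (n - harm n) * ((\<Sum>b\<le>n. E b) - (\<Sum>b\<le>n. D b)) /
      (real n * (real n - 1)) - Suc n * n"
    by (simp add: sum_subtractf sum.distrib flip: sum_distrib_left sum_divide_distrib) (simp add: algebra_simps)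
  also have "\<dots> = harm n * (n * T) / n + (n - harm n) * ((real n - 1) * (TT - T)) / (real n * (real n - 1))
      - Suc n * n"
    unfolding SD SE by (simp add: algebra_simps)
  finally have L: "(\<Sum>b\<le>n. perm_divergence n (\<lambda>i j. g (Transposition.transpose n b i)
      (Transposition.transpose n b j)))
    = harm n * (n * T) / n + (n - harm n) * ((real n - 1) * (TT - T)) / (real n * (real n - 1)) - Suc n * n" .
  have R: "perm_divergence (Suc n) g = harm (Suc n) * T / Suc n
      + (Suc n - harm (Suc n)) * (TT - T) / (Suc n * (real (Suc n) - 1)) - Suc n"
    unfolding perm_divergence_def T_def TT_def lessThan_Suc_atMost by simp
  have h: "harm (Suc n) = harm n + 1 / (real n + 1)" by (simp add: harm_Suc inverse_eq_divide add.commute)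
  \<comment> \<open>The closed form divides by \<open>n\<close> and \<open>n - 1\<close>. In the
    first two cases the value 0 of a division by 0 happens to be the right one.\<close>
  consider "n = 0" | "n = 1" | "n \<ge> 2" by linarith
  then show ?thesis
  proof cases
    case 1
    then show ?thesis unfolding L R TT_def[symmetric] by (simp add: harm_def T_def TT_def)
  next
    case 2
    then show ?thesis unfolding L R TT_def[symmetric] by (simp add: harm_def field_simps)
  next
    case 3
    then have x: "real n \<noteq> 0" "real n - 1 \<noteq> 0" "real n + 1 \<noteq> 0" by auto
    define W where "W = TT - T"
    have c: "harm n * (n * T) / n = harm n * T"
      "(n - harm n) * ((real n - 1) * W) / (real n * (real n - 1)) = (n - harm n) * W / real n"
      using x by simp_all
    have "(harm n * T + (n - harm n) * W / real n - (real n + 1) * n) / (real n + 1)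
        + (T + W) / (real n + 1)\<^sup>2 - 1
      = (harm n + 1 / (real n + 1)) * T / (real n + 1) + (real n + 1 - (harm n + 1 / (real n + 1))) * W /
          ((real n + 1) * real n) - (real n + 1)"
      using x(1,3) by (simp add: divide_simps power2_eq_square) (simp add: algebra_simps)
    then show ?thesis unfolding L R TT_def[symmetric] h W_def[symmetric] c
      by (simp add: W_def add.commute distrib_right)
  qed
qed

text \<open>The chain rule in dual form, by induction on the number of coordinates: relative entropy
  appears only through bounded test functions \<open>f\<close>. The last coordinate has the averaged
  density \<open>R\<close> relative to \<open>q\<close>, and the remaining ones are handled by the
  induction hypothesis for each removed distribution.\<close>

lemma expectation_Perm_dist_le:
  fixes f :: "(nat \<Rightarrow> nat) \<Rightarrow> real" and q :: "nat pmf" and p :: "nat \<Rightarrow> nat pmf" and r :: "nat \<Rightarrow> nat \<Rightarrow> real"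
  assumes f: "\<And>x. \<bar>f x\<bar> \<le> B"
    and r: "\<And>i x. r i x \<ge> 0"
    and dens: "\<And>i h b. (\<And>x. \<bar>h x\<bar> \<le> b) \<Longrightarrow>
      measure_pmf.expectation (p i) h = measure_pmf.expectation q (\<lambda>x. r i x * h x :: real)"
    and i1: "\<And>i. integrable (measure_pmf q) (r i)"
    and i2: "\<And>i j. integrable (measure_pmf q) (\<lambda>x. r i x * r j x)"
  shows "measure_pmf.expectation (Perm_dist n p) f
    \<le> perm_divergence n (\<lambda>i j. measure_pmf.expectation q (\<lambda>x. r i x * r j x))
      + ln (measure_pmf.expectation (Prod_dist n (\<lambda>_. q)) (\<lambda>y. exp (f y)))"
  using f r dens i1 i2
proof (induction n arbitrary: f p r)
  case 0
  have "measure_pmf.expectation (Perm_dist 0 p) f = f (\<lambda>_. 0)"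
    by (subst expectation_Perm_dist[OF "0.prems"(1)]) (simp add: Prod_dist_def)
  then show ?case by (simp add: perm_divergence_def Prod_dist_def)
next
  case (Suc n)
  note prems = Suc.prems
  define g where "g = (\<lambda>i j. measure_pmf.expectation q (\<lambda>x. r i x * r j x))"
  define \<tau> where "\<tau> = (\<lambda>b. Transposition.transpose n b)"
  \<comment> \<open>The log-partition function of the coordinates below \<open>n\<close> given the
    last value. It inherits the bound \<open>B\<close>, so it is again a valid test function, and
    the mean of \<open>exp (H z)\<close> under \<open>q\<close> is the partition function of all
    coordinates.\<close>
  define H where "H = (\<lambda>z. ln (measure_pmf.expectation (Prod_dist n (\<lambda>_. q)) (\<lambda>y. exp (f (y(n := z))))))"
  have Hb: "\<bar>H z\<bar> \<le> B" for z
    unfolding H_def by (rule expectation_exp_pos(4)) (rule prems(1))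
  have IH: "measure_pmf.expectation (Perm_dist n (p \<circ> \<tau> b)) (\<lambda>y. f (y(n := z)))
      \<le> perm_divergence n (\<lambda>i j. g (\<tau> b i) (\<tau> b j)) + H z" for b z
    unfolding H_def g_def
    by (rule Suc.IH[of "\<lambda>y. f (y(n := z))" "\<lambda>i. r (\<tau> b i)" "p \<circ> \<tau> b"])
       (auto simp only: o_def intro!: prems(1,2,4,5), rule prems(3))
  have Eb: "\<bar>measure_pmf.expectation (Perm_dist n (p \<circ> \<tau> b)) (\<lambda>y. f (y(n := z)))\<bar> \<le> B" for b z
    by (rule abs_expectation_pmf_le) (rule prems(1))
  have one: "measure_pmf.expectation q (r i) = 1" for i
    using prems(3)[of "\<lambda>_. 1" 1 i] by simp
  define R where "R = (\<lambda>x. (\<Sum>b\<le>n. r b x) / Suc n)"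
  have irH: "integrable (measure_pmf q) (\<lambda>x. r b x * H x)" for b
  proof (rule Bochner_Integration.integrable_bound[of _ "\<lambda>x. B * r b x"])
    show "AE x in measure_pmf q. norm (r b x * H x) \<le> norm (B * r b x)"
    proof (rule AE_I2)
      fix x
      have "\<bar>H x\<bar> \<le> \<bar>B\<bar>" using Hb[of x] by linarith
      then have "r b x * \<bar>H x\<bar> \<le> r b x * \<bar>B\<bar>" using prems(2)[of b x] by (intro mult_left_mono) auto
      then show "norm (r b x * H x) \<le> norm (B * r b x)" using prems(2)[of b x]
          by (simp add: abs_mult mult.commute)
    qed
  qed (use prems in auto)
  have "measure_pmf.expectation (Perm_dist (Suc n) p) f =
      (\<Sum>b\<le>n. measure_pmf.expectation (p b)
         (\<lambda>z. measure_pmf.expectation (Perm_dist n (p \<circ> \<tau> b)) (\<lambda>y. f (y(n := z))))) / Suc n"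
    unfolding \<tau>_def by (rule expectation_Perm_dist_Suc[OF prems(1)])
  also have "\<dots> \<le> (\<Sum>b\<le>n. perm_divergence n (\<lambda>i j. g (\<tau> b i) (\<tau> b j)) + measure_pmf.expectation (p b) H) / Suc n"
  proof (intro divide_right_mono sum_mono)
    fix b
    have "measure_pmf.expectation (p b) (\<lambda>z. measure_pmf.expectation (Perm_dist n (p \<circ> \<tau> b))
        (\<lambda>y. f (y(n := z))))
      \<le> measure_pmf.expectation (p b) (\<lambda>z. perm_divergence n (\<lambda>i j. g (\<tau> b i) (\<tau> b j)) + H z)"
      by (rule integral_mono)
         (auto intro!: integrable_pmf_bounded[OF Eb] IH integrable_pmf_bounded[OF Hb]
             Bochner_Integration.integrable_add)
    also have "\<dots> = perm_divergence n (\<lambda>i j. g (\<tau> b i) (\<tau> b j)) + measure_pmf.expectation (p b) H"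
      by (subst Bochner_Integration.integral_add) (auto intro!: integrable_pmf_bounded[OF Hb])
    finally show "measure_pmf.expectation (p b) (\<lambda>z. measure_pmf.expectation (Perm_dist n (p \<circ> \<tau> b))
        (\<lambda>y. f (y(n := z))))
      \<le> perm_divergence n (\<lambda>i j. g (\<tau> b i) (\<tau> b j)) + measure_pmf.expectation (p b) H" .
  qed simp
  also have "\<dots> = (\<Sum>b\<le>n. perm_divergence n (\<lambda>i j. g (\<tau> b i) (\<tau> b j))) / Suc n
      + (\<Sum>b\<le>n. measure_pmf.expectation (p b) H) / Suc n"
    by (simp add: sum.distrib add_divide_distrib)
  also have "(\<Sum>b\<le>n. measure_pmf.expectation (p b) H) / Suc n = measure_pmf.expectation q (\<lambda>x. R x * H x)"
  proof -
    have "(\<Sum>b\<le>n. measure_pmf.expectation (p b) H) = (\<Sum>b\<le>n. measure_pmf.expectation q (\<lambda>x. r b x * H x))"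
      using prems(3)[OF Hb] by simp
    also have "\<dots> = measure_pmf.expectation q (\<lambda>x. \<Sum>b\<le>n. r b x * H x)"
      by (subst Bochner_Integration.integral_sum) (auto intro: irH)
    finally show ?thesis by (simp add: R_def sum_distrib_right)
  qed
  also have "measure_pmf.expectation q (\<lambda>x. R x * H x) \<le>
      ln (measure_pmf.expectation q (\<lambda>x. exp (H x))) + measure_pmf.expectation q (\<lambda>x. (R x)\<^sup>2) - 1"
  proof (rule expectation_density_le[OF Hb])
    show "R x \<ge> 0" for x unfolding R_def by (intro divide_nonneg_nonneg sum_nonneg prems(2)) auto
    show "integrable (measure_pmf q) R" unfolding R_def using prems(4) by auto
    show "integrable (measure_pmf q) (\<lambda>x. (R x)\<^sup>2)"
      unfolding R_def power2_eq_square using prems(5)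
      by (auto simp: sum_product power_divide intro!: Bochner_Integration.integrable_sum)
    show "measure_pmf.expectation q R = 1"
      unfolding R_def using prems(4) one by (simp add: Bochner_Integration.integral_sum)
  qed
  also have "measure_pmf.expectation q (\<lambda>x. exp (H x)) =
      measure_pmf.expectation (Prod_dist (Suc n) (\<lambda>_. q)) (\<lambda>y. exp (f y))"
  proof -
    have "\<bar>exp (f y)\<bar> \<le> exp B" for y using prems(1)[of y] by auto
    note e = expectation_Prod_dist_Suc[where n = n and p = "\<lambda>_. q" and f = "\<lambda>y. exp (f y)", OF this]
    have "exp (H z) = measure_pmf.expectation (Prod_dist n (\<lambda>_. q)) (\<lambda>y. exp (f (y(n := z))))" for z
      unfolding H_def using expectation_exp_pos(3)[where h = "\<lambda>y. f (y(n := z))", OF prems(1)] by simp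
    then show ?thesis using e by simp
  qed
  also have "measure_pmf.expectation q (\<lambda>x. (R x)\<^sup>2) = (\<Sum>i\<le>n. \<Sum>j\<le>n. g i j) / (Suc n)\<^sup>2"
  proof -
    have "measure_pmf.expectation q (\<lambda>x. (R x)\<^sup>2) = measure_pmf.expectation q
        (\<lambda>x. (\<Sum>i\<le>n. \<Sum>j\<le>n. r i x * r j x) / (Suc n)\<^sup>2)"
      by (simp only: R_def power_divide power2_eq_square[of "sum _ _"] sum_product of_nat_power)
    also have "\<dots> = (\<Sum>i\<le>n. \<Sum>j\<le>n. g i j) / (Suc n)\<^sup>2"
      using prems(5) by (simp add: Bochner_Integration.integral_sum g_def power2_eq_square algebra_simps)
    finally show ?thesis .
  qed
  finally have "measure_pmf.expectation (Perm_dist (Suc n) p) f \<le>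
     ((\<Sum>b\<le>n. perm_divergence n (\<lambda>i j. g (\<tau> b i) (\<tau> b j))) / Suc n + (\<Sum>i\<le>n. \<Sum>j\<le>n. g i j) / (Suc n)\<^sup>2 - 1)
     + ln (measure_pmf.expectation (Prod_dist (Suc n) (\<lambda>_. q)) (\<lambda>y. exp (f y)))"
    by simp
  then show ?case
    unfolding \<tau>_def perm_divergence_Suc g_def[symmetric] by simp
qed

section \<open>An upper bound for the permutation divergence\<close>

lemma harm_le_nat: "harm n \<le> real n"
proof (induction n)
  case (Suc n)
  have "inverse (1 + real n) \<le> 1" by (simp add: divide_simps)
  then show ?case using Suc by (simp add: harm_Suc)
qed (simp add: harm_def)

lemma harm_ge_1: "n \<ge> 1 \<Longrightarrow> harm n \<ge> (1::real)"
proof -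
  assume "n \<ge> 1"
  have "harm 1 \<le> (harm n :: real)"
    unfolding harm_def by (rule sum_mono2) (use \<open>n \<ge> 1\<close> in auto)
  then show ?thesis by (simp add: harm_def)
qed

text \<open>With h the harmonic number, the divergence is (h - 1) / (n - 1) times the diagonal sum
  plus \<open>a\<close> times the full double sum minus n. Since h lies between 1 and n, both
  weights are nonnegative, so the two sums may be replaced by their upper bounds;
  \<open>a * m \<le> 1\<close> then limits the share of \<open>x\<close>.\<close>

lemma perm_divergence_le:
  assumes n: "n \<ge> 2" and x: "x \<ge> 0" and \<tau>: "\<tau> \<ge> 0"
    and TT: "(\<Sum>i<n. \<Sum>j<n. g i j) \<le> (real n)\<^sup>2 * (1 + x)"
    and T: "(\<Sum>i<n. g i i) \<le> n * (1 + \<tau>)"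
  shows "perm_divergence n g \<le> n * x + harm n * \<tau>"
proof -
  define h m A D where "h = (harm n :: real)" and "m = real n" and "A = (\<Sum>i<n. \<Sum>j<n. g i j)" and "D
      = (\<Sum>i<n. g i i)"
  have h: "1 \<le> h" "h \<le> m" and m: "m \<ge> 2"
    unfolding h_def m_def using n harm_ge_1[of n] harm_le_nat[of n] by auto
  define a where "a = (m - h) / (m * (m - 1))"
  have a: "a \<ge> 0" unfolding a_def using h m by simp
  have b: "h / m - a \<ge> 0" unfolding a_def using h m by (simp add: field_simps)
  have am: "a * m \<le> 1" unfolding a_def using h m by (simp add: field_simps)
  have am2: "a * m * (m - 1) = m - h" unfolding a_def using m by simp
  have "perm_divergence n g = (h / m - a) * D + a * A - m"
    unfolding perm_divergence_def h_def[symmetric] m_def[symmetric] A_def[symmetric] D_def[symmetric] a_def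
    by (simp add: left_diff_distrib right_diff_distrib diff_divide_distrib)
  also have "\<dots> \<le> (h / m - a) * (m * (1 + \<tau>)) + a * (m\<^sup>2 * (1 + x)) - m"
    using a b TT T unfolding A_def D_def m_def by (intro diff_right_mono add_mono mult_left_mono) auto
  also have "\<dots> = h * (1 + \<tau>) + a * m * (m - 1) - a * m * \<tau> + a * m * (m * x) - m"
    using m by (simp add: field_simps power2_eq_square)
  also have "\<dots> = h * \<tau> - a * m * \<tau> + a * m * (m * x)"
    unfolding am2 by (simp add: algebra_simps)
  also have "\<dots> \<le> h * \<tau> + 1 * (m * x)"
  proof -
    have "a * m * \<tau> \<ge> 0" using a m \<tau> by simp
    moreover have "a * m * (m * x) \<le> 1 * (m * x)" using am m x by (intro mult_right_mono) auto
    ultimately show ?thesis by simp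
  qed
  finally show ?thesis unfolding h_def m_def by simp
qed

section \<open>From relative entropy to total variation\<close>

lemma prob_le_of_expectation_le:
  assumes ub: "\<And>f B. (\<And>x. \<bar>f x\<bar> \<le> B) \<Longrightarrow>
      measure_pmf.expectation P f \<le> d + ln (measure_pmf.expectation Q (\<lambda>x. exp (f x :: real)))"
    and \<theta>: "0 < \<theta>" "\<theta> \<le> 1"
  shows "measure_pmf.prob P S \<le> measure_pmf.prob Q S + d / \<theta> + \<theta>"
proof -
  \<comment> \<open>This test function turns the dual entropy bound into a Pinsker-type inequality
    with a free parameter, which later balances \<open>d / \<theta>\<close> against
    \<theta>.\<close>
  define f where "f = (\<lambda>x. \<theta> * indicator S x :: real)"
  have ef: "exp (f x) = 1 + (exp \<theta> - 1) * indicator S x" for x by (auto simp: f_def indicator_def)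
  define u where "u = measure_pmf.prob Q S"
  have u: "0 \<le> u" "u \<le> 1" by (auto simp: u_def)
  have "\<theta> * measure_pmf.prob P S = measure_pmf.expectation P f" by (simp add: f_def)
  also have "\<dots> \<le> d + ln (measure_pmf.expectation Q (\<lambda>x. exp (f x)))"
    by (rule ub[of _ 1]) (use \<theta> in \<open>auto simp: f_def indicator_def\<close>)
  also have "measure_pmf.expectation Q (\<lambda>x. exp (f x)) = 1 + (exp \<theta> - 1) * u"
    unfolding ef u_def by (subst Bochner_Integration.integral_add)
        (auto intro!: integrable_mult_right integrable_pmf_bounded[of _ 1] split: split_indicator)
  also have "ln (1 + (exp \<theta> - 1) * u) \<le> (exp \<theta> - 1) * u"
    using u \<theta> by (intro ln_add_one_self_le_self) auto
  also have "\<dots> \<le> (\<theta> + \<theta>\<^sup>2) * u"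
    using exp_bound[of \<theta>] \<theta> u by (intro mult_right_mono) auto
  also have "\<dots> \<le> \<theta> * u + \<theta>\<^sup>2"
    using u \<theta> mult_left_mono[of u 1 "\<theta>\<^sup>2"] by (simp add: algebra_simps)
  finally have "\<theta> * measure_pmf.prob P S \<le> \<theta> * (u + d / \<theta> + \<theta>)"
    using \<theta> by (simp add: algebra_simps power2_eq_square)
  then show ?thesis using \<theta> by (simp add: u_def)
qed

lemma has_sum_pmf: "(pmf p has_sum measure_pmf.prob p S) S"
proof -
  note a = pmf_abs_summable[of p S]
  have "pmf p summable_on S"
    using a abs_summable_equivalent abs_summable_summable by blast
  moreover have "infsum (pmf p) S = measure_pmf.prob p S"
    using infsetsum_infsum[OF a] measure_pmf_conv_infsetsum[of p S] by simp
  ultimately show ?thesis using has_sum_infsum by fastforce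
qed

text \<open>The excess of \<open>P\<close> over \<open>Q\<close> is largest on the set where
  \<open>P\<close> dominates, and the absolute differences on this set and on its complement have
  the same sum because both masses are 1.\<close>

lemma d_TV_le:
  assumes "\<And>S. measure_pmf.prob P S \<le> measure_pmf.prob Q S + e"
  shows "d_TV P Q \<le> e"
proof -
  define S where "S = {x. pmf P x \<ge> pmf Q x}"
  have 1: "((\<lambda>x. pmf P x - pmf Q x) has_sum (measure_pmf.prob P S - measure_pmf.prob Q S)) S"
    using has_sum_add[OF has_sum_pmf[of P S] has_sum_cmult_right[OF has_sum_pmf[of Q S], of "-1"]] by simp
  have 2: "((\<lambda>x. pmf Q x - pmf P x) has_sum (measure_pmf.prob Q (- S) - measure_pmf.prob P (- S))) (- S)"
    using has_sum_add[OF has_sum_pmf[of Q "- S"] has_sum_cmult_right[OF has_sum_pmf[of P "- S"], of "-1"]]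
        by simp
  have a: "((\<lambda>x. \<bar>pmf P x - pmf Q x\<bar>) has_sum (measure_pmf.prob P S - measure_pmf.prob Q S)) S"
    using 1 by (rule has_sum_cong[THEN iffD1, rotated]) (auto simp: S_def)
  have b: "((\<lambda>x. \<bar>pmf P x - pmf Q x\<bar>) has_sum (measure_pmf.prob Q (- S) - measure_pmf.prob P (- S))) (- S)"
    using 2 by (rule has_sum_cong[THEN iffD1, rotated]) (auto simp: S_def)
  have "((\<lambda>x. \<bar>pmf P x - pmf Q x\<bar>) has_sum (measure_pmf.prob P S - measure_pmf.prob Q S
      + (measure_pmf.prob Q (- S) - measure_pmf.prob P (- S)))) (S \<union> - S)"
    by (rule has_sum_Un_disjoint[OF a b]) auto
  then have "(\<Sum>\<^sub>\<infinity>x. \<bar>pmf P x - pmf Q x\<bar>) = measure_pmf.prob P S - measure_pmf.prob Q S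
      + (measure_pmf.prob Q (- S) - measure_pmf.prob P (- S))"
    by (simp add: infsumI)
  also have "\<dots> = 2 * (measure_pmf.prob P S - measure_pmf.prob Q S)"
    using measure_pmf.prob_compl[of S P] measure_pmf.prob_compl[of S Q] by (simp add: Compl_eq_Diff_UNIV)
  finally show ?thesis using assms[of S] by (simp add: d_TV_def)
qed

text \<open>This lets the entropy bound for permutations also compare two products of identical
  factors.\<close>

lemma Perm_dist_const: "Perm_dist n (\<lambda>_. p) = Prod_dist n (\<lambda>_. p)"
  unfolding Perm_dist_def by (simp add: bind_pmf_const)

section \<open>Poisson moments\<close>

lemma exp_le_quadratic:
  fixes x :: real
  assumes "x \<le> 1"
  shows "exp x \<le> 1 + x + x\<^sup>2"
proof (cases "x \<ge> 0")
  case True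
  then show ?thesis using exp_bound[of x] assms by simp
next
  case False
  define u where "u = - x"
  have u: "u > 0" using False by (simp add: u_def)
  have "exp x = 1 / exp u" by (simp add: u_def exp_minus inverse_eq_divide)
  also have "\<dots> \<le> 1 / (1 + u)" using u exp_ge_add_one_self[of u] by (intro divide_left_mono) auto
  also have "\<dots> \<le> 1 - u + u\<^sup>2"
  proof -
    have "(1 - u + u\<^sup>2) * (1 + u) = 1 + u ^ 3" by (simp add: power2_eq_square power3_eq_cube algebra_simps)
    then have "(1 - u + u\<^sup>2) * (1 + u) \<ge> 1" using u by simp
    then show ?thesis using u by (simp add: divide_le_eq)
  qed
  finally show ?thesis by (simp add: u_def)
qed

lemma nat_pmf_expectation_sums:
  fixes f :: "nat \<Rightarrow> real"
  assumes "summable (\<lambda>k. pmf p k * \<bar>f k\<bar>)"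
  shows "integrable (measure_pmf p) f" and "(\<lambda>k. pmf p k * f k) sums measure_pmf.expectation p f"
proof -
  have i: "integrable (count_space UNIV) (\<lambda>k. pmf p k * f k)"
    using assms by (subst integrable_count_space_nat_iff) (simp add: abs_mult)
  show "integrable (measure_pmf p) f"
    unfolding measure_pmf_eq_density using i by (subst integrable_density) auto
  have "measure_pmf.expectation p f = integral\<^sup>L (count_space UNIV) (\<lambda>k. pmf p k * f k)"
    unfolding measure_pmf_eq_density by (subst integral_density) auto
  then show "(\<lambda>k. pmf p k * f k) sums measure_pmf.expectation p f"
    using sums_integral_count_space_nat[OF i] by simp
qed

lemma nat_pmf_integrable_summable:
  fixes f :: "nat \<Rightarrow> real"
  assumes "integrable (measure_pmf p) f"
  shows "summable (\<lambda>k. pmf p k * \<bar>f k\<bar>)"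
proof -
  have "integrable (count_space UNIV) (\<lambda>k. pmf p k * f k)"
    using assms unfolding measure_pmf_eq_density by (subst (asm) integrable_density) auto
  then show ?thesis by (subst (asm) integrable_count_space_nat_iff) (simp add: abs_mult)
qed

lemma Poi_power:
  assumes "r \<ge> 0"
  shows "integrable (measure_pmf (Poi r)) (\<lambda>y. z ^ y :: real)"
    and "measure_pmf.expectation (Poi r) (\<lambda>y. z ^ y) = exp (r * (z - 1))"
proof -
  have s: "(\<lambda>k. pmf (Poi r) k * w ^ k) sums exp (r * (w - 1))" for w :: real
  proof -
    have "(\<lambda>k. exp (- r) * ((r * w) ^ k /\<^sub>R fact k)) sums (exp (- r) * exp (r * w))"
      by (intro sums_mult exp_converges)
    moreover have "exp (- r) * ((r * w) ^ k /\<^sub>R fact k) = pmf (Poi r) k * w ^ k" for k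
      by (simp add: pmf_Poi[OF assms] power_mult_distrib field_simps)
    ultimately show ?thesis by (simp only:) (simp add: algebra_simps flip: exp_add)
  qed
  have a: "summable (\<lambda>k. pmf (Poi r) k * \<bar>z ^ k\<bar>)"
    using s[of "\<bar>z\<bar>"] by (simp add: power_abs sums_iff)
  show "integrable (measure_pmf (Poi r)) (\<lambda>y. z ^ y :: real)"
    by (rule nat_pmf_expectation_sums(1)[OF a])
  show "measure_pmf.expectation (Poi r) (\<lambda>y. z ^ y) = exp (r * (z - 1))"
    using nat_pmf_expectation_sums(2)[OF a] s[of z] sums_unique2 by blast
qed

lemma Poi_exp:
  assumes "r \<ge> 0"
  shows "integrable (measure_pmf (Poi r)) (\<lambda>y. exp (t * (real y - c)))"
    and "measure_pmf.expectation (Poi r) (\<lambda>y. exp (t * (real y - c))) = exp (r * (exp t - 1) - t * c)"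
proof -
  have e: "exp (t * (real y - c)) = exp (- (t * c)) * exp t ^ y" for y
    by (simp add: exp_of_nat_mult[symmetric] exp_add[symmetric] algebra_simps)
  show "integrable (measure_pmf (Poi r)) (\<lambda>y. exp (t * (real y - c)))"
    unfolding e using Poi_power(1)[OF assms] by (intro integrable_mult_right) auto
  show "measure_pmf.expectation (Poi r) (\<lambda>y. exp (t * (real y - c))) = exp (r * (exp t - 1) - t * c)"
    unfolding e using Poi_power(2)[OF assms] by (simp add: exp_add[symmetric] algebra_simps)
qed

lemma Poi_exp_centered_le:
  assumes "r \<ge> 0" "t \<le> 1"
  shows "measure_pmf.expectation (Poi r) (\<lambda>y. exp (t * (real y - r))) \<le> exp (r * t\<^sup>2)"
proof -
  have "r * (exp t - 1) \<le> r * (t + t\<^sup>2)"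
    using exp_le_quadratic[OF assms(2)] assms(1) by (intro mult_left_mono) auto
  then have "r * (exp t - 1) - t * r \<le> r * t\<^sup>2" by (simp add: algebra_simps)
  then show ?thesis unfolding Poi_exp(2)[OF assms(1)] by simp
qed

text \<open>The Stein-Chen identity, an index shift in the Poisson series. It yields the moments one
  degree at a time.\<close>

lemma Poi_Suc:
  fixes f :: "nat \<Rightarrow> real"
  assumes r: "r \<ge> 0" and f: "integrable (measure_pmf (Poi r)) (\<lambda>y. f (Suc y))"
  shows "integrable (measure_pmf (Poi r)) (\<lambda>y. real y * f y)"
    and "measure_pmf.expectation (Poi r) (\<lambda>y. real y * f y)
        = r * measure_pmf.expectation (Poi r) (\<lambda>y. f (Suc y))"
proof -
  have p: "pmf (Poi r) (Suc k) * (real (Suc k) * w) = r * (pmf (Poi r) k * w)" for k w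
    by (simp add: pmf_Poi[OF r] field_simps del: of_nat_Suc)
  have a: "summable (\<lambda>k. pmf (Poi r) k * \<bar>real k * f k\<bar>)"
    by (subst summable_Suc_iff[symmetric])
       (simp only: abs_mult abs_of_nat p, intro summable_mult nat_pmf_integrable_summable[OF f])
  show "integrable (measure_pmf (Poi r)) (\<lambda>y. real y * f y)"
    by (rule nat_pmf_expectation_sums(1)[OF a])
  have "(\<lambda>k. pmf (Poi r) (Suc k) * (real (Suc k) * f (Suc k))) sums
      (r * measure_pmf.expectation (Poi r) (\<lambda>y. f (Suc y)))"
    unfolding p using nat_pmf_expectation_sums(2)[OF nat_pmf_integrable_summable[OF f]] by (rule sums_mult)
  then have "(\<lambda>k. pmf (Poi r) k * (real k * f k)) sums (r * measure_pmf.expectation (Poi r) (\<lambda>y. f (Suc y)))"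
    by (subst (asm) sums_Suc_iff) simp
  then show "measure_pmf.expectation (Poi r) (\<lambda>y. real y * f y)
      = r * measure_pmf.expectation (Poi r) (\<lambda>y. f (Suc y))"
    using nat_pmf_expectation_sums(2)[OF a] sums_unique2 by blast
qed

lemma Poi_moments:
  assumes r: "r \<ge> 0"
  shows "integrable (measure_pmf (Poi r)) (\<lambda>y. real y)" "measure_pmf.expectation (Poi r) (\<lambda>y. real y) = r"
    and "integrable (measure_pmf (Poi r)) (\<lambda>y. (real y)\<^sup>2)"
      "measure_pmf.expectation (Poi r) (\<lambda>y. (real y)\<^sup>2) = r + r\<^sup>2"
    and "integrable (measure_pmf (Poi r)) (\<lambda>y. (real y) ^ 3)"
      "measure_pmf.expectation (Poi r) (\<lambda>y. (real y) ^ 3) = r + 3 * r\<^sup>2 + r ^ 3"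
    and "integrable (measure_pmf (Poi r)) (\<lambda>y. (real y) ^ 4)"
      "measure_pmf.expectation (Poi r) (\<lambda>y. (real y) ^ 4) = r + 7 * r\<^sup>2 + 6 * r ^ 3 + r ^ 4"
proof -
  show 1: "integrable (measure_pmf (Poi r)) (\<lambda>y. real y)" "measure_pmf.expectation (Poi r) (\<lambda>y. real y) = r"
    using Poi_Suc[OF r, of "\<lambda>_. 1"] by auto
  have s2: "(real (Suc y)) = real y + 1" for y by simp
  have i2: "integrable (measure_pmf (Poi r)) (\<lambda>y. real (Suc y))" unfolding s2 using 1 by simp
  show 2: "integrable (measure_pmf (Poi r)) (\<lambda>y. (real y)\<^sup>2)"
      "measure_pmf.expectation (Poi r) (\<lambda>y. (real y)\<^sup>2) = r + r\<^sup>2"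
    using Poi_Suc[OF r i2] 1 by (auto simp: power2_eq_square algebra_simps)
  have s3: "(real (Suc y))\<^sup>2 = (real y)\<^sup>2 + (2 * real y + 1)" for y
      by (simp add: power2_eq_square algebra_simps)
  have i3: "integrable (measure_pmf (Poi r)) (\<lambda>y. (real (Suc y))\<^sup>2)" unfolding s3 using 1 2 by simp
  have e3: "measure_pmf.expectation (Poi r) (\<lambda>y. (real (Suc y))\<^sup>2) = r + r\<^sup>2 + (2 * r + 1)"
    unfolding s3 using 1 2 by simp
  show 3: "integrable (measure_pmf (Poi r)) (\<lambda>y. (real y) ^ 3)"
      "measure_pmf.expectation (Poi r) (\<lambda>y. (real y) ^ 3) = r + 3 * r\<^sup>2 + r ^ 3"
    using Poi_Suc[OF r i3] e3 by (auto simp: power3_eq_cube power2_eq_square algebra_simps)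
  have s4: "(real (Suc y)) ^ 3 = (real y) ^ 3 + (3 * (real y)\<^sup>2 + (3 * real y + 1))" for y
    by (simp add: power2_eq_square power3_eq_cube algebra_simps)
  have i4: "integrable (measure_pmf (Poi r)) (\<lambda>y. (real (Suc y)) ^ 3)" unfolding s4 using 1 2 3 by simp
  have e4: "measure_pmf.expectation (Poi r) (\<lambda>y. (real (Suc y)) ^ 3) = r + 3 * r\<^sup>2 + r ^ 3
      + (3 * (r + r\<^sup>2) + (3 * r + 1))"
    unfolding s4 using 1 2 3 by simp
  show "integrable (measure_pmf (Poi r)) (\<lambda>y. (real y) ^ 4)"
      "measure_pmf.expectation (Poi r) (\<lambda>y. (real y) ^ 4) = r + 7 * r\<^sup>2 + 6 * r ^ 3 + r ^ 4"
    using Poi_Suc[OF r i4] e4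
    by (auto simp: power3_eq_cube power2_eq_square power4_eq_xxxx algebra_simps)
qed

text \<open>The second Charlier polynomial: for a Poisson variable of rate \<open>r\<close> it has mean \<open>(r - l)\<^sup>2\<close>.\<close>

definition charlier2 :: "real \<Rightarrow> real \<Rightarrow> real" where
  "charlier2 l y = (y - l)\<^sup>2 - y"

lemma Poi_charlier2:
  assumes r: "r \<ge> 0"
  shows "integrable (measure_pmf (Poi r)) (\<lambda>y. charlier2 l (real y))"
    and "measure_pmf.expectation (Poi r) (\<lambda>y. charlier2 r (real y)) = 0"
    and "integrable (measure_pmf (Poi r)) (\<lambda>y. (charlier2 l (real y))\<^sup>2)"
    and "measure_pmf.expectation (Poi r) (\<lambda>y. (charlier2 r (real y))\<^sup>2) = 2 * r\<^sup>2"
proof -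
  note m = Poi_moments[OF r]
  have e: "charlier2 l y = y\<^sup>2 + (l\<^sup>2 + (- (2 * l + 1)) * y)" for y l
    by (simp add: charlier2_def power2_eq_square algebra_simps)
  show "integrable (measure_pmf (Poi r)) (\<lambda>y. charlier2 l (real y))" unfolding e using m by simp
  show "measure_pmf.expectation (Poi r) (\<lambda>y. charlier2 r (real y)) = 0"
    unfolding e using m by simp (simp add: power2_eq_square algebra_simps)
  have e2: "(charlier2 l y)\<^sup>2 = y ^ 4 + ((- 2 * (2 * l + 1)) * y ^ 3
      + (((2 * l + 1)\<^sup>2 + 2 * l\<^sup>2) * y\<^sup>2 + ((- 2 * (2 * l + 1) * l\<^sup>2) * y + l ^ 4)))" for y l
    by (simp add: charlier2_def power2_eq_square power3_eq_cube power4_eq_xxxx algebra_simps)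
  show "integrable (measure_pmf (Poi r)) (\<lambda>y. (charlier2 l (real y))\<^sup>2)" unfolding e2 using m by simp
  show "measure_pmf.expectation (Poi r) (\<lambda>y. (charlier2 r (real y))\<^sup>2) = 2 * r\<^sup>2"
    unfolding e2 using m by simp (simp add: power2_eq_square power3_eq_cube power4_eq_xxxx algebra_simps)
qed

section \<open>Total variation for large rates\<close>

lemma nat_pmf_expectation_density:
  fixes h :: "nat \<Rightarrow> real"
  assumes "\<And>k. pmf p k = pmf q k * r k"
  shows "measure_pmf.expectation p h = measure_pmf.expectation q (\<lambda>x. r x * h x)"
  unfolding measure_pmf_eq_density
proof (subst (1 2) integral_density)
  show "AE x in count_space UNIV. 0 \<le> pmf q x" "AE x in count_space UNIV. 0 \<le> pmf p x" by auto
qed (auto simp: assms mult.assoc)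

lemma Perm_dist_cong:
  assumes "\<And>i. i < n \<Longrightarrow> p i = p' i"
  shows "Perm_dist n p = Perm_dist n p'"
  unfolding Perm_dist_def
proof (rule bind_pmf_cong[OF refl])
  fix \<pi> assume "\<pi> \<in> set_pmf (pmf_of_set {\<pi>. \<pi> permutes {..<n}})"
  then have \<pi>: "\<pi> permutes {..<n}"
    using permutes_id[of "{..<n}"] finite_permutes_lessThan[of n]
    by (metis empty_iff mem_Collect_eq set_pmf_of_set)
  show "Prod_dist n (\<lambda>j. p (\<pi> j)) = Prod_dist n (\<lambda>j. p' (\<pi> j))"
    by (rule Prod_dist_cong) (use permutes_in_image[OF \<pi>] assms in auto)
qed

text \<open>The density inner products are \<open>exp (d i * d j / \<mu>)\<close> with
  \<open>d i = lam i - \<mu>\<close>. As the exponents are at most 1,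
  \<open>exp x \<le> 1 + x + x\<^sup>2\<close> applies, and the double sum becomes n^2 plus the
  squares of the sum of the \<open>d i\<close> and of the sum of their squares, scaled by \<mu>.
  These are the two quantities that the tests for large rates control; \<open>b\<close> bounds the
  divergence of a single coordinate.\<close>

lemma expectation_Perm_Poi_le:
  fixes f :: "(nat \<Rightarrow> nat) \<Rightarrow> real"
  assumes f: "\<And>x. \<bar>f x\<bar> \<le> B"
    and \<mu>: "\<mu> > 0" and n: "n \<ge> 2" and lam: "\<And>i. i < n \<Longrightarrow> lam i \<ge> 0"
    and b: "\<And>i. i < n \<Longrightarrow> (lam i - \<mu>)\<^sup>2 \<le> \<mu> * b" "0 \<le> b" "b \<le> 1"
    and u: "(\<Sum>i<n. lam i - \<mu>)\<^sup>2 \<le> n * \<mu> * u"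
    and v: "(\<Sum>i<n. (lam i - \<mu>)\<^sup>2)\<^sup>2 \<le> n * \<mu>\<^sup>2 * v"
  shows "measure_pmf.expectation (Perm_dist n (\<lambda>i. Poi (lam i))) f
    \<le> u + v + harm n * (2 * b) + ln (measure_pmf.expectation (Prod_dist n (\<lambda>_. Poi \<mu>)) (\<lambda>y. exp (f y)))"
proof -
  \<comment> \<open>The entropy bound asks for densities at all indices, so the rates are continued
    by \<mu>.\<close>
  define l where "l = (\<lambda>i. if i < n then lam i else \<mu>)"
  have l: "l i \<ge> 0" for i using lam \<mu> by (simp add: l_def)
  define r where "r = (\<lambda>i x. exp (\<mu> - l i) * (l i / \<mu>) ^ x)"
  have dens: "pmf (Poi (l i)) k = pmf (Poi \<mu>) k * r i k" for i k
    using \<mu> l[of i] by (simp add: pmf_Poi r_def power_divide exp_diff exp_minus field_simps)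
  have rr: "r i x * r j x = exp (2 * \<mu> - l i - l j) * (l i * l j / \<mu>\<^sup>2) ^ x" for i j x
  proof -
    have "r i x * r j x = (exp (\<mu> - l i) * exp (\<mu> - l j)) * ((l i / \<mu>) * (l j / \<mu>)) ^ x"
      by (simp only: r_def power_mult_distrib mult_ac)
    also have "exp (\<mu> - l i) * exp (\<mu> - l j) = exp (2 * \<mu> - l i - l j)"
      by (simp flip: exp_add)
    also have "(l i / \<mu>) * (l j / \<mu>) = l i * l j / \<mu>\<^sup>2" by (simp add: power2_eq_square)
    finally show ?thesis .
  qed
  have g: "measure_pmf.expectation (Poi \<mu>) (\<lambda>x. r i x * r j x) = exp ((l i - \<mu>) * (l j - \<mu>) / \<mu>)" for i j
    unfolding rr using \<mu> by (simp add: Poi_power flip: exp_add) (simp add: field_simps power2_eq_square)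
  have "measure_pmf.expectation (Perm_dist n (\<lambda>i. Poi (l i))) f \<le>
     perm_divergence n (\<lambda>i j. measure_pmf.expectation (Poi \<mu>) (\<lambda>x. r i x * r j x))
     + ln (measure_pmf.expectation (Prod_dist n (\<lambda>_. Poi \<mu>)) (\<lambda>y. exp (f y)))"
  proof (rule expectation_Perm_dist_le[OF f])
    show "r i x \<ge> 0" for i x using \<mu> l by (simp add: r_def)
    show "measure_pmf.expectation (Poi (l i)) h = measure_pmf.expectation (Poi \<mu>) (\<lambda>x. r i x * h x)" for i h
      by (rule nat_pmf_expectation_density) (rule dens)
    show "integrable (measure_pmf (Poi \<mu>)) (r i)" for i
      unfolding r_def using \<mu> by (intro integrable_mult_right Poi_power) auto
    show "integrable (measure_pmf (Poi \<mu>)) (\<lambda>x. r i x * r j x)" for i j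
      unfolding rr using \<mu> by (intro integrable_mult_right Poi_power) auto
  qed
  also have "perm_divergence n (\<lambda>i j. measure_pmf.expectation (Poi \<mu>) (\<lambda>x. r i x * r j x))
      \<le> n * ((u + v) / n) + harm n * (2 * b)"
  proof (rule perm_divergence_le[OF n])
    have "0 \<le> real n * \<mu> * u" using u zero_le_power2 order_trans by blast
    moreover have "real n * \<mu> > 0" using n \<mu> by simp
    ultimately have u0: "u \<ge> 0" by (simp only: zero_le_mult_iff) linarith
    have "0 \<le> real n * \<mu>\<^sup>2 * v" using v zero_le_power2 order_trans by blast
    moreover have "real n * \<mu>\<^sup>2 > 0" using n \<mu> by simp
    ultimately have v0: "v \<ge> 0" by (simp only: zero_le_mult_iff) linarith
    show "(u + v) / n \<ge> 0" using u0 v0 by simp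
    define d where "d = (\<lambda>i. lam i - \<mu>)"
    have w1: "d i * d j / \<mu> \<le> 1" if "i < n" "j < n" for i j
    proof -
      have "2 * (d i * d j) \<le> (d i)\<^sup>2 + (d j)\<^sup>2" using sum_squares_bound[of "d i" "d j"] by simp
      also have "\<dots> \<le> \<mu> * b + \<mu> * b" using b(1)[OF that(1)] b(1)[OF that(2)] by (simp add: d_def)
      also have "\<dots> \<le> 2 * \<mu>" using b \<mu> by (simp add: mult_left_le)
      finally show ?thesis using \<mu> by simp
    qed
    have "(\<Sum>i<n. \<Sum>j<n. exp (d i * d j / \<mu>)) \<le> (\<Sum>i<n. \<Sum>j<n. 1 + d i * d j / \<mu> + (d i * d j / \<mu>)\<^sup>2)"
      by (intro sum_mono exp_le_quadratic w1) auto
    also have "\<dots> = (real n)\<^sup>2 + (\<Sum>i<n. d i)\<^sup>2 / \<mu> + (\<Sum>i<n. (d i)\<^sup>2)\<^sup>2 / \<mu>\<^sup>2"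
      unfolding power2_eq_square[of "sum _ _"] sum_product sum_divide_distrib
      by (simp add: sum.distrib power2_eq_square algebra_simps)
    also have "\<dots> \<le> (real n)\<^sup>2 + n * u + n * v"
    proof -
      have "(\<Sum>i<n. d i)\<^sup>2 / \<mu> \<le> n * u" using u \<mu> unfolding d_def by (simp add: divide_le_eq mult_ac)
      moreover have "(\<Sum>i<n. (d i)\<^sup>2)\<^sup>2 / \<mu>\<^sup>2 \<le> n * v" using v \<mu> unfolding d_def
          by (simp add: divide_le_eq mult_ac)
      ultimately show ?thesis by simp
    qed
    also have "\<dots> = (real n)\<^sup>2 * (1 + (u + v) / n)" using n by (simp add: field_simps power2_eq_square)
    finally show "(\<Sum>i<n. \<Sum>j<n. measure_pmf.expectation (Poi \<mu>) (\<lambda>x. r i x * r j x))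
        \<le> (real n)\<^sup>2 * (1 + (u + v) / n)"
      unfolding g by (simp add: l_def d_def)
    have "(\<Sum>i<n. exp (d i * d i / \<mu>)) \<le> (\<Sum>i<n. 1 + 2 * b)"
    proof (intro sum_mono)
      fix i assume i: "i \<in> {..<n}"
      define w where "w = d i * d i / \<mu>"
      have w: "0 \<le> w" "w \<le> b" using b(1)[of i] i \<mu> by (auto simp: w_def d_def power2_eq_square divide_le_eq
          mult.commute)
      have "exp w \<le> 1 + w + w\<^sup>2" using w b by (intro exp_le_quadratic) auto
      also have "w\<^sup>2 \<le> w" using w b by (simp add: power2_eq_square mult_left_le)
      finally show "exp (d i * d i / \<mu>) \<le> 1 + 2 * b" using w unfolding w_def by simp
    qed
    then show "(\<Sum>i<n. measure_pmf.expectation (Poi \<mu>) (\<lambda>x. r i x * r i x)) \<le> n * (1 + 2 * b)"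
      unfolding g by (simp add: l_def d_def)
  qed (use b in auto)
  also have "Perm_dist n (\<lambda>i. Poi (l i)) = Perm_dist n (\<lambda>i. Poi (lam i))"
    by (rule Perm_dist_cong) (simp add: l_def)
  finally show ?thesis using n by simp
qed

text \<open>A reference with bounded densities: relative to it \<open>p'\<close> and the average of
  the \<open>p i\<close> have densities at most 2, and each single \<open>p i\<close> at most
  \<open>2 * n\<close>.\<close>

definition half_mixture :: "nat \<Rightarrow> (nat \<Rightarrow> 'a pmf) \<Rightarrow> 'a pmf \<Rightarrow> 'a pmf" where
  "half_mixture n p p' = bind_pmf (bernoulli_pmf (1/2))
     (\<lambda>b. if b then p' else bind_pmf (pmf_of_set {..<n}) p)"

lemma pmf_half_mixture:
  assumes "n > 0"
  shows "pmf (half_mixture n p p') x = (pmf p' x + (\<Sum>i<n. pmf (p i) x) / n) / 2"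
proof -
  have "pmf (bind_pmf (pmf_of_set {..<n}) p) x = (\<Sum>i<n. pmf (p i) x) / n"
    unfolding pmf_bind by (rule trans[OF integral_pmf_of_set]) (use assms in auto)
  then show ?thesis unfolding half_mixture_def by (subst pmf_bind) simp
qed

lemma nat_pmf_expectation_le:
  fixes F b :: "nat \<Rightarrow> real"
  assumes F: "\<And>x. F x \<ge> 0" and b: "b sums c" "\<And>x. pmf q x * F x \<le> b x"
  shows "integrable (measure_pmf q) F" and "measure_pmf.expectation q F \<le> c"
proof -
  have s: "summable (\<lambda>k. pmf q k * \<bar>F k\<bar>)"
    by (rule summable_comparison_test'[of b 0]) (use b F in \<open>auto simp: sums_iff\<close>)
  show "integrable (measure_pmf q) F" by (rule nat_pmf_expectation_sums(1)[OF s])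
  show "measure_pmf.expectation q F \<le> c"
    by (rule sums_le[OF b(2) nat_pmf_expectation_sums(2)[OF s] b(1)])
qed

section \<open>Total variation for small rates\<close>

lemma sums_geometric_real: "\<bar>c\<bar> < 1 \<Longrightarrow> (\<lambda>x. a * c ^ x) sums (a / (1 - c))" for c :: real
  using sums_mult[OF geometric_sums[of c], of a] by simp

text \<open>For the density R = 2 b / (a + b) this is R^2 = (R - 1)^2 + 2 R - 1. As R has mean 1,
  its chi-square divergence is the mean of the squared relative difference, which is symmetric in a
  and b and thus serves both comparisons with the mixture.\<close>

lemma square_ratio_eq:
  fixes a b :: real
  assumes "a + b > 0"
  shows "(2 * b / (a + b)) * (2 * b / (a + b)) = ((a - b) / (a + b))\<^sup>2 + (2 * (2 * b / (a + b)) - 1)"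
proof -
  define t where "t = b / (a + b)"
  have "(a - b) / (a + b) = 1 - 2 * t" unfolding t_def using assms by (simp add: field_simps)
  moreover have "2 * b / (a + b) = 2 * t" by (simp add: t_def)
  ultimately show ?thesis by (simp only: power2_eq_square) (simp add: algebra_simps)
qed

lemma pmf_Poi_le_power: "0 \<le> r \<Longrightarrow> r \<le> l \<Longrightarrow> pmf (Poi r) x \<le> l ^ x"
proof -
  assume r: "0 \<le> r" "r \<le> l"
  have "pmf (Poi r) x \<le> r ^ x / 1 * 1"
    unfolding pmf_Poi[OF r(1)] using r by (intro mult_mono divide_left_mono) auto
  also have "\<dots> \<le> l ^ x" using r by (simp add: power_mono)
  finally show ?thesis .
qed

lemma sums_le_abs:
  fixes f g :: "nat \<Rightarrow> real"
  assumes "f sums a" "g sums b" "\<And>n. \<bar>f n\<bar> \<le> g n"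
  shows "\<bar>a\<bar> \<le> b"
proof -
  have "a \<le> b" using assms(3) by (intro sums_le[OF _ assms(1,2)]) (auto intro: order_trans[OF abs_ge_self])
  moreover have "- a \<le> b"
    using sums_minus[OF assms(1)] assms(3) by (intro sums_le[OF _ _ assms(2)])
        (auto intro: order_trans[OF abs_ge_minus_self])
  ultimately show ?thesis by linarith
qed

text \<open>The random permutation and the product of copies of \<open>Poi \<mu>\<close> are both compared to the product of
  copies of \<open>q\<close>. A reference of the form \<open>Poi \<mu>\<close> would fail, because the density of \<open>Poi (lam i)\<close> is
  unbounded for \<open>lam i > \<mu>\<close>.\<close>

locale small_rates =
  fixes n :: nat and \<mu> :: real and lam :: "nat \<Rightarrow> real" and l \<eta> c3 :: real and X :: nat
  assumes n: "n \<ge> 2" and \<mu>: "0 < \<mu>" "\<mu> \<le> l" and lam: "\<And>i. i < n \<Longrightarrow> 0 \<le> lam i \<and> lam i \<le> l"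
    and l: "l \<le> 1/4" and nX: "n \<le> 2 ^ X" and \<eta>: "0 < \<eta>" "\<eta> \<le> 1" and c3: "1 \<le> c3"
begin

definition M :: "nat \<Rightarrow> real" where "M x = (\<Sum>i<n. pmf (Poi (lam i)) x)"
definition M' :: "nat \<Rightarrow> real" where "M' x = n * pmf (Poi \<mu>) x"
definition v :: "nat \<Rightarrow> real" where "v x = n * (\<mu> ^ x / fact x)"
text \<open>The deviation from a Poisson profile whose height is read off at 0; it vanishes if all
  rates are \<mu>. The height itself is recovered from the fact that the \<open>M x\<close> sum to
  \<open>n\<close>, which makes \<open>Etot\<close> the sum of all deviations.\<close>

definition D :: "nat \<Rightarrow> real" where "D x = M x - M 0 * (\<mu> ^ x / fact x)"
definition Etot :: real where "Etot = n - M 0 * exp \<mu>"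
definition q :: "nat pmf" where "q = half_mixture n (\<lambda>i. Poi (lam i)) (Poi \<mu>)"

lemma l0: "0 < l" using \<mu> by linarith

lemma M_nonneg: "M x \<ge> 0" unfolding M_def by (intro sum_nonneg) auto

lemma M'_pos: "M' x > 0" unfolding M'_def using n \<mu> by (simp add: pmf_Poi)

lemma M_le: "M x \<le> n * l ^ x"
proof -
  have "M x \<le> (\<Sum>i<n. l ^ x)"
    unfolding M_def using lam by (intro sum_mono pmf_Poi_le_power) auto
  then show ?thesis by simp
qed

lemma M'_le: "M' x \<le> n * l ^ x"
  unfolding M'_def using \<mu> by (intro mult_left_mono pmf_Poi_le_power) auto

lemma M0_le: "M 0 \<le> n" using M_le[of 0] by simp

lemma mu_power_le: "\<mu> ^ x / fact x \<le> l ^ x"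
proof -
  have "\<mu> ^ x / fact x \<le> \<mu> ^ x / 1" using \<mu> by (intro divide_left_mono) auto
  also have "\<dots> \<le> l ^ x" using \<mu> by (simp add: power_mono)
  finally show ?thesis .
qed

lemma pmf_q: "pmf q x = (M x + M' x) / (2 * n)"
  unfolding q_def using n by (subst pmf_half_mixture) (auto simp: M_def M'_def field_simps)

lemma pmf_q_pos: "pmf q x > 0"
  unfolding pmf_q using M_nonneg[of x] M'_pos[of x] n by (intro divide_pos_pos add_nonneg_pos) auto

lemma sums_M: "M sums n"
proof -
  have "(\<lambda>x. pmf (Poi (lam i)) x) sums 1" for i
    using nat_pmf_expectation_sums(2)[of "Poi (lam i)" "\<lambda>_. 1"]
        nat_pmf_integrable_summable[of "Poi (lam i)" "\<lambda>_. 1"]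
    by simp
  then have "(\<lambda>x. \<Sum>i<n. pmf (Poi (lam i)) x) sums (\<Sum>i<n. 1)" by (intro sums_sum)
  then show ?thesis unfolding M_def by simp
qed

lemma sums_D: "D sums Etot"
proof -
  have "(\<lambda>x. \<mu> ^ x /\<^sub>R fact x) sums exp \<mu>" by (rule exp_converges)
  then have "(\<lambda>x. \<mu> ^ x / fact x) sums exp \<mu>" by (simp add: field_simps)
  then show ?thesis unfolding D_def Etot_def by (intro sums_diff sums_M sums_mult)
qed

lemma M0_eq: "M 0 = (n - Etot) * exp (- \<mu>)"
  unfolding Etot_def by (simp add: exp_minus field_simps)

lemma M'_eq: "M' x = v x * exp (- \<mu>)"
  unfolding M'_def v_def using \<mu> by (simp add: pmf_Poi)

lemma diff_eq: "M x - M' x = D x - Etot * exp (- \<mu>) * (\<mu> ^ x / fact x)"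
  unfolding D_def M'_eq v_def M0_eq by (simp add: algebra_simps)

text \<open>A Poisson law of rate at most \<open>l\<close> has mass at most \<open>l ^ x\<close> at
  \<open>x\<close>. Since \<open>n \<le> 2 ^ X\<close> and \<open>2 * l \<le> 1/2\<close>, the
  degrees beyond \<open>X\<close> contribute a geometric series of total order \<open>l\<close>,
  even after summation over all coordinates.\<close>

lemma tail_le: "x > X \<Longrightarrow> n * l ^ x \<le> 2 * l * (1/2) ^ x"
proof -
  assume "x > X"
  then obtain k where k: "x = Suc k" "k \<ge> X" by (cases x) auto
  have "n * l ^ x \<le> 2 ^ X * l ^ x" using nX l0 by (intro mult_right_mono)
      (auto simp: numeral_power_le_of_nat_cancel_iff of_nat_le_numeral_power_cancel_iff)
  also have "\<dots> \<le> 2 ^ k * l ^ x" using k l0 by (intro mult_right_mono power_increasing) auto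
  also have "\<dots> = l * (2 * l) ^ k" using k by (simp add: power_mult_distrib)
  also have "\<dots> \<le> l * (1/2) ^ k" using l l0 by (intro mult_left_mono power_mono) auto
  finally show ?thesis using k by simp
qed

text \<open>A term of the triangular (Vincze-Le Cam) discrimination of \<open>M\<close> and
  \<open>M'\<close>; up to the factor \<open>2 * n\<close> it is the contribution of
  \<open>x\<close> to the chi-square divergence from the mixture \<open>q\<close>.\<close>

definition chi :: "nat \<Rightarrow> real" where "chi x = (M x - M' x)\<^sup>2 / (M x + M' x)"

lemma chi_le_abs: "chi x \<le> \<bar>M x - M' x\<bar>" "chi x \<le> M x + M' x"
proof -
  have p: "M x + M' x > 0" using M_nonneg[of x] M'_pos[of x] by simp
  have a: "\<bar>M x - M' x\<bar> \<le> M x + M' x" using M_nonneg[of x] M'_pos[of x] by linarith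
  have "(M x - M' x)\<^sup>2 \<le> \<bar>M x - M' x\<bar> * (M x + M' x)"
    using mult_left_mono[OF a, of "\<bar>M x - M' x\<bar>"] by (simp add: power2_eq_square abs_mult_self_eq)
  then show 1: "chi x \<le> \<bar>M x - M' x\<bar>" using p by (simp add: chi_def divide_le_eq)
  then show "chi x \<le> M x + M' x" using a by simp
qed

section \<open>From deviations of the expected counts to total variation\<close>

context
  assumes Dbound: "\<And>x. 1 \<le> x \<Longrightarrow> x \<le> X \<Longrightarrow> \<bar>D x\<bar> \<le> c3 * (sqrt (v x * \<eta>) + \<eta>)"
begin

lemma v_le: "v x \<le> n"
proof -
  have "\<mu> ^ x / fact x \<le> l ^ x" by (rule mu_power_le)
  also have "\<dots> \<le> 1" using l l0 by (intro power_le_one) auto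
  finally show ?thesis unfolding v_def by (intro mult_left_le) auto
qed

lemma v_nonneg: "v x \<ge> 0" unfolding v_def using \<mu> by auto

lemma D_le: "\<bar>D x\<bar> \<le> (if x \<le> X then c3 * 2 * sqrt (n * \<eta>) else 0) + 2 * l * (1/2) ^ x"
proof (cases "x \<le> X")
  case True
  have "c3 * (sqrt (v x * \<eta>) + \<eta>) \<le> c3 * (sqrt (n * \<eta>) + sqrt (n * \<eta>))"
  proof (intro mult_left_mono add_mono)
    show "sqrt (v x * \<eta>) \<le> sqrt (n * \<eta>)" using v_le[of x] \<eta> by (intro real_sqrt_le_mono mult_right_mono) auto
    have "\<eta> = sqrt (\<eta> * \<eta>)" using \<eta> by simp
    also have "\<dots> \<le> sqrt (n * \<eta>)" using \<eta> n by (intro real_sqrt_le_mono mult_right_mono) auto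
    finally show "\<eta> \<le> sqrt (n * \<eta>)" .
  qed (use c3 in auto)
  moreover have "D 0 = 0" by (simp add: D_def)
  ultimately have "\<bar>D x\<bar> \<le> c3 * 2 * sqrt (n * \<eta>)"
    using order_trans[OF Dbound[of x], of "c3 * 2 * sqrt (n * \<eta>)"] True c3 \<eta> by (cases "x = 0") auto
  moreover have "2 * l * (1/2) ^ x \<ge> 0" using l0 by simp
  ultimately show ?thesis using True by auto
next
  case False
  have "M 0 * (\<mu> ^ x / fact x) \<le> n * l ^ x"
    using M0_le M_nonneg[of 0] mu_power_le[of x] \<mu> l0 by (intro mult_mono) auto
  moreover have "0 \<le> M 0 * (\<mu> ^ x / fact x)" using M_nonneg[of 0] \<mu> by auto
  ultimately have "\<bar>D x\<bar> \<le> n * l ^ x" unfolding D_def using M_le[of x] M_nonneg[of x] by linarith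
  then show ?thesis using tail_le[of x] False by simp
qed

lemma Etot_le: "\<bar>Etot\<bar> \<le> 2 * c3 * (X + 1) * sqrt (n * \<eta>) + 4 * l"
proof -
  have "(\<lambda>x. (if x \<in> {..X} then c3 * 2 * sqrt (n * \<eta>) else 0) + 2 * l * (1/2) ^ x) sums
      ((\<Sum>x\<le>X. c3 * 2 * sqrt (n * \<eta>)) + 2 * l / (1 - 1/2))"
    by (intro sums_add sums_If_finite_set sums_geometric_real) auto
  from sums_le_abs[OF sums_D this] D_le show ?thesis by (simp add: algebra_simps)
qed

definition e2 :: real where "e2 = Etot\<^sup>2 / n"

text \<open>The squared error of the normalization, relative to \<open>n\<close>. It collects
  \<open>X + 1\<close> deviations of size \<open>sqrt (n * \<eta>)\<close>, whose sum is squared: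
  this is where the factor \<open>(X + 1)\<^sup>2\<close>, and hence the order of \<eta>, comes
  from.\<close>

lemma e2_le: "e2 \<le> 8 * c3\<^sup>2 * (real X + 1)\<^sup>2 * \<eta> + 4 * l"
proof -
  define a where "a = 2 * c3 * (X + 1) * sqrt (n * \<eta>)"
  have "Etot\<^sup>2 \<le> (a + 4 * l)\<^sup>2"
    using Etot_le unfolding a_def by (intro abs_le_square_iff[THEN iffD1]) auto
  also have "\<dots> \<le> 2 * a\<^sup>2 + 2 * (4 * l)\<^sup>2"
    using sum_squares_bound[of a "4 * l"] by (simp add: power2_sum)
  also have "a\<^sup>2 = 4 * c3\<^sup>2 * (real X + 1)\<^sup>2 * (n * \<eta>)"
    unfolding a_def using \<eta> by (simp add: power_mult_distrib)
  finally have "Etot\<^sup>2 \<le> n * (8 * c3\<^sup>2 * (real X + 1)\<^sup>2 * \<eta>) + 32 * l * l"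
      by (simp add: power2_eq_square algebra_simps)
  also have "32 * l * l \<le> 8 * l" using l l0 mult_left_mono[of l "1/4" "32 * l"] by simp
  also have "8 * l \<le> n * (4 * l)" using n l0 mult_right_mono[of 2 "real n" "4 * l"] by simp
  finally show ?thesis unfolding e2_def using n by (simp add: divide_le_eq algebra_simps)
qed

lemma e2_nonneg: "e2 \<ge> 0" by (simp add: e2_def)

text \<open>For \<open>x \<le> X\<close> it matters which part of the deviation dominates. If
  \<open>v x \<ge> \<eta>\<close>, then \<open>(D x)\<^sup>2\<close> is of order
  \<open>v x * \<eta>\<close>, and division by \<open>M' x\<close>, which is comparable to
  \<open>v x\<close>, leaves \<eta>. If \<open>v x < \<eta>\<close>, then \<open>M x - M' x\<close>
  itself is of order \<eta>. In the first case the error of the normalization adds a share of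
  \<open>e2\<close> that decays geometrically in \<open>x\<close>.\<close>

lemma chi_le: "chi x \<le> (if x \<le> X then 16 * c3\<^sup>2 * \<eta> else 0) + (2 * e2 * (1/4) ^ x + 4 * l * (1/2) ^ x)"
proof (cases "x \<le> X")
  case False
  have "chi x \<le> 2 * (n * l ^ x)" using chi_le_abs(2)[of x] M_le[of x] M'_le[of x] by simp
  also have "\<dots> \<le> 4 * l * (1/2) ^ x" using tail_le[of x] False by simp
  finally show ?thesis using False e2_nonneg by (simp add: add_increasing)
next
  case True
  have em: "1/2 \<le> exp (- \<mu>)" "exp (- \<mu>) \<le> 1"
  proof -
    have "1 + (- \<mu>) \<le> exp (- \<mu>)" by (rule exp_ge_add_one_self)
    then show "1/2 \<le> exp (- \<mu>)" using \<mu> l by linarith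
  qed (use \<mu> in auto)
  define w where "w = \<mu> ^ x / fact x"
  have w: "w > 0" "w \<le> (1/4) ^ x"
  proof -
    show "w > 0" unfolding w_def using \<mu> by simp
    have "w \<le> l ^ x" unfolding w_def by (rule mu_power_le)
    also have "\<dots> \<le> (1/4) ^ x" using l l0 by (intro power_mono) auto
    finally show "w \<le> (1/4) ^ x" .
  qed
  have vw: "v x = n * w" by (simp add: v_def w_def)
  have vp: "v x > 0" using w n by (simp add: vw)
  have Dx: "\<bar>D x\<bar> \<le> c3 * (sqrt (v x * \<eta>) + \<eta>)"
  proof (cases "x = 0")
    case True
    then show ?thesis using c3 \<eta> v_nonneg[of 0] by (simp add: D_def)
  qed (use Dbound True in auto)
  have goal: "chi x \<le> 16 * c3\<^sup>2 * \<eta> + 2 * e2 * (1/4) ^ x"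
  proof (cases "v x \<ge> \<eta>")
    case big: True
    have "\<eta> = sqrt (\<eta> * \<eta>)" using \<eta> by simp
    also have "\<dots> \<le> sqrt (v x * \<eta>)" using big \<eta> by (intro real_sqrt_le_mono mult_right_mono) auto
    finally have "c3 * (sqrt (v x * \<eta>) + \<eta>) \<le> c3 * (2 * sqrt (v x * \<eta>))" using c3 by (intro mult_left_mono) auto
    then have "\<bar>D x\<bar> \<le> 2 * c3 * sqrt (v x * \<eta>)" using Dx by simp
    then have "(D x)\<^sup>2 \<le> (2 * c3 * sqrt (v x * \<eta>))\<^sup>2" by (intro abs_le_square_iff[THEN iffD1]) auto
    then have D2: "(D x)\<^sup>2 \<le> 4 * c3\<^sup>2 * (v x * \<eta>)" using vp \<eta> by (simp add: power_mult_distrib)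
    have "(Etot * exp (- \<mu>) * w)\<^sup>2 = (Etot\<^sup>2 * w) * (exp (- \<mu>) * exp (- \<mu>) * w)"
        by (simp add: power2_eq_square mult_ac)
    also have "\<dots> \<le> (Etot\<^sup>2 * w) * (1 * exp (- \<mu>) * w)"
      using em w by (intro mult_left_mono mult_right_mono) auto
    also have "\<dots> = e2 * w * M' x" unfolding M'_eq vw e2_def using n by simp
    finally have E2: "(Etot * exp (- \<mu>) * w)\<^sup>2 \<le> e2 * w * M' x" .
    have "(M x - M' x)\<^sup>2 \<le> 2 * (D x)\<^sup>2 + 2 * (Etot * exp (- \<mu>) * w)\<^sup>2"
      unfolding diff_eq w_def[symmetric] using sum_squares_bound[of "D x" "- (Etot * exp (- \<mu>) * w)"]
      by (simp add: power2_diff)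
    also have "\<dots> \<le> 2 * (4 * c3\<^sup>2 * (v x * \<eta>)) + 2 * (e2 * w * M' x)" using D2 E2 by simp
    also have "2 * (4 * c3\<^sup>2 * (v x * \<eta>)) \<le> 16 * c3\<^sup>2 * \<eta> * M' x"
    proof -
      have "v x \<le> 2 * M' x" unfolding M'_eq using em vp by (simp add: field_simps)
      then have "(8 * c3\<^sup>2 * \<eta>) * v x \<le> (8 * c3\<^sup>2 * \<eta>) * (2 * M' x)" using \<eta> by (intro mult_left_mono) auto
      then show ?thesis by (simp add: mult_ac)
    qed
    finally have "(M x - M' x)\<^sup>2 \<le> (16 * c3\<^sup>2 * \<eta> + 2 * e2 * w) * M' x" by (simp add: algebra_simps)
    then have "(M x - M' x)\<^sup>2 / M' x \<le> 16 * c3\<^sup>2 * \<eta> + 2 * e2 * w" using M'_pos[of x]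
        by (simp add: divide_le_eq)
    moreover have "chi x \<le> (M x - M' x)\<^sup>2 / M' x"
      unfolding chi_def using M_nonneg[of x] M'_pos[of x] by (intro divide_left_mono) auto
    moreover have "2 * e2 * w \<le> 2 * e2 * (1/4) ^ x" using w e2_nonneg by (intro mult_left_mono) auto
    ultimately show ?thesis by linarith
  next
    case small: False
    have "sqrt (v x * \<eta>) \<le> sqrt (\<eta> * \<eta>)" using small \<eta> by (intro real_sqrt_le_mono mult_right_mono) auto
    then have "c3 * (sqrt (v x * \<eta>) + \<eta>) \<le> c3 * (2 * \<eta>)" using c3 \<eta> by (intro mult_left_mono) auto
    then have D2: "\<bar>D x\<bar> \<le> 2 * c3 * \<eta>" using Dx by simp
    have "exp \<mu> \<le> 2"
    proof -
      have "exp \<mu> \<le> 1 + \<mu> + \<mu>\<^sup>2" using \<mu> l by (intro exp_le_quadratic) auto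
      also have "\<mu>\<^sup>2 \<le> \<mu> * 1" unfolding power2_eq_square using \<mu> l by (intro mult_left_mono) auto
      finally show ?thesis using \<mu> l by simp
    qed
    then have "M 0 * exp \<mu> \<le> real n * 2" using M0_le M_nonneg[of 0] by (intro mult_mono) auto
    moreover have "0 \<le> M 0 * exp \<mu>" using M_nonneg[of 0] by simp
    ultimately have En: "\<bar>Etot\<bar> \<le> n" unfolding Etot_def by simp
    have "\<bar>Etot * exp (- \<mu>) * w\<bar> = \<bar>Etot\<bar> * (exp (- \<mu>) * w)" using w by (simp add: abs_mult)
    also have "\<dots> \<le> n * (1 * w)" using En em w by (intro mult_mono) auto
    also have "\<dots> \<le> \<eta>" using small by (simp add: vw)
    finally have "chi x \<le> 2 * c3 * \<eta> + \<eta>"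
      using chi_le_abs(1)[of x] D2 unfolding diff_eq w_def[symmetric] by linarith
    also have "\<dots> \<le> 16 * c3\<^sup>2 * \<eta>"
    proof -
      have "c3 \<le> c3\<^sup>2" using c3 by (simp add: power2_eq_square)
      then have "2 * c3 + 1 \<le> 16 * c3\<^sup>2" using c3 by linarith
      then have "(2 * c3 + 1) * \<eta> \<le> 16 * c3\<^sup>2 * \<eta>" using \<eta> by (intro mult_right_mono) auto
      then show ?thesis by (simp add: algebra_simps)
    qed
    finally show ?thesis using e2_nonneg by (simp add: add_increasing2)
  qed
  have "4 * l * (1/2) ^ x \<ge> 0" using l0 by simp
  then show ?thesis using goal True by simp
qed

text \<open>An upper bound for the sum of all \<open>chi x\<close>, with \<open>e2_le\<close>
  inserted; 40 exceeds 16 + 64/3.\<close>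

definition xi :: real where "xi = 40 * c3\<^sup>2 * (real X + 1)\<^sup>2 * \<eta> + 100 * l"

lemma xi_nonneg: "xi \<ge> 0" unfolding xi_def using \<eta> l0 by auto

lemma density_ratio:
  assumes F: "\<And>x. F x = ((M x - M' x) / (M x + M' x))\<^sup>2"
  shows "integrable (measure_pmf q) F" and "measure_pmf.expectation q F
      \<le> xi / (2 * n)" "measure_pmf.expectation q F \<ge> 0"
proof -
  have p: "M x + M' x > 0" for x using M_nonneg[of x] M'_pos[of x] by simp
  have qF: "pmf q x * F x = chi x / (2 * n)" for x
    unfolding pmf_q F chi_def using p[of x] n by (simp add: power_divide power2_eq_square)
  have s: "(\<lambda>x. (if x \<in> {..X} then 16 * c3\<^sup>2 * \<eta> else 0) + (2 * e2 * (1/4) ^ x + 4 * l * (1/2) ^ x)) sums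
      ((\<Sum>x\<le>X. 16 * c3\<^sup>2 * \<eta>) + (2 * e2 / (1 - 1/4) + 4 * l / (1 - 1/2)))"
    by (intro sums_add sums_If_finite_set sums_geometric_real) auto
  have "(\<Sum>x\<le>X. 16 * c3\<^sup>2 * \<eta>) + (2 * e2 / (1 - 1/4) + 4 * l / (1 - 1/2)) = 16 * (c3\<^sup>2 * (real X + 1) * \<eta>)
      + 8/3 * e2 + 8 * l"
    by (simp add: algebra_simps)
  also have "\<dots> \<le> 16 * (c3\<^sup>2 * (real X + 1)\<^sup>2 * \<eta>) + 8/3 * (8 * c3\<^sup>2 * (real X + 1)\<^sup>2 * \<eta> + 4 * l) + 8 * l"
  proof (intro add_mono mult_left_mono e2_le order.refl mult_right_mono)
    show "real X + 1 \<le> (real X + 1)\<^sup>2" by (simp add: power2_eq_square)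
  qed (use \<eta> in auto)
  also have "\<dots> \<le> xi"
  proof -
    define w where "w = c3\<^sup>2 * (real X + 1)\<^sup>2 * \<eta>"
    have "w \<ge> 0" unfolding w_def using \<eta> by auto
    moreover have "8/3 * (8 * w + 4 * l) = 64/3 * w + 32/3 * l" by (simp add: algebra_simps)
    ultimately have "16 * w + 8/3 * (8 * w + 4 * l) + 8 * l \<le> 40 * w + 100 * l" using l0 by linarith
    then show ?thesis unfolding xi_def w_def by (simp add: mult.assoc)
  qed
  finally have le: "(\<Sum>x\<le>X. 16 * c3\<^sup>2 * \<eta>) + (2 * e2 / (1 - 1/4) + 4 * l / (1 - 1/2)) \<le> xi" .
  note bs = sums_divide[OF s, of "2 * real n"]
  have b: "pmf q x * F x \<le> ((if x \<in> {..X} then 16 * c3\<^sup>2 * \<eta> else 0)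
      + (2 * e2 * (1/4) ^ x + 4 * l * (1/2) ^ x)) / (2 * real n)" for x
    unfolding qF using divide_right_mono[OF chi_le[of x], of "2 * real n"] by simp
  have F0: "F x \<ge> 0" for x by (simp add: F)
  show "integrable (measure_pmf q) F" by (rule nat_pmf_expectation_le(1)[OF F0 bs b])
  have "measure_pmf.expectation q F \<le> ((\<Sum>x\<le>X. 16 * c3\<^sup>2 * \<eta>) + (2 * e2 / (1 - 1/4) + 4 * l / (1 - 1/2))) /
      (2 * real n)"
    by (rule nat_pmf_expectation_le(2)[OF F0 bs b])
  also have "\<dots> \<le> xi / (2 * real n)" using le by (rule divide_right_mono) auto
  finally show "measure_pmf.expectation q F \<le> xi / (2 * n)" by simp
  show "measure_pmf.expectation q F \<ge> 0" using F0 by simp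
qed

text \<open>A constant family is an instance of the permutation bound. Its single divergence equals
  that of its mixture, so with \<open>harm n \<le> n\<close> the total is at most twice the mixture
  term.\<close>

lemma expectation_Prod_Poi_le_mix:
  fixes f :: "(nat \<Rightarrow> nat) \<Rightarrow> real"
  assumes f: "\<And>x. \<bar>f x\<bar> \<le> B"
  shows "measure_pmf.expectation (Prod_dist n (\<lambda>_. Poi \<mu>)) f
    \<le> xi + ln (measure_pmf.expectation (Prod_dist n (\<lambda>_. q)) (\<lambda>y. exp (f y)))"
proof -
  define R where "R = (\<lambda>x. 2 * M' x / (M x + M' x))"
  have p: "M x + M' x > 0" for x using M_nonneg[of x] M'_pos[of x] by simp
  have R: "0 \<le> R x" "R x \<le> 2" for x
    unfolding R_def using M_nonneg[of x] M'_pos[of x] p[of x] by (auto simp: divide_le_eq)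
  have Rb: "\<bar>R x\<bar> \<le> 2" for x using R[of x] by simp
  have RRb: "\<bar>R x * R x\<bar> \<le> 4" for x using mult_mono[of "R x" 2 "R x" 2] R[of x] by simp
  have dens: "pmf (Poi \<mu>) x = pmf q x * R x" for x
    unfolding pmf_q R_def using p[of x] n by (simp add: M'_def)
  define F where "F = (\<lambda>x. ((M x - M' x) / (M x + M' x))\<^sup>2)"
  note F = density_ratio[of F, unfolded F_def, OF refl, folded F_def]
  have ER: "measure_pmf.expectation q R = 1"
    using nat_pmf_expectation_density[of "Poi \<mu>" q R "\<lambda>_. 1", OF dens] by simp
  have RF: "R x * R x = F x + (2 * R x - 1)" for x
    unfolding F_def R_def by (rule square_ratio_eq[OF p])
  have g: "measure_pmf.expectation q (\<lambda>x. R x * R x) = measure_pmf.expectation q F + 1"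
    unfolding RF using F(1) ER integrable_pmf_bounded[OF Rb, of q] by simp
  define x where "x = measure_pmf.expectation q F"
  have "measure_pmf.expectation (Perm_dist n (\<lambda>_. Poi \<mu>)) f \<le>
     perm_divergence n (\<lambda>i j. measure_pmf.expectation q (\<lambda>x. R x * R x))
     + ln (measure_pmf.expectation (Prod_dist n (\<lambda>_. q)) (\<lambda>y. exp (f y)))"
    by (rule expectation_Perm_dist_le[OF f R(1) nat_pmf_expectation_density[OF dens]
          integrable_pmf_bounded[OF Rb] integrable_pmf_bounded[OF RRb]])
  also have "perm_divergence n (\<lambda>i j. measure_pmf.expectation q (\<lambda>x. R x * R x)) \<le> n * x + harm n * x"
    by (rule perm_divergence_le[OF n]) (use F in \<open>auto simp: g x_def power2_eq_square algebra_simps\<close>)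
  also have "n * x + harm n * x \<le> n * x + n * x"
    using F(3) harm_le_nat[of n] by (intro add_left_mono mult_right_mono) (auto simp: x_def)
  also have "\<dots> \<le> xi" using F(2) n by (simp add: x_def field_simps)
  finally show ?thesis by (simp add: Perm_dist_const)
qed

text \<open>The mean divergence of a single law is of order \<open>l\<close>: at 0 the mixture has
  mass at least \<open>1 - l\<close>, so the density there is at most \<open>1 + 2 * l\<close>; at
  \<open>x \<ge> 1\<close> the law has mass at most \<open>l ^ x\<close>, while the densities
  average to at most 2. Writing \<open>l ^ x\<close> as at most \<open>4 * l * (1/4) ^ x\<close>
  gives the factor 8 and the total 8 / (1 - 1/4) \<le> 11.\<close>

lemma expectation_Perm_Poi_le_mix:
  fixes f :: "(nat \<Rightarrow> nat) \<Rightarrow> real"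
  assumes f: "\<And>x. \<bar>f x\<bar> \<le> B"
  shows "measure_pmf.expectation (Perm_dist n (\<lambda>i. Poi (lam i))) f
    \<le> xi + harm n * (11 * l) + ln (measure_pmf.expectation (Prod_dist n (\<lambda>_. q)) (\<lambda>y. exp (f y)))"
proof -
  define la where "la = (\<lambda>i. if i < n then lam i else \<mu>)"
  define r where "r = (\<lambda>i x. pmf (Poi (la i)) x / pmf q x)"
  have p: "M x + M' x > 0" for x using M_nonneg[of x] M'_pos[of x] by simp
  have pM: "pmf (Poi (lam i)) x \<le> M x" if "i < n" for i x
    unfolding M_def using that by (intro member_le_sum) auto
  have pM': "pmf (Poi \<mu>) x \<le> M' x" for x
    unfolding M'_def using n mult_right_mono[of 1 "real n" "pmf (Poi \<mu>) x"] by simp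
  have "pmf (Poi (la i)) x \<le> M x + M' x" for i x
    using pM[of i x] pM'[of x] M_nonneg[of x] M'_pos[of x] unfolding la_def by auto
  then have r: "0 \<le> r i x" "r i x \<le> 2 * n" for i x
    unfolding r_def pmf_q using p[of x] n by (auto simp: divide_le_eq)
  have rb: "\<bar>r i x\<bar> \<le> 2 * n" for i x using r[of i x] by simp
  have rrb: "\<bar>r i x * r j x\<bar> \<le> real (2 * n) * real (2 * n)" for i j x
    unfolding abs_mult using rb[of i x] rb[of j x] by (intro mult_mono) auto
  have irr: "integrable (measure_pmf q) (\<lambda>x. r i x * r j x)" for i j
    by (rule integrable_pmf_bounded[OF rrb])
  have dens: "pmf (Poi (la i)) x = pmf q x * r i x" for i x
    unfolding r_def using pmf_q_pos[of x] by simp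
  define R where "R = (\<lambda>x. (\<Sum>i<n. r i x) / n)"
  have R: "R x = 2 * M x / (M x + M' x)" for x
    unfolding R_def r_def sum_divide_distrib[symmetric] pmf_q using p[of x] n
    by (simp add: la_def M_def)
  have Rb: "\<bar>R x\<bar> \<le> 2" for x
    unfolding R using M_nonneg[of x] M'_pos[of x] by (simp add: divide_le_eq)
  define F where "F = (\<lambda>x. ((M x - M' x) / (M x + M' x))\<^sup>2)"
  note F = density_ratio[of F, unfolded F_def, OF refl, folded F_def]
  have RF: "R x * R x = F x + (2 * R x - 1)" for x
    unfolding F_def R using square_ratio_eq[of "M' x" "M x"] p[of x]
    by (simp add: add.commute power2_commute power_divide)
  have E1: "measure_pmf.expectation q (r i) = 1" for i
    using nat_pmf_expectation_density[of "Poi (la i)" q "r i" "\<lambda>_. 1", OF dens] by simp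
  have ER: "measure_pmf.expectation q R = 1"
  proof -
    have "measure_pmf.expectation q (\<lambda>x. \<Sum>i<n. r i x) = (\<Sum>i<n. measure_pmf.expectation q (r i))"
      by (rule Bochner_Integration.integral_sum) (rule integrable_pmf_bounded[OF rb])
    then show ?thesis unfolding R_def using n by (simp add: E1)
  qed
  have gR: "measure_pmf.expectation q (\<lambda>x. R x * R x) = measure_pmf.expectation q F + 1"
    unfolding RF using F(1) ER integrable_pmf_bounded[OF Rb, of q] by simp
  define x where "x = measure_pmf.expectation q F"
  have TT: "(\<Sum>i<n. \<Sum>j<n. measure_pmf.expectation q (\<lambda>x. r i x * r j x)) = (real n)\<^sup>2 * (1 + x)"
  proof -
    have "(\<Sum>i<n. \<Sum>j<n. measure_pmf.expectation q (\<lambda>x. r i x * r j x))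
      = measure_pmf.expectation q (\<lambda>x. \<Sum>i<n. \<Sum>j<n. r i x * r j x)"
      using irr by (simp add: Bochner_Integration.integral_sum)
    also have "\<dots> = measure_pmf.expectation q (\<lambda>x. (real n)\<^sup>2 * (R x * R x))"
      unfolding R_def sum_product[symmetric] using n by (simp add: power2_eq_square)
    finally show ?thesis by (simp add: gR x_def)
  qed
  have T: "(\<Sum>i<n. measure_pmf.expectation q (\<lambda>x. r i x * r i x)) \<le> n * (1 + 11 * l)"
  proof -
    have "(\<Sum>i<n. measure_pmf.expectation q (\<lambda>x. r i x * r i x))
        = measure_pmf.expectation q (\<lambda>x. \<Sum>i<n. r i x * r i x)"
      using irr by (simp add: Bochner_Integration.integral_sum)
    also have "\<dots> \<le> n + 8 * n * l / (1 - 1/4)"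
    proof (rule nat_pmf_expectation_le(2))
      show "(\<Sum>i<n. r i x * r i x) \<ge> 0" for x by (intro sum_nonneg) simp
      have "(\<lambda>x. (if x = 0 then real n else 0) + 8 * n * l * (1/4) ^ x) sums (real n + 8 * n * l / (1 - 1/4))"
        by (intro sums_add sums_single[of 0 "\<lambda>_. real n"] sums_geometric_real) auto
      then show "(\<lambda>x. (if x = 0 then real n else 0) + 8 * n * l * (1/4) ^ x) sums (n + 8 * n * l / (1 - 1/4))"
        by simp
      show "pmf q x * (\<Sum>i<n. r i x * r i x) \<le> (if x = 0 then real n else 0) + 8 * n * l * (1/4) ^ x" for x
      proof -
        have "pmf q x * (\<Sum>i<n. r i x * r i x) = (\<Sum>i<n. pmf (Poi (lam i)) x * r i x)"
          unfolding sum_distrib_left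
        proof (rule sum.cong[OF refl])
          fix i assume "i \<in> {..<n}"
          then have "pmf (Poi (lam i)) x = pmf q x * r i x" using dens[of i x] by (simp add: la_def)
          then show "pmf q x * (r i x * r i x) = pmf (Poi (lam i)) x * r i x" by simp
        qed
        also have "\<dots> \<le> (if x = 0 then real n else 0) + 8 * n * l * (1/4) ^ x"
        proof (cases "x = 0")
          case True
          have "1 - l \<le> pmf q 0"
          proof -
            have e: "1 - l \<le> pmf (Poi c) 0" if "0 \<le> c" "c \<le> l" for c
              using exp_ge_add_one_self[of "- c"] that by (simp add: pmf_Poi)
            have "n * (1 - l) \<le> M 0"
              unfolding M_def using sum_bounded_below[of "{..<n}" "1 - l" "\<lambda>i. pmf (Poi (lam i)) 0"] e lam
                  by simp
            moreover have "n * (1 - l) \<le> M' 0"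
              unfolding M'_def using e[of \<mu>] \<mu> by (intro mult_left_mono) auto
            ultimately show ?thesis unfolding pmf_q using n by (simp add: le_divide_eq algebra_simps)
          qed
          have i1: "1 / pmf q 0 \<le> 1 + 2 * l"
          proof -
            have "1 \<le> (1 + 2 * l) * (1 - l)" using l l0 mult_left_mono[OF l, of "2 * l"]
                by (simp add: algebra_simps)
            also have "\<dots> \<le> (1 + 2 * l) * pmf q 0" using \<open>1 - l \<le> pmf q 0\<close> l0 by (intro mult_left_mono) auto
            finally show ?thesis using pmf_q_pos[of 0] by (simp add: divide_le_eq)
          qed
          have "(\<Sum>i<n. pmf (Poi (lam i)) 0 * r i 0) \<le> (\<Sum>i<n. 1 * (1 + 2 * l))"
          proof (intro sum_mono mult_mono)
            fix i
            have "r i 0 \<le> 1 / pmf q 0" unfolding r_def by (intro divide_right_mono) (auto simp: pmf_le_1)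
            then show "r i 0 \<le> 1 + 2 * l" using i1 by simp
          qed (use r in \<open>auto simp: pmf_le_1\<close>)
          also have "\<dots> = n + 2 * n * l" by (simp add: algebra_simps)
          also have "\<dots> \<le> n + 8 * n * l" using l0 by (intro add_left_mono mult_right_mono) auto
          finally show ?thesis using True by simp
        next
          case False
          then obtain k where k: "x = Suc k" by (cases x) auto
          have "(\<Sum>i<n. pmf (Poi (lam i)) x * r i x) \<le> (\<Sum>i<n. l ^ x * r i x)"
            using lam r by (intro sum_mono mult_right_mono pmf_Poi_le_power) auto
          also have "\<dots> = l ^ x * (n * R x)" unfolding R_def sum_distrib_left[symmetric] using n by simp
          also have "\<dots> \<le> l ^ x * (real n * 2)" using abs_le_D1[OF Rb[of x]] l0 by (intro mult_left_mono) auto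
          also have "\<dots> = 2 * n * l * l ^ k" using k by simp
          also have "\<dots> \<le> 2 * n * l * (1/4) ^ k" using l l0 by (intro mult_left_mono power_mono) auto
          finally show ?thesis using k by (simp add: mult_ac)
        qed
        finally show ?thesis .
      qed
    qed
    also have "\<dots> \<le> n * (1 + 11 * l)" using l0 by (simp add: algebra_simps)
    finally show ?thesis .
  qed
  have "measure_pmf.expectation (Perm_dist n (\<lambda>i. Poi (la i))) f \<le>
     perm_divergence n (\<lambda>i j. measure_pmf.expectation q (\<lambda>x. r i x * r j x))
     + ln (measure_pmf.expectation (Prod_dist n (\<lambda>_. q)) (\<lambda>y. exp (f y)))"
    by (rule expectation_Perm_dist_le[OF f r(1) nat_pmf_expectation_density[OF dens]
          integrable_pmf_bounded[OF rb] integrable_pmf_bounded[OF rrb]])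
  also have "perm_divergence n (\<lambda>i j. measure_pmf.expectation q (\<lambda>x. r i x * r j x)) \<le> n * x
      + harm n * (11 * l)"
    by (rule perm_divergence_le[OF n]) (use F TT T l0 in \<open>auto simp: x_def\<close>)
  also have "n * x \<le> xi" using F(2) n xi_nonneg by (simp add: x_def field_simps)
  also have "Perm_dist n (\<lambda>i. Poi (la i)) = Perm_dist n (\<lambda>i. Poi (lam i))"
    by (rule Perm_dist_cong) (simp add: la_def)
  finally show ?thesis by simp
qed

lemma d_TV_small:
  assumes \<theta>: "0 < \<theta>" "\<theta> \<le> 1"
  shows "d_TV (Prod_dist n (\<lambda>_. Poi \<mu>)) (Perm_dist n (\<lambda>i. Poi (lam i)))
    \<le> (2 * xi + harm n * (11 * l)) / \<theta> + 2 * \<theta>"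
proof (rule d_TV_le)
  fix S
  let ?P = "Prod_dist n (\<lambda>_. Poi \<mu>)" and ?P' = "Perm_dist n (\<lambda>i. Poi (lam i))" and ?Q = "Prod_dist n (\<lambda>_. q)"
  have "measure_pmf.prob ?P S \<le> measure_pmf.prob ?Q S + xi / \<theta> + \<theta>"
    by (rule prob_le_of_expectation_le[OF expectation_Prod_Poi_le_mix \<theta>])
  \<comment> \<open>The entropy bounds are one-sided and both have the mixture on the right, so the
    second one is applied to the complement.\<close>
  moreover have "measure_pmf.prob ?P' (- S) \<le> measure_pmf.prob ?Q (- S) + (xi + harm n * (11 * l)) / \<theta> + \<theta>"
    by (rule prob_le_of_expectation_le[OF expectation_Perm_Poi_le_mix \<theta>])
  moreover have "measure_pmf.prob ?P' (- S) = 1 - measure_pmf.prob ?P' S"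
    "measure_pmf.prob ?Q (- S) = 1 - measure_pmf.prob ?Q S"
    using measure_pmf.prob_compl[of S] by (auto simp: Compl_eq_Diff_UNIV)
  ultimately show "measure_pmf.prob ?P S \<le> measure_pmf.prob ?P' S + ((2 * xi + harm n * (11 * l)) / \<theta> + 2 * \<theta>)"
    by (simp add: add_divide_distrib)
qed

end

end

section \<open>Concentration\<close>

text \<open>Chernoff's bound for a variable whose moment generating function is at most that of a Gaussian of
  variance \<open>2 V\<close> on \<open>[0, \<kappa>]\<close>; the set \<open>A\<close> allows truncation.\<close>

lemma chernoff_subgamma:
  fixes Z :: "'a \<Rightarrow> real"
  assumes mgf: "\<And>t. 0 \<le> t \<Longrightarrow> t \<le> \<kappa> \<Longrightarrow> integrable (measure_pmf p) (\<lambda>y. exp (t * Z y) * indicator A y)"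
      "\<And>t. 0 \<le> t \<Longrightarrow> t \<le> \<kappa> \<Longrightarrow> measure_pmf.expectation p (\<lambda>y. exp (t * Z y) * indicator A y) \<le> exp (t\<^sup>2 * V)"
    and V: "V \<ge> 0" and K: "K > 0" and \<kappa>: "0 < \<kappa>" "\<kappa> \<le> 1"
    and D: "D \<ge> 2 * (sqrt (V * K) + K) / \<kappa>"
  shows "measure_pmf.prob p {y \<in> A. Z y \<ge> D} \<le> exp (- K)"
proof -
  have markov: "measure_pmf.prob p {y \<in> A. Z y \<ge> D} \<le> exp (t\<^sup>2 * V - t * D)" if t: "0 \<le> t" "t \<le> \<kappa>" for t
  proof -
    have "measure_pmf.prob p {y \<in> A. Z y \<ge> D} = measure_pmf.expectation p (indicator {y \<in> A. Z y \<ge> D})"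
      by simp
    also have "\<dots> \<le> measure_pmf.expectation p (\<lambda>y. exp (- (t * D)) * (exp (t * Z y) * indicator A y))"
    proof (rule integral_mono)
      show "integrable (measure_pmf p) (indicator {y \<in> A. Z y \<ge> D} :: 'a \<Rightarrow> real)"
        by (rule integrable_pmf_bounded[of _ 1]) (auto simp: indicator_def)
      show "integrable (measure_pmf p) (\<lambda>y. exp (- (t * D)) * (exp (t * Z y) * indicator A y))"
        by (intro integrable_mult_right mgf t)
      fix y
      show "indicator {y \<in> A. Z y \<ge> D} y \<le> exp (- (t * D)) * (exp (t * Z y) * indicator A y)"
      proof (cases "y \<in> A \<and> Z y \<ge> D")
        case True
        then have "t * D \<le> t * Z y" using t by (intro mult_left_mono) auto
        then have "1 \<le> exp (- (t * D) + t * Z y)" by simp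
        then show ?thesis using True unfolding exp_add by simp
      qed (auto simp: indicator_def)
    qed
    also have "\<dots> \<le> exp (- (t * D)) * exp (t\<^sup>2 * V)"
      using mgf[OF t] by simp
    finally show ?thesis by (simp add: exp_add[symmetric])
  qed
  have sq: "sqrt (V * K) \<ge> 0" using V K by simp
  show ?thesis
  \<comment> \<open>The optimal exponent \<open>sqrt (K / V)\<close> is admissible in the first
    case; otherwise the end point \<kappa> is used and the linear part of \<open>D\<close>
    pays.\<close>
  proof (cases "K \<le> \<kappa>\<^sup>2 * V")
    case True
    then have Vp: "V > 0" using K \<kappa> V by (cases "V = 0") auto
    define t where "t = sqrt (K / V)"
    have t2: "t\<^sup>2 = K / V" and t0: "t > 0" unfolding t_def using K Vp by auto
    have tk: "t \<le> \<kappa>"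
      unfolding t_def using True Vp \<kappa> by (intro real_le_lsqrt) (auto simp: divide_le_eq)
    have "sqrt (V * K) \<le> sqrt (V * K) / \<kappa>" using \<kappa> sq by (simp add: le_divide_eq mult_left_le)
    moreover have "K / \<kappa> \<ge> 0" using K \<kappa> by simp
    ultimately have "2 * sqrt (V * K) \<le> D" using D by (simp add: add_divide_distrib)
    then have "t * (2 * sqrt (V * K)) \<le> t * D" using t0 by (intro mult_left_mono) auto
    moreover have "t * sqrt (V * K) = K"
      unfolding t_def using K Vp by (simp add: real_sqrt_mult[symmetric])
    ultimately have "t\<^sup>2 * V - t * D \<le> - K" using t2 Vp by simp
    then have "exp (t\<^sup>2 * V - t * D) \<le> exp (- K)" by simp
    then show ?thesis by (rule order_trans[OF markov[OF less_imp_le[OF t0] tk]])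
  next
    case False
    have "\<kappa> * D \<ge> 2 * (sqrt (V * K) + K)" using D \<kappa> by (simp add: divide_le_eq mult.commute)
    moreover have "2 * (sqrt (V * K) + K) = 2 * sqrt (V * K) + 2 * K" by (rule distrib_left)
    ultimately have "\<kappa>\<^sup>2 * V - \<kappa> * D \<le> - K" using False sq by linarith
    then have "exp (\<kappa>\<^sup>2 * V - \<kappa> * D) \<le> exp (- K)" by simp
    then show ?thesis by (rule order_trans[OF markov[OF less_imp_le[OF \<kappa>(1)] order.refl]])
  qed
qed

lemma Prod_dist_prod:
  fixes f :: "nat \<Rightarrow> nat \<Rightarrow> real"
  assumes "\<And>j. j < n \<Longrightarrow> integrable (measure_pmf (p j)) (f j)"
    and "\<And>j y. j < n \<Longrightarrow> 0 \<le> f j y"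
  shows "measure_pmf.expectation (Prod_dist n p) (\<lambda>y. \<Prod>j<n. f j (y j)) =
      (\<Prod>j<n. measure_pmf.expectation (p j) (f j))"
    and "integrable (measure_pmf (Prod_dist n p)) (\<lambda>y. \<Prod>j<n. f j (y j))"
  unfolding Prod_dist_def
  by (rule expectation_prod_Pi_pmf, use assms in auto)
     (rule integrable_prod_Pi_pmf, use assms in auto)

lemma Prod_dist_chernoff:
  fixes z :: "nat \<Rightarrow> nat \<Rightarrow> real"
  assumes i: "\<And>j t. j < n \<Longrightarrow> 0 \<le> t \<Longrightarrow> t \<le> \<kappa> \<Longrightarrow> integrable (measure_pmf (p j))
      (\<lambda>y. exp (t * z j y) * indicator (A j) y)"
    and mgf: "\<And>j t. j < n \<Longrightarrow> 0 \<le> t \<Longrightarrow> t \<le> \<kappa> \<Longrightarrow>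
       measure_pmf.expectation (p j) (\<lambda>y. exp (t * z j y) * indicator (A j) y) \<le> exp (t\<^sup>2 * V j)"
    and V: "(\<Sum>j<n. V j) \<le> W" "W \<ge> 0" and K: "K > 0" and \<kappa>: "0 < \<kappa>" "\<kappa> \<le> 1"
    and D: "D \<ge> 2 * (sqrt (W * K) + K) / \<kappa>"
  shows "measure_pmf.prob (Prod_dist n p) {y. (\<forall>j<n. y j \<in> A j) \<and> (\<Sum>j<n. z j (y j)) \<ge> D} \<le> exp (- K)"
proof -
  have e: "exp (t * (\<Sum>j<n. z j (y j))) * indicator {y. \<forall>j<n. y j \<in> A j} y
      = (\<Prod>j<n. exp (t * z j (y j)) * indicator (A j) (y j))" for t y
  proof -
    have "(\<Prod>j<n. indicator (A j) (y j)) = (indicator {y. \<forall>j<n. y j \<in> A j} y :: real)"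
      by (auto simp: indicator_def)
    then show ?thesis by (simp add: prod.distrib exp_sum[symmetric] sum_distrib_left)
  qed
  have "measure_pmf.prob (Prod_dist n p) {y \<in> {y. \<forall>j<n. y j \<in> A j}. (\<Sum>j<n. z j (y j)) \<ge> D} \<le> exp (- K)"
  proof (rule chernoff_subgamma[OF _ _ V(2) K \<kappa> D])
    fix t :: real assume t: "0 \<le> t" "t \<le> \<kappa>"
    show "integrable (measure_pmf (Prod_dist n p)) (\<lambda>y. exp (t * (\<Sum>j<n. z j (y j))) * indicator
        {y. \<forall>j<n. y j \<in> A j} y)"
      unfolding e by (rule Prod_dist_prod(2)) (use i t in auto)
    have "measure_pmf.expectation (Prod_dist n p) (\<lambda>y. exp (t * (\<Sum>j<n. z j (y j))) * indicator
        {y. \<forall>j<n. y j \<in> A j} y)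
       = (\<Prod>j<n. measure_pmf.expectation (p j) (\<lambda>y. exp (t * z j y) * indicator (A j) y))"
      unfolding e by (rule Prod_dist_prod(1)) (use i t in auto)
    also have "\<dots> \<le> (\<Prod>j<n. exp (t\<^sup>2 * V j))"
      by (intro prod_mono conjI mgf t Bochner_Integration.integral_nonneg) auto
    also have "\<dots> = exp (t\<^sup>2 * (\<Sum>j<n. V j))" by (simp add: exp_sum[symmetric] sum_distrib_left)
    also have "\<dots> \<le> exp (t\<^sup>2 * W)" using V by (simp add: mult_left_mono)
    finally show "measure_pmf.expectation (Prod_dist n p)
        (\<lambda>y. exp (t * (\<Sum>j<n. z j (y j))) * indicator {y. \<forall>j<n. y j \<in> A j} y) \<le> exp (t\<^sup>2 * W)" .
  qed
  then show ?thesis by (simp add: conj_commute)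
qed

lemma Prod_dist_chernoff_two_sided:
  fixes z :: "nat \<Rightarrow> nat \<Rightarrow> real"
  assumes i: "\<And>j t. j < n \<Longrightarrow> \<bar>t\<bar> \<le> 1 \<Longrightarrow> integrable (measure_pmf (p j)) (\<lambda>y. exp (t * z j y))"
    and mgf: "\<And>j t. j < n \<Longrightarrow> \<bar>t\<bar> \<le> 1 \<Longrightarrow> measure_pmf.expectation (p j) (\<lambda>y. exp (t * z j y)) \<le> exp (t\<^sup>2 * V j)"
    and V: "(\<Sum>j<n. V j) \<le> W" "W \<ge> 0" and K: "K > 0"
    and D: "D \<ge> 2 * (sqrt (W * K) + K)"
  shows "measure_pmf.prob (Prod_dist n p) {y. \<bar>\<Sum>j<n. z j (y j)\<bar> \<ge> D} \<le> 2 * exp (- K)"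
proof -
  have 1: "measure_pmf.prob (Prod_dist n p) {y. (\<forall>j<n. y j \<in> UNIV) \<and> (\<Sum>j<n. z j (y j)) \<ge> D} \<le> exp (- K)"
    by (rule Prod_dist_chernoff[where \<kappa> = 1 and V = V and W = W]) (use i mgf V K D in auto)
  have 2: "measure_pmf.prob (Prod_dist n p) {y. (\<forall>j<n. y j \<in> UNIV) \<and> (\<Sum>j<n. - z j (y j)) \<ge> D} \<le> exp (- K)"
  proof (rule Prod_dist_chernoff[where \<kappa> = 1 and V = V and W = W])
    show "integrable (measure_pmf (p j)) (\<lambda>y. exp (t * - z j y) * indicator UNIV y)"
        if "j < n" "0 \<le> t" "t \<le> 1" for j t
      using i[of j "- t"] that by simp
    show "measure_pmf.expectation (p j) (\<lambda>y. exp (t * - z j y) * indicator UNIV y) \<le> exp (t\<^sup>2 * V j)"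
        if "j < n" "0 \<le> t" "t \<le> 1" for j t
      using mgf[of j "- t"] that by simp
  qed (use V K D in auto)
  define S1 S2 where "S1 = {y. (\<forall>j<n. y j \<in> (UNIV :: nat set)) \<and> (\<Sum>j<n. z j (y j)) \<ge> D}"
    and "S2 = {y. (\<forall>j<n. y j \<in> (UNIV :: nat set)) \<and> (\<Sum>j<n. - z j (y j)) \<ge> D}"
  have "{y. \<bar>\<Sum>j<n. z j (y j)\<bar> \<ge> D} = S1 \<union> S2"
    unfolding S1_def S2_def by (auto simp: sum_negf abs_if)
  moreover have "measure_pmf.prob (Prod_dist n p) (S1 \<union> S2) \<le> measure_pmf.prob (Prod_dist n p) S1
      + measure_pmf.prob (Prod_dist n p) S2"
    by (rule measure_Un_le) simp_all
  ultimately show ?thesis using 1 2 unfolding S1_def[symmetric] S2_def[symmetric] by simp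
qed

lemma Prod_Poi_sum_concentrated:
  assumes r: "\<And>j. j < n \<Longrightarrow> r j \<ge> 0" and K: "K > 0"
  shows "measure_pmf.prob (Prod_dist n (\<lambda>j. Poi (r j)))
    {y. \<bar>\<Sum>j<n. real (y j) - r j\<bar> \<ge> 2 * (sqrt ((\<Sum>j<n. r j) * K) + K)} \<le> 2 * exp (- K)"
proof (rule Prod_dist_chernoff_two_sided[where V = r and W = "\<Sum>j<n. r j" and z = "\<lambda>j y. real y - r j"])
  show "measure_pmf.expectation (Poi (r j)) (\<lambda>y. exp (t * (real y - r j))) \<le> exp (t\<^sup>2 * r j)"
      if "j < n" "\<bar>t\<bar> \<le> 1" for j t
    using Poi_exp_centered_le[of "r j" t] r that by (simp add: mult.commute)
  show "integrable (measure_pmf (Poi (r j))) (\<lambda>y. exp (t * (real y - r j)))" if "j < n" for j t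
    using Poi_exp(1)[OF r[OF that], of t] .
  show "(\<Sum>j<n. r j) \<ge> 0" using r by (intro sum_nonneg) auto
qed (rule K order.refl)+

text \<open>The bound for sums, with the summands of all other coordinates set to 0.\<close>

lemma Prod_Poi_coordinate_concentrated:
  assumes r: "\<And>j. j < n \<Longrightarrow> r j \<ge> 0" and K: "K > 0" and i: "i < n"
  shows "measure_pmf.prob (Prod_dist n (\<lambda>j. Poi (r j)))
    {y. \<bar>real (y i) - r i\<bar> \<ge> 2 * (sqrt (r i * K) + K)} \<le> 2 * exp (- K)"
proof -
  have "measure_pmf.prob (Prod_dist n (\<lambda>j. Poi (r j)))
    {y. \<bar>\<Sum>j<n. if j = i then real (y j) - r j else 0\<bar> \<ge> 2 * (sqrt (r i * K) + K)} \<le> 2 * exp (- K)"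
  proof (rule Prod_dist_chernoff_two_sided[where V = "\<lambda>j. if j = i then r j else 0"
        and z = "\<lambda>j y. if j = i then real y - r j else 0" and W = "r i"])
    show "(\<Sum>j<n. if j = i then r j else 0) \<le> r i" using r i by (subst sum.delta) auto
    fix j and t :: real assume j: "j < n" and t: "\<bar>t\<bar> \<le> 1"
    show "measure_pmf.expectation (Poi (r j)) (\<lambda>y. exp (t * (if j = i then real y - r j else 0)))
        \<le> exp (t\<^sup>2 * (if j = i then r j else 0))"
      using Poi_exp_centered_le[OF r[OF j], of t] t by (cases "j = i") (simp_all add: mult.commute)
    show "integrable (measure_pmf (Poi (r j))) (\<lambda>y. exp (t * (if j = i then real y - r j else 0)))"
      using Poi_exp(1)[OF r[OF j], of t] by (cases "j = i") simp_all
  qed (rule K order.refl r i)+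
  moreover have "(\<Sum>j<n. if j = i then real (y j) - r j else 0) = real (y i) - r i" for y :: "nat \<Rightarrow> nat"
    using i by (subst sum.delta) auto
  ultimately show ?thesis by (simp only:)
qed

section \<open>Concentration of the second Charlier polynomial\<close>

lemma charlier2_ge:
  assumes "l \<ge> 0"
  shows "charlier2 l y \<ge> - l - 1/4"
proof -
  have "charlier2 l y = (y - l - 1/2)\<^sup>2 - l - 1/4"
    by (simp add: charlier2_def power2_eq_square algebra_simps)
  then show ?thesis by simp
qed

lemma exp_le_quadratic_abs: "exp u \<le> 1 + u + u\<^sup>2 * exp \<bar>u\<bar>" for u :: real
proof (cases "u \<le> 1")
  case True
  have "exp u \<le> 1 + u + u\<^sup>2" by (rule exp_le_quadratic[OF True])
  also have "u\<^sup>2 \<le> u\<^sup>2 * exp \<bar>u\<bar>" by (simp add: mult_le_cancel_left1)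
  finally show ?thesis by simp
next
  case False
  then have "1 \<le> u\<^sup>2" by simp
  then have "exp u \<le> u\<^sup>2 * exp u" by (simp add: mult_le_cancel_right1)
  moreover have "\<bar>u\<bar> = u" "1 + u \<ge> 0" using False by auto
  ultimately show ?thesis using \<open>exp u \<le> u\<^sup>2 * exp u\<close> by linarith
qed

text
  \<open>A Gaussian square exponential is dominated by a sum of exponentials of linear functions, whose Poisson means are known.\<close>

lemma exp_square_le_sum:
  fixes v :: real
  assumes "\<bar>v\<bar> \<le> c"
  shows "exp (v\<^sup>2 / 16) \<le> exp (1/8) * (\<Sum>k\<le>nat \<lfloor>c\<rfloor>. exp (- (3/8) * (real k)\<^sup>2) *
      (exp (real k / 2 * v) + exp (- (real k / 2) * v)))"
proof -
  define k where "k = nat \<lfloor>\<bar>v\<bar>\<rfloor>"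
  have k: "real k \<le> \<bar>v\<bar>" "\<bar>v\<bar> < real k + 1" unfolding k_def by linarith+
  have kN: "k \<le> nat \<lfloor>c\<rfloor>" unfolding k_def using assms by (intro nat_mono floor_mono)
  have "v\<^sup>2 \<le> (real k + 1)\<^sup>2" using k by (simp add: abs_le_square_iff[symmetric])
  also have "\<dots> \<le> 2 * (real k)\<^sup>2 + 2" using sum_squares_bound[of "real k" 1] by (simp add: power2_sum)
  finally have "v\<^sup>2 / 16 \<le> 1/8 + (- (3/8) * (real k)\<^sup>2 + real k / 2 * real k)" by (simp add: power2_eq_square)
  also have "\<dots> \<le> 1/8 + (- (3/8) * (real k)\<^sup>2 + real k / 2 * \<bar>v\<bar>)"
    using k by (intro add_left_mono mult_left_mono) auto
  finally have "exp (v\<^sup>2 / 16) \<le> exp (1/8) * (exp (- (3/8) * (real k)\<^sup>2) * exp (real k / 2 * \<bar>v\<bar>))"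
    by (simp only: exp_add[symmetric] exp_le_cancel_iff)
  also have "\<dots> \<le> exp (1/8) * (exp (- (3/8) * (real k)\<^sup>2) * (exp (real k / 2 * v) + exp (- (real k / 2) * v)))"
    by (intro mult_left_mono) (auto simp: abs_if)
  also have "\<dots> \<le> exp (1/8) * (\<Sum>k\<le>nat \<lfloor>c\<rfloor>. exp (- (3/8) * (real k)\<^sup>2) *
      (exp (real k / 2 * v) + exp (- (real k / 2) * v)))"
    using kN by (intro mult_left_mono member_le_sum[of k "{..nat \<lfloor>c\<rfloor>}"
        "\<lambda>k. exp (- (3/8) * (real k)\<^sup>2) * (exp (real k / 2 * v) + exp (- (real k / 2) * v))"])
            (auto intro: add_nonneg_nonneg)
  finally show ?thesis .
qed

text \<open>Truncation to \<open>\<bar>y - L\<bar> \<le> L\<close> limits the slopes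
  \<open>t k = k / (2 * sqrt L)\<close> to at most 1, where the Poisson moment generating function
  is still Gaussian. Its value \<open>exp (k\<^sup>2 / 4)\<close> against the weight
  \<open>exp (- 3/8 * k\<^sup>2)\<close> leaves a convergent sum. The constant is 8/7 * 18, from
  \<open>exp (1/8) \<le> 8/7\<close> and a geometric series with ratio 8/9.\<close>

lemma Poi_exp_square_le:
  assumes L: "L \<ge> 1"
  shows "measure_pmf.expectation (Poi L) (\<lambda>y. exp ((real y - L)\<^sup>2 / L / 16) * indicator
      {y. \<bar>real y - L\<bar> \<le> L} y) \<le> 144/7"
proof -
  define N where "N = nat \<lfloor>sqrt L\<rfloor>"
  define t where "t = (\<lambda>k::nat. real k / (2 * sqrt L))"
  have sL: "sqrt L > 0" "sqrt L * sqrt L = L" "sqrt L \<ge> 1" using L by auto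
  define G where "G = (\<lambda>y::nat. exp (1/8) * (\<Sum>k\<le>N. exp (- (3/8) * (real k)\<^sup>2) *
      (exp (t k * (real y - L)) + exp (- t k * (real y - L)))))"
  have iG: "integrable (measure_pmf (Poi L)) G"
    unfolding G_def using L by (intro integrable_mult_right Bochner_Integration.integrable_sum
        Bochner_Integration.integrable_add Poi_exp(1)) auto
  have "measure_pmf.expectation (Poi L) (\<lambda>y. exp ((real y - L)\<^sup>2 / L / 16) * indicator {y. \<bar>real y - L\<bar> \<le> L}
      y) \<le> measure_pmf.expectation (Poi L) G"
  proof (rule integral_mono')
    fix y :: nat
    have G0: "G y \<ge> 0" unfolding G_def by (intro mult_nonneg_nonneg sum_nonneg add_nonneg_nonneg) auto
    show "exp ((real y - L)\<^sup>2 / L / 16) * indicator {y. \<bar>real y - L\<bar> \<le> L} y \<le> G y"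
    proof (cases "\<bar>real y - L\<bar> \<le> L")
      case True
      define v where "v = (real y - L) / sqrt L"
      have "\<bar>v\<bar> \<le> L / sqrt L" unfolding v_def abs_divide using True sL by (simp add: divide_right_mono)
      also have "L / sqrt L = sqrt L" using L by (rule real_div_sqrt[OF order_trans[OF zero_le_one]])
      finally have "\<bar>v\<bar> \<le> sqrt L" .
      from exp_square_le_sum[OF this] have "exp (v\<^sup>2 / 16) \<le> G y"
        unfolding G_def N_def[symmetric] v_def t_def by (simp add: field_simps)
      moreover have "v\<^sup>2 = (real y - L)\<^sup>2 / L" unfolding v_def using L by (simp add: power_divide)
      ultimately show ?thesis using True by simp
    qed (use G0 in simp)
    show "0 \<le> G y" by (rule G0)
  qed (rule iG)
  also have "measure_pmf.expectation (Poi L) G = exp (1/8) * (\<Sum>k\<le>N. exp (- (3/8) * (real k)\<^sup>2) *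
      (measure_pmf.expectation (Poi L) (\<lambda>y. exp (t k * (real y - L)))
          + measure_pmf.expectation (Poi L) (\<lambda>y. exp (- t k * (real y - L)))))"
  proof -
    have i: "integrable (measure_pmf (Poi L)) (\<lambda>y. exp (c * (real y - L)))" for c
      using L by (intro Poi_exp(1)) simp
    have "measure_pmf.expectation (Poi L) (\<lambda>y. exp (- (3/8) * (real k)\<^sup>2) *
        (exp (t k * (real y - L)) + exp (- t k * (real y - L))))
      = exp (- (3/8) * (real k)\<^sup>2) * (measure_pmf.expectation (Poi L) (\<lambda>y. exp (t k * (real y - L)))
          + measure_pmf.expectation (Poi L) (\<lambda>y. exp (- t k * (real y - L))))" for k
      by (simp only: integral_mult_right_zero Bochner_Integration.integral_add[OF i i])
    moreover have "measure_pmf.expectation (Poi L) G = exp (1/8) * (\<Sum>k\<le>N. measure_pmf.expectation (Poi L)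
        (\<lambda>y. exp (- (3/8) * (real k)\<^sup>2) * (exp (t k * (real y - L)) + exp (- t k * (real y - L)))))"
      unfolding G_def
      by (subst integral_mult_right_zero, subst Bochner_Integration.integral_sum)
         (intro integrable_mult_right Bochner_Integration.integrable_add i, rule refl)
    ultimately show ?thesis by (simp only:)
  qed
  also have "\<dots> \<le> exp (1/8) * (\<Sum>k\<le>N. exp (- (3/8) * (real k)\<^sup>2) * (exp ((real k)\<^sup>2 / 4) + exp ((real k)\<^sup>2 / 4)))"
  proof -
    have "measure_pmf.expectation (Poi L) (\<lambda>y. exp (t k * (real y - L))) \<le> exp ((real k)\<^sup>2 / 4)
      \<and> measure_pmf.expectation (Poi L) (\<lambda>y. exp (- t k * (real y - L))) \<le> exp ((real k)\<^sup>2 / 4)"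
      if "k \<le> N" for k
    proof -
      have "real k \<le> real N" using that by simp
      also have "real N \<le> sqrt L" unfolding N_def using sL by linarith
      finally have "t k \<le> 1" unfolding t_def using sL by (auto simp: divide_le_eq)
      have "t k \<ge> 0" unfolding t_def using sL by simp
      then have "- t k \<le> 1" by linarith
      have e: "(real k)\<^sup>2 / 4 = L * (t k)\<^sup>2" unfolding t_def using L
          by (simp add: power_divide power_mult_distrib)
      show ?thesis
        unfolding e using Poi_exp_centered_le[of L "t k"] Poi_exp_centered_le[of L "- t k"] L \<open>t k \<le> 1\<close>
            \<open>- t k \<le> 1\<close> by simp
    qed
    then show ?thesis by (intro mult_left_mono sum_mono add_mono) auto
  qed
  also have "\<dots> = exp (1/8) * (\<Sum>k\<le>N. 2 * exp (- (real k)\<^sup>2 / 8))"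
  proof -
    have "exp (- (3/8) * (real k)\<^sup>2) * (exp ((real k)\<^sup>2 / 4) + exp ((real k)\<^sup>2 / 4))
        = 2 * exp (- (real k)\<^sup>2 / 8)" for k
      by (simp add: distrib_left exp_add[symmetric])
    then show ?thesis by (simp only:)
  qed
  also have "\<dots> \<le> (8/7) * (\<Sum>k\<le>N. 2 * (8/9) ^ k)"
  proof -
    have "exp (1/8 :: real) = inverse (exp (- (1/8)))" by (simp add: exp_minus)
    also have "\<dots> \<le> inverse (7/8)" using exp_ge_add_one_self[of "- (1/8::real)"]
        by (intro le_imp_inverse_le) auto
    finally have e8: "exp (1/8::real) \<le> 8/7" by simp
    have "exp (- (1/8) :: real) = inverse (exp (1/8))" by (simp add: exp_minus)
    also have "\<dots> \<le> inverse (9/8)" using exp_ge_add_one_self[of "1/8::real"] by (intro le_imp_inverse_le) auto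
    finally have e: "exp (- (1/8) :: real) \<le> 8/9" by simp
    have "2 * exp (- (real k)\<^sup>2 / 8) \<le> 2 * (8/9) ^ k" for k :: nat
    proof -
      have "real k \<le> (real k)\<^sup>2" by (cases k) (auto simp: power2_eq_square)
      then have "exp (- (real k)\<^sup>2 / 8) \<le> exp (real k * (- (1/8)))" by simp
      also have "\<dots> = exp (- (1/8)) ^ k" by (rule exp_of_nat_mult)
      also have "\<dots> \<le> (8/9) ^ k" using e by (intro power_mono) auto
      finally show ?thesis by simp
    qed
    then have "(\<Sum>k\<le>N. 2 * exp (- (real k)\<^sup>2 / 8)) \<le> (\<Sum>k\<le>N. 2 * (8/9) ^ k)" by (rule sum_mono)
    then show ?thesis using e8 by (intro mult_mono) (auto intro!: sum_nonneg)
  qed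
  also have "(\<Sum>k\<le>N. 2 * (8/9 :: real) ^ k) \<le> 18"
  proof -
    have "(\<Sum>k\<le>N. (8/9 :: real) ^ k) \<le> 9"
      using sum_gp0[of "8/9::real" N] by simp
    then show ?thesis by (simp add: sum_distrib_left[symmetric])
  qed
  finally show ?thesis by simp
qed

text \<open>The exponential of a positive multiple of \<open>charlier2\<close> is not integrable
  under a Poisson law, hence the truncation. Since \<open>charlier2 L\<close> has mean 0, the
  second-order expansion of \<open>exp\<close> leaves a multiple of t^2 times the Gaussian square
  exponential. The constant 50000 exceeds 2048 * 8/7 * 144/7.\<close>

lemma Poi_exp_charlier2_le:
  assumes L: "L \<ge> 1" and t: "0 \<le> t" "t \<le> 1/32"
  shows "measure_pmf.expectation (Poi L) (\<lambda>y. exp (t * (charlier2 L (real y) / L)) * indicator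
      {y. \<bar>real y - L\<bar> \<le> L} y)
     \<le> exp (t\<^sup>2 * 50000)"
    and "integrable (measure_pmf (Poi L)) (\<lambda>y. exp (t * (charlier2 L (real y) / L)) * indicator
        {y. \<bar>real y - L\<bar> \<le> L} y)"
proof -
  define I where "I = (indicator {y. \<bar>real y - L\<bar> \<le> L} :: nat \<Rightarrow> real)"
  define E where "E = (\<lambda>y::nat. exp ((real y - L)\<^sup>2 / L / 16) * I y)"
  define u where "u = (\<lambda>y::nat. t * (charlier2 L (real y) / L))"
  have I: "I y = 1 \<and> \<bar>real y - L\<bar> \<le> L \<or> I y = 0" for y unfolding I_def by (auto simp: indicator_def)
  have finite: "finite {y::nat. \<bar>real y - L\<bar> \<le> L}"
    by (rule finite_subset[of _ "{..nat \<lceil>2 * L\<rceil>}"]) (auto, linarith)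
  have bdd: "integrable (measure_pmf (Poi L)) (\<lambda>y. h y * I y)" for h :: "nat \<Rightarrow> real"
  proof -
    have "\<bar>h y * I y\<bar> \<le> (\<Sum>z | \<bar>real z - L\<bar> \<le> L. \<bar>h z\<bar>)" for y
      using I[of y] member_le_sum[of y "{z. \<bar>real z - L\<bar> \<le> L}" "\<lambda>z. \<bar>h z\<bar>"] finite
      by (auto intro: sum_nonneg)
    then show ?thesis by (rule integrable_pmf_bounded)
  qed
  show "integrable (measure_pmf (Poi L)) (\<lambda>y. exp (t * (charlier2 L (real y) / L)) * indicator
      {y. \<bar>real y - L\<bar> \<le> L} y)"
    using bdd unfolding I_def .
  have iE: "integrable (measure_pmf (Poi L)) E" unfolding E_def by (rule bdd)
  have iu: "integrable (measure_pmf (Poi L)) u"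
    unfolding u_def using Poi_charlier2(1)[of L L] L by simp
  \<comment> \<open>Where the indicator vanishes, the right-hand side of \<open>point\<close> must
    still be nonnegative. This keeps the linear term on the whole space, where its mean is
    0.\<close>
  have u_ge: "u y \<ge> -1" for y
  proof -
    have "charlier2 L (real y) / L \<ge> -2"
      using charlier2_ge[of L "real y"] L by (simp add: le_divide_eq)
    then have "t * (charlier2 L (real y) / L) \<ge> t * (-2)" using t by (intro mult_left_mono) auto
    then show ?thesis using t unfolding u_def by linarith
  qed
  have point: "exp (u y) * I y \<le> 1 + u y + t\<^sup>2 * (2048 * (8/7) * E y)" for y
  proof (cases "\<bar>real y - L\<bar> \<le> L")
    case False
    then have "I y = 0" using I[of y] by auto
    then show ?thesis using u_ge[of y] by (simp add: E_def)
  next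
    case True
    then have Iy: "I y = 1" by (simp add: I_def)
    define w where "w = (real y - L)\<^sup>2 / L + 2"
    have w: "w \<ge> 2" unfolding w_def using L by simp
    have "\<bar>charlier2 L (real y)\<bar> \<le> (real y - L)\<^sup>2 + real y" unfolding charlier2_def by (simp add: abs_le_iff)
    also have "\<dots> \<le> (real y - L)\<^sup>2 + 2 * L" using True by linarith
    finally have cw: "\<bar>charlier2 L (real y) / L\<bar> \<le> w" unfolding w_def abs_divide using L
        by (simp add: field_simps)
    then have uw: "\<bar>u y\<bar> \<le> t * w" unfolding u_def abs_mult[of t] using mult_left_mono[OF cw t(1)] t(1) by simp
    have u2: "(u y)\<^sup>2 \<le> (t * w)\<^sup>2" using uw by (rule abs_le_square_iff[THEN iffD1, OF order_trans]) simp
    \<comment> \<open>One factor \<open>exp (w / 32)\<close> comes from the expansion and another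
      from absorbing \<open>w\<^sup>2\<close>, with 2048 = 2 * 32^2; together they make the exponent
      1/16 of \<open>E\<close>.\<close>
    have "t * w \<le> (1/32) * w" using t w by (intro mult_right_mono) auto
    then have "exp \<bar>u y\<bar> \<le> exp (w / 32)" using uw by simp
    then have "(u y)\<^sup>2 * exp \<bar>u y\<bar> \<le> (t * w)\<^sup>2 * exp (w / 32)" using u2 by (intro mult_mono) auto
    also have "\<dots> = t\<^sup>2 * (w\<^sup>2 * exp (w / 32))" by (simp add: power_mult_distrib)
    also have "\<dots> \<le> t\<^sup>2 * ((2048 * exp (w / 32)) * exp (w / 32))"
    proof (intro mult_left_mono mult_right_mono)
      have "1 + w / 32 + (w / 32)\<^sup>2 / 2 \<le> exp (w / 32)" using w by (intro exp_lower_Taylor_quadratic) auto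
      then show "w\<^sup>2 \<le> 2048 * exp (w / 32)" using w by (simp add: power_divide)
    qed auto
    also have "\<dots> = t\<^sup>2 * (2048 * exp (1/8) * E y)"
      unfolding E_def Iy w_def by (simp add: exp_add[symmetric] add_divide_distrib)
    also have "\<dots> \<le> t\<^sup>2 * (2048 * (8/7) * E y)"
    proof -
      have "exp (1/8 :: real) = inverse (exp (- (1/8)))" by (simp add: exp_minus)
      also have "\<dots> \<le> inverse (7/8)" using exp_ge_add_one_self[of "- (1/8::real)"]
          by (intro le_imp_inverse_le) auto
      finally have "exp (1/8::real) \<le> 8/7" by simp
      then show ?thesis by (intro mult_left_mono mult_right_mono) (auto simp: E_def I_def)
    qed
    finally have "(u y)\<^sup>2 * exp \<bar>u y\<bar> \<le> t\<^sup>2 * (2048 * (8/7) * E y)" .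
    then show ?thesis using exp_le_quadratic_abs[of "u y"] Iy by simp
  qed
  have "measure_pmf.expectation (Poi L) (\<lambda>y. exp (u y) * I y)
      \<le> measure_pmf.expectation (Poi L) (\<lambda>y. 1 + u y + t\<^sup>2 * (2048 * (8/7) * E y))"
    by (rule integral_mono) (use iu iE bdd point in auto)
  also have "\<dots> = 1 + t * (measure_pmf.expectation (Poi L) (\<lambda>y. charlier2 L (real y)) / L)
      + t\<^sup>2 * (2048 * (8/7) * measure_pmf.expectation (Poi L) E)"
    using iu iE unfolding u_def by simp
  also have "\<dots> = 1 + t\<^sup>2 * (2048 * (8/7) * measure_pmf.expectation (Poi L) E)"
    using Poi_charlier2(2)[of L] L by simp
  also have "\<dots> \<le> 1 + t\<^sup>2 * (2048 * (8/7) * (144/7))"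
    using Poi_exp_square_le[OF L] unfolding E_def I_def by (intro add_left_mono mult_left_mono) auto
  also have "\<dots> \<le> 1 + t\<^sup>2 * 50000" by (intro add_left_mono mult_left_mono) auto
  also have "\<dots> \<le> exp (t\<^sup>2 * 50000)" by (rule exp_ge_add_one_self)
  finally show "measure_pmf.expectation (Poi L) (\<lambda>y. exp (t * (charlier2 L (real y) / L)) * indicator
      {y. \<bar>real y - L\<bar> \<le> L} y)
     \<le> exp (t\<^sup>2 * 50000)" unfolding u_def I_def .
qed

lemma Prod_Poi_charlier2_upper:
  assumes L: "L \<ge> 1" and K: "K > 0" and D: "D \<ge> 64 * (sqrt (50000 * real n * K) + K)"
  shows "measure_pmf.prob (Prod_dist n (\<lambda>_. Poi L))
     {y. (\<forall>j<n. \<bar>real (y j) - L\<bar> \<le> L) \<and> (\<Sum>j<n. charlier2 L (real (y j)) / L) \<ge> D} \<le> exp (- K)"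
proof -
  have "measure_pmf.prob (Prod_dist n (\<lambda>_. Poi L))
     {y. (\<forall>j<n. y j \<in> {y. \<bar>real y - L\<bar> \<le> L}) \<and> (\<Sum>j<n. charlier2 L (real (y j)) / L) \<ge> D} \<le> exp (- K)"
    by (rule Prod_dist_chernoff[where \<kappa> = "1/32" and V = "\<lambda>_. 50000" and W = "50000 * real n"])
       (use Poi_exp_charlier2_le[OF L] K D in \<open>auto simp: mult.commute\<close>)
  then show ?thesis by simp
qed

text \<open>\<open>charlier2\<close> is bounded below, so the lower tail needs no truncation. Around
  the true rate it splits into d^2, a linear term and \<open>charlier2 r\<close>, which are
  separated by the inequality of the means. Only half of d^2 is claimed: the other half absorbs the
  cost \<open>32 * t * \<theta> * d\<^sup>2\<close> of the linear term, which is what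
  \<open>t \<le> 1/64\<close> is for.\<close>

lemma Poi_exp_charlier2_lower:
  assumes L: "L \<ge> 1" and r: "0 \<le> r" "\<bar>r - L\<bar> \<le> L" and t: "0 \<le> t" "t \<le> 1/64"
  shows "measure_pmf.expectation (Poi r) (\<lambda>y. exp (t * (((r - L)\<^sup>2 / 2 - charlier2 L (real y)) / L)))
      \<le> exp (t\<^sup>2 * 32)"
    and "integrable (measure_pmf (Poi r)) (\<lambda>y. exp (t * (((r - L)\<^sup>2 / 2 - charlier2 L (real y)) / L)))"
proof -
  define d \<theta> where "d = r - L" and "\<theta> = t / L"
  have \<theta>: "\<theta> \<ge> 0" "\<theta> * L = t" unfolding \<theta>_def using t L by auto
  have r2: "r \<le> 2 * L" using r by linarith
  have dec: "charlier2 L (real y) = d\<^sup>2 + (2 * d * (real y - r) + charlier2 r (real y))" for y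
    unfolding d_def charlier2_def by (simp add: power2_eq_square algebra_simps)
  have b: "exp (t * (((r - L)\<^sup>2 / 2 - charlier2 L (real y)) / L)) \<le> exp (t * ((d\<^sup>2 / 2 + L + 1) / L))" for y
    using charlier2_ge[of L "real y"] L t unfolding d_def exp_le_cancel_iff
        by (intro mult_left_mono divide_right_mono) auto
  show i0: "integrable (measure_pmf (Poi r)) (\<lambda>y. exp (t * (((r - L)\<^sup>2 / 2 - charlier2 L (real y)) / L)))"
    by (rule integrable_pmf_bounded[of _ "exp (t * ((d\<^sup>2 / 2 + L + 1) / L))"]) (use b in auto)
  define A where "A = (\<lambda>y::nat. exp (- 4 * \<theta> * d * (real y - r)))"
  define B where "B = (\<lambda>y::nat. 1 + (- 2 * \<theta> * charlier2 r (real y)) + (4 * \<theta>\<^sup>2) * (charlier2 r (real y))\<^sup>2)"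
  have iA: "integrable (measure_pmf (Poi r)) A" unfolding A_def by (rule Poi_exp(1)[OF r(1)])
  have iB: "integrable (measure_pmf (Poi r)) B" unfolding B_def
    using Poi_charlier2(1,3)[OF r(1)] by (intro Bochner_Integration.integrable_add integrable_mult_right) auto
  have EA: "measure_pmf.expectation (Poi r) A \<le> exp (32 * t * \<theta> * d\<^sup>2)"
  proof -
    have "\<bar>4 * \<theta> * d\<bar> \<le> 4 * \<theta> * L" unfolding abs_mult using \<theta> r unfolding d_def by (intro mult_mono) auto
    then have "- 4 * \<theta> * d \<le> 1" using \<theta> t by linarith
    from Poi_exp_centered_le[OF r(1) this] have "measure_pmf.expectation (Poi r) A
        \<le> exp (r * (- 4 * \<theta> * d)\<^sup>2)" unfolding A_def .
    also have "r * (- 4 * \<theta> * d)\<^sup>2 \<le> (2 * L) * (- 4 * \<theta> * d)\<^sup>2" using r2 by (intro mult_right_mono) auto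
    also have "\<dots> = 32 * (\<theta> * L) * \<theta> * d\<^sup>2" by (simp add: power2_eq_square)
    finally show ?thesis unfolding \<theta> by simp
  qed
  have EB: "measure_pmf.expectation (Poi r) B \<le> exp (32 * t\<^sup>2)"
  proof -
    have "measure_pmf.expectation (Poi r) B = 1 + 4 * \<theta>\<^sup>2 * (2 * r\<^sup>2)"
      unfolding B_def using Poi_charlier2[OF r(1)] by simp
    also have "\<dots> \<le> 1 + 4 * \<theta>\<^sup>2 * (2 * (2 * L)\<^sup>2)" using r r2
        by (intro add_left_mono mult_left_mono power_mono) auto
    also have "\<dots> = 1 + 32 * (\<theta> * L)\<^sup>2" by (simp add: power2_eq_square)
    also have "\<dots> \<le> exp (32 * (\<theta> * L)\<^sup>2)" by (rule exp_ge_add_one_self)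
    finally show ?thesis unfolding \<theta> .
  qed
  have point: "exp (t * (((r - L)\<^sup>2 / 2 - charlier2 L (real y)) / L))
      \<le> exp (- \<theta> * d\<^sup>2 / 2) * ((A y + B y) / 2)" for y
  proof -
    define a where "a = exp (- 2 * \<theta> * d * (real y - r))"
    define c where "c = exp (- \<theta> * charlier2 r (real y))"
    have "t * (((r - L)\<^sup>2 / 2 - charlier2 L (real y)) / L) = \<theta> * (d\<^sup>2 / 2 - charlier2 L (real y))"
      unfolding \<theta>_def d_def by simp
    also have "\<dots> = - \<theta> * d\<^sup>2 / 2 + (- 2 * \<theta> * d * (real y - r) + - \<theta> * charlier2 r (real y))"
      unfolding dec by (simp add: algebra_simps)
    finally have "exp (t * (((r - L)\<^sup>2 / 2 - charlier2 L (real y)) / L)) = exp (- \<theta> * d\<^sup>2 / 2) * (a * c)"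
      unfolding a_def c_def by (simp only: exp_add)
    also have "\<dots> \<le> exp (- \<theta> * d\<^sup>2 / 2) * ((a\<^sup>2 + c\<^sup>2) / 2)"
      using sum_squares_bound[of a c] by (intro mult_left_mono) auto
    also have "a\<^sup>2 = A y" unfolding a_def A_def by (simp add: power2_eq_square exp_add[symmetric])
    also have "c\<^sup>2 \<le> B y"
    proof -
      have "- 2 * \<theta> * charlier2 r (real y) \<le> 2 * \<theta> * (r + 1/4)"
        using charlier2_ge[OF r(1), of "real y"] \<theta>(1) mult_left_mono[of "- charlier2 r (real y)" "r
            + 1/4" "2 * \<theta>"] by simp
      also have "\<dots> \<le> 2 * \<theta> * (3 * L)" using r2 L \<theta> by (intro mult_left_mono) auto
      also have "\<dots> = 6 * t" using \<theta> by (simp add: mult.commute)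
      finally have "- 2 * \<theta> * charlier2 r (real y) \<le> 1" using t by linarith
      from exp_le_quadratic[OF this] have "exp (- 2 * \<theta> * charlier2 r (real y)) \<le> B y"
        unfolding B_def by (simp add: power_mult_distrib)
      then show ?thesis
        unfolding c_def by (simp add: power2_eq_square exp_add[symmetric] mult.assoc)
    qed
    finally show ?thesis by (simp add: mult_left_mono)
  qed
  have "measure_pmf.expectation (Poi r) (\<lambda>y. exp (t * (((r - L)\<^sup>2 / 2 - charlier2 L (real y)) / L)))
     \<le> measure_pmf.expectation (Poi r) (\<lambda>y. exp (- \<theta> * d\<^sup>2 / 2) * ((A y + B y) / 2))"
    by (rule integral_mono[OF i0 _ point]) (use iA iB in auto)
  also have "\<dots> = exp (- \<theta> * d\<^sup>2 / 2) * ((measure_pmf.expectation (Poi r) A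
      + measure_pmf.expectation (Poi r) B) / 2)"
    using iA iB by simp
  also have "\<dots> \<le> exp (- \<theta> * d\<^sup>2 / 2) * ((exp (32 * t * \<theta> * d\<^sup>2 + 32 * t\<^sup>2)
      + exp (32 * t * \<theta> * d\<^sup>2 + 32 * t\<^sup>2)) / 2)"
  proof -
    have "measure_pmf.expectation (Poi r) A \<le> exp (32 * t * \<theta> * d\<^sup>2 + 32 * t\<^sup>2)"
      by (rule order_trans[OF EA]) simp
    moreover have "measure_pmf.expectation (Poi r) B \<le> exp (32 * t * \<theta> * d\<^sup>2 + 32 * t\<^sup>2)"
      by (rule order_trans[OF EB]) (use t \<theta> in auto)
    ultimately show ?thesis by (intro mult_left_mono divide_right_mono add_mono) auto
  qed
  also have "\<dots> = exp (- \<theta> * d\<^sup>2 / 2 + (32 * t * \<theta> * d\<^sup>2 + 32 * t\<^sup>2))" by (simp only: exp_add) simp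
  also have "\<dots> \<le> exp (t\<^sup>2 * 32)"
  proof -
    have "32 * t * (\<theta> * d\<^sup>2) \<le> (1/2) * (\<theta> * d\<^sup>2)" using t \<theta> by (intro mult_right_mono) auto
    then show ?thesis by (simp add: mult_ac)
  qed
  finally show "measure_pmf.expectation (Poi r) (\<lambda>y. exp (t * (((r - L)\<^sup>2 / 2 - charlier2 L (real y)) / L)))
      \<le> exp (t\<^sup>2 * 32)" .
qed

lemma Prod_Poi_charlier2_lower:
  assumes L: "L \<ge> 1" and r: "\<And>j. j < n \<Longrightarrow> 0 \<le> r j" "\<And>j. j < n \<Longrightarrow> \<bar>r j - L\<bar> \<le> L"
    and K: "K > 0" and D: "D \<ge> 128 * (sqrt (32 * real n * K) + K)"
  shows "measure_pmf.prob (Prod_dist n (\<lambda>j. Poi (r j)))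
     {y. (\<Sum>j<n. ((r j - L)\<^sup>2 / 2 - charlier2 L (real (y j))) / L) \<ge> D} \<le> exp (- K)"
proof -
  have "measure_pmf.prob (Prod_dist n (\<lambda>j. Poi (r j)))
     {y. (\<forall>j<n. y j \<in> UNIV) \<and> (\<Sum>j<n. ((r j - L)\<^sup>2 / 2 - charlier2 L (real (y j))) / L) \<ge> D} \<le> exp (- K)"
    by (rule Prod_dist_chernoff[where \<kappa> = "1/64" and V = "\<lambda>_. 32" and W = "32 * real n"])
       (use Poi_exp_charlier2_lower[OF L] r K D in \<open>auto simp: mult.commute\<close>)
  then show ?thesis by simp
qed

section \<open>Thinned counts\<close>

text \<open>The probability that exactly \<open>x\<close> of \<open>y\<close> points survive an independent thinning with probability
  \<open>1 / s\<close>.\<close>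

definition thin :: "nat \<Rightarrow> nat \<Rightarrow> nat \<Rightarrow> real" where
  "thin s x y = (y choose x) * (real s - 1) ^ (y - x) / real s ^ y"

lemma thin_bounds:
  assumes "s \<ge> 1"
  shows "0 \<le> thin s x y" "thin s x y \<le> 1"
proof -
  show "0 \<le> thin s x y" using assms by (simp add: thin_def)
  show "thin s x y \<le> 1"
  proof (cases "x \<le> y")
    case True
    have "(y choose x) * (real s - 1) ^ (y - x) = (y choose x) * 1 ^ x * (real s - 1) ^ (y - x)" by simp
    also have "\<dots> \<le> (\<Sum>k\<le>y. real (y choose k) * 1 ^ k * (real s - 1) ^ (y - k))"
      using True assms member_le_sum[of x "{..y}" "\<lambda>k. real (y choose k) * 1 ^ k * (real s - 1) ^ (y - k)"]
          by simp
    also have "\<dots> = (1 + (real s - 1)) ^ y" by (rule binomial_ring[symmetric])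
    finally show ?thesis unfolding thin_def using assms by (simp add: divide_le_eq)
  qed (simp add: thin_def binomial_eq_0)
qed

text \<open>Poisson splitting: the \<open>x\<close> surviving and the \<open>w\<close> deleted
  points of a thinned Poisson variable are independent and again Poisson.\<close>

lemma pmf_Poi_thin:
  assumes "r \<ge> 0" "s \<ge> 1"
  shows "pmf (Poi (real s * r)) (w + x) * thin s x (w + x) = pmf (Poi r) x * pmf (Poi ((real s - 1) * r)) w"
proof -
  have 1: "pmf (Poi (real s * r)) (w + x) = (real s * r) ^ (w + x) / fact (w + x) * exp (- (real s * r))"
    using assms by (intro pmf_Poi) auto
  have 2: "pmf (Poi ((real s - 1) * r)) w = ((real s - 1) * r) ^ w / fact w * exp (- ((real s - 1) * r))"
    using assms by (intro pmf_Poi) auto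
  have 3: "pmf (Poi r) x = r ^ x / fact x * exp (- r)" using assms by (intro pmf_Poi) auto
  have e: "exp (- r) * exp (- ((real s - 1) * r)) = exp (- (real s * r))"
    by (simp add: exp_add[symmetric] algebra_simps)
  have b: "real (w + x choose x) = fact (w + x) / (fact x * fact w)"
    by (subst binomial_fact) auto
  have "pmf (Poi (real s * r)) (w + x) * thin s x (w + x)
      = (r ^ (w + x) * (real s - 1) ^ w / (fact x * fact w)) * exp (- (real s * r))"
    unfolding 1 thin_def b using assms by (simp add: power_mult_distrib field_simps)
  also have "\<dots> = pmf (Poi r) x * pmf (Poi ((real s - 1) * r)) w"
    unfolding 2 3 e[symmetric] power_mult_distrib power_add by (simp add: mult_ac)
  finally show ?thesis .
qed

lemma Poi_thin_shift:
  fixes g :: "nat \<Rightarrow> real"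
  assumes r: "r \<ge> 0" and s: "s \<ge> 1" and g: "\<And>y. \<bar>g y\<bar> \<le> B"
  shows "measure_pmf.expectation (Poi (real s * r)) (\<lambda>y. thin s x y * g y)
    = pmf (Poi r) x * measure_pmf.expectation (Poi ((real s - 1) * r)) (\<lambda>w. g (w + x))"
proof -
  have "\<bar>thin s x y * g y\<bar> \<le> 1 * B" for y
    unfolding abs_mult using thin_bounds[OF s, of x y] g[of y] by (intro mult_mono) auto
  then have i: "integrable (measure_pmf (Poi (real s * r))) (\<lambda>y. thin s x y * g y)"
    by (rule integrable_pmf_bounded)
  have S: "(\<lambda>y. pmf (Poi (real s * r)) y * (thin s x y * g y)) sums measure_pmf.expectation
      (Poi (real s * r)) (\<lambda>y. thin s x y * g y)"
    by (rule nat_pmf_expectation_sums(2)[OF nat_pmf_integrable_summable[OF i]])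
  have "(\<lambda>w. pmf (Poi (real s * r)) (w + x) * (thin s x (w + x) * g (w + x))) sums measure_pmf.expectation
      (Poi (real s * r)) (\<lambda>y. thin s x y * g y)"
    using S by (subst sums_zero_iff_shift) (auto simp: thin_def binomial_eq_0)
  then have "(\<lambda>w. pmf (Poi r) x * (pmf (Poi ((real s - 1) * r)) w * g (w + x))) sums measure_pmf.expectation
      (Poi (real s * r)) (\<lambda>y. thin s x y * g y)"
    using pmf_Poi_thin[OF r s] by (simp add: mult.assoc[symmetric])
  moreover have "(\<lambda>w. pmf (Poi r) x * (pmf (Poi ((real s - 1) * r)) w * g (w + x))) sums
      (pmf (Poi r) x * measure_pmf.expectation (Poi ((real s - 1) * r)) (\<lambda>w. g (w + x)))"
    by (intro sums_mult nat_pmf_expectation_sums(2)[OF nat_pmf_integrable_summable]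
        integrable_pmf_bounded[of _ B] g)
  ultimately show ?thesis by (rule sums_unique2)
qed

lemma Poi_convolution:
  fixes g :: "nat \<Rightarrow> real"
  assumes ab: "a \<ge> 0" "b \<ge> 0" and g: "\<And>y. \<bar>g y\<bar> \<le> B"
  shows "measure_pmf.expectation (Poi a) (\<lambda>z. measure_pmf.expectation (Poi b) (\<lambda>w. g (w + z)))
    = measure_pmf.expectation (Poi (a + b)) g"
proof -
  have "bind_pmf (Poi a) (\<lambda>z. map_pmf (\<lambda>w. w + z) (Poi b)) = Poi (a + b)"
  proof (rule pmf_eqI)
    fix y
    have pm: "pmf (map_pmf (\<lambda>w. w + z) (Poi b)) y = (if z \<le> y then pmf (Poi b) (y - z) else 0)" for z
    proof (cases "z \<le> y")
      case True
      have "pmf (map_pmf (\<lambda>w. w + z) (Poi b)) ((y - z) + z) = pmf (Poi b) (y - z)"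
        by (rule pmf_map_inj') (simp add: inj_def)
      then show ?thesis using True by simp
    next
      case False
      then have "y \<notin> set_pmf (map_pmf (\<lambda>w. w + z) (Poi b))" by auto
      then have "pmf (map_pmf (\<lambda>w. w + z) (Poi b)) y = 0" by (simp only: set_pmf_iff not_not)
      then show ?thesis using False by simp
    qed
    have "pmf (bind_pmf (Poi a) (\<lambda>z. map_pmf (\<lambda>w. w + z) (Poi b))) y
      = measure_pmf.expectation (Poi a) (\<lambda>z. if z \<le> y then pmf (Poi b) (y - z) else 0)"
      unfolding pmf_bind pm ..
    also have "\<dots> = (\<Sum>z\<in>{..y}. (if z \<le> y then pmf (Poi b) (y - z) else 0) * pmf (Poi a) z)"
      by (rule integral_measure_pmf_real) (auto split: if_splits)
    also have "\<dots> = (\<Sum>z\<le>y. exp (- (a + b)) / fact y * ((y choose z) * a ^ z * b ^ (y - z)))"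
    proof (rule sum.cong[OF refl])
      fix z assume z: "z \<in> {..y}"
      have "real (y choose z) = fact y / (fact z * fact (y - z))" using z by (subst binomial_fact) auto
      then have "exp (- (a + b)) / fact y * ((y choose z) * a ^ z * b ^ (y - z))
        = (exp (- a) * exp (- b)) * (a ^ z * b ^ (y - z) / (fact z * fact (y - z)))"
        unfolding exp_add[symmetric] by simp
      then show "(if z \<le> y then pmf (Poi b) (y - z) else 0) * pmf (Poi a) z
          = exp (- (a + b)) / fact y * ((y choose z) * a ^ z * b ^ (y - z))"
        using z ab by (simp add: pmf_Poi mult_ac)
    qed
    also have "\<dots> = exp (- (a + b)) / fact y * (a + b) ^ y"
      by (simp add: binomial_ring sum_distrib_left)
    also have "\<dots> = pmf (Poi (a + b)) y" using ab by (simp add: pmf_Poi)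
    finally show "pmf (bind_pmf (Poi a) (\<lambda>z. map_pmf (\<lambda>w. w + z) (Poi b))) y = pmf (Poi (a + b)) y" .
  qed
  then have "measure_pmf.expectation (Poi (a + b)) g = measure_pmf.expectation
      (bind_pmf (Poi a) (\<lambda>z. map_pmf (\<lambda>w. w + z) (Poi b))) g"
    by simp
  also have "\<dots> = measure_pmf.expectation (Poi a) (\<lambda>z. measure_pmf.expectation (map_pmf (\<lambda>w. w + z) (Poi b)) g)"
    by (rule expectation_bind_pmf_bounded[OF g])
  finally show ?thesis by simp
qed

lemma Prod_Poi_sum:
  fixes g :: "nat \<Rightarrow> real"
  assumes r: "r \<ge> 0" and g: "\<And>y. \<bar>g y\<bar> \<le> B"
  shows "measure_pmf.expectation (Prod_dist s (\<lambda>_. Poi r)) (\<lambda>u. g (\<Sum>i<s. u i))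
      = measure_pmf.expectation (Poi (real s * r)) g"
  using g
proof (induction s arbitrary: g)
  case 0
  then show ?case by (simp add: Prod_dist_def Poi_def)
next
  case (Suc s)
  have "measure_pmf.expectation (Prod_dist (Suc s) (\<lambda>_. Poi r)) (\<lambda>u. g (\<Sum>i<Suc s. u i))
    = measure_pmf.expectation (Poi r) (\<lambda>z. measure_pmf.expectation (Prod_dist s (\<lambda>_. Poi r))
        (\<lambda>u. g ((\<Sum>i<s. u i) + z)))"
    by (subst expectation_Prod_dist_Suc[where B = B]) (auto simp: Suc.prems)
  also have "\<dots> = measure_pmf.expectation (Poi r) (\<lambda>z. measure_pmf.expectation (Poi (real s * r))
      (\<lambda>w. g (w + z)))"
    using Suc.IH[of "\<lambda>w. g (w + _)"] Suc.prems by simp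
  also have "\<dots> = measure_pmf.expectation (Poi (r + real s * r)) g"
    by (rule Poi_convolution[where B = B]) (use r Suc.prems in auto)
  finally show ?case by (simp add: algebra_simps)
qed

text \<open>Given that one summand equals \<open>x\<close>, the remaining ones add up to a Poisson
  variable of rate \<open>(s - 1) * r\<close>. The value agrees with that of
  \<open>Poi_thin_shift\<close>, which identifies \<open>thin s x\<close> as the conditional
  probability of \<open>u k = x\<close> given the sum.\<close>

lemma Prod_Poi_indicator_sum:
  fixes g :: "nat \<Rightarrow> real"
  assumes r: "r \<ge> 0" and g: "\<And>y. \<bar>g y\<bar> \<le> B" and k: "k < s"
  shows "measure_pmf.expectation (Prod_dist s (\<lambda>_. Poi r)) (\<lambda>u. of_bool (u k = x) * g (\<Sum>i<s. u i))
    = pmf (Poi r) x * measure_pmf.expectation (Poi ((real s - 1) * r)) (\<lambda>w. g (w + x))"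
  using g k
proof (induction s arbitrary: g)
  case (Suc s)
  have bd: "\<bar>of_bool P * g y\<bar> \<le> B" for P y using Suc.prems(1)[of y] by (cases P) auto
  have B0: "B \<ge> 0" using Suc.prems(1)[of 0] by linarith
  have peel: "measure_pmf.expectation (Prod_dist (Suc s) (\<lambda>_. Poi r))
      (\<lambda>u. of_bool (u k = x) * g (\<Sum>i<Suc s. u i))
    = measure_pmf.expectation (Poi r) (\<lambda>z. measure_pmf.expectation (Prod_dist s (\<lambda>_. Poi r))
        (\<lambda>u. of_bool ((u(s := z)) k = x) * g ((\<Sum>i<s. u i) + z)))"
    by (subst expectation_Prod_dist_Suc[where B = B]) (auto simp: bd simp del: of_bool_eq_iff)
  show ?case
  proof (cases "k = s")
    case True
    have "measure_pmf.expectation (Prod_dist s (\<lambda>_. Poi r))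
        (\<lambda>u. of_bool ((u(s := z)) k = x) * g ((\<Sum>i<s. u i) + z))
       = (if z = x then measure_pmf.expectation (Poi (real s * r)) (\<lambda>w. g (w + x)) else 0)" for z
      using True Prod_Poi_sum[OF r, of "\<lambda>w. g (w + x)" B s] Suc.prems by auto
    then have "measure_pmf.expectation (Prod_dist (Suc s) (\<lambda>_. Poi r))
        (\<lambda>u. of_bool (u k = x) * g (\<Sum>i<Suc s. u i))
      = measure_pmf.expectation (Poi r) (\<lambda>z. if z = x then measure_pmf.expectation (Poi (real s * r))
          (\<lambda>w. g (w + x)) else 0)"
      unfolding peel by simp
    also have "\<dots> = (\<Sum>z\<in>{x}. (if z = x then measure_pmf.expectation (Poi (real s * r)) (\<lambda>w. g (w + x)) else
        0) * pmf (Poi r) z)"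
      by (rule integral_measure_pmf_real) (auto split: if_splits)
    finally show ?thesis by simp
  next
    case False
    then have ks: "k < s" using Suc.prems by simp
    have IH: "measure_pmf.expectation (Prod_dist s (\<lambda>_. Poi r))
        (\<lambda>u. of_bool ((u(s := z)) k = x) * g ((\<Sum>i<s. u i) + z))
      = pmf (Poi r) x * measure_pmf.expectation (Poi ((real s - 1) * r)) (\<lambda>w. g (w + z + x))" for z
      using Suc.IH[of "\<lambda>w. g (w + z)"] Suc.prems ks False by (simp add: add_ac)
    have "measure_pmf.expectation (Prod_dist (Suc s) (\<lambda>_. Poi r)) (\<lambda>u. of_bool (u k = x) * g (\<Sum>i<Suc s. u i))
      = pmf (Poi r) x * measure_pmf.expectation (Poi r) (\<lambda>z. measure_pmf.expectation
          (Poi ((real s - 1) * r)) (\<lambda>w. g (w + z + x)))"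
      unfolding peel IH by simp
    also have "measure_pmf.expectation (Poi r) (\<lambda>z. measure_pmf.expectation (Poi ((real s - 1) * r))
        (\<lambda>w. g (w + z + x)))
      = measure_pmf.expectation (Poi (r + (real s - 1) * r)) (\<lambda>w. g (w + x))"
      by (rule Poi_convolution[of _ _ "\<lambda>w. g (w + x)" B]) (use r ks Suc.prems in auto)
    finally show ?thesis by (simp add: algebra_simps)
  qed
qed simp

text \<open>Hoeffding's averaging argument for U-statistics: a Poisson variable of rate \<open>s r\<close> is a sum of \<open>s\<close>
  independent ones of rate \<open>r\<close>, and \<open>s * thin s x\<close> is the conditional expectation of the number of
  summands equal to \<open>x\<close>. The tangent line of the exponential function takes the place of Jensen's
  inequality.\<close>

lemma Poi_exp_thin_le:
  assumes r: "r \<ge> 0" and s: "s \<ge> 1" and t: "t \<le> 1"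
  shows "measure_pmf.expectation (Poi (real s * r)) (\<lambda>y. exp (t * (s * (thin s x y - pmf (Poi r) x))))
    \<le> exp (t\<^sup>2 * (s * pmf (Poi r) x))"
proof -
  define p where "p = pmf (Poi r) x"
  define c where "c = (\<lambda>y. t * (s * thin s x y))"
  define N where "N = (\<lambda>u::nat \<Rightarrow> nat. \<Sum>k<s. of_bool (u k = x) :: real)"
  define U where "U = Prod_dist s (\<lambda>_. Poi r)"
  define Y where "Y = (\<lambda>u::nat \<Rightarrow> nat. \<Sum>i<s. u i)"
  have cb: "\<bar>c y\<bar> \<le> \<bar>t\<bar> * s" for y
    unfolding c_def abs_mult using thin_bounds[OF s, of x y]
        by (intro mult_left_mono) (auto intro: mult_left_le)
  have eb: "\<bar>exp (c y)\<bar> \<le> exp (\<bar>t\<bar> * s)" for y using cb[of y] by (simp add: abs_le_iff)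
  have ceb: "\<bar>exp (c y) * (1 - c y)\<bar> \<le> exp (\<bar>t\<bar> * s) * (1 + \<bar>t\<bar> * s)" for y
    unfolding abs_mult using eb[of y] cb[of y] by (intro mult_mono) auto
  have ceb2: "\<bar>exp (c y) * c y\<bar> \<le> exp (\<bar>t\<bar> * s) * (\<bar>t\<bar> * s)" for y
    unfolding abs_mult using eb[of y] cb[of y] by (intro mult_mono) auto
  have Nb: "0 \<le> N u" "N u \<le> s" for u
    unfolding N_def using sum_bounded_above[of "{..<s}" "\<lambda>k. of_bool (u k = x) :: real" 1]
        by (auto intro!: sum_nonneg)
  have tN: "\<bar>t * N u\<bar> \<le> \<bar>t\<bar> * s" for u using Nb[of u] by (simp add: abs_mult mult_left_mono)
  have enb: "\<bar>exp (t * N u)\<bar> \<le> exp (\<bar>t\<bar> * s)" for u using tN[of u] by (simp add: abs_le_iff)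
  have i1: "\<bar>of_bool (u k = x) * exp (c (Y u))\<bar> \<le> exp (\<bar>t\<bar> * s)" for u k
    using eb[of "Y u"] by (cases "u k = x") auto
  \<comment> \<open>The part linear in \<open>c\<close> is the one in which the conditional
    expectation may be replaced by \<open>t * N u\<close>. What results is the tangent of
    \<open>exp\<close> at \<open>c (Y u)\<close>, evaluated at \<open>t * N u\<close>.\<close>
  have "measure_pmf.expectation (Poi (real s * r)) (\<lambda>y. exp (c y))
     = measure_pmf.expectation (Poi (real s * r)) (\<lambda>y. exp (c y) * (1 - c y))
         + measure_pmf.expectation (Poi (real s * r)) (\<lambda>y. exp (c y) * c y)"
    by (subst Bochner_Integration.integral_add[symmetric])
       (rule integrable_pmf_bounded[OF ceb] integrable_pmf_bounded[OF ceb2] | simp add: algebra_simps)+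
  also have "measure_pmf.expectation (Poi (real s * r)) (\<lambda>y. exp (c y) * (1 - c y))
      = measure_pmf.expectation U (\<lambda>u. exp (c (Y u)) * (1 - c (Y u)))"
    unfolding U_def Y_def by (rule Prod_Poi_sum[OF r ceb, symmetric])
  also have "measure_pmf.expectation (Poi (real s * r)) (\<lambda>y. exp (c y) * c y)
      = measure_pmf.expectation U (\<lambda>u. t * (N u * exp (c (Y u))))"
  proof -
    have k: "measure_pmf.expectation U (\<lambda>u. of_bool (u k = x) * exp (c (Y u))) =
        measure_pmf.expectation (Poi (real s * r)) (\<lambda>y. thin s x y * exp (c y))" if "k < s" for k
      unfolding U_def Y_def
      by (subst Prod_Poi_indicator_sum[OF r eb that], subst Poi_thin_shift[OF r s eb]) simp
    have "measure_pmf.expectation U (\<lambda>u. t * (N u * exp (c (Y u)))) =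
       t * (\<Sum>k<s. measure_pmf.expectation U (\<lambda>u. of_bool (u k = x) * exp (c (Y u))))"
      unfolding N_def sum_distrib_right
      by (subst integral_mult_right_zero, subst Bochner_Integration.integral_sum)
          (auto intro!: integrable_pmf_bounded[OF i1])
    also have "\<dots> = t * (s * measure_pmf.expectation (Poi (real s * r)) (\<lambda>y. thin s x y * exp (c y)))"
      using k by simp
    also have "\<dots> = measure_pmf.expectation (Poi (real s * r)) (\<lambda>y. exp (c y) * c y)"
      unfolding integral_mult_right_zero[symmetric] c_def by (simp add: mult_ac)
    finally show ?thesis by simp
  qed
  also have "measure_pmf.expectation U (\<lambda>u. exp (c (Y u)) * (1 - c (Y u)))
      + measure_pmf.expectation U (\<lambda>u. t * (N u * exp (c (Y u))))
     = measure_pmf.expectation U (\<lambda>u. exp (c (Y u)) * (1 - c (Y u)) + t * (N u * exp (c (Y u))))"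
  proof (rule Bochner_Integration.integral_add[symmetric])
    show "integrable (measure_pmf U) (\<lambda>u. exp (c (Y u)) * (1 - c (Y u)))"
        by (rule integrable_pmf_bounded[OF ceb])
    have "\<bar>t * (N u * exp (c (Y u)))\<bar> \<le> \<bar>t\<bar> * s * exp (\<bar>t\<bar> * s)" for u
      unfolding mult.assoc[symmetric] abs_mult[of "t * N u"] using tN[of u] eb[of "Y u"]
          by (intro mult_mono) auto
    then show "integrable (measure_pmf U) (\<lambda>u. t * (N u * exp (c (Y u))))" by (rule integrable_pmf_bounded)
  qed
  also have "\<dots> \<le> measure_pmf.expectation U (\<lambda>u. exp (t * N u))"
  proof (rule integral_mono)
    show "integrable (measure_pmf U) (\<lambda>u. exp (t * N u))" by (rule integrable_pmf_bounded[OF enb])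
    have "\<bar>exp (c (Y u)) * (1 - c (Y u)) + t * (N u * exp (c (Y u)))\<bar> \<le> exp (\<bar>t\<bar> * s) * (1 + \<bar>t\<bar> * s)
        + \<bar>t\<bar> * s * exp (\<bar>t\<bar> * s)" for u
    proof -
      have "\<bar>t * (N u * exp (c (Y u)))\<bar> \<le> \<bar>t\<bar> * s * exp (\<bar>t\<bar> * s)"
        unfolding mult.assoc[symmetric] abs_mult[of "t * N u"] using tN[of u] eb[of "Y u"]
            by (intro mult_mono) auto
      then show ?thesis using ceb[of "Y u"] by linarith
    qed
    then show "integrable (measure_pmf U) (\<lambda>u. exp (c (Y u)) * (1 - c (Y u)) + t * (N u * exp (c (Y u))))"
      by (rule integrable_pmf_bounded)
    fix u
    have "exp (c (Y u)) * (1 + (t * N u - c (Y u))) \<le> exp (c (Y u)) * exp (t * N u - c (Y u))"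
      by (intro mult_left_mono exp_ge_add_one_self) auto
    also have "\<dots> = exp (t * N u)" by (simp add: exp_add[symmetric])
    finally show "exp (c (Y u)) * (1 - c (Y u)) + t * (N u * exp (c (Y u))) \<le> exp (t * N u)"
        by (simp add: algebra_simps)
  qed
  \<comment> \<open>\<open>N\<close> counts independent events of probability \<open>p\<close>, so
    its moment generating function is a power.\<close>
  also have "measure_pmf.expectation U (\<lambda>u. exp (t * N u))
      = (\<Prod>k<s. measure_pmf.expectation (Poi r) (\<lambda>y. exp (t * of_bool (y = x))))"
  proof -
    have "exp (t * N u) = (\<Prod>k<s. exp (t * of_bool (u k = x)))" for u
      unfolding N_def sum_distrib_left by (rule exp_sum) simp
    moreover have "\<bar>exp (t * of_bool (y = x))\<bar> \<le> exp \<bar>t\<bar>" for y :: nat by (cases "y = x") auto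
    ultimately show ?thesis unfolding U_def
      by (simp only:) (rule Prod_dist_prod(1)[of s "\<lambda>_. Poi r" "\<lambda>_ y. exp (t * of_bool (y = x))"], rule
          integrable_pmf_bounded, assumption, simp)
  qed
  also have "measure_pmf.expectation (Poi r) (\<lambda>y. exp (t * of_bool (y = x))) = 1 + (exp t - 1) * p"
  proof -
    have "exp (t * of_bool (y = x)) = 1 + (exp t - 1) * indicator {x} y" for y :: nat by (cases "y = x") auto
    then have "measure_pmf.expectation (Poi r) (\<lambda>y. exp (t * of_bool (y = x))) = 1
        + (exp t - 1) * measure_pmf.prob (Poi r) {x}"
      by (simp only:) (subst Bochner_Integration.integral_add, auto intro!: integrable_mult_right
          integrable_pmf_bounded[of _ 1] split: split_indicator)
    then show ?thesis by (simp add: p_def measure_pmf_single)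
  qed
  also have "(\<Prod>k<s. 1 + (exp t - 1) * p) \<le> exp (s * ((t + t\<^sup>2) * p))"
  proof -
    have "0 \<le> 1 + (exp t - 1) * p"
    proof -
      have "(-1) * p \<le> (exp t - 1) * p" by (intro mult_right_mono) (auto simp: p_def)
      moreover have "p \<le> 1" by (simp add: p_def pmf_le_1)
      ultimately show ?thesis by simp
    qed
    moreover have "1 + (exp t - 1) * p \<le> exp ((t + t\<^sup>2) * p)"
    proof -
      have "(exp t - 1) * p \<le> (t + t\<^sup>2) * p" using exp_le_quadratic[OF t]
          by (intro mult_right_mono) (auto simp: p_def)
      then show ?thesis using exp_ge_add_one_self[of "(t + t\<^sup>2) * p"] by linarith
    qed
    ultimately have "(1 + (exp t - 1) * p) ^ s \<le> exp ((t + t\<^sup>2) * p) ^ s" by (intro power_mono) auto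
    then show ?thesis by (simp add: exp_of_nat_mult)
  qed
  finally have main: "measure_pmf.expectation (Poi (real s * r)) (\<lambda>y. exp (c y)) \<le> exp (s * ((t + t\<^sup>2) * p))" .
  have "exp (t * (s * (thin s x y - p))) = exp (- (t * s * p)) * exp (c y)" for y
    unfolding c_def exp_add[symmetric] by (simp add: algebra_simps)
  then have "measure_pmf.expectation (Poi (real s * r)) (\<lambda>y. exp (t * (s * (thin s x y - p))))
      = exp (- (t * s * p)) * measure_pmf.expectation (Poi (real s * r)) (\<lambda>y. exp (c y))"
    by simp
  also have "\<dots> \<le> exp (- (t * s * p)) * exp (s * ((t + t\<^sup>2) * p))" using main by (intro mult_left_mono) auto
  also have "\<dots> = exp (t\<^sup>2 * (s * p))" unfolding exp_add[symmetric] by (simp add: algebra_simps)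
  finally show ?thesis unfolding p_def .
qed

lemma Prod_Poi_thin_concentrated:
  fixes x :: nat
  assumes r: "\<And>j. j < n \<Longrightarrow> r j \<ge> 0" and s: "s \<ge> 1" and \<eta>: "\<eta> > 0"
  defines "m \<equiv> \<Sum>j<n. pmf (Poi (r j)) x"
  shows "measure_pmf.prob (Prod_dist n (\<lambda>j. Poi (real s * r j)))
    {y. \<bar>(\<Sum>j<n. thin s x (y j)) - m\<bar> \<ge> 2 * (sqrt (m * \<eta>) + \<eta>)} \<le> 2 * exp (- (s * \<eta>))"
proof -
  have m: "m \<ge> 0" unfolding m_def by (intro sum_nonneg) auto
  have "measure_pmf.prob (Prod_dist n (\<lambda>j. Poi (real s * r j)))
    {y. \<bar>\<Sum>j<n. real s * (thin s x (y j) - pmf (Poi (r j)) x)\<bar> \<ge> s * (2 * (sqrt (m * \<eta>) + \<eta>))}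
        \<le> 2 * exp (- (s * \<eta>))"
  proof (rule Prod_dist_chernoff_two_sided[where V = "\<lambda>j. s * pmf (Poi (r j)) x" and W = "s * m"
        and z = "\<lambda>j y. real s * (thin s x y - pmf (Poi (r j)) x)"])
    show "(\<Sum>j<n. s * pmf (Poi (r j)) x) \<le> s * m" by (simp add: m_def sum_distrib_left)
    show "s * m \<ge> 0" using m by simp
    show "s * \<eta> > 0" using s \<eta> by simp
    have "sqrt (s * m * (s * \<eta>)) = sqrt ((real s)\<^sup>2 * (m * \<eta>))" by (simp add: power2_eq_square mult_ac)
    also have "\<dots> = s * sqrt (m * \<eta>)" by (simp add: real_sqrt_mult)
    finally show "s * (2 * (sqrt (m * \<eta>) + \<eta>)) \<ge> 2 * (sqrt (s * m * (s * \<eta>)) + s * \<eta>)"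
        by (simp add: algebra_simps)
    fix j and t :: real assume j: "j < n" and t: "\<bar>t\<bar> \<le> 1"
    show "measure_pmf.expectation (Poi (real s * r j)) (\<lambda>y. exp
        (t * (real s * (thin s x y - pmf (Poi (r j)) x)))) \<le> exp (t\<^sup>2 * (s * pmf (Poi (r j)) x))"
      by (rule Poi_exp_thin_le) (use r j s t in auto)
    show "integrable (measure_pmf (Poi (real s * r j))) (\<lambda>y. exp
        (t * (real s * (thin s x y - pmf (Poi (r j)) x))))"
    proof (rule integrable_pmf_bounded[of _ "exp s"])
      fix y
      have "\<bar>thin s x y - pmf (Poi (r j)) x\<bar> \<le> 1"
        using thin_bounds[OF s, of x y] pmf_le_1[of "Poi (r j)" x] pmf_nonneg[of "Poi (r j)" x] by linarith
      then have "\<bar>t\<bar> * (s * \<bar>thin s x y - pmf (Poi (r j)) x\<bar>) \<le> 1 * (real s * 1)" using t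
          by (intro mult_mono) auto
      then have "t * (real s * (thin s x y - pmf (Poi (r j)) x)) \<le> s"
        using abs_ge_self[of "t * (real s * (thin s x y - pmf (Poi (r j)) x))"] by (simp add: abs_mult)
      then show "\<bar>exp (t * (real s * (thin s x y - pmf (Poi (r j)) x)))\<bar> \<le> exp s" by simp
    qed
  qed
  moreover have "\<bar>\<Sum>j<n. real s * (thin s x (y j) - pmf (Poi (r j)) x)\<bar> = s * \<bar>(\<Sum>j<n. thin s x (y j)) - m\<bar>"
      for y :: "nat \<Rightarrow> nat"
  proof -
    have "(\<Sum>j<n. real s * (thin s x (y j) - pmf (Poi (r j)) x)) = s * ((\<Sum>j<n. thin s x (y j)) - m)"
      unfolding m_def sum_subtractf[symmetric] by (rule sum_distrib_left[symmetric])
    then show ?thesis by (simp only: abs_mult abs_of_nat)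
  qed
  moreover have "s * a \<le> s * b \<longleftrightarrow> a \<le> b" for a b :: real using s by simp
  ultimately show ?thesis by (simp only:)
qed

section \<open>Analysis of the tests\<close>

text \<open>Every normalized count \<open>y j / s\<close> has to be close to \<open>m\<close>, which approximates \<open>\<mu>\<close>, and \<open>\<eta>\<close> is the
  variance scale. For large rates the sum and an unbiased estimate of the second moment are tested, for
  small rates the unbiased estimates of the expected number of coordinates with value \<open>x\<close> under the
  original rates.\<close>

definition accepts :: "nat \<Rightarrow> nat \<Rightarrow> nat \<Rightarrow> real \<Rightarrow> real \<Rightarrow> (nat \<Rightarrow> nat) \<Rightarrow> bool" where
  "accepts n s X \<eta> m y \<longleftrightarrow>
    (\<forall>j<n. (y j / s - m)\<^sup>2 \<le> 32 * (m * \<eta> + \<eta>\<^sup>2)) \<and>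
    (if 1024 * \<eta> \<le> m then
       ((\<Sum>j<n. real (y j)) / s - n * m)\<^sup>2 \<le> 16 * n * m * \<eta> \<and>
       (let w = \<Sum>j<n. (y j / s - m)\<^sup>2 - y j / (real s)\<^sup>2 in w \<le> 0 \<or> 1024 * w\<^sup>2 \<le> n * m\<^sup>2)
     else
       (\<forall>x. 1 \<le> x \<and> x \<le> X \<longrightarrow>
         ((\<Sum>j<n. thin s x (y j)) - (\<Sum>j<n. thin s 0 (y j)) * (m ^ x / fact x))\<^sup>2
           \<le> 64 * (n * (m ^ x / fact x) * \<eta> + \<eta>\<^sup>2)))"

lemma harm_le_log: "n \<ge> 1 \<Longrightarrow> n \<le> 2 ^ X \<Longrightarrow> harm n \<le> real X + 1"
proof -
  assume n: "n \<ge> 1" "n \<le> 2 ^ X"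
  obtain m where m: "n = Suc m" using n by (cases n) auto
  have "harm (Suc m) - ln (Suc m) \<le> harm (Suc 0) - ln (Suc 0)"
    using decseq_harm_diff_ln by (rule decseqD) simp
  then have "harm n \<le> 1 + ln n" using m by (simp add: harm_def)
  also have "ln n \<le> ln (2 ^ X)" using n by (subst ln_le_cancel_iff) (auto simp flip: of_nat_le_iff)
  also have "\<dots> = X * ln 2" by (simp add: ln_realpow)
  also have "\<dots> \<le> real X * 1" using ln_2_less_1 by (intro mult_left_mono) auto
  finally show ?thesis by simp
qed

text \<open>The weights serve to absorb noise whose size depends on the unknown \<open>a\<close>
  itself: half of \<open>a\<close> moves to the other side of the inequality.\<close>

lemma sqrt_mult_le_avg: "a \<ge> 0 \<Longrightarrow> b \<ge> 0 \<Longrightarrow> 2 * sqrt (a * b) \<le> a / 2 + 2 * b"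
proof -
  assume ab: "a \<ge> 0" "b \<ge> 0"
  have "2 * (sqrt (a / 2) * sqrt (2 * b)) \<le> (sqrt (a / 2))\<^sup>2 + (sqrt (2 * b))\<^sup>2"
    using sum_squares_bound[of "sqrt (a/2)" "sqrt (2*b)"] by simp
  then show ?thesis using ab by (simp add: real_sqrt_mult[symmetric])
qed

lemma square_le_two: "(a + b)\<^sup>2 \<le> 2 * a\<^sup>2 + 2 * b\<^sup>2" for a b :: real
  using sum_squares_bound[of a b] by (simp add: power2_sum)

text \<open>The tests compare squares, which integer arithmetic can do; this recovers the linear
  form of a threshold.\<close>

lemma square_le_imp_le_sqrt:
  fixes z :: real
  assumes "z\<^sup>2 \<le> c\<^sup>2 * (u + \<eta>\<^sup>2)" "c \<ge> 0" "u \<ge> 0" "\<eta> \<ge> 0"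
  shows "\<bar>z\<bar> \<le> c * (sqrt u + \<eta>)"
proof -
  have "\<bar>z\<bar> = sqrt (z\<^sup>2)" by simp
  also have "\<dots> \<le> sqrt (c\<^sup>2 * (u + \<eta>\<^sup>2))" using assms by (intro real_sqrt_le_mono)
  also have "\<dots> = c * sqrt (u + \<eta>\<^sup>2)" using assms by (simp add: real_sqrt_mult)
  also have "\<dots> \<le> c * (sqrt u + sqrt (\<eta>\<^sup>2))" using assms by (intro mult_left_mono sqrt_add_le_add_sqrt) auto
  finally show ?thesis using assms by simp
qed

lemma prob_le_sum:
  fixes b c :: real
  assumes "A \<subseteq> B \<union> C" "measure_pmf.prob p B \<le> b" "measure_pmf.prob p C \<le> c"
  shows "measure_pmf.prob p A \<le> b + c"
proof -
  have "measure_pmf.prob p A \<le> measure_pmf.prob p (B \<union> C)"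
    using assms(1) by (intro measure_pmf.finite_measure_mono) auto
  also have "\<dots> \<le> measure_pmf.prob p B + measure_pmf.prob p C" by (rule measure_Un_le) auto
  finally show ?thesis using assms by linarith
qed

lemma prob_UN_le:
  fixes b :: real
  assumes "finite I" "A \<subseteq> (\<Union>i\<in>I. B i)" "\<And>i. i \<in> I \<Longrightarrow> measure_pmf.prob p (B i) \<le> b"
  shows "measure_pmf.prob p A \<le> card I * b"
proof -
  have "measure_pmf.prob p A \<le> measure_pmf.prob p (\<Union>i\<in>I. B i)"
    using assms(2) by (intro measure_pmf.finite_measure_mono) auto
  also have "\<dots> \<le> (\<Sum>i\<in>I. measure_pmf.prob p (B i))"
    using assms(1) by (intro measure_pmf.finite_measure_subadditive_finite) auto
  also have "\<dots> \<le> card I * b" using assms(3) sum_bounded_above[of I "\<lambda>i. measure_pmf.prob p (B i)" b] by simp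
  finally show ?thesis .
qed

text \<open>Here \<open>m\<close> is the rational approximation of \<mu> available to the program
  and \<open>e0\<close> bounds its error, which stays below \<open>\<eta>\<^sup>2\<close> even when
  accumulated over all coordinates. Each deviation event below has probability at most a constant
  times \<open>exp (- (s * \<eta>))\<close>.\<close>

locale tester_analysis =
  fixes n s X :: nat and \<mu> m \<eta> e0 :: real
  assumes n: "n \<ge> 2" and s: "s \<ge> 1" and \<mu>: "\<mu> > 0" and m: "0 \<le> m" "m \<le> \<mu>" "\<mu> \<le> m + e0"
    and e0: "n * e0 \<le> \<eta>\<^sup>2" and \<eta>: "0 < \<eta>" "\<eta> \<le> 1 / 2 ^ 44" "(real X + 1)\<^sup>2 * \<eta> \<le> 1 / 2 ^ 40"
    and nX: "n \<le> 2 ^ X" and K: "s * \<eta> \<ge> 1"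
begin

lemma e0_nonneg: "e0 \<ge> 0" using m by linarith

lemma e0_le: "e0 \<le> \<eta>\<^sup>2"
proof -
  have "1 * e0 \<le> n * e0" using n e0_nonneg by (intro mult_right_mono) auto
  then show ?thesis using e0 by simp
qed

lemma eta_small: "\<eta> \<le> 1 / 1000000"
proof -
  have "1 / 2 ^ 44 \<le> (1 / 1000000 :: real)" by simp
  then show ?thesis using \<eta>(2) by linarith
qed

lemma eta2: "\<eta>\<^sup>2 \<le> \<eta> / 1000"
  using mult_left_mono[OF eta_small, of \<eta>] \<eta>(1) by (simp add: power2_eq_square)

lemma sqrt_mu_le: "sqrt (\<mu> * \<eta>) \<le> sqrt (m * \<eta>) + \<eta> / 100"
proof -
  have "sqrt (\<mu> * \<eta>) \<le> sqrt (m * \<eta> + e0 * \<eta>)" using m \<eta> by (intro real_sqrt_le_mono)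
      (simp add: distrib_right[symmetric])
  also have "\<dots> \<le> sqrt (m * \<eta>) + sqrt (e0 * \<eta>)" using m \<eta> e0_nonneg by (intro sqrt_add_le_add_sqrt) auto
  also have "sqrt (e0 * \<eta>) \<le> \<eta> / 100"
  proof (rule real_le_lsqrt)
    have "e0 * \<eta> \<le> \<eta>\<^sup>2 * \<eta>" using e0_le \<eta> by (intro mult_right_mono) auto
    also have "\<dots> \<le> \<eta>\<^sup>2 * (1 / 2 ^ 44)" using \<eta> by (intro mult_left_mono) auto
    also have "\<dots> \<le> \<eta>\<^sup>2 * (1 / 10000)" by (intro mult_left_mono) auto
    finally show "e0 * \<eta> \<le> (\<eta> / 100)\<^sup>2" by (simp add: power_divide)
  qed (use e0_nonneg \<eta> in auto)
  finally show ?thesis by simp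
qed

lemma coordinate_accepted:
  assumes "\<bar>Y - \<mu>\<bar> < 2 * (sqrt (\<mu> * \<eta>) + \<eta>)"
  shows "(Y - m)\<^sup>2 \<le> 32 * (m * \<eta> + \<eta>\<^sup>2)"
proof -
  have "\<bar>Y - m\<bar> \<le> 2 * sqrt (m * \<eta>) + 3 * \<eta>"
    using assms sqrt_mu_le m e0_le eta2 \<eta>(1) unfolding distrib_left by linarith
  then have "(Y - m)\<^sup>2 \<le> (2 * sqrt (m * \<eta>) + 3 * \<eta>)\<^sup>2"
    by (intro abs_le_square_iff[THEN iffD1]) linarith
  also have "\<dots> \<le> 2 * (2 * sqrt (m * \<eta>))\<^sup>2 + 2 * (3 * \<eta>)\<^sup>2" by (rule square_le_two)
  also have "\<dots> = 8 * (m * \<eta>) + 18 * \<eta>\<^sup>2" using m \<eta> by (simp add: power_mult_distrib)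
  also have "\<dots> \<le> 32 * (m * \<eta>) + 32 * \<eta>\<^sup>2" using m \<eta> by (intro add_mono mult_right_mono) auto
  finally show ?thesis by (simp only: distrib_left)
qed

lemma accepted_coordinate:
  assumes "(Y - m)\<^sup>2 \<le> 32 * (m * \<eta> + \<eta>\<^sup>2)"
  shows "\<bar>Y - m\<bar> \<le> 6 * sqrt (\<mu> * \<eta>) + 6 * \<eta>"
proof -
  have "32 * (m * \<eta> + \<eta>\<^sup>2) \<le> 6\<^sup>2 * (m * \<eta> + \<eta>\<^sup>2)" using m \<eta> by (intro mult_right_mono) auto
  then have "(Y - m)\<^sup>2 \<le> 6\<^sup>2 * (m * \<eta> + \<eta>\<^sup>2)" using assms by linarith
  then have "\<bar>Y - m\<bar> \<le> 6 * (sqrt (m * \<eta>) + \<eta>)" using m \<eta> by (intro square_le_imp_le_sqrt) auto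
  also have "sqrt (m * \<eta>) \<le> sqrt (\<mu> * \<eta>)" using m \<eta> by (intro real_sqrt_le_mono mult_right_mono) auto
  finally show ?thesis unfolding distrib_left by simp
qed

text \<open>The fluctuation of \<open>Y\<close> depends on the unknown rate. By subadditivity
  \<open>sqrt (r * \<eta>)\<close> is at most \<open>sqrt (\<mu> * \<eta>)\<close> plus
  \<open>sqrt (\<bar>r - \<mu>\<bar> * \<eta>)\<close>, and the latter is absorbed into the
  difference to be bounded.\<close>

lemma rate_close:
  assumes Y: "(Y - m)\<^sup>2 \<le> 32 * (m * \<eta> + \<eta>\<^sup>2)" and r: "r \<ge> 0" "\<bar>Y - r\<bar> < 2 * (sqrt (r * \<eta>) + \<eta>)"
  shows "\<bar>r - \<mu>\<bar> \<le> 22 * (sqrt (\<mu> * \<eta>) + \<eta>)"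
proof -
  have "sqrt (r * \<eta>) \<le> sqrt (\<mu> * \<eta> + \<bar>r - \<mu>\<bar> * \<eta>)"
    using \<eta> unfolding distrib_right[symmetric] by (intro real_sqrt_le_mono mult_right_mono) auto
  also have "\<dots> \<le> sqrt (\<mu> * \<eta>) + sqrt (\<bar>r - \<mu>\<bar> * \<eta>)" using \<mu> \<eta> by (intro sqrt_add_le_add_sqrt) auto
  finally have 1: "sqrt (r * \<eta>) \<le> sqrt (\<mu> * \<eta>) + sqrt (\<bar>r - \<mu>\<bar> * \<eta>)" .
  have 2: "2 * sqrt (\<bar>r - \<mu>\<bar> * \<eta>) \<le> \<bar>r - \<mu>\<bar> / 2 + 2 * \<eta>" using \<eta> by (intro sqrt_mult_le_avg) auto
  have 3: "sqrt (\<mu> * \<eta>) \<ge> 0" using \<mu> \<eta> by simp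
  have 4: "\<bar>r - \<mu>\<bar> \<le> \<bar>Y - r\<bar> + \<bar>Y - m\<bar> + (\<mu> - m)" using m by linarith
  define D B A C where "D = \<bar>r - \<mu>\<bar>" and "B = sqrt (D * \<eta>)" and "A = sqrt (\<mu> * \<eta>)" and "C = sqrt (r * \<eta>)"
  have "C \<le> A + B" "2 * B \<le> D / 2 + 2 * \<eta>" "A \<ge> 0" "D \<le> (2 * C + 2 * \<eta>) + (6 * A + 6 * \<eta>) + \<eta> / 1000"
    using 1 2 3 4 accepted_coordinate[OF Y] r(2) m e0_le eta2 unfolding distrib_left D_def B_def A_def C_def
        by linarith+
  then show ?thesis using \<eta>(1) unfolding distrib_left D_def[symmetric] A_def[symmetric] by linarith
qed

lemma prob_coordinate:
  assumes "\<And>j. j < n \<Longrightarrow> r j \<ge> 0" "i < n"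
  shows "measure_pmf.prob (Prod_dist n (\<lambda>j. Poi (real s * r j)))
      {y. \<bar>y i / s - r i\<bar> \<ge> 2 * (sqrt (r i * \<eta>) + \<eta>)} \<le> 2 * exp (- (s * \<eta>))"
proof -
  have e: "\<bar>real (y i) - s * r i\<bar> \<ge> 2 * (sqrt (s * r i * (s * \<eta>)) + s * \<eta>) \<longleftrightarrow> \<bar>y i / s
      - r i\<bar> \<ge> 2 * (sqrt (r i * \<eta>) + \<eta>)" for y :: "nat \<Rightarrow> nat"
  proof -
    have "sqrt (s * r i * (s * \<eta>)) = sqrt ((real s)\<^sup>2 * (r i * \<eta>))" by (simp add: power2_eq_square mult_ac)
    also have "\<dots> = s * sqrt (r i * \<eta>)" by (simp add: real_sqrt_mult)
    finally have 1: "2 * (sqrt (s * r i * (s * \<eta>)) + s * \<eta>) = s * (2 * (sqrt (r i * \<eta>) + \<eta>))"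
        by (simp add: algebra_simps)
    have "real (y i) - s * r i = s * (y i / s - r i)" using s by (simp add: field_simps)
    then have 2: "\<bar>real (y i) - s * r i\<bar> = s * \<bar>y i / s - r i\<bar>" by (simp only: abs_mult abs_of_nat)
    show ?thesis unfolding 1 2 using s by (subst mult_le_cancel_left_pos) auto
  qed
  show ?thesis
    using Prod_Poi_coordinate_concentrated[of n "\<lambda>j. s * r j" "s * \<eta>" i] assms K unfolding e by simp
qed

lemma prob_sum:
  assumes "\<And>j. j < n \<Longrightarrow> r j \<ge> 0"
  shows "measure_pmf.prob (Prod_dist n (\<lambda>j. Poi (real s * r j)))
    {y. \<bar>(\<Sum>j<n. real (y j)) / s - (\<Sum>j<n. r j)\<bar> \<ge> 2 * (sqrt ((\<Sum>j<n. r j) * \<eta>) + \<eta>)} \<le> 2 * exp (- (s * \<eta>))"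
proof -
  define R where "R = (\<Sum>j<n. r j)"
  have sR: "(\<Sum>j<n. s * r j) = s * R" by (simp add: R_def sum_distrib_left)
  have e: "\<bar>\<Sum>j<n. real (y j) - s * r j\<bar> \<ge> 2 * (sqrt ((\<Sum>j<n. s * r j) * (s * \<eta>)) + s * \<eta>) \<longleftrightarrow>
      \<bar>(\<Sum>j<n. real (y j)) / s - R\<bar> \<ge> 2 * (sqrt (R * \<eta>) + \<eta>)" for y :: "nat \<Rightarrow> nat"
  proof -
    have "sqrt (s * R * (s * \<eta>)) = sqrt ((real s)\<^sup>2 * (R * \<eta>))" by (simp add: power2_eq_square mult_ac)
    also have "\<dots> = s * sqrt (R * \<eta>)" by (simp add: real_sqrt_mult)
    finally have 1: "2 * (sqrt (s * R * (s * \<eta>)) + s * \<eta>) = s * (2 * (sqrt (R * \<eta>) + \<eta>))"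
        by (simp add: algebra_simps)
    have "(\<Sum>j<n. real (y j) - s * r j) = s * ((\<Sum>j<n. real (y j)) / s - R)" using s
        by (simp add: sum_subtractf sR field_simps)
    then have 2: "\<bar>\<Sum>j<n. real (y j) - s * r j\<bar> = s * \<bar>(\<Sum>j<n. real (y j)) / s - R\<bar>"
        by (simp only: abs_mult abs_of_nat)
    show ?thesis unfolding sR 1 2 using s by (subst mult_le_cancel_left_pos) auto
  qed
  show ?thesis
    using Prod_Poi_sum_concentrated[of n "\<lambda>j. s * r j" "s * \<eta>"] assms K unfolding e R_def[symmetric] by simp
qed

end

section \<open>The tests for large rates\<close>

locale tester_analysis_large = tester_analysis +
  assumes large: "1024 * \<eta> \<le> m"
begin

definition a where "a = sqrt (\<mu> * \<eta>)"

text \<open>The radius \<open>a\<close> of the coordinatewise test is the geometric mean of \<eta>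
  and \<mu>. The threshold 1024 = 32^2 separates it from both by a factor of 32, so \<eta> is
  negligible against \<open>a\<close>, and \<open>a\<close> against \<mu>.\<close>

lemma a: "32 * \<eta> \<le> a" "32 * a \<le> \<mu>" "a > 0" "a\<^sup>2 = \<mu> * \<eta>"
proof -
  have L: "1024 * \<eta> \<le> \<mu>" using large m by linarith
  have "sqrt ((32 * \<eta>)\<^sup>2) \<le> a"
    unfolding a_def using mult_right_mono[OF L, of \<eta>] \<eta> by (intro real_sqrt_le_mono)
        (simp add: power2_eq_square)
  then show "32 * \<eta> \<le> a" using \<eta>(1) by (simp only: real_sqrt_abs)
  have "a \<le> sqrt ((\<mu> / 32)\<^sup>2)"
    unfolding a_def using mult_left_mono[OF L, of \<mu>] \<mu> by (intro real_sqrt_le_mono) (simp add: power2_eq_square)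
  then show "32 * a \<le> \<mu>" using \<mu> by simp
  show "a > 0" "a\<^sup>2 = \<mu> * \<eta>" unfolding a_def using \<mu> \<eta> by auto
qed

lemma mu_le: "\<mu> \<le> 2 * m" using m large e0_le eta2 \<eta>(1) by linarith

lemma sL: "real s * \<mu> \<ge> 1"
proof -
  have "1 \<le> s * \<eta>" by (rule K)
  also have "\<dots> \<le> s * \<mu>" using large m \<eta> by (intro mult_left_mono) auto
  finally show ?thesis .
qed

text \<open>The sum of \<open>charlier2 (s * m) (y j)\<close>, divided by \<open>s\<^sup>2\<close>:
  the statistic that estimates the second moment of the deviations of the rates.\<close>

definition W where "W y = (\<Sum>j<n. (real (y j) / s - m)\<^sup>2 - y j / (real s)\<^sup>2)" for y :: "nat \<Rightarrow> nat"

text \<open>The concentration bounds concern polynomials centered at \<open>s * \<mu>\<close>, the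
  program centers at \<open>s * m\<close>. Each coordinate changes by at most
  \<open>3 * e0 * \<mu>\<close>, and \<open>n * e0 \<le> \<eta>\<^sup>2\<close>.\<close>

lemma W_charlier:
  assumes "\<And>j. j < n \<Longrightarrow> \<bar>real (y j) / s - \<mu>\<bar> \<le> \<mu>"
  shows "\<bar>W y - (\<Sum>j<n. charlier2 (s * \<mu>) (y j)) / (real s)\<^sup>2\<bar> \<le> \<mu> / 1000"
proof -
  have c: "charlier2 (s * \<mu>) (y j) / (real s)\<^sup>2 = (real (y j) / s - \<mu>)\<^sup>2 - y j / (real s)\<^sup>2" for j
  proof -
    have "real (y j) - s * \<mu> = s * (real (y j) / s - \<mu>)" using s by (simp add: field_simps)
    then show ?thesis unfolding charlier2_def using s by (simp add: power_mult_distrib diff_divide_distrib)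
  qed
  have "W y - (\<Sum>j<n. charlier2 (s * \<mu>) (y j)) / (real s)\<^sup>2
      = (\<Sum>j<n. (\<mu> - m) * (2 * (real (y j) / s - \<mu>) + (\<mu> - m)))"
    unfolding W_def sum_divide_distrib c sum_subtractf[symmetric]
  proof (rule sum.cong[OF refl])
    fix j
    define v where "v = real (y j) / s"
    show "(real (y j) / s - m)\<^sup>2 - real (y j) / (real s)\<^sup>2 - ((real (y j) / s - \<mu>)\<^sup>2 - real (y j) / (real s)\<^sup>2)
      = (\<mu> - m) * (2 * (real (y j) / s - \<mu>) + (\<mu> - m))"
      unfolding v_def[symmetric] by (simp add: power2_eq_square algebra_simps)
  qed
  also have "\<bar>\<dots>\<bar> \<le> (\<Sum>j<n. e0 * (3 * \<mu>))"
  proof (rule order_trans[OF sum_abs], rule sum_mono)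
    fix j assume "j \<in> {..<n}"
    then have "\<bar>2 * (real (y j) / s - \<mu>) + (\<mu> - m)\<bar> \<le> 3 * \<mu>" using assms[of j] m
        unfolding right_diff_distrib by simp
    then show "\<bar>(\<mu> - m) * (2 * (real (y j) / s - \<mu>) + (\<mu> - m))\<bar> \<le> e0 * (3 * \<mu>)"
      unfolding abs_mult using m by (intro mult_mono) auto
  qed
  also have "\<dots> = (n * e0) * (3 * \<mu>)" by simp
  also have "\<dots> \<le> \<eta>\<^sup>2 * (3 * \<mu>)" using e0 \<mu> by (intro mult_right_mono) auto
  also have "\<dots> \<le> (1 / 3000) * (3 * \<mu>)"
  proof (rule mult_right_mono)
    show "\<eta>\<^sup>2 \<le> 1 / 3000" using eta2 eta_small by linarith
  qed (use \<mu> in auto)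
  finally show ?thesis by simp
qed

text \<open>The constant in \<eta> is fixed by these inequalities: \<open>sqrt \<eta>\<close> is at
  most 2^-22, while 50000 \<le> 224^2 and 32 \<le> 6^2.\<close>

lemma thresholds:
  "64 * (sqrt (50000 * real n * (real s * \<eta>)) + real s * \<eta>) \<le> real s * (sqrt n / 128)"
  "128 * (sqrt (32 * real n * (real s * \<eta>)) + real s * \<eta>) \<le> real s * (sqrt n / 128)"
proof -
  have sq: "sqrt \<eta> \<le> 1 / 4194304" using \<eta> by (intro real_le_lsqrt) (auto simp: power_divide)
  have sn: "s * \<eta> \<le> (s * sqrt n) * (1 / 17592186044416)"
  proof -
    have "s * \<eta> \<le> s * (1 / 17592186044416)" using \<eta> by (intro mult_left_mono) auto
    also have "\<dots> = (s * 1) * (1 / 17592186044416)" by simp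
    also have "\<dots> \<le> (real s * sqrt n) * (1 / 17592186044416)"
    proof (rule mult_right_mono)
      have "1 \<le> sqrt n" using n by simp
      then show "real (s * 1) \<le> real s * sqrt n" using mult_left_mono[of 1 "sqrt n" "real s"] by simp
    qed simp
    finally show ?thesis .
  qed
  have sr: "sqrt (c\<^sup>2 * real n * (real s * \<eta>)) \<le> c * ((s * sqrt n) * (1 / 4194304))" if "c \<ge> 0" for c
  proof -
    have "sqrt (c\<^sup>2 * real n * (real s * \<eta>)) = c * (sqrt n * (sqrt s * sqrt \<eta>))" using that
        by (simp add: real_sqrt_mult)
    also have "\<dots> \<le> c * (sqrt n * (s * (1 / 4194304)))"
    proof (intro mult_left_mono mult_mono sq)
      show "sqrt s \<le> s" using s by (intro real_le_lsqrt) (auto simp: power2_eq_square)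
    qed (use that \<eta> in auto)
    finally show ?thesis by (simp add: mult_ac)
  qed
  define z where "z = s * sqrt n"
  have z: "z \<ge> 0" by (simp add: z_def)
  have zz: "real s * (sqrt n / 128) = z * (1 / 128)" by (simp add: z_def)
  have "sqrt (50000 * real n * (real s * \<eta>)) \<le> sqrt (224\<^sup>2 * real n * (real s * \<eta>))" using \<eta>
      by (intro real_sqrt_le_mono mult_right_mono) auto
  then have 1: "sqrt (50000 * real n * (real s * \<eta>)) \<le> 224 * (z * (1 / 4194304))" using sr[of 224]
      unfolding z_def by linarith
  have "sqrt (32 * real n * (real s * \<eta>)) \<le> sqrt (6\<^sup>2 * real n * (real s * \<eta>))" using \<eta>
      by (intro real_sqrt_le_mono mult_right_mono) auto
  then have 2: "sqrt (32 * real n * (real s * \<eta>)) \<le> 6 * (z * (1 / 4194304))" using sr[of 6] unfolding z_def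
      by linarith
  have 3: "s * \<eta> \<le> z * (1 / 17592186044416)" using sn by (simp add: z_def)
  show "64 * (sqrt (50000 * real n * (real s * \<eta>)) + real s * \<eta>) \<le> real s * (sqrt n / 128)"
    using 1 3 z unfolding distrib_left zz by linarith
  show "128 * (sqrt (32 * real n * (real s * \<eta>)) + real s * \<eta>) \<le> real s * (sqrt n / 128)"
    using 2 3 z unfolding distrib_left zz by linarith
qed

end

context tester_analysis_large
begin

text \<open>A union bound: 2 for each coordinate, 2 for the sum, and 1 for the second moment, which
  is tested on one side only.\<close>

lemma null_rejected:
  "measure_pmf.prob (Prod_dist n (\<lambda>_. Poi (real s * \<mu>))) {y. \<not> accepts n s X \<eta> m y}
      \<le> (2 * real n + 3) * exp (- (s * \<eta>))"
proof -
  let ?P = "Prod_dist n (\<lambda>_. Poi (real s * \<mu>))"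
  define B1 where "B1 = {y :: nat \<Rightarrow> nat. \<exists>i<n. \<bar>y i / s - \<mu>\<bar> \<ge> 2 * (sqrt (\<mu> * \<eta>) + \<eta>)}"
  define B2 where "B2 = {y :: nat \<Rightarrow> nat. \<bar>(\<Sum>j<n. real (y j)) / s - n * \<mu>\<bar> \<ge> 2 * (sqrt (n * \<mu> * \<eta>) + \<eta>)}"
  define B3 where "B3 = {y :: nat \<Rightarrow> nat. (\<forall>j<n. \<bar>real (y j) - s * \<mu>\<bar> \<le> s * \<mu>)
      \<and> (\<Sum>j<n. charlier2 (s * \<mu>) (real (y j)) / (s * \<mu>)) \<ge> s * (sqrt n / 128)}"
  have p1: "measure_pmf.prob ?P B1 \<le> real (card {..<n}) * (2 * exp (- (s * \<eta>)))"
  proof (rule prob_UN_le[where I = "{..<n}" and B = "\<lambda>i.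
      {y :: nat \<Rightarrow> nat. \<bar>y i / s - \<mu>\<bar> \<ge> 2 * (sqrt (\<mu> * \<eta>) + \<eta>)}"])
    show "B1 \<subseteq> (\<Union>i\<in>{..<n}. {y. \<bar>y i / s - \<mu>\<bar> \<ge> 2 * (sqrt (\<mu> * \<eta>) + \<eta>)})" by (auto simp: B1_def)
    show "measure_pmf.prob ?P {y. \<bar>y i / s - \<mu>\<bar> \<ge> 2 * (sqrt (\<mu> * \<eta>) + \<eta>)} \<le> 2 * exp (- (s * \<eta>))"
        if "i \<in> {..<n}" for i
      using prob_coordinate[of "\<lambda>_. \<mu>" i] \<mu> that by simp
  qed simp
  have p2: "measure_pmf.prob ?P B2 \<le> 2 * exp (- (s * \<eta>))"
    using prob_sum[of "\<lambda>_. \<mu>"] \<mu> unfolding B2_def by simp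
  have p3: "measure_pmf.prob ?P B3 \<le> exp (- (s * \<eta>))"
    unfolding B3_def by (rule Prod_Poi_charlier2_upper[OF sL _ thresholds(1)]) (use K in simp)
  have "{y. \<not> accepts n s X \<eta> m y} \<subseteq> B1 \<union> (B2 \<union> B3)"
  proof (rule ccontr)
    assume "\<not> ?thesis"
    then obtain y where y: "\<not> accepts n s X \<eta> m y" "y \<notin> B1" "y \<notin> B2" "y \<notin> B3" by auto
    have 1: "\<bar>y i / s - \<mu>\<bar> < 2 * (sqrt (\<mu> * \<eta>) + \<eta>)" if "i < n" for i
      using y(2) that unfolding B1_def by (simp add: not_le)
    have t1: "(y i / s - m)\<^sup>2 \<le> 32 * (m * \<eta> + \<eta>\<^sup>2)" if "i < n" for i
      by (rule coordinate_accepted[OF 1[OF that]])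
    have close: "\<bar>y i / s - \<mu>\<bar> \<le> \<mu>" if "i < n" for i
      using 1[OF that] a unfolding a_def[symmetric] distrib_left by linarith
    have t2: "((\<Sum>j<n. real (y j)) / s - n * m)\<^sup>2 \<le> 16 * n * m * \<eta>"
    proof -
      define b where "b = sqrt (n * \<mu> * \<eta>)"
      have "1 * (\<mu> * \<eta>) \<le> n * (\<mu> * \<eta>)" using n \<mu> \<eta> by (intro mult_right_mono) auto
      then have ab: "a \<le> b" unfolding a_def b_def by (intro real_sqrt_le_mono) (simp add: mult.assoc)
      have "n * \<mu> - n * m \<le> n * e0" using m n by (simp add: right_diff_distrib[symmetric])
      then have d: "0 \<le> n * \<mu> - n * m" "n * \<mu> - n * m \<le> \<eta> / 1000" using e0 eta2 m
          by (auto intro: mult_left_mono)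
      have "\<bar>(\<Sum>j<n. real (y j)) / s - n * \<mu>\<bar> < 2 * b + 2 * \<eta>"
        using y(3) unfolding B2_def b_def distrib_left by (simp add: not_le)
      then have "\<bar>(\<Sum>j<n. real (y j)) / s - n * m\<bar> \<le> (5/2) * b" using d a ab \<eta>(1) by linarith
      then have "((\<Sum>j<n. real (y j)) / s - n * m)\<^sup>2 \<le> ((5/2) * b)\<^sup>2"
        by (intro abs_le_square_iff[THEN iffD1]) linarith
      also have "\<dots> = 25/4 * (n * \<mu> * \<eta>)" unfolding b_def using \<mu> \<eta>
          by (simp add: power_mult_distrib power_divide)
      also have "\<dots> \<le> 25/4 * (n * (2 * m) * \<eta>)" using mu_le \<eta> by (intro mult_left_mono mult_right_mono) auto
      also have "\<dots> \<le> 16 * n * m * \<eta>" using m \<eta> by simp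
      finally show ?thesis .
    qed
    have t3: "W y \<le> 0 \<or> 1024 * (W y)\<^sup>2 \<le> n * m\<^sup>2"
    proof -
      \<comment> \<open>Outside \<open>B1\<close> the truncation in the Chernoff bound for
        \<open>charlier2\<close> holds by itself.\<close>
      have in3: "\<forall>j<n. \<bar>real (y j) - s * \<mu>\<bar> \<le> s * \<mu>"
      proof (intro allI impI)
        fix j assume "j < n"
        then have "s * \<bar>y j / s - \<mu>\<bar> \<le> s * \<mu>" using close by (intro mult_left_mono) auto
        then have "\<bar>s * (y j / s - \<mu>)\<bar> \<le> s * \<mu>" by (simp only: abs_mult abs_of_nat)
        moreover have "s * (y j / s - \<mu>) = real (y j) - s * \<mu>" using s by (simp add: field_simps)
        ultimately show "\<bar>real (y j) - s * \<mu>\<bar> \<le> s * \<mu>" by simp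
      qed
      define Z where "Z = (\<Sum>j<n. charlier2 (s * \<mu>) (real (y j)))"
      have "Z / (s * \<mu>) < s * (sqrt n / 128)"
        using y(4) in3 unfolding B3_def Z_def by (simp add: sum_divide_distrib not_le)
      then have "Z / (real s)\<^sup>2 \<le> \<mu> * (sqrt n / 128)"
        using s \<mu> by (simp add: field_simps power2_eq_square)
      moreover have "\<bar>W y - Z / (real s)\<^sup>2\<bar> \<le> \<mu> / 1000"
        unfolding Z_def by (rule W_charlier) (use close in auto)
      moreover have "\<mu> / 1000 \<le> \<mu> * (sqrt n / 1000)" using n \<mu> by simp
      ultimately have "W y \<le> \<mu> * (sqrt n / 128) + \<mu> * (sqrt n / 1000)" by linarith
      also have "\<dots> \<le> \<mu> * (sqrt n / 64)" using \<mu> by (simp add: field_simps)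
      also have "\<dots> \<le> (2 * m) * (sqrt n / 64)" using mu_le by (intro mult_right_mono) auto
      finally have W32: "W y \<le> m * sqrt n / 32" by simp
      show ?thesis
      proof (cases "W y \<le> 0")
        case False
        then have "(W y)\<^sup>2 \<le> (m * sqrt n / 32)\<^sup>2" using W32 by (intro power_mono) auto
        also have "\<dots> = n * m\<^sup>2 / 1024" by (simp add: power_mult_distrib power_divide)
        finally show ?thesis by simp
      qed simp
    qed
    have "accepts n s X \<eta> m y"
      unfolding accepts_def Let_def using t1 t2 t3 large unfolding W_def by simp
    then show False using y by simp
  qed
  then have "measure_pmf.prob ?P {y. \<not> accepts n s X \<eta> m y} \<le> real (card {..<n}) * (2 * exp (- (s * \<eta>)))
      + (2 * exp (- (s * \<eta>)) + exp (- (s * \<eta>)))"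
    by (rule prob_le_sum[OF _ p1 prob_le_sum[OF order.refl p2 p3]])
  then show ?thesis by (simp add: algebra_simps)
qed

end

context tester_analysis
begin

lemma far_coordinate_rejected:
  fixes r :: "nat \<Rightarrow> real"
  assumes r: "\<And>j. j < n \<Longrightarrow> r j \<ge> 0" and i: "i < n" "\<bar>r i - \<mu>\<bar> > 22 * (sqrt (\<mu> * \<eta>) + \<eta>)"
  shows "measure_pmf.prob (Prod_dist n (\<lambda>j. Poi (real s * r j))) {y. accepts n s X \<eta> m y} \<le> 2 * exp (- (s * \<eta>))"
proof -
  have "{y. accepts n s X \<eta> m y} \<subseteq> {y. \<bar>y i / s - r i\<bar> \<ge> 2 * (sqrt (r i * \<eta>) + \<eta>)}"
  proof (intro subsetI CollectI, rule ccontr)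
    fix y assume y: "y \<in> {y. accepts n s X \<eta> m y}" and far: "\<not> \<bar>y i / s - r i\<bar> \<ge> 2 * (sqrt (r i * \<eta>) + \<eta>)"
    have "(y i / s - m)\<^sup>2 \<le> 32 * (m * \<eta> + \<eta>\<^sup>2)" using y i unfolding accepts_def by auto
    from rate_close[OF this r[OF i(1)]] far i show False by auto
  qed
  then have "measure_pmf.prob (Prod_dist n (\<lambda>j. Poi (real s * r j))) {y. accepts n s X \<eta> m y}
    \<le> measure_pmf.prob (Prod_dist n (\<lambda>j. Poi (real s * r j))) {y. \<bar>y i / s - r i\<bar> \<ge> 2 * (sqrt (r i * \<eta>) + \<eta>)}"
    by (intro measure_pmf.finite_measure_mono) auto
  also have "\<dots> \<le> 2 * exp (- (s * \<eta>))" by (rule prob_coordinate[OF r i(1)])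
  finally show ?thesis .
qed

lemma harm_eta: "harm n * \<eta> \<le> 1 / 2 ^ 40"
proof -
  have "harm n \<le> real X + 1" using n nX by (intro harm_le_log) auto
  also have "\<dots> \<le> (real X + 1)\<^sup>2" by (simp add: power2_eq_square)
  finally have "harm n * \<eta> \<le> (real X + 1)\<^sup>2 * \<eta>" using \<eta> by (intro mult_right_mono) auto
  then show ?thesis using \<eta> by linarith
qed

end

context tester_analysis_large
begin

text \<open>Argued by contraposition. A coordinate far from \<mu> is rejected directly. If all are
  near, an accepted \<open>y\<close> outside the deviation events \<open>E1\<close> and
  \<open>E2\<close> certifies that the sum and the second moment of the \<open>r i - \<mu>\<close>
  are small; then the total variation distance is at most 3/10, which contradicts
  \<open>far\<close>. So acceptance implies \<open>E1\<close> or \<open>E2\<close>.\<close>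

lemma alternative_accepted:
  fixes r :: "nat \<Rightarrow> real"
  assumes r: "\<And>j. j < n \<Longrightarrow> r j \<ge> 0"
    and far: "d_TV (Prod_dist n (\<lambda>_. Poi \<mu>)) (Perm_dist n (\<lambda>i. Poi (r i))) \<ge> 1 / 2"
  shows "measure_pmf.prob (Prod_dist n (\<lambda>j. Poi (real s * r j))) {y. accepts n s X \<eta> m y} \<le> 4 * exp (- (s * \<eta>))"
proof -
  let ?P = "Prod_dist n (\<lambda>j. Poi (real s * r j))"
  have ex: "exp (- (s * \<eta>)) > 0" by simp
  consider "\<exists>i<n. \<bar>r i - \<mu>\<bar> > 22 * (sqrt (\<mu> * \<eta>) + \<eta>)"
    | "\<forall>i<n. \<bar>r i - \<mu>\<bar> \<le> 22 * (sqrt (\<mu> * \<eta>) + \<eta>)" by force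
  then show ?thesis
  proof cases
    case 1
    then obtain i where "i < n" "\<bar>r i - \<mu>\<bar> > 22 * (sqrt (\<mu> * \<eta>) + \<eta>)" by auto
    from far_coordinate_rejected[of r, OF r this] ex show ?thesis by linarith
  next
    case 2
    have near: "\<bar>r i - \<mu>\<bar> \<le> 23 * a" if "i < n" for i
      using 2 that a unfolding a_def[symmetric] distrib_left by fastforce
    have near\<mu>: "\<bar>r i - \<mu>\<bar> \<le> \<mu>" if "i < n" for i using near[OF that] a by linarith
    have near2: "(r i - \<mu>)\<^sup>2 \<le> \<mu> * (529 * \<eta>)" if "i < n" for i
    proof -
      have "(r i - \<mu>)\<^sup>2 \<le> (23 * a)\<^sup>2" using near[OF that] a by (intro abs_le_square_iff[THEN iffD1]) auto
      then show ?thesis using a(4) by (simp add: power_mult_distrib mult_ac)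
    qed
    define b where "b = sqrt (n * \<mu> * \<eta>)"
    have b2: "b\<^sup>2 = n * \<mu> * \<eta>" unfolding b_def using \<mu> \<eta> by simp
    have "1 * (\<mu> * \<eta>) \<le> n * (\<mu> * \<eta>)" using n \<mu> \<eta> by (intro mult_right_mono) auto
    then have ab: "a \<le> b" unfolding a_def b_def by (intro real_sqrt_le_mono) (simp add: mult.assoc)
    define R where "R = (\<Sum>j<n. r j)"
    define V where "V = (\<Sum>j<n. (r j - \<mu>)\<^sup>2)"
    define Y where "Y y = (\<Sum>j<n. real (y j)) / s" for y :: "nat \<Rightarrow> nat"
    have "R \<le> (\<Sum>j<n. 2 * \<mu>)" unfolding R_def using near\<mu> by (intro sum_mono) (force simp: abs_le_iff)
    then have R2: "R \<le> 2 * (n * \<mu>)" by simp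
    have R0: "R \<ge> 0" unfolding R_def using r by (intro sum_nonneg) auto
    define E1 where "E1 = {y :: nat \<Rightarrow> nat. \<bar>Y y - R\<bar> \<ge> 2 * (sqrt (R * \<eta>) + \<eta>)}"
    define E2 where "E2 = {y :: nat \<Rightarrow> nat. (\<Sum>j<n. ((s * r j - s * \<mu>)\<^sup>2 / 2 - charlier2 (s * \<mu>) (real (y j)))
        / (s * \<mu>)) \<ge> s * (sqrt n / 128)}"
    have p1: "measure_pmf.prob ?P E1 \<le> 2 * exp (- (s * \<eta>))"
      using prob_sum[OF r] unfolding E1_def Y_def R_def .
    have p2: "measure_pmf.prob ?P E2 \<le> exp (- (s * \<eta>))"
      unfolding E2_def
    proof (rule Prod_Poi_charlier2_lower[OF sL _ _ _ thresholds(2)])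
      show "0 \<le> s * r j" if "j < n" for j using r[OF that] by simp
      show "\<bar>s * r j - s * \<mu>\<bar> \<le> s * \<mu>" if "j < n" for j
        using near\<mu>[OF that] by (simp add: right_diff_distrib[symmetric] abs_mult mult_left_mono)
    qed (use K in simp)
    have "{y. accepts n s X \<eta> m y} \<subseteq> E1 \<union> E2"
    proof (rule ccontr)
      assume "\<not> ?thesis"
      then obtain y where y: "accepts n s X \<eta> m y" "y \<notin> E1" "y \<notin> E2" by auto
      have acc: "\<forall>j<n. (y j / s - m)\<^sup>2 \<le> 32 * (m * \<eta> + \<eta>\<^sup>2)" "(Y y - n * m)\<^sup>2 \<le> 16 * n * m * \<eta>"
        "W y \<le> 0 \<or> 1024 * (W y)\<^sup>2 \<le> n * m\<^sup>2"
        using y(1) large unfolding accepts_def Let_def Y_def W_def by auto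
      have close: "\<bar>y i / s - \<mu>\<bar> \<le> \<mu>" if "i < n" for i
      proof -
        have "\<bar>y i / s - m\<bar> \<le> 6 * a + 6 * \<eta>" unfolding a_def using acc(1) that
            by (intro accepted_coordinate) auto
        then show ?thesis using a m e0_le eta2 \<eta>(1) by linarith
      qed
      have dR: "\<bar>R - n * \<mu>\<bar> \<le> 9 * b"
      proof -
        have "n * \<mu> - n * m \<le> n * e0" using m n by (simp add: right_diff_distrib[symmetric])
        then have d: "0 \<le> n * \<mu> - n * m" "n * \<mu> - n * m \<le> \<eta> / 1000" using e0 eta2 m
            by (auto intro: mult_left_mono)
        have "(Y y - n * m)\<^sup>2 \<le> (4 * b)\<^sup>2"
        proof -
          have "16 * n * m * \<eta> \<le> 16 * n * \<mu> * \<eta>" using m \<eta> by (intro mult_right_mono mult_left_mono) auto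
          then show ?thesis using acc(2) b2 by (simp add: power_mult_distrib)
        qed
        moreover have b0: "0 \<le> b" using ab a by linarith
        ultimately have 1: "\<bar>Y y - n * m\<bar> \<le> 4 * b"
          using abs_le_square_iff[of "Y y - n * m" "4 * b"] by simp
        have "sqrt (R * \<eta>) \<le> sqrt ((3/2 * b)\<^sup>2)"
        proof (rule real_sqrt_le_mono)
          have "R * \<eta> \<le> 2 * (n * \<mu>) * \<eta>" using R2 \<eta> by (intro mult_right_mono) auto
          also have "\<dots> \<le> 9/4 * (n * \<mu> * \<eta>)" using \<mu> \<eta> by simp
          also have "\<dots> = (3/2 * b)\<^sup>2" unfolding power_mult_distrib b2 by (simp add: power_divide)
          finally show "R * \<eta> \<le> (3/2 * b)\<^sup>2" .
        qed
        then have "sqrt (R * \<eta>) \<le> 3/2 * b" using b0 by simp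
        moreover have "\<bar>Y y - R\<bar> < 2 * sqrt (R * \<eta>) + 2 * \<eta>" using y(2) unfolding E1_def distrib_left
            by (simp add: not_le)
        ultimately show ?thesis using 1 d ab a \<eta>(1) by linarith
      qed
      \<comment> \<open>The lower tail bound controls only half of \<open>V\<close>; the three
        errors 1/128, 1/1000 and 1/32 add up to less than 1/20.\<close>
      have V: "V \<le> \<mu> * (sqrt n / 10)"
      proof -
        define Z where "Z = (\<Sum>j<n. charlier2 (s * \<mu>) (real (y j)))"
        have "(\<Sum>j<n. ((s * r j - s * \<mu>)\<^sup>2 / 2 - charlier2 (s * \<mu>) (real (y j))) / (s * \<mu>))
            = ((real s)\<^sup>2 * V / 2 - Z) / (s * \<mu>)"
          unfolding V_def Z_def sum_divide_distrib[symmetric]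
          by (simp add: sum_subtractf right_diff_distrib[symmetric] power_mult_distrib
              sum_distrib_left[symmetric] sum_divide_distrib[symmetric])
        then have "((real s)\<^sup>2 * V / 2 - Z) / (s * \<mu>) < s * (sqrt n / 128)" using y(3) unfolding E2_def by simp
        then have "(real s)\<^sup>2 * V / 2 - Z < (s * (sqrt n / 128)) * (s * \<mu>)" using sL
            by (subst (asm) divide_less_eq) auto
        moreover have "(real s)\<^sup>2 * V / 2 - Z = (real s)\<^sup>2 * (V / 2 - Z / (real s)\<^sup>2)"
          "(s * (sqrt n / 128)) * (s * \<mu>) = (real s)\<^sup>2 * (\<mu> * (sqrt n / 128))"
          using s by (simp_all add: right_diff_distrib power2_eq_square)
        ultimately have "(real s)\<^sup>2 * (V / 2 - Z / (real s)\<^sup>2) < (real s)\<^sup>2 * (\<mu> * (sqrt n / 128))"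
          by (simp only:)
        then have "V / 2 - Z / (real s)\<^sup>2 < \<mu> * (sqrt n / 128)"
          by (rule mult_left_less_imp_less) simp
        moreover have "\<bar>W y - Z / (real s)\<^sup>2\<bar> \<le> \<mu> / 1000"
          unfolding Z_def by (rule W_charlier) (use close in auto)
        moreover have "\<mu> / 1000 \<le> \<mu> * (sqrt n / 1000)" using n \<mu> by simp
        moreover have "W y \<le> \<mu> * (sqrt n / 32)"
        proof (cases "W y \<le> 0")
          case True
          moreover have "\<mu> * (sqrt n / 32) \<ge> 0" using \<mu> by simp
          ultimately show ?thesis by linarith
        next
          case False
          then have "(W y)\<^sup>2 \<le> (m * sqrt n / 32)\<^sup>2" using acc(3)
              by (simp add: power_mult_distrib power_divide mult.commute)
          then have "W y \<le> m * sqrt n / 32" by (rule power2_le_imp_le) (use m in auto)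
          also have "\<dots> \<le> \<mu> * (sqrt n / 32)" using m by (simp add: mult_right_mono)
          finally show ?thesis .
        qed
        moreover have "\<mu> * (sqrt n / 128) = \<mu> * sqrt n / 128" "\<mu> * (sqrt n / 1000) = \<mu> * sqrt n / 1000"
          "\<mu> * (sqrt n / 32) = \<mu> * sqrt n / 32" "\<mu> * (sqrt n / 10) = \<mu> * sqrt n / 10" by simp_all
        moreover have "\<mu> * sqrt n \<ge> 0" using \<mu> by simp
        ultimately show ?thesis by linarith
      qed
      have V0: "V \<ge> 0" unfolding V_def by (intro sum_nonneg) auto
      have "V\<^sup>2 \<le> (\<mu> * (sqrt n / 10))\<^sup>2" using V V0 by (intro power_mono) auto
      then have V2: "(\<Sum>i<n. (r i - \<mu>)\<^sup>2)\<^sup>2 \<le> n * \<mu>\<^sup>2 * (1/100)" unfolding V_def[symmetric]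
          by (simp add: power_mult_distrib power_divide mult_ac)
      have "(R - n * \<mu>)\<^sup>2 \<le> (9 * b)\<^sup>2" using dR ab a by (intro abs_le_square_iff[THEN iffD1]) linarith
      then have R2': "(\<Sum>i<n. r i - \<mu>)\<^sup>2 \<le> n * \<mu> * (81 * \<eta>)" unfolding R_def
          by (simp add: sum_subtractf power_mult_distrib b2)
      have b1: "0 \<le> 529 * \<eta>" "529 * \<eta> \<le> 1" using \<eta>(1) eta_small by auto
      have "d_TV (Prod_dist n (\<lambda>_. Poi \<mu>)) (Perm_dist n (\<lambda>i. Poi (r i))) \<le> 3/10"
      proof (rule d_TV_le)
        fix S
        \<comment> \<open>Here 81 = 9^2 and 529 = 23^2 stem from \<open>dR\<close> and
          \<open>near\<close>. As \<open>d \<le> 1/50\<close>, the choice of 1/7 for the free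
          parameter gives 7/50 + 1/7 < 3/10.\<close>
        define d where "d = 81 * \<eta> + 1/100 + harm n * (2 * (529 * \<eta>))"
        have "measure_pmf.prob (Perm_dist n (\<lambda>i. Poi (r i))) (- S)
            \<le> measure_pmf.prob (Prod_dist n (\<lambda>_. Poi \<mu>)) (- S) + d / (1/7) + 1/7"
          unfolding d_def
          by (rule prob_le_of_expectation_le)
             (rule expectation_Perm_Poi_le[where b = "529 * \<eta>" and u = "81 * \<eta>" and v = "1/100"], use \<mu> n r
                 near2 b1 R2' V2 in auto)
        moreover have "d \<le> 2/100"
        proof -
          have "harm n * (2 * (529 * \<eta>)) = 1058 * (harm n * \<eta>)" by simp
          also have "\<dots> \<le> 1058 * (1 / 2 ^ 40)" using harm_eta by (intro mult_left_mono) auto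
          also have "\<dots> \<le> 1/200" by simp
          finally show ?thesis unfolding d_def using eta_small by linarith
        qed
        moreover have "measure_pmf.prob (Perm_dist n (\<lambda>i. Poi (r i))) (- S) = 1
            - measure_pmf.prob (Perm_dist n (\<lambda>i. Poi (r i))) S"
          "measure_pmf.prob (Prod_dist n (\<lambda>_. Poi \<mu>)) (- S) = 1 - measure_pmf.prob (Prod_dist n (\<lambda>_. Poi \<mu>)) S"
          using measure_pmf.prob_compl[of S] by (auto simp: Compl_eq_Diff_UNIV)
        ultimately show "measure_pmf.prob (Prod_dist n (\<lambda>_. Poi \<mu>)) S
            \<le> measure_pmf.prob (Perm_dist n (\<lambda>i. Poi (r i))) S + 3/10"
          by simp
      qed
      then show False using far by simp
    qed
    from prob_le_sum[OF this p1 p2] ex show ?thesis by linarith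
  qed
qed

end

section \<open>The tests for small rates\<close>

lemma power_diff_le:
  fixes a b :: real
  assumes "0 \<le> b" "b \<le> a" "a \<le> 1"
  shows "a ^ k - b ^ k \<le> k * (a - b)"
proof (induction k)
  case (Suc k)
  have "a ^ Suc k - b ^ Suc k = a * (a ^ k - b ^ k) + b ^ k * (a - b)" by (simp add: algebra_simps)
  also have "\<dots> \<le> 1 * (a ^ k - b ^ k) + 1 * (a - b)"
  proof (intro add_mono mult_right_mono)
    show "b ^ k \<le> 1" using assms by (intro power_le_one) auto
    show "0 \<le> a ^ k - b ^ k" using power_mono[OF assms(2,1), of k] by simp
  qed (use assms in auto)
  also have "\<dots> \<le> Suc k * (a - b)" using Suc by (simp add: algebra_simps)
  finally show ?case .
qed simp

locale tester_analysis_small = tester_analysis +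
  assumes small: "m < 1024 * \<eta>"
begin

text \<open>Poisson weights without the factor exp (- \<mu>); \<open>wt\<close> is the version
  computable from the approximate rate.\<close>

definition w where "w x = \<mu> ^ x / fact x" for x :: nat
definition wt where "wt x = m ^ x / fact x" for x :: nat
definition T where "T x y = (\<Sum>j<n. thin s x (y j))" for x :: nat and y :: "nat \<Rightarrow> nat"

lemma mu_small: "\<mu> \<le> 1025 * \<eta>"
  using small m e0_le eta2 \<eta>(1) by linarith

lemma mu_le_1: "\<mu> \<le> 1" using mu_small eta_small by linarith

lemma w: "0 \<le> wt x" "wt x \<le> w x" "w x \<le> 1" "n * (w x - wt x) \<le> \<eta> / 1000"
proof -
  show "0 \<le> wt x" unfolding wt_def using m by simp
  show "wt x \<le> w x" unfolding wt_def w_def using m by (intro divide_right_mono power_mono) auto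
  have "\<mu> ^ x \<le> 1" using \<mu> mu_le_1 by (intro power_le_one) auto
  also have "1 \<le> (fact x :: real)" by (rule fact_ge_1)
  finally show "w x \<le> 1" unfolding w_def by simp
  have "w x - wt x = (\<mu> ^ x - m ^ x) / fact x" unfolding w_def wt_def by (simp add: diff_divide_distrib)
  also have "\<dots> \<le> (x * (\<mu> - m)) / fact x" using m mu_le_1 by (intro divide_right_mono power_diff_le) auto
  also have "\<dots> \<le> (fact x * (\<mu> - m)) / fact x"
  proof (intro divide_right_mono mult_right_mono)
    have "real x \<le> real (fact x)" using fact_ge_self[of x] by (simp only: of_nat_le_iff)
    then show "real x \<le> fact x" by (simp only: of_nat_fact)
  qed (use m in auto)
  also have "\<dots> \<le> e0" using m by simp
  finally have "n * (w x - wt x) \<le> n * e0" by (intro mult_left_mono) auto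
  then show "n * (w x - wt x) \<le> \<eta> / 1000" using e0 eta2 by linarith
qed

text \<open>The first inequality is what allows the zero count as a normalization: its fluctuation
  of order \<open>sqrt (n * \<eta>)\<close>, multiplied by the weight of degree \<open>x\<close>,
  does not exceed the scale \<open>sqrt (n * wt x * \<eta>)\<close> of the test of that
  degree.\<close>

lemma sqrt_nwt:
  "sqrt n * wt x \<le> sqrt (n * wt x)"
  "sqrt (n * w x * \<eta>) \<le> sqrt (n * wt x * \<eta>) + \<eta> / 10"
  "sqrt (n * wt x * \<eta>) \<le> sqrt (n * w x * \<eta>)"
proof -
  have w1: "0 \<le> w x" "wt x \<le> 1" using w[of x] by auto
  have "sqrt n * wt x = sqrt (n * (wt x * wt x))" using w(1)[of x] by (simp add: real_sqrt_mult)
  also have "\<dots> \<le> sqrt (n * (wt x * 1))" using w1 w(1)[of x] by (intro real_sqrt_le_mono mult_left_mono) auto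
  finally show "sqrt n * wt x \<le> sqrt (n * wt x)" by simp
  have "sqrt (n * w x * \<eta>) = sqrt (n * wt x * \<eta> + n * (w x - wt x) * \<eta>)" by (simp add: algebra_simps)
  also have "\<dots> \<le> sqrt (n * wt x * \<eta>) + sqrt (n * (w x - wt x) * \<eta>)"
    using w[of x] \<eta> by (intro sqrt_add_le_add_sqrt) auto
  also have "sqrt (n * (w x - wt x) * \<eta>) \<le> \<eta> / 10"
  proof (rule real_le_lsqrt)
    have "n * (w x - wt x) * \<eta> \<le> \<eta> / 1000 * \<eta>" using w[of x] \<eta> by (intro mult_right_mono) auto
    also have "\<dots> = \<eta>\<^sup>2 / 1000" by (simp add: power2_eq_square)
    also have "\<dots> \<le> \<eta>\<^sup>2 / 100" by (intro divide_left_mono) auto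
    finally show "n * (w x - wt x) * \<eta> \<le> (\<eta> / 10)\<^sup>2" by (simp add: power_divide)
  qed (use w[of x] \<eta> in auto)
  finally show "sqrt (n * w x * \<eta>) \<le> sqrt (n * wt x * \<eta>) + \<eta> / 10" by simp
  show "sqrt (n * wt x * \<eta>) \<le> sqrt (n * w x * \<eta>)"
    using w[of x] \<eta> by (intro real_sqrt_le_mono mult_right_mono mult_left_mono) auto
qed

lemma prob_thin:
  fixes r :: "nat \<Rightarrow> real"
  assumes "\<And>j. j < n \<Longrightarrow> r j \<ge> 0"
  shows "measure_pmf.prob (Prod_dist n (\<lambda>j. Poi (real s * r j)))
    {y. \<bar>T x y - (\<Sum>j<n. pmf (Poi (r j)) x)\<bar> \<ge> 2 * (sqrt ((\<Sum>j<n. pmf (Poi (r j)) x) * \<eta>) + \<eta>)}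
        \<le> 2 * exp (- (s * \<eta>))"
  unfolding T_def by (rule Prod_Poi_thin_concentrated[OF assms s \<eta>(1)])

text \<open>The deviation of the statistic of degree \<open>x\<close>, where \<open>p\<close> and \<open>p0\<close> are the expectations of the thinned
  counts.\<close>

lemma statistic_close:
  fixes p p0 t t0 :: real
  assumes p0: "0 \<le> p0" "p0 \<le> n" and p: "0 \<le> p"
    and t0: "\<bar>t0 - p0\<bar> < 2 * (sqrt (p0 * \<eta>) + \<eta>)" and t: "\<bar>t - p\<bar> < 2 * (sqrt (p * \<eta>) + \<eta>)"
  shows "\<bar>(t - t0 * wt x) - (p - p0 * w x)\<bar> \<le> 2 * sqrt (p * \<eta>) + 2 * sqrt (n * wt x * \<eta>) + 5 * \<eta>"
proof -
  have w0: "0 \<le> wt x" "wt x \<le> 1" using w[of x] by auto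
  have "(t - t0 * wt x) - (p - p0 * w x) = (t - p) - (t0 - p0) * wt x + p0 * (w x - wt x)"
      by (simp add: algebra_simps)
  moreover have "\<bar>(t0 - p0) * wt x\<bar> \<le> 2 * sqrt (n * wt x * \<eta>) + 2 * \<eta>"
  proof -
    have "\<bar>(t0 - p0) * wt x\<bar> = \<bar>t0 - p0\<bar> * wt x" using w0 by (simp add: abs_mult)
    also have "\<dots> \<le> (2 * sqrt (p0 * \<eta>) + 2 * \<eta>) * wt x" using t0 w0 by (intro mult_right_mono) auto
    also have "\<dots> = 2 * (sqrt (p0 * \<eta>) * wt x) + 2 * (\<eta> * wt x)" by (simp add: algebra_simps)
    also have "\<eta> * wt x \<le> \<eta>" using w0 \<eta> by (simp add: mult_left_le)
    also have "sqrt (p0 * \<eta>) * wt x \<le> sqrt (n * \<eta>) * wt x"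
      using p0 \<eta> w0 by (intro mult_right_mono real_sqrt_le_mono) auto
    also have "\<dots> = (sqrt n * wt x) * sqrt \<eta>" by (simp add: real_sqrt_mult)
    also have "\<dots> \<le> sqrt (n * wt x) * sqrt \<eta>" using \<eta> by (intro mult_right_mono sqrt_nwt) auto
    also have "\<dots> = sqrt (n * wt x * \<eta>)" by (simp add: real_sqrt_mult)
    finally show ?thesis by simp
  qed
  moreover have "\<bar>p0 * (w x - wt x)\<bar> \<le> \<eta>"
  proof -
    have "p0 * (w x - wt x) \<le> n * (w x - wt x)" using p0 w[of x] by (intro mult_right_mono) auto
    moreover have "0 \<le> p0 * (w x - wt x)" using p0 w[of x] by auto
    ultimately show ?thesis using w(4)[of x] \<eta>(1) by linarith
  qed
  moreover have "\<bar>t - p\<bar> \<le> 2 * sqrt (p * \<eta>) + 2 * \<eta>" using t by simp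
  ultimately show ?thesis by linarith
qed

lemma null_rejected:
  "measure_pmf.prob (Prod_dist n (\<lambda>_. Poi (real s * \<mu>))) {y. \<not> accepts n s X \<eta> m y}
      \<le> (2 * real n + 2 * (real X + 1)) * exp (- (s * \<eta>))"
proof -
  let ?P = "Prod_dist n (\<lambda>_. Poi (real s * \<mu>))"
  define p where "p x = n * pmf (Poi \<mu>) x" for x
  define C1 where "C1 i = {y :: nat \<Rightarrow> nat. \<bar>y i / s - \<mu>\<bar> \<ge> 2 * (sqrt (\<mu> * \<eta>) + \<eta>)}" for i
  define C2 where "C2 x = {y :: nat \<Rightarrow> nat. \<bar>T x y - p x\<bar> \<ge> 2 * (sqrt (p x * \<eta>) + \<eta>)}" for x
  have p1: "measure_pmf.prob ?P (\<Union>i\<in>{..<n}. C1 i) \<le> real (card {..<n}) * (2 * exp (- (s * \<eta>)))"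
  proof (rule prob_UN_le[OF _ order.refl])
    show "measure_pmf.prob ?P (C1 i) \<le> 2 * exp (- (s * \<eta>))" if "i \<in> {..<n}" for i
      unfolding C1_def using prob_coordinate[of "\<lambda>_. \<mu>" i] \<mu> that by simp
  qed simp
  have p2: "measure_pmf.prob ?P (\<Union>x\<in>{..X}. C2 x) \<le> real (card {..X}) * (2 * exp (- (s * \<eta>)))"
  proof (rule prob_UN_le[OF _ order.refl])
    show "measure_pmf.prob ?P (C2 x) \<le> 2 * exp (- (s * \<eta>))" for x
      unfolding C2_def p_def using prob_thin[of "\<lambda>_. \<mu>" x] \<mu> by simp
  qed simp
  have "{y. \<not> accepts n s X \<eta> m y} \<subseteq> (\<Union>i\<in>{..<n}. C1 i) \<union> (\<Union>x\<in>{..X}. C2 x)"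
  proof (rule ccontr)
    assume "\<not> ?thesis"
    then obtain y where y: "\<not> accepts n s X \<eta> m y" "\<forall>i<n. y \<notin> C1 i" "\<forall>x\<le>X. y \<notin> C2 x" by auto
    have t1: "(y i / s - m)\<^sup>2 \<le> 32 * (m * \<eta> + \<eta>\<^sup>2)" if "i < n" for i
      by (rule coordinate_accepted) (use y(2) that in \<open>auto simp: C1_def not_le\<close>)
    have p0: "0 \<le> p 0" "p 0 \<le> n" and pp: "\<And>x. p x \<ge> 0" unfolding p_def by (auto simp: pmf_le_1 mult_left_le)
    have t2: "(T x y - T 0 y * wt x)\<^sup>2 \<le> 64 * (n * wt x * \<eta> + \<eta>\<^sup>2)" if x: "1 \<le> x" "x \<le> X" for x
    proof -
      define A where "A = sqrt (n * wt x * \<eta>)"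
      have A2: "A\<^sup>2 = n * wt x * \<eta>" unfolding A_def using w[of x] \<eta> by simp
      have "\<bar>T 0 y - p 0\<bar> < 2 * (sqrt (p 0 * \<eta>) + \<eta>)" "\<bar>T x y - p x\<bar> < 2 * (sqrt (p x * \<eta>) + \<eta>)"
        using y(3) x unfolding C2_def by (auto simp: not_le)
      from statistic_close[OF p0 pp this, of x]
      have st: "\<bar>(T x y - T 0 y * wt x) - (p x - p 0 * w x)\<bar> \<le> 2 * sqrt (p x * \<eta>) + 2 * A + 5 * \<eta>"
          unfolding A_def .
      \<comment> \<open>Under the null hypothesis the normalized profile is exact, so only
        fluctuations and the rounding of \<mu> remain.\<close>
      have "p x - p 0 * w x = 0" unfolding p_def w_def using \<mu> by (simp add: pmf_Poi)
      moreover have "sqrt (p x * \<eta>) \<le> A + \<eta> / 10"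
      proof -
        have "p x = (n * exp (- \<mu>)) * w x" unfolding p_def w_def using \<mu> by (simp add: pmf_Poi)
        also have "\<dots> \<le> (real n * 1) * w x" using w[of x] \<mu> by (intro mult_right_mono mult_left_mono) auto
        finally have "sqrt (p x * \<eta>) \<le> sqrt (n * w x * \<eta>)" using \<eta>
            by (intro real_sqrt_le_mono mult_right_mono) auto
        then show ?thesis using sqrt_nwt(2)[of x] unfolding A_def by linarith
      qed
      ultimately have "\<bar>T x y - T 0 y * wt x\<bar> \<le> 4 * A + (26/5) * \<eta>"
        using st by linarith
      then have "(T x y - T 0 y * wt x)\<^sup>2 \<le> (4 * A + (26/5) * \<eta>)\<^sup>2"
          by (intro abs_le_square_iff[THEN iffD1]) linarith
      also have "\<dots> \<le> 2 * (4 * A)\<^sup>2 + 2 * ((26/5) * \<eta>)\<^sup>2" by (rule square_le_two)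
      also have "\<dots> = 32 * A\<^sup>2 + 1352/25 * \<eta>\<^sup>2" by (simp add: power_mult_distrib power_divide)
      also have "\<dots> \<le> 64 * A\<^sup>2 + 64 * \<eta>\<^sup>2" by (intro add_mono mult_right_mono) auto
      finally show ?thesis unfolding A2 by (simp only: distrib_left)
    qed
    have "accepts n s X \<eta> m y"
      unfolding accepts_def using t1 t2 small unfolding T_def wt_def by simp
    then show False using y by simp
  qed
  then have "measure_pmf.prob ?P {y. \<not> accepts n s X \<eta> m y} \<le> real (card {..<n}) * (2 * exp (- (s * \<eta>)))
      + real (card {..X}) * (2 * exp (- (s * \<eta>)))"
    by (rule prob_le_sum[OF _ p1 p2])
  then show ?thesis by (simp add: algebra_simps)
qed

text \<open>Three cases: a coordinate far from \<mu> is rejected; a large deviation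
  \<open>D x\<close> of some tested degree is detected by its statistic; if neither occurs, the
  locale \<open>small_rates\<close> bounds the total variation distance by less than 1/2, which
  contradicts \<open>far\<close>.\<close>

lemma alternative_accepted:
  fixes r :: "nat \<Rightarrow> real"
  assumes r: "\<And>j. j < n \<Longrightarrow> r j \<ge> 0"
    and far: "d_TV (Prod_dist n (\<lambda>_. Poi \<mu>)) (Perm_dist n (\<lambda>i. Poi (r i))) \<ge> 1 / 2"
  shows "measure_pmf.prob (Prod_dist n (\<lambda>j. Poi (real s * r j))) {y. accepts n s X \<eta> m y} \<le> 4 * exp (- (s * \<eta>))"
proof -
  let ?P = "Prod_dist n (\<lambda>j. Poi (real s * r j))"
  have ex: "exp (- (s * \<eta>)) > 0" by simp
  define p where "p x = (\<Sum>j<n. pmf (Poi (r j)) x)" for x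
  have p: "0 \<le> p x" "p x \<le> n" for x
    unfolding p_def using sum_bounded_above[of "{..<n}" "\<lambda>j. pmf (Poi (r j)) x" 1]
        by (auto intro!: sum_nonneg simp: pmf_le_1)
  define D where "D x = p x - p 0 * w x" for x
  consider "\<exists>i<n. \<bar>r i - \<mu>\<bar> > 22 * (sqrt (\<mu> * \<eta>) + \<eta>)"
    | x where "1 \<le> x" "x \<le> X" "\<bar>D x\<bar> > 30 * (sqrt (n * w x * \<eta>) + \<eta>)"
    | "\<forall>i<n. \<bar>r i - \<mu>\<bar> \<le> 22 * (sqrt (\<mu> * \<eta>) + \<eta>)"
      "\<forall>x. 1 \<le> x \<and> x \<le> X \<longrightarrow> \<bar>D x\<bar> \<le> 30 * (sqrt (n * w x * \<eta>) + \<eta>)"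
    unfolding not_le[symmetric] by blast
  then show ?thesis
  proof cases
    case 1
    then obtain i where "i < n" "\<bar>r i - \<mu>\<bar> > 22 * (sqrt (\<mu> * \<eta>) + \<eta>)" by auto
    from far_coordinate_rejected[of r, OF r this] ex show ?thesis by linarith
  next
    case x: 2
    define E where "E x = {y :: nat \<Rightarrow> nat. \<bar>T x y - p x\<bar> \<ge> 2 * (sqrt (p x * \<eta>) + \<eta>)}" for x
    have pE: "measure_pmf.prob ?P (E x) \<le> 2 * exp (- (s * \<eta>))" for x
      unfolding E_def p_def by (rule prob_thin[OF r])
    have "{y. accepts n s X \<eta> m y} \<subseteq> E 0 \<union> E x"
    proof (rule ccontr)
      assume "\<not> ?thesis"
      then obtain y where y: "accepts n s X \<eta> m y" "y \<notin> E 0" "y \<notin> E x" by auto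
      define A where "A = sqrt (n * w x * \<eta>)"
      define P where "P = sqrt (p x * \<eta>)"
      define Q where "Q = sqrt (\<bar>D x\<bar> * \<eta>)"
      have A0: "A \<ge> 0" unfolding A_def using w[of x] \<eta> by auto
      have "(T x y - T 0 y * wt x)\<^sup>2 \<le> 8\<^sup>2 * (n * wt x * \<eta> + \<eta>\<^sup>2)"
        using y(1) small x unfolding accepts_def T_def wt_def by simp
      then have "\<bar>T x y - T 0 y * wt x\<bar> \<le> 8 * (sqrt (n * wt x * \<eta>) + \<eta>)"
        using w[of x] \<eta> by (intro square_le_imp_le_sqrt) auto
      moreover have AA: "sqrt (n * wt x * \<eta>) \<le> A" unfolding A_def by (rule sqrt_nwt)
      ultimately have st: "\<bar>T x y - T 0 y * wt x\<bar> \<le> 8 * A + 8 * \<eta>" unfolding distrib_left by linarith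
      have "\<bar>T 0 y - p 0\<bar> < 2 * (sqrt (p 0 * \<eta>) + \<eta>)" "\<bar>T x y - p x\<bar> < 2 * (sqrt (p x * \<eta>) + \<eta>)"
        using y(2,3) unfolding E_def by (auto simp: not_le)
      from statistic_close[OF p p(1) this, of x]
      have cl: "\<bar>(T x y - T 0 y * wt x) - D x\<bar> \<le> 2 * P + 2 * sqrt (n * wt x * \<eta>) + 5 * \<eta>"
          unfolding P_def D_def .
      \<comment> \<open>The noise depends on \<open>p x\<close>, hence on the deviation itself.
        After absorbing half of \<open>D x\<close>, twice the remainder is 24 \<open>A\<close> + 30
        \<eta>, which explains the constant 30.\<close>
      have "P \<le> sqrt (\<bar>D x\<bar> * \<eta> + n * w x * \<eta>)"
        unfolding P_def distrib_right[symmetric]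
      proof (intro real_sqrt_le_mono mult_right_mono)
        have "p 0 * w x \<le> n * w x" using p[of 0] w[of x] by (intro mult_right_mono) auto
        then show "p x \<le> \<bar>D x\<bar> + n * w x" unfolding D_def by linarith
      qed (use \<eta> in auto)
      also have "\<dots> \<le> Q + A" unfolding Q_def A_def using w[of x] \<eta> by (intro sqrt_add_le_add_sqrt) auto
      finally have P: "P \<le> Q + A" .
      have "2 * Q \<le> \<bar>D x\<bar> / 2 + 2 * \<eta>" unfolding Q_def using \<eta> by (intro sqrt_mult_le_avg) auto
      then have "\<bar>D x\<bar> \<le> 30 * A + 30 * \<eta>" using P cl st AA A0 \<eta>(1) by linarith
      then show False using x(3) unfolding A_def by (simp add: distrib_left)
    qed
    from prob_le_sum[OF this pE pE] show ?thesis by simp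
  next
    case 3
    \<comment> \<open>The rates are at most 1025 + 22 * (33 + 1) = 1773 times \<eta>.\<close>
    define l where "l = 2000 * \<eta>"
    have sq: "sqrt (\<mu> * \<eta>) \<le> 33 * \<eta>"
    proof (rule real_le_lsqrt)
      have "\<mu> * \<eta> \<le> 1025 * \<eta> * \<eta>" using mu_small \<eta> by (intro mult_right_mono) auto
      also have "\<dots> \<le> 1089 * \<eta> * \<eta>" using \<eta> by (intro mult_right_mono) auto
      finally show "\<mu> * \<eta> \<le> (33 * \<eta>)\<^sup>2" by (simp add: power_mult_distrib power2_eq_square)
    qed (use \<mu> \<eta> in auto)
    have rl: "r i \<le> l" if "i < n" for i
    proof -
      have "\<bar>r i - \<mu>\<bar> \<le> 22 * sqrt (\<mu> * \<eta>) + 22 * \<eta>" using 3(1) that by (auto simp: distrib_left)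
      then show ?thesis using sq mu_small \<eta>(1) unfolding l_def by linarith
    qed
    interpret sr: small_rates n \<mu> r l \<eta> 30 X
      by unfold_locales (use n \<mu> mu_small r rl nX \<eta> eta_small in \<open>auto simp: l_def\<close>)
    have Db: "\<bar>sr.D x\<bar> \<le> 30 * (sqrt (sr.v x * \<eta>) + \<eta>)" if "1 \<le> x" "x \<le> X" for x
      using 3(2) that unfolding sr.D_def sr.M_def sr.v_def D_def p_def w_def by auto
    \<comment> \<open>With 1/5 for the free parameter and a divergence of at most 3/1000 the bound
      is 3/200 + 2/5, below 1/2.\<close>
    have "d_TV (Prod_dist n (\<lambda>_. Poi \<mu>)) (Perm_dist n (\<lambda>i. Poi (r i)))
        \<le> (2 * sr.xi + harm n * (11 * l)) / (1/5) + 2 * (1/5)"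
      by (rule sr.d_TV_small[OF Db]) auto
    moreover have "sr.xi \<le> 1/1000"
    proof -
      have "sr.xi = 36000 * ((real X + 1)\<^sup>2 * \<eta>) + 200000 * \<eta>" by (subst sr.xi_def[OF Db]) (simp_all add: l_def)
      also have "\<dots> \<le> 36000 * (1 / 2 ^ 40) + 200000 * (1 / 2 ^ 44)" using \<eta>
          by (intro add_mono mult_left_mono) auto
      also have "\<dots> \<le> 1/1000" by simp
      finally show ?thesis .
    qed
    moreover have "harm n * (11 * l) \<le> 1/1000"
    proof -
      have "harm n * (11 * l) = 22000 * (harm n * \<eta>)" by (simp add: l_def)
      also have "\<dots> \<le> 22000 * (1 / 2 ^ 40)" using harm_eta by (intro mult_left_mono) auto
      also have "\<dots> \<le> 1/1000" by simp
      finally show ?thesis .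
    qed
    ultimately show ?thesis using far by simp
  qed
qed

end

context tester_analysis
begin

theorem null_accepted:
  "measure_pmf.prob (Prod_dist n (\<lambda>_. Poi (real s * \<mu>))) {y. \<not> accepts n s X \<eta> m y}
      \<le> (2 * real n + 2 * real X + 3) * exp (- (s * \<eta>))"
proof (cases "1024 * \<eta> \<le> m")
  case True
  then interpret tester_analysis_large by unfold_locales
  have "(2 * real n + 3) * exp (- (s * \<eta>)) \<le> (2 * real n + 2 * real X + 3) * exp (- (s * \<eta>))"
    by (intro mult_right_mono) auto
  then show ?thesis using null_rejected by linarith
next
  case False
  then interpret tester_analysis_small by unfold_locales auto
  have "(2 * real n + 2 * (real X + 1)) * exp (- (s * \<eta>)) \<le> (2 * real n + 2 * real X + 3) * exp (- (s * \<eta>))"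
    by (intro mult_right_mono) auto
  then show ?thesis using null_rejected by linarith
qed

theorem alternative_rejected:
  fixes r :: "nat \<Rightarrow> real"
  assumes r: "\<And>j. j < n \<Longrightarrow> r j \<ge> 0"
    and far: "d_TV (Prod_dist n (\<lambda>_. Poi \<mu>)) (Perm_dist n (\<lambda>i. Poi (r i))) \<ge> 1 / 2"
  shows "measure_pmf.prob (Prod_dist n (\<lambda>j. Poi (real s * r j))) {y. accepts n s X \<eta> m y} \<le> 4 * exp (- (s * \<eta>))"
proof (cases "1024 * \<eta> \<le> m")
  case True
  then interpret tester_analysis_large by unfold_locales
  show ?thesis by (rule alternative_accepted[OF r far])
next
  case False
  then interpret tester_analysis_small by unfold_locales auto
  show ?thesis by (rule alternative_accepted[OF r far])
qed

end

section \<open>Verification of deterministic programs\<close>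

lemma bits_less: "\<bar>z\<bar> < 2 ^ bits z"
proof (cases "z = 0")
  case False
  then show ?thesis using bitlen_bounds[of "\<bar>z\<bar>"] by (simp add: bits_def)
qed (simp add: bits_def)

lemma bits_le: "\<bar>z\<bar> < 2 ^ k \<Longrightarrow> bits z \<le> k"
proof -
  assume "\<bar>z\<bar> < 2 ^ k"
  then have "bitlen \<bar>z\<bar> \<le> int k" by (subst bitlen_le_iff_power) auto
  then show ?thesis by (simp add: bits_def)
qed

lemma bits_le_Suc: "\<bar>z\<bar> \<le> 2 ^ k \<Longrightarrow> bits z \<le> Suc k"
  by (rule bits_le) (auto intro: le_less_trans)

text \<open>The cost of \<open>Digits\<close> grows with the value of its argument rather than with
  its length, and its result depends on a real parameter; neither is controlled by the size of the
  memory cells.\<close>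

primrec digit_free :: "expr \<Rightarrow> bool" where
  "digit_free (Lit z) = True"
| "digit_free (Cell x e) = digit_free e"
| "digit_free (Digits x e) = False"
| "digit_free (Plus a b) = (digit_free a \<and> digit_free b)"
| "digit_free (Minus a b) = (digit_free a \<and> digit_free b)"
| "digit_free (Times a b) = (digit_free a \<and> digit_free b)"
| "digit_free (Quot a b) = (digit_free a \<and> digit_free b)"
| "digit_free (Less a b) = (digit_free a \<and> digit_free b)"

text \<open>With \<open>b\<close>-bit memory cells, a value of \<open>e\<close> has at most \<open>width e * (b + 1)\<close> bits and its evaluation
  costs at most \<open>ecost e * (b + 1)\<close>.\<close>

primrec width :: "expr \<Rightarrow> nat" where
  "width (Lit z) = bits z"
| "width (Cell x e) = 1"
| "width (Digits x e) = 0"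
| "width (Plus a b) = width a + width b + 1"
| "width (Minus a b) = width a + width b + 1"
| "width (Times a b) = width a + width b"
| "width (Quot a b) = width a"
| "width (Less a b) = 1"

primrec ecost :: "expr \<Rightarrow> nat" where
  "ecost (Lit z) = 1 + bits z"
| "ecost (Cell x e) = ecost e + width e + 3"
| "ecost (Digits x e) = 0"
| "ecost (Plus a b) = ecost a + ecost b + width a + width b + 3"
| "ecost (Minus a b) = ecost a + ecost b + width a + width b + 3"
| "ecost (Times a b) = ecost a + ecost b + width a + width b + 3"
| "ecost (Quot a b) = ecost a + ecost b + width a + width b + 3"
| "ecost (Less a b) = ecost a + ecost b + width a + width b + 3"

definition bounded_memory :: "nat \<Rightarrow> memory \<Rightarrow> bool" where
  "bounded_memory b \<sigma> \<longleftrightarrow> (\<forall>x i. \<bar>\<sigma> x i\<bar> \<le> 2 ^ b)"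

lemma abs_div_le_int: "\<bar>a div b\<bar> \<le> \<bar>a :: int\<bar>"
proof -
  have pos: "\<bar>a div b\<bar> \<le> \<bar>a\<bar>" if "b > 0" for a b :: int
  proof (cases "a \<ge> 0")
    case True
    then show ?thesis using that zdiv_mono2[of a 1 b] pos_imp_zdiv_nonneg_iff[of b a] by simp
  next
    case False
    then show ?thesis using that zdiv_mono2_neg[of a 1 b] pos_imp_zdiv_neg_iff[of b a]
      by simp
  qed
  show ?thesis
  proof (cases b "0 :: int" rule: linorder_cases)
    case less
    then show ?thesis using pos[of "- b" "- a"] by simp
  next
    case greater
    then show ?thesis using pos by simp
  qed simp
qed

lemma eval_bounded:
  assumes \<sigma>: "bounded_memory b \<sigma>"
  shows "digit_free e \<Longrightarrow> \<bar>eval \<rho> \<sigma> e\<bar> \<le> 2 ^ (width e * (b + 1))"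
proof (induction e)
  case (Lit z)
  have "\<bar>z\<bar> \<le> 2 ^ bits z" using bits_less[of z] by simp
  also have "\<dots> \<le> 2 ^ (bits z * (b + 1))" by (rule power_increasing) auto
  finally show ?case by simp
next
  case (Cell x e)
  have "\<bar>\<sigma> x (eval \<rho> \<sigma> e)\<bar> \<le> 2 ^ b" using \<sigma> by (auto simp: bounded_memory_def)
  also have "\<dots> \<le> 2 ^ (b + 1)" by simp
  finally show ?case by simp
next
  case (Plus a c)
  have "\<bar>eval \<rho> \<sigma> a + eval \<rho> \<sigma> c\<bar> \<le> 2 ^ (width a * (b + 1)) + 2 ^ (width c * (b + 1))" using Plus by auto
  also have "\<dots> \<le> 2 ^ ((width a + width c) * (b + 1)) + 2 ^ ((width a + width c) * (b + 1))"
    by (intro add_mono power_increasing mult_right_mono) auto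
  also have "\<dots> = 2 ^ ((width a + width c) * (b + 1) + 1)" by simp
  also have "\<dots> \<le> 2 ^ ((width a + width c + 1) * (b + 1))" by (intro power_increasing) auto
  finally show ?case by simp
next
  case (Minus a c)
  have "\<bar>eval \<rho> \<sigma> a - eval \<rho> \<sigma> c\<bar> \<le> 2 ^ (width a * (b + 1)) + 2 ^ (width c * (b + 1))" using Minus by auto
  also have "\<dots> \<le> 2 ^ ((width a + width c) * (b + 1)) + 2 ^ ((width a + width c) * (b + 1))"
    by (intro add_mono power_increasing mult_right_mono) auto
  also have "\<dots> = 2 ^ ((width a + width c) * (b + 1) + 1)" by simp
  also have "\<dots> \<le> 2 ^ ((width a + width c + 1) * (b + 1))" by (intro power_increasing) auto
  finally show ?case by simp
next
  case (Times a c)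
  have "\<bar>eval \<rho> \<sigma> a\<bar> * \<bar>eval \<rho> \<sigma> c\<bar> \<le> 2 ^ (width a * (b + 1)) * 2 ^ (width c * (b + 1))"
    using Times by (intro mult_mono) auto
  then show ?case by (simp add: abs_mult power_add[symmetric] algebra_simps)
next
  case (Quot a c)
  then show ?case using abs_div_le_int[of "eval \<rho> \<sigma> a" "eval \<rho> \<sigma> c"] by auto
next
  case (Less a c)
  have "1 \<le> (2 :: int) ^ (1 * (b + 1))" by (rule one_le_power) simp
  then show ?case by simp
qed auto

lemma cost_bounded:
  assumes \<sigma>: "bounded_memory b \<sigma>"
  shows "digit_free e \<Longrightarrow> cost \<rho> \<sigma> e \<le> ecost e * (b + 1)"
proof (induction e)
  have B: "bits (eval \<rho> \<sigma> e) \<le> width e * (b + 1) + 1" if "digit_free e" for e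
    using bits_le_Suc[OF eval_bounded[OF \<sigma> that]] by simp
  {
    case (Cell x e)
    have "bits (\<sigma> x (eval \<rho> \<sigma> e)) \<le> b + 1" using \<sigma> by (auto simp: bounded_memory_def intro: bits_le_Suc)
    then show ?case using Cell B[of e] by (simp add: algebra_simps)
  next
    case (Plus a c)
    then show ?case using B[of a] B[of c] by (simp add: algebra_simps)
  next
    case (Minus a c)
    then show ?case using B[of a] B[of c] by (simp add: algebra_simps)
  next
    case (Times a c)
    then show ?case using B[of a] B[of c] by (simp add: algebra_simps)
  next
    case (Quot a c)
    then show ?case using B[of a] B[of c] by (simp add: algebra_simps)
  next
    case (Less a c)
    then show ?case using B[of a] B[of c] by (simp add: algebra_simps)
  }
qed auto

text \<open>A bound for one elementary step anywhere in the program, hence the maximum at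
  compositions; the number of steps is counted separately.\<close>

primrec pcost :: "prog \<Rightarrow> nat" where
  "pcost Skip = 1"
| "pcost (Store x i e) = ecost i + ecost e + width i + width e + 3"
| "pcost (Flip x i) = 0"
| "pcost (Seq p q) = max (pcost p) (pcost q)"
| "pcost (Cond e p q) = max (ecost e + 1) (max (pcost p) (pcost q))"
| "pcost (Loop e p) = max (ecost e + 1) (pcost p)"

text \<open>Time is counted in steps of cost at most \<open>u * (b + 1)\<close>. The bound on \<^term>\<open>pcost p\<close> is a premise inside
  the definition, so that the proof rules need not propagate it.\<close>

definition ends :: "reals \<Rightarrow> nat \<Rightarrow> nat \<Rightarrow> prog \<Rightarrow> nat \<Rightarrow> (memory \<Rightarrow> bool) \<Rightarrow> memory \<Rightarrow> bool" where
  "ends \<rho> b u p k Q \<sigma> \<longleftrightarrow> (pcost p \<le> u \<longrightarrow> bounded_memory b \<sigma> \<longrightarrow>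
     (\<forall>t. \<exists>\<sigma>' t'. exec \<rho> p (\<sigma>, t) = return_spmf (\<sigma>', t') \<and> t' \<le> t + k * (u * (b + 1)) \<and> bounded_memory b \<sigma>'
         \<and> Q \<sigma>'))"

lemma ends_mono: "ends \<rho> b u p k Q \<sigma> \<Longrightarrow> k \<le> k' \<Longrightarrow> (\<And>\<sigma>'. Q \<sigma>' \<Longrightarrow> Q' \<sigma>') \<Longrightarrow> ends \<rho> b u p k' Q' \<sigma>"
  unfolding ends_def by (meson add_left_mono mult_le_mono1 order_trans)

lemma bounded_memory_upd: "bounded_memory b \<sigma> \<Longrightarrow> \<bar>z\<bar> \<le> 2 ^ b \<Longrightarrow> bounded_memory b (upd \<sigma> x i z)"
  by (auto simp: bounded_memory_def upd_def)

lemma ends_Store_cost: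
  assumes "\<bar>eval \<rho> \<sigma> e\<bar> \<le> 2 ^ b" "Q (upd \<sigma> x (eval \<rho> \<sigma> i) (eval \<rho> \<sigma> e))"
    and "bounded_memory b \<sigma> \<Longrightarrow> cost \<rho> \<sigma> i + cost \<rho> \<sigma> e + 1 + bits (eval \<rho> \<sigma> i) + bits (eval \<rho> \<sigma> e)
        \<le> k * (u * (b + 1))"
  shows "ends \<rho> b u (Store x i e) k Q \<sigma>"
  unfolding ends_def using assms by (auto intro: bounded_memory_upd)

lemma ends_Store:
  assumes "Q (upd \<sigma> x (eval \<rho> \<sigma> i) (eval \<rho> \<sigma> e))" "\<bar>eval \<rho> \<sigma> e\<bar> \<le> 2 ^ b" "digit_free i" "digit_free e"
  shows "ends \<rho> b u (Store x i e) 1 Q \<sigma>"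
proof (cases "pcost (Store x i e) \<le> u")
  case True
  show ?thesis
  proof (rule ends_Store_cost[where Q = Q, OF assms(2,1)])
    assume \<sigma>: "bounded_memory b \<sigma>"
    have "cost \<rho> \<sigma> i + cost \<rho> \<sigma> e + 1 + bits (eval \<rho> \<sigma> i) + bits (eval \<rho> \<sigma> e)
      \<le> ecost i * (b + 1) + ecost e * (b + 1) + 1 + (width i * (b + 1) + 1) + (width e * (b + 1) + 1)"
      using cost_bounded[OF \<sigma> assms(3), of \<rho>] cost_bounded[OF \<sigma> assms(4), of \<rho>]
        bits_le_Suc[OF eval_bounded[OF \<sigma> assms(3), of \<rho>]] bits_le_Suc[OF eval_bounded[OF \<sigma> assms(4), of \<rho>]]
            by linarith
    also have "\<dots> \<le> pcost (Store x i e) * (b + 1)" by (simp add: algebra_simps)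
    also have "\<dots> \<le> u * (b + 1)" using True by (rule mult_right_mono) simp
    finally show "cost \<rho> \<sigma> i + cost \<rho> \<sigma> e + 1 + bits (eval \<rho> \<sigma> i) + bits (eval \<rho> \<sigma> e) \<le> 1 * (u * (b + 1))"
        by simp
  qed
qed (simp add: ends_def)

text \<open>The postcondition of the first program is that the second one ends well, so a sequence
  is verified by rule application without intermediate assertions.\<close>

lemma ends_Seq:
  assumes "ends \<rho> b u p k (\<lambda>\<sigma>'. ends \<rho> b u q k' Q \<sigma>') \<sigma>"
  shows "ends \<rho> b u (Seq p q) (k + k') Q \<sigma>"
  unfolding ends_def
proof (intro impI allI)
  fix t assume c: "pcost (Seq p q) \<le> u" and \<sigma>: "bounded_memory b \<sigma>"
  then obtain \<sigma>' t' where 1: "exec \<rho> p (\<sigma>, t) = return_spmf (\<sigma>', t')" "t' \<le> t + k * (u * (b + 1))"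
    "bounded_memory b \<sigma>'" "ends \<rho> b u q k' Q \<sigma>'"
    using assms unfolding ends_def by (auto, blast)
  then obtain \<sigma>'' t'' where 2: "exec \<rho> q (\<sigma>', t') = return_spmf (\<sigma>'', t'')" "t'' \<le> t' + k' * (u * (b + 1))"
    "bounded_memory b \<sigma>''" "Q \<sigma>''"
    using c unfolding ends_def[of _ _ _ q] by (auto, blast)
  have "t'' \<le> t + (k + k') * (u * (b + 1))" using 1(2) 2(2) unfolding add_mult_distrib by linarith
  then show "\<exists>\<sigma>' t'. exec \<rho> (Seq p q) (\<sigma>, t) = return_spmf (\<sigma>', t') \<and> t' \<le> t + (k + k') * (u * (b + 1))
      \<and> bounded_memory b \<sigma>' \<and> Q \<sigma>'"
    using 1 2 by (intro exI[of _ \<sigma>''] exI[of _ t'']) simp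
qed

lemma guard_cost:
  assumes "bounded_memory b \<sigma>" "digit_free e" "ecost e + 1 \<le> u"
  shows "1 + cost \<rho> \<sigma> e \<le> u * (b + 1)"
proof -
  have "1 + cost \<rho> \<sigma> e \<le> (ecost e + 1) * (b + 1)" using cost_bounded[OF assms(1,2), of \<rho>]
      by (simp add: algebra_simps)
  also have "\<dots> \<le> u * (b + 1)" using assms(3) by (rule mult_right_mono) simp
  finally show ?thesis .
qed

lemma ends_Cond:
  assumes e: "digit_free e" and "eval \<rho> \<sigma> e \<noteq> 0 \<Longrightarrow> ends \<rho> b u p k Q \<sigma>" "eval \<rho> \<sigma> e = 0 \<Longrightarrow> ends \<rho> b u q k Q \<sigma>"
  shows "ends \<rho> b u (Cond e p q) (1 + k) Q \<sigma>"
  unfolding ends_def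
proof (intro impI allI)
  fix t assume c: "pcost (Cond e p q) \<le> u" and \<sigma>: "bounded_memory b \<sigma>"
  define r where "r = (if eval \<rho> \<sigma> e \<noteq> 0 then p else q)"
  have r: "ends \<rho> b u r k Q \<sigma>" "pcost r \<le> u" using assms c by (auto simp: r_def)
  obtain \<sigma>' t' where 1: "exec \<rho> r (\<sigma>, t + 1 + cost \<rho> \<sigma> e) = return_spmf (\<sigma>', t')" "t' \<le> t + 1 + cost \<rho> \<sigma> e
      + k * (u * (b + 1))"
    "bounded_memory b \<sigma>'" "Q \<sigma>'"
    using r \<sigma> unfolding ends_def by blast
  have "1 + cost \<rho> \<sigma> e \<le> u * (b + 1)" using c by (intro guard_cost[OF \<sigma> e]) auto
  then have "t' \<le> t + (1 + k) * (u * (b + 1))" using 1(2) unfolding add_mult_distrib by linarith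
  moreover have "exec \<rho> (Cond e p q) (\<sigma>, t) = return_spmf (\<sigma>', t')" using 1(1)
      by (simp add: r_def split: if_splits)
  ultimately show "\<exists>\<sigma>' t'. exec \<rho> (Cond e p q) (\<sigma>, t) = return_spmf (\<sigma>', t') \<and> t' \<le> t
      + (1 + k) * (u * (b + 1)) \<and> bounded_memory b \<sigma>' \<and> Q \<sigma>'"
    using 1 by blast
qed

text \<open>For a loop with a known number \<open>N\<close> of rounds. Each round adds one step for
  its guard, and the exit adds one for the failing guard. The induction is on the rounds left,
  because the loop unfolds at its front.\<close>

lemma ends_Loop:
  assumes e: "digit_free e"
    and step: "\<And>i \<sigma>. i < N \<Longrightarrow> I i \<sigma> \<Longrightarrow> eval \<rho> \<sigma> e \<noteq> 0 \<and> ends \<rho> b u p k (I (Suc i)) \<sigma>"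
    and stop: "\<And>\<sigma>. I N \<sigma> \<Longrightarrow> eval \<rho> \<sigma> e = 0 \<and> Q \<sigma>"
    and init: "I 0 \<sigma>"
  shows "ends \<rho> b u (Loop e p) (N * (k + 1) + 1) Q \<sigma>"
  unfolding ends_def
proof (intro impI allI)
  fix t assume c: "pcost (Loop e p) \<le> u" and \<sigma>: "bounded_memory b \<sigma>"
  define g where "g = (\<lambda>(\<sigma>, t :: nat). eval \<rho> \<sigma> e \<noteq> 0)"
  define f where "f = (\<lambda>(\<sigma>, t). exec \<rho> p (\<sigma>, t + 1 + cost \<rho> \<sigma> e))"
  define U where "U = u * (b + 1)"
  have gc: "1 + cost \<rho> \<sigma> e \<le> U" if "bounded_memory b \<sigma>" for \<sigma>
    unfolding U_def using c by (intro guard_cost[OF that e]) auto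
  have "\<exists>\<sigma>' t'. while_spmf g f (\<sigma>, t) = return_spmf (\<sigma>', t') \<and> t' \<le> t + (N - i) * ((k + 1) * U)
      \<and> bounded_memory b \<sigma>' \<and> I N \<sigma>'"
    if "i \<le> N" "I i \<sigma>" "bounded_memory b \<sigma>" for i \<sigma> t
    using that
  proof (induction "N - i" arbitrary: i \<sigma> t)
    case 0
    then have "i = N" by simp
    then have "\<not> g (\<sigma>, t)" using stop 0 by (simp add: g_def)
    then have "while_spmf g f (\<sigma>, t) = return_spmf (\<sigma>, t)" by (simp add: while_spmf.simps)
    then show ?case using 0 \<open>i = N\<close> by auto
  next
    case (Suc d)
    then have i: "i < N" by simp
    note st = step[OF i Suc.prems(2)]
    obtain \<sigma>1 t1 where 1: "exec \<rho> p (\<sigma>, t + 1 + cost \<rho> \<sigma> e) = return_spmf (\<sigma>1, t1)"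
      "t1 \<le> t + 1 + cost \<rho> \<sigma> e + k * U" "bounded_memory b \<sigma>1" "I (Suc i) \<sigma>1"
    proof -
      have "pcost p \<le> u" using c by simp
      then show ?thesis using st Suc.prems(3) that unfolding ends_def U_def by blast
    qed
    obtain \<sigma>' t' where 2: "while_spmf g f (\<sigma>1, t1) = return_spmf (\<sigma>', t')" "t' \<le> t1
        + (N - Suc i) * ((k + 1) * U)"
      "bounded_memory b \<sigma>'" "I N \<sigma>'"
    proof -
      have "d = N - Suc i" "Suc i \<le> N" using Suc.hyps(2) i by auto
      from Suc.hyps(1)[OF this 1(4) 1(3), of t1] show ?thesis using that by blast
    qed
    have "while_spmf g f (\<sigma>, t) = return_spmf (\<sigma>', t')"
      using st 1(1) 2(1) by (subst while_spmf.simps) (simp add: g_def f_def)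
    moreover have "t' \<le> t + (N - i) * ((k + 1) * U)"
    proof -
      have "(N - i) * ((k + 1) * U) = (k + 1) * U + (N - Suc i) * ((k + 1) * U)"
        using i by (simp add: Suc_diff_Suc[OF i, symmetric] add_mult_distrib)
      moreover have "(k + 1) * U = k * U + U" by (simp add: add_mult_distrib)
      ultimately show ?thesis using 1(2) 2(2) gc[OF Suc.prems(3)] by linarith
    qed
    ultimately show ?case using 2 by blast
  qed
  from this[of 0 \<sigma> t] init \<sigma> obtain \<sigma>' t' where w: "while_spmf g f (\<sigma>, t) = return_spmf (\<sigma>', t')"
    "t' \<le> t + N * ((k + 1) * U)" "bounded_memory b \<sigma>'" "I N \<sigma>'" by auto
  have "exec \<rho> (Loop e p) (\<sigma>, t) = return_spmf (\<sigma>', t' + 1 + cost \<rho> \<sigma>' e)"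
    using w(1) by (simp add: g_def f_def)
  moreover have "t' + 1 + cost \<rho> \<sigma>' e \<le> t + (N * (k + 1) + 1) * U"
    using w(2) gc[OF w(3)] by (simp add: algebra_simps)
  ultimately show "\<exists>\<sigma>' t'. exec \<rho> (Loop e p) (\<sigma>, t) = return_spmf (\<sigma>', t') \<and> t' \<le> t
      + (N * (k + 1) + 1) * (u * (b + 1)) \<and> bounded_memory b \<sigma>' \<and> Q \<sigma>'"
    using w stop unfolding U_def by blast
qed

abbreviation Var :: "string \<Rightarrow> expr" where "Var x \<equiv> Cell x (Lit 0)"

abbreviation Set :: "string \<Rightarrow> expr \<Rightarrow> prog" where "Set x e \<equiv> Store x (Lit 0) e"

definition For :: "string \<Rightarrow> expr \<Rightarrow> prog \<Rightarrow> prog" where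
  "For x e p = Seq (Set x (Lit 0)) (Loop (Less (Var x) e) (Seq p (Set x (Plus (Var x) (Lit 1)))))"

text \<open>\<open>stable\<close> keeps the invariant independent of the counter, and
  \<open>ev\<close> says that the bound, which is evaluated again in every round, does not
  change.\<close>

lemma ends_For:
  assumes e: "digit_free e" and Nb: "int N \<le> 2 ^ b"
    and init: "I 0 \<sigma>"
    and stable: "\<And>k \<sigma> v. I k \<sigma> \<Longrightarrow> I k (upd \<sigma> x 0 v)"
    and ev: "\<And>k \<sigma>. k \<le> N \<Longrightarrow> I k \<sigma> \<Longrightarrow> eval \<rho> \<sigma> e = int N"
    and step: "\<And>k \<sigma>. k < N \<Longrightarrow> I k \<sigma> \<Longrightarrow> \<sigma> x 0 = int k \<Longrightarrow>
        ends \<rho> b u p c (\<lambda>\<sigma>'. \<sigma>' x 0 = int k \<and> I (Suc k) \<sigma>') \<sigma>"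
    and Q: "\<And>\<sigma>. I N \<sigma> \<Longrightarrow> Q \<sigma>"
  shows "ends \<rho> b u (For x e p) (1 + (N * (c + 1 + 1) + 1)) Q \<sigma>"
  unfolding For_def
proof (rule ends_Seq, rule ends_Store)
  show "ends \<rho> b u (Loop (Less (Var x) e) (Seq p (Set x (Plus (Var x) (Lit 1))))) (N * (c + 1 + 1) + 1) Q
    (upd \<sigma> x (eval \<rho> \<sigma> (Lit 0)) (eval \<rho> \<sigma> (Lit 0)))"
  proof (rule ends_Loop[where I = "\<lambda>k \<sigma>. \<sigma> x 0 = int k \<and> I k \<sigma>"])
    fix k \<sigma> assume k: "k < N" and I: "\<sigma> x 0 = int k \<and> I k \<sigma>"
    have "ends \<rho> b u (Seq p (Set x (Plus (Var x) (Lit 1)))) (c + 1) (\<lambda>\<sigma>. \<sigma> x 0 = int (Suc k) \<and> I (Suc k) \<sigma>) \<sigma>"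
    proof (rule ends_Seq, rule ends_mono[OF step[OF k]])
      fix \<sigma>' assume I': "\<sigma>' x 0 = int k \<and> I (Suc k) \<sigma>'"
      show "ends \<rho> b u (Set x (Plus (Var x) (Lit 1))) 1 (\<lambda>\<sigma>. \<sigma> x 0 = int (Suc k) \<and> I (Suc k) \<sigma>) \<sigma>'"
      proof (rule ends_Store)
        have "int k + 1 \<le> 2 ^ b" using k Nb by linarith
        then show "\<bar>eval \<rho> \<sigma>' (Plus (Var x) (Lit 1))\<bar> \<le> 2 ^ b" using I' by simp
      qed (use I' stable in \<open>auto simp: upd_def\<close>)
    qed (use I in auto)
    moreover have "eval \<rho> \<sigma> e = int N" using ev[of k \<sigma>] k I by simp
    ultimately show "eval \<rho> \<sigma> (Less (Var x) e) \<noteq> 0 \<and> ends \<rho> b u (Seq p (Set x (Plus (Var x) (Lit 1))))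
        (c + 1) (\<lambda>\<sigma>. \<sigma> x 0 = int (Suc k) \<and> I (Suc k) \<sigma>) \<sigma>"
      using k I by simp
  next
    fix \<sigma> assume "\<sigma> x 0 = int N \<and> I N \<sigma>"
    then show "eval \<rho> \<sigma> (Less (Var x) e) = 0 \<and> Q \<sigma>" using Q ev[of N \<sigma>] by simp
  qed (use e init stable in \<open>auto simp: upd_def\<close>)
qed auto

section \<open>The program\<close>

abbreviation "nV \<equiv> Var ''n''"
abbreviation "sV \<equiv> Var ''s''"
abbreviation "AV \<equiv> Var ''A''"
abbreviation "pV \<equiv> Var ''p''"
abbreviation "NV \<equiv> Var ''N''"
abbreviation "yj \<equiv> Cell ''y'' (Var ''j'')"
abbreviation "okV \<equiv> Var ''accept''"

text \<open>Leaves in \<open>l\<close> the bit length of \<open>n\<close>, that is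
  \<open>floorlog 2 n\<close>; it serves as the largest tested degree and determines \<eta>.\<close>

definition prog_log :: prog where
  "prog_log = Seq (Set ''l'' (Lit 0)) (Seq (Set ''w'' (Lit 1))
     (Loop (Less (Var ''w'') (Plus nV (Lit 1)))
        (Seq (Set ''w'' (Times (Lit 2) (Var ''w''))) (Set ''l'' (Plus (Var ''l'') (Lit 1))))))"

text \<open>\<open>A / p\<close> is \<mu> rounded down to \<open>k\<close> binary digits. The
  precision has to beat \<open>\<eta>\<^sup>2 / n\<close>: 96 digits for the factor 2^-96 in
  \<open>\<eta>\<^sup>2\<close> and \<open>8 * n\<close> for n (log n)^4.\<close>

definition prog_digits :: prog where
  "prog_digits = Seq (Set ''k'' (Plus (Times (Lit 8) nV) (Lit 96))) (Seq (Set ''A'' (Digits ''mu'' (Var ''k'')))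
     (Seq (Set ''p'' (Lit 1)) (For ''i'' (Var ''k'') (Set ''p'' (Times (Lit 2) pV)))))"

definition dev_expr :: expr where
  "dev_expr = Minus (Times pV yj) (Times sV AV)"

text \<open>\<open>N\<close> is the reciprocal of \<eta>, and \<open>W\<close> carries the factor (s
  p)^2. Tests are conjoined by multiplying into \<open>accept\<close>; a comparison with
  \<open>\<le>\<close> becomes \<open><\<close> against the successor.\<close>

definition prog_coords :: prog where
  "prog_coords = Seq (Set ''N'' (Times (Lit (2 ^ 48)) (Times (Var ''l'') (Var ''l''))))
     (Seq (Set ''accept'' (Lit 1)) (Seq (Set ''Y'' (Lit 0)) (Seq (Set ''W'' (Lit 0))
     (For ''j'' nV
       (Seq (Set ''accept'' (Times okV (Less (Times (Times dev_expr dev_expr) (Times NV NV))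
            (Plus (Times (Lit 32) (Times (Times sV sV) (Plus (Times (Times pV AV) NV) (Times pV pV))))
                (Lit 1)))))
       (Seq (Set ''Y'' (Plus (Var ''Y'') yj))
         (Set ''W'' (Plus (Var ''W'') (Minus (Times dev_expr dev_expr) (Times (Times pV pV) yj))))))))))"

definition prog_large :: prog where
  "prog_large =
    (let d = Minus (Times pV (Var ''Y'')) (Times (Times sV nV) AV) in
     Seq (Set ''accept'' (Times okV (Less (Times (Times d d) NV)
          (Plus (Times (Times (Times (Lit 16) nV) (Times AV pV)) (Times sV sV)) (Lit 1)))))
       (Set ''accept'' (Times okV (Minus (Lit 1)
          (Times (Less (Lit 0) (Var ''W''))
             (Less (Times (Times nV (Times AV AV)) (Times (Times (Times sV sV) (Times sV sV)) (Times pV pV)))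
                (Times (Lit 1024) (Times (Var ''W'') (Var ''W''))))))))) "

text \<open>A count may be exponential in its length, so the product runs over \<open>2 * s\<close>
  factors instead of \<open>y j\<close>: s - 1 for indices below \<open>y j\<close>, and s for the
  others. For \<open>y j \<le> 2 * s\<close> it is \<open>thin s 0 (y j)\<close> times the common
  denominator \<open>D\<close>.\<close>

definition prog_small_init :: prog where
  "prog_small_init = Seq (Set ''D'' (Lit 1)) (Seq (For ''i'' (Times (Lit 2) sV)
      (Set ''D'' (Times (Var ''D'') sV)))
     (Seq (Set ''T'' (Lit 0))
       (For ''j'' nV (Seq (Store ''c'' (Var ''j'') (Lit 1))
          (Seq (For ''i'' (Times (Lit 2) sV)
             (Store ''c'' (Var ''j'') (Times (Cell ''c'' (Var ''j'')) (Minus sV (Less (Var ''i'') yj)))))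
          (Set ''T'' (Plus (Var ''T'') (Cell ''c'' (Var ''j'')))))))))"

text \<open>Passing from degree x to x + 1 multiplies a thinned count by (y - x) / ((x + 1) (s -
  1)), so one division per coordinate updates all numerators. \<open>P / F\<close> is the Poisson
  weight m^x / x!.\<close>

definition prog_small_moments :: prog where
  "prog_small_moments = Seq (Set ''P'' (Lit 1)) (Seq (Set ''F'' (Lit 1))
     (For ''x'' (Var ''l'')
        (Seq (Set ''P'' (Times (Var ''P'') AV))
        (Seq (Set ''F'' (Times (Var ''F'') (Times (Plus (Var ''x'') (Lit 1)) pV)))
        (Seq (Set ''M'' (Lit 0))
        (Seq (For ''j'' nV
           (Seq (Store ''c'' (Var ''j'') (Quot (Times (Cell ''c'' (Var ''j'')) (Minus yj (Var ''x'')))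
                    (Times (Plus (Var ''x'') (Lit 1)) (Minus sV (Lit 1)))))
             (Set ''M'' (Plus (Var ''M'') (Cell ''c'' (Var ''j''))))))
        (let d = Minus (Times (Var ''M'') (Var ''F'')) (Times (Var ''T'') (Var ''P'')) in
          Set ''accept'' (Times okV (Less (Times (Times d d) (Times NV NV))
            (Plus (Times (Times (Lit 64) (Times (Var ''D'') (Var ''D'')))
                (Plus (Times (Times NV nV) (Times (Var ''P'') (Var ''F'')))
                    (Times (Var ''F'') (Var ''F'')))) (Lit 1)))))))))))"

definition tester :: prog where
  "tester = Seq prog_log (Seq prog_digits (Seq prog_coords
     (Cond (Less (Times (Lit 1024) pV) (Plus (Times AV NV) (Lit 1))) prog_large
        (Seq prog_small_init prog_small_moments))))"

lemma abs_mult_pow2: "\<bar>x\<bar> \<le> 2 ^ a \<Longrightarrow> \<bar>y\<bar> \<le> 2 ^ c \<Longrightarrow> \<bar>x * y :: int\<bar> \<le> 2 ^ (a + c)"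
  unfolding abs_mult power_add by (intro mult_mono) auto

lemma abs_diff_pow2: "\<bar>x\<bar> \<le> 2 ^ a \<Longrightarrow> \<bar>y\<bar> \<le> 2 ^ a \<Longrightarrow> \<bar>x - y :: int\<bar> \<le> 2 ^ (a + 1)"
  using abs_triangle_ineq4[of x y] by simp

lemma abs_le_pow2_mono: "\<bar>x :: int\<bar> \<le> 2 ^ a \<Longrightarrow> a \<le> c \<Longrightarrow> \<bar>x\<bar> \<le> 2 ^ c"
  by (rule order_trans) (auto intro: power_increasing)

lemma abs_sum_pow2:
  fixes j n z :: nat
  assumes "\<And>i. i < j \<Longrightarrow> \<bar>f i :: int\<bar> \<le> 2 ^ a" "j \<le> n" "n \<le> 2 ^ z"
  shows "\<bar>\<Sum>i<j. f i\<bar> \<le> 2 ^ (a + z)"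
proof -
  have "\<bar>\<Sum>i<j. f i\<bar> \<le> (\<Sum>i<j. \<bar>f i\<bar>)" by (rule sum_abs)
  also have "\<dots> \<le> (\<Sum>i<j. 2 ^ a)" using assms(1) by (intro sum_mono) auto
  also have "\<dots> = int j * 2 ^ a" by simp
  also have "\<dots> \<le> 2 ^ z * 2 ^ a"
  proof (rule mult_right_mono)
    have "int j \<le> int (2 ^ z)" using assms(2,3) by (simp only: of_nat_le_iff)
    then show "int j \<le> 2 ^ z" by simp
  qed simp
  finally show ?thesis by (simp add: power_add mult.commute)
qed

lemma floorlog_2_bounds:
  assumes "n \<ge> 2"
  shows "floorlog 2 n \<le> n" "floorlog 2 n \<ge> 1" "2 ^ (floorlog 2 n - 1) \<le> n" "n < 2 ^ floorlog 2 n"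
proof -
  have "n < 2 ^ n" by (rule less_exp)
  then show "floorlog 2 n \<le> n" by (intro floorlog_leI) auto
  show "floorlog 2 n \<ge> 1"
    using assms by (simp add: floorlog_eq_zero_iff Suc_le_eq neq0_conv[symmetric] del: neq0_conv)
  show "2 ^ (floorlog 2 n - 1) \<le> n" "n < 2 ^ floorlog 2 n" using floorlog_bounds[of n 2] assms by auto
qed

text \<open>All memory cells stay below \<open>2 ^ b\<close>. The program needs integers of up to \<open>5 * z\<^sup>2\<close> bits because of
  the common denominator \<open>s ^ (2 * s)\<close> of the thinned counts.\<close>

locale tester_run =
  fixes \<rho> :: reals and b u z n s L k :: nat and y :: "nat \<Rightarrow> nat" and A :: int
  assumes n: "n \<ge> 2" and L: "L = floorlog 2 n" and k: "k = 8 * n + 96" and A: "A = \<lfloor>2 ^ k * \<rho> ''mu''\<rfloor>"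
    and z: "k \<le> z" "s \<le> z" "\<bar>A\<bar> \<le> 2 ^ z" "\<And>j. j < n \<Longrightarrow> y j \<le> 2 ^ z"
    and b: "b = 5 * z * z"
begin

lemma z96: "z \<ge> 96" using z(1) k by simp

lemmas L_le = floorlog_2_bounds[OF n, folded L]

lemma zz: "c \<le> 96 \<Longrightarrow> c * z \<le> z * z" using z96 by (intro mult_right_mono) auto

lemma le_pow2: "x \<le> z \<Longrightarrow> \<bar>int x\<bar> \<le> 2 ^ z"
proof -
  assume "x \<le> z"
  also have "z < 2 ^ z" by (rule less_exp)
  finally have "int x \<le> int (2 ^ z)" by (simp only: of_nat_le_iff)
  then show ?thesis by simp
qed

lemma n_le_z: "n \<le> z" using z(1) k by simp

lemma basic_bounds: "\<bar>int n\<bar> \<le> 2 ^ z" "\<bar>int s\<bar> \<le> 2 ^ z" "\<bar>int L\<bar> \<le> 2 ^ z" "j < n \<Longrightarrow> \<bar>int (y j)\<bar> \<le> 2 ^ z"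
  "\<bar>2 ^ k :: int\<bar> \<le> 2 ^ z" "\<bar>A\<bar> \<le> 2 ^ z"
proof -
  show "\<bar>int n\<bar> \<le> 2 ^ z" "\<bar>int s\<bar> \<le> 2 ^ z" "\<bar>int L\<bar> \<le> 2 ^ z"
    using n_le_z z(2) L_le by (intro le_pow2, simp)+
  show "\<bar>int (y j)\<bar> \<le> 2 ^ z" if "j < n"
  proof -
    have "int (y j) \<le> int (2 ^ z)" using z(4)[OF that] by (simp only: of_nat_le_iff)
    then show ?thesis by simp
  qed
  show "\<bar>2 ^ k :: int\<bar> \<le> 2 ^ z" using z(1) by simp
  show "\<bar>A\<bar> \<le> 2 ^ z" by (rule z(3))
qed

lemma small_le_pow2: "\<bar>x :: int\<bar> \<le> 2 ^ a \<Longrightarrow> a \<le> b \<Longrightarrow> \<bar>x\<bar> \<le> 2 ^ b"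
  by (rule abs_le_pow2_mono)

lemma z_le_b: "c \<le> 96 \<Longrightarrow> c * z \<le> b" "c \<le> 4 \<Longrightarrow> c * (z * z) + 96 * z \<le> b" "1 \<le> b"
proof -
  show "c \<le> 96 \<Longrightarrow> c * z \<le> b" using zz[of c] unfolding b by (simp add: mult.assoc del: mult_le_cancel2) linarith
  show "c \<le> 4 \<Longrightarrow> c * (z * z) + 96 * z \<le> b"
  proof -
    assume "c \<le> 4"
    then have "c * (z * z) \<le> 4 * (z * z)" by (rule mult_right_mono) simp
    moreover have "96 * z \<le> z * z" by (rule zz) simp
    ultimately show ?thesis unfolding b by linarith
  qed
  show "1 \<le> b" using z96 unfolding b by (cases z) auto
qed

definition base :: "memory \<Rightarrow> bool" where
  "base \<sigma> \<longleftrightarrow> \<sigma> ''n'' 0 = int n \<and> \<sigma> ''s'' 0 = int s \<and> (\<forall>j<n. \<sigma> ''y'' (int j) = int (y j))"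

definition st1 :: "memory \<Rightarrow> bool" where
  "st1 \<sigma> \<longleftrightarrow> base \<sigma> \<and> \<sigma> ''l'' 0 = int L"

text \<open>The step counts are left in the unevaluated form produced by the proof rules.\<close>

lemma prog_log: "base \<sigma> \<Longrightarrow> ends \<rho> b u prog_log (1 + (1 + (L * (1 + 1 + 1) + 1))) st1 \<sigma>"
  unfolding prog_log_def
proof (rule ends_Seq, rule ends_Store, rule ends_Seq, rule ends_Store)
  assume base: "base \<sigma>"
  show "ends \<rho> b u
     (Loop (Less (Var ''w'') (Plus nV (Lit 1)))
       (Seq (Set ''w'' (Times (Lit 2) (Var ''w''))) (Set ''l'' (Plus (Var ''l'') (Lit 1)))))
     (L * (1 + 1 + 1) + 1) st1
     (upd (upd \<sigma> ''l'' (eval \<rho> \<sigma> (Lit 0)) (eval \<rho> \<sigma> (Lit 0))) ''w''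
       (eval \<rho> (upd \<sigma> ''l'' (eval \<rho> \<sigma> (Lit 0)) (eval \<rho> \<sigma> (Lit 0))) (Lit 0))
       (eval \<rho> (upd \<sigma> ''l'' (eval \<rho> \<sigma> (Lit 0)) (eval \<rho> \<sigma> (Lit 0))) (Lit 1)))"
  proof (rule ends_Loop[where I = "\<lambda>i \<sigma>. base \<sigma> \<and> \<sigma> ''w'' 0 = 2 ^ i \<and> \<sigma> ''l'' 0 = int i"])
    fix i \<sigma> assume i: "i < L" and I: "base \<sigma> \<and> \<sigma> ''w'' 0 = 2 ^ i \<and> \<sigma> ''l'' 0 = int i"
    have "(2 :: nat) ^ i \<le> 2 ^ (L - 1)" using i by (intro power_increasing) auto
    then have "2 ^ i \<le> n" using L_le(3) by (rule order_trans)
    then have "int (2 ^ i) \<le> int n" by (simp only: of_nat_le_iff)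
    then have g: "(2 :: int) ^ i < int n + 1" by simp
    have i2: "\<bar>2 * 2 ^ i :: int\<bar> \<le> 2 ^ b" "\<bar>int i + 1\<bar> \<le> 2 ^ b"
    proof -
      have "\<bar>2 ^ Suc i :: int\<bar> \<le> 2 ^ b"
        using i L_le n_le_z z_le_b(1)[of 1] by (intro small_le_pow2[of _ "Suc i"]) auto
      then show "\<bar>2 * 2 ^ i :: int\<bar> \<le> 2 ^ b" by simp
      have "\<bar>int (Suc i)\<bar> \<le> 2 ^ z" using i L_le n_le_z by (intro le_pow2) simp
      from small_le_pow2[OF this] z_le_b(1)[of 1] show "\<bar>int i + 1\<bar> \<le> 2 ^ b" by simp
    qed
    have "ends \<rho> b u (Seq (Set ''w'' (Times (Lit 2) (Var ''w''))) (Set ''l'' (Plus (Var ''l'') (Lit 1))))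
        (1 + 1)
         (\<lambda>\<sigma>. base \<sigma> \<and> \<sigma> ''w'' 0 = 2 ^ Suc i \<and> \<sigma> ''l'' 0 = int (Suc i)) \<sigma>"
      by (rule ends_Seq, (rule ends_Store)+) (use I i2 in \<open>auto simp: upd_def base_def\<close>)
    then show "eval \<rho> \<sigma> (Less (Var ''w'') (Plus nV (Lit 1))) \<noteq> 0 \<and>
        ends \<rho> b u (Seq (Set ''w'' (Times (Lit 2) (Var ''w''))) (Set ''l'' (Plus (Var ''l'') (Lit 1)))) (1 + 1)
         (\<lambda>\<sigma>. base \<sigma> \<and> \<sigma> ''w'' 0 = 2 ^ Suc i \<and> \<sigma> ''l'' 0 = int (Suc i)) \<sigma>"
      using I g by (simp add: base_def)
  next
    fix \<sigma> assume I: "base \<sigma> \<and> \<sigma> ''w'' 0 = 2 ^ L \<and> \<sigma> ''l'' 0 = int L"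
    have "int n < int (2 ^ L)" using L_le(4) by (simp only: of_nat_less_iff)
    then show "eval \<rho> \<sigma> (Less (Var ''w'') (Plus nV (Lit 1))) = 0 \<and> st1 \<sigma>"
      using I by (simp add: base_def st1_def)
  qed (use base in \<open>auto simp: upd_def base_def\<close>)
qed auto

definition st2 :: "memory \<Rightarrow> bool" where
  "st2 \<sigma> \<longleftrightarrow> st1 \<sigma> \<and> \<sigma> ''k'' 0 = int k \<and> \<sigma> ''A'' 0 = A \<and> \<sigma> ''p'' 0 = 2 ^ k"

text \<open>Reading \<open>k\<close> digits is the only step whose cost is not covered by the bound on the memory cells.\<close>

lemma prog_digits: "st1 \<sigma> \<Longrightarrow> ends \<rho> b u prog_digits (1 + (10 + (1 + (1 + (k * (1 + 1 + 1) + 1))))) st2 \<sigma>"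
  unfolding prog_digits_def
proof (rule ends_Seq, rule ends_Store)
  assume st: "st1 \<sigma>"
  define \<sigma>1 where "\<sigma>1 = upd \<sigma> ''k'' 0 (int k)"
  have ek: "eval \<rho> \<sigma> (Plus (Times (Lit 8) nV) (Lit 96)) = int k" using st by (simp add: st1_def base_def k)
  have kz: "\<bar>int k\<bar> \<le> 2 ^ z" using z(1) by (rule le_pow2)
  have zb: "z \<le> b" using z_le_b(1)[of 1] by simp
  show "\<bar>eval \<rho> \<sigma> (Plus (Times (Lit 8) nV) (Lit 96))\<bar> \<le> 2 ^ b"
    unfolding ek using kz zb by (rule small_le_pow2)
  have "ends \<rho> b u (Seq (Set ''A'' (Digits ''mu'' (Var ''k'')))
      (Seq (Set ''p'' (Lit 1)) (For ''i'' (Var ''k'') (Set ''p'' (Times (Lit 2) pV)))))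
     (10 + (1 + (1 + (k * (1 + 1 + 1) + 1)))) st2 \<sigma>1"
  proof (cases "1 \<le> u")
    case False
    then show ?thesis by (simp add: ends_def)
  next
    case True
    show ?thesis
    proof (rule ends_Seq, rule ends_Store_cost)
      have eA: "eval \<rho> \<sigma>1 (Digits ''mu'' (Var ''k'')) = A" by (simp add: \<sigma>1_def upd_def A)
      show "\<bar>eval \<rho> \<sigma>1 (Digits ''mu'' (Var ''k''))\<bar> \<le> 2 ^ b" unfolding eA using z(3) zb by (rule small_le_pow2)
      have bk: "bits (int k) \<le> z + 1" "bits A \<le> z + 1" using bits_le_Suc[OF kz] bits_le_Suc[OF z(3)] by auto
      have "cost \<rho> \<sigma>1 (Lit 0) + cost \<rho> \<sigma>1 (Digits ''mu'' (Var ''k'')) + 1 + bits (eval \<rho> \<sigma>1 (Lit 0))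
          + bits (eval \<rho> \<sigma>1 (Digits ''mu'' (Var ''k'')))
         \<le> 8 + 5 * (z + 1)"
        using bk z(1) unfolding eA cost.simps by (simp add: \<sigma>1_def upd_def bits_def A[symmetric])
      also have "\<dots> \<le> 10 * (b + 1)" using zb z96 by simp
      also have "\<dots> \<le> 10 * (u * (b + 1))" using mult_right_mono[OF True, of "b + 1"] by simp
      finally show "cost \<rho> \<sigma>1 (Lit 0) + cost \<rho> \<sigma>1 (Digits ''mu'' (Var ''k'')) + 1 + bits (eval \<rho> \<sigma>1 (Lit 0))
          + bits (eval \<rho> \<sigma>1 (Digits ''mu'' (Var ''k'')))
         \<le> 10 * (u * (b + 1))" .
      show "ends \<rho> b u (Seq (Set ''p'' (Lit 1)) (For ''i'' (Var ''k'') (Set ''p'' (Times (Lit 2) pV))))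
          (1 + (1 + (k * (1 + 1 + 1) + 1))) st2
         (upd \<sigma>1 ''A'' (eval \<rho> \<sigma>1 (Lit 0)) (eval \<rho> \<sigma>1 (Digits ''mu'' (Var ''k''))))"
        unfolding eA
      proof (rule ends_Seq, rule ends_Store, rule ends_For[where I = "\<lambda>i \<sigma>. st1 \<sigma> \<and> \<sigma> ''k'' 0 = int k
          \<and> \<sigma> ''A'' 0 = A \<and> \<sigma> ''p'' 0 = 2 ^ i"])
        show "int k \<le> 2 ^ b" using small_le_pow2[OF kz zb] by simp
        fix i \<sigma> assume i: "i < k" and I: "st1 \<sigma> \<and> \<sigma> ''k'' 0 = int k \<and> \<sigma> ''A'' 0 = A \<and> \<sigma> ''p'' 0
            = 2 ^ i" "\<sigma> ''i'' 0 = int i"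
        have "\<bar>2 ^ Suc i :: int\<bar> \<le> 2 ^ b" using i z(1) zb by (intro small_le_pow2[of _ "Suc i"]) auto
        then have "\<bar>2 * 2 ^ i :: int\<bar> \<le> 2 ^ b" by simp
        then show "ends \<rho> b u (Set ''p'' (Times (Lit 2) pV)) 1 (\<lambda>\<sigma>'. \<sigma>' ''i'' 0 = int i \<and>
           (st1 \<sigma>' \<and> \<sigma>' ''k'' 0 = int k \<and> \<sigma>' ''A'' 0 = A \<and> \<sigma>' ''p'' 0 = 2 ^ Suc i)) \<sigma>"
          by (intro ends_Store) (use I in \<open>auto simp: upd_def st1_def base_def\<close>)
      qed (use st in \<open>auto simp: \<sigma>1_def upd_def st1_def base_def st2_def\<close>)
    qed
  qed
  then show "ends \<rho> b u (Seq (Set ''A'' (Digits ''mu'' (Var ''k'')))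
      (Seq (Set ''p'' (Lit 1)) (For ''i'' (Var ''k'') (Set ''p'' (Times (Lit 2) pV)))))
     (10 + (1 + (1 + (k * (1 + 1 + 1) + 1)))) st2 (upd \<sigma> ''k'' (eval \<rho> \<sigma> (Lit 0))
         (eval \<rho> \<sigma> (Plus (Times (Lit 8) nV) (Lit 96))))"
    unfolding ek \<sigma>1_def by simp
qed auto

text \<open>The tests \<open>t1\<close>, \<open>t2\<close>, \<open>t3\<close>, \<open>t4\<close> are those of \<^const>\<open>accepts\<close>, cleared of denominators: \<open>\<eta> = 1 / Nv\<close> and
  \<open>m = A / p\<close>, and \<open>thin s x (y j) = cc j x / Dv\<close> provided that \<open>y j \<le> 2 * s\<close>, which follows from \<open>t1\<close>
  when \<open>t4\<close> matters.\<close>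

definition Nv :: int where "Nv = 2 ^ 48 * (int L * int L)"
definition p :: int where "p = 2 ^ k"
definition q :: "nat \<Rightarrow> int" where "q j = p * int (y j) - int s * A"
definition t1 :: "nat \<Rightarrow> bool" where
  "t1 j \<longleftrightarrow> q j * q j * (Nv * Nv) < 32 * (int s * int s * (p * A * Nv + p * p)) + 1"
definition Yv :: "nat \<Rightarrow> int" where "Yv j = (\<Sum>i<j. int (y i))"
definition Wv :: "nat \<Rightarrow> int" where "Wv j = (\<Sum>i<j. q i * q i - p * p * int (y i))"

lemma p_bound: "\<bar>p\<bar> \<le> 2 ^ z" unfolding p_def by (rule basic_bounds)

lemma Nv_bound: "\<bar>Nv\<bar> \<le> 2 ^ (3 * z)"
proof -
  have "\<bar>2 ^ 48 :: int\<bar> \<le> 2 ^ z" using z96 by (simp only: abs_power2 abs_numeral power_abs)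
      (rule power_increasing, auto)
  from abs_mult_pow2[OF this abs_mult_pow2[OF basic_bounds(3) basic_bounds(3)]]
  show ?thesis unfolding Nv_def by (rule abs_le_pow2_mono) simp
qed

lemma q_bound: "j < n \<Longrightarrow> \<bar>q j\<bar> \<le> 2 ^ (2 * z + 1)"
  unfolding q_def
  by (rule abs_le_pow2_mono[OF abs_diff_pow2[OF abs_mult_pow2[OF p_bound basic_bounds(4)]
      abs_mult_pow2[OF basic_bounds(2,6)]]]) auto

lemma Yv_bound: "j \<le> n \<Longrightarrow> \<bar>Yv j\<bar> \<le> 2 ^ (2 * z)"
proof -
  have "n \<le> 2 ^ z" using n_le_z less_exp[of z] by linarith
  moreover assume "j \<le> n"
  ultimately have "\<bar>\<Sum>i<j. int (y i)\<bar> \<le> 2 ^ (z + z)" using basic_bounds(4) by (intro abs_sum_pow2) auto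
  then show ?thesis unfolding Yv_def by (simp add: mult_2)
qed

lemma Wv_bound: "j \<le> n \<Longrightarrow> \<bar>Wv j\<bar> \<le> 2 ^ (5 * z + 3)"
proof -
  have "n \<le> 2 ^ z" using n_le_z less_exp[of z] by linarith
  moreover assume j: "j \<le> n"
  moreover have "\<bar>q i * q i - p * p * int (y i)\<bar> \<le> 2 ^ (4 * z + 2 + 1)" if "i < j" for i
  proof (rule abs_diff_pow2)
    have i: "i < n" using that j by simp
    show "\<bar>q i * q i\<bar> \<le> 2 ^ (4 * z + 2)"
      by (rule abs_le_pow2_mono[OF abs_mult_pow2[OF q_bound[OF i] q_bound[OF i]]]) simp
    show "\<bar>p * p * int (y i)\<bar> \<le> 2 ^ (4 * z + 2)"
      by (rule abs_le_pow2_mono[OF abs_mult_pow2[OF abs_mult_pow2[OF p_bound p_bound]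
          basic_bounds(4)[OF i]]]) simp
  qed
  ultimately have "\<bar>\<Sum>i<j. q i * q i - p * p * int (y i)\<bar> \<le> 2 ^ (4 * z + 2 + 1 + z)" by (intro abs_sum_pow2) auto
  then show ?thesis unfolding Wv_def by (rule abs_le_pow2_mono) simp
qed

definition st3 :: "memory \<Rightarrow> bool" where
  "st3 \<sigma> \<longleftrightarrow> st2 \<sigma> \<and> \<sigma> ''N'' 0 = Nv"

definition st4 :: "nat \<Rightarrow> memory \<Rightarrow> bool" where
  "st4 j \<sigma> \<longleftrightarrow> st3 \<sigma> \<and> \<sigma> ''accept'' 0 = of_bool (\<forall>i<j. t1 i) \<and> \<sigma> ''Y'' 0 = Yv j \<and> \<sigma> ''W'' 0 = Wv j"

lemma prog_coords: "st2 \<sigma> \<Longrightarrow> ends \<rho> b u prog_coords (1 + (1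
    + (1 + (1 + (1 + (n * (1 + (1 + 1) + 1 + 1) + 1)))))) (st4 n) \<sigma>"
  unfolding prog_coords_def
proof (rule ends_Seq, rule ends_Store, (rule ends_Seq, rule ends_Store)+, rule
    ends_For[where I = st4 and N = n])
  assume st: "st2 \<sigma>"
  have "\<bar>Nv\<bar> \<le> 2 ^ b" using Nv_bound z_le_b(1)[of 3] by (intro small_le_pow2) auto
  then show "\<bar>eval \<rho> \<sigma> (Times (Lit (2 ^ 48)) (Times (Var ''l'') (Var ''l'')))\<bar> \<le> 2 ^ b"
    using st by (simp add: st2_def st1_def Nv_def)
  show "int n \<le> 2 ^ b" using small_le_pow2[OF basic_bounds(1)] z_le_b(1)[of 1] by simp
  fix j \<sigma> assume j: "j < n" and I: "st4 j \<sigma>" "\<sigma> ''j'' 0 = int j"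
  have bd: "\<bar>Yv (Suc j)\<bar> \<le> 2 ^ b" "\<bar>Wv (Suc j)\<bar> \<le> 2 ^ b"
    using j z_le_b(1)[of 6] z96
    by (intro small_le_pow2[OF Yv_bound] small_le_pow2[OF Wv_bound]; simp)+
  show "ends \<rho> b u
       (Seq (Set ''accept'' (Times okV (Less (Times (Times dev_expr dev_expr) (Times NV NV))
            (Plus (Times (Lit 32) (Times (Times sV sV) (Plus (Times (Times pV AV) NV) (Times pV pV))))
                (Lit 1)))))
       (Seq (Set ''Y'' (Plus (Var ''Y'') yj))
         (Set ''W'' (Plus (Var ''W'') (Minus (Times dev_expr dev_expr) (Times (Times pV pV) yj))))))
             (1 + (1 + 1))
      (\<lambda>\<sigma>'. \<sigma>' ''j'' 0 = int j \<and> st4 (Suc j) \<sigma>') \<sigma>"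
    by (rule ends_Seq, rule ends_Store, rule ends_Seq, rule ends_Store, rule ends_Store)
       (use I j bd in \<open>auto simp: upd_def dev_expr_def st4_def st3_def st2_def st1_def base_def
           p_def[symmetric] q_def[symmetric]
          t1_def less_Suc_eq Yv_def Wv_def\<close>)
qed (auto simp: upd_def st4_def st3_def st2_def st1_def base_def Yv_def Wv_def Nv_def)

definition d2 :: int where "d2 = p * Yv n - int s * int n * A"
definition t2 :: bool where "t2 \<longleftrightarrow> d2 * d2 * Nv < 16 * int n * (A * p) * (int s * int s) + 1"
definition t3 :: bool where
  "t3 \<longleftrightarrow> \<not> (0 < Wv n \<and> int n * (A * A) * (int s * int s * (int s * int s) * (p * p)) < 1024 * (Wv n * Wv n))"

lemma prog_large: "st4 n \<sigma> \<Longrightarrow> ends \<rho> b u prog_large (1 + 1)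
    (\<lambda>\<sigma>. \<sigma> ''accept'' 0 = of_bool ((\<forall>i<n. t1 i) \<and> t2 \<and> t3)) \<sigma>"
  unfolding prog_large_def Let_def
  by (rule ends_Seq, rule ends_Store, rule ends_Store)
     (auto simp: upd_def st4_def st3_def st2_def st1_def base_def p_def[symmetric] d2_def[symmetric] t2_def
         t3_def)

definition c0 :: "nat \<Rightarrow> nat \<Rightarrow> int" where
  "c0 j i = (\<Prod>m<i. int s - (if m < y j then 1 else 0))"

primrec cc :: "nat \<Rightarrow> nat \<Rightarrow> int" where
  "cc j 0 = c0 j (2 * s)"
| "cc j (Suc x) = cc j x * (int (y j) - int x) div ((int x + 1) * (int s - 1))"

primrec Fv :: "nat \<Rightarrow> int" where
  "Fv 0 = 1"
| "Fv (Suc x) = Fv x * ((int x + 1) * p)"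

definition Mv :: "nat \<Rightarrow> nat \<Rightarrow> int" where "Mv x j = (\<Sum>i<j. cc i x)"
definition Dv :: int where "Dv = int s ^ (2 * s)"
definition d4 :: "nat \<Rightarrow> int" where "d4 x = Mv x n * Fv x - Mv 0 n * A ^ x"
definition t4 :: "nat \<Rightarrow> bool" where
  "t4 x \<longleftrightarrow> d4 x * d4 x * (Nv * Nv) < 64 * (Dv * Dv) * (Nv * int n * (A ^ x * Fv x) + Fv x * Fv x) + 1"

lemma pow_bound: "\<bar>v\<bar> \<le> 2 ^ w \<Longrightarrow> \<bar>v ^ x :: int\<bar> \<le> 2 ^ (w * x)"
proof (induction x)
  case (Suc x)
  then show ?case using abs_mult_pow2[of v w "v ^ x" "w * x"] by simp
qed simp

lemma c0_bound: "\<bar>c0 j i\<bar> \<le> 2 ^ (z * i)"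
proof (induction i)
  case (Suc i)
  have "(1 :: int) \<le> 2 ^ z" by simp
  then have "\<bar>int s - (if i < y j then 1 else 0)\<bar> \<le> 2 ^ z" using basic_bounds(2)
      by (smt (verit) of_nat_0_le_iff)
  from abs_mult_pow2[OF Suc this] show ?case unfolding c0_def by (simp add: add.commute)
qed (simp add: c0_def)

lemma two_s: "z * (2 * s) \<le> 2 * (z * z)"
  using mult_left_mono[OF z(2), of "2 * z"] by (simp add: mult_ac)

text \<open>Integer division does not increase absolute values, so the bound holds for every input,
  whether or not the quotients are exact.\<close>

lemma cc_bound: "j < n \<Longrightarrow> x \<le> z \<Longrightarrow> \<bar>cc j x\<bar> \<le> 2 ^ (2 * (z * z) + z * x)"
proof (induction x)
  case 0
  show ?case using abs_le_pow2_mono[OF c0_bound[of j "2 * s"] two_s] by simp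
next
  case (Suc x)
  have "\<bar>int x\<bar> \<le> 2 ^ z" using Suc.prems by (intro le_pow2) simp
  moreover have "\<bar>int (y j)\<bar> \<le> 2 ^ z" using Suc.prems by (intro basic_bounds)
  ultimately have "\<bar>int (y j) - int x\<bar> \<le> 2 ^ z" by linarith
  then have "\<bar>cc j x * (int (y j) - int x)\<bar> \<le> 2 ^ (2 * (z * z) + z * x + z)"
    using Suc by (intro abs_mult_pow2) auto
  then show ?case using abs_div_le_int[of "cc j x * (int (y j) - int x)" "(int x + 1) * (int s - 1)"]
    by (simp add: algebra_simps)
qed

lemma le_zz: "x \<le> L \<Longrightarrow> z * x \<le> z * z"
  using L_le n_le_z by (intro mult_left_mono) auto

lemma zz_le_b: "4 * (z * z) + 96 * z \<le> b"
  by (rule z_le_b(2)) simp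

lemma cc_le_b: "j < n \<Longrightarrow> x \<le> L \<Longrightarrow> \<bar>cc j x\<bar> \<le> 2 ^ b"
proof -
  assume j: "j < n" and x: "x \<le> L"
  have "x \<le> z" using x L_le n_le_z by linarith
  moreover have "2 * (z * z) + z * x \<le> b" using le_zz[OF x] zz_le_b by linarith
  ultimately show ?thesis using cc_bound[OF j] by (blast intro: small_le_pow2)
qed

lemma Mv_le_b: "j \<le> n \<Longrightarrow> x \<le> L \<Longrightarrow> \<bar>Mv x j\<bar> \<le> 2 ^ b"
proof -
  assume j: "j \<le> n" and x: "x \<le> L"
  have "n \<le> 2 ^ z" using n_le_z less_exp[of z] by linarith
  then have "\<bar>Mv x j\<bar> \<le> 2 ^ (2 * (z * z) + z * x + z)"
    unfolding Mv_def using j x L_le n_le_z by (intro abs_sum_pow2 cc_bound) auto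
  then show ?thesis by (rule small_le_pow2) (use le_zz[OF x] zz_le_b in linarith)
qed

lemma Fv_bound: "x \<le> z \<Longrightarrow> \<bar>Fv x\<bar> \<le> 2 ^ (2 * (z * x))"
proof (induction x)
  case (Suc x)
  have "\<bar>int x + 1\<bar> \<le> 2 ^ z" using le_pow2[of "Suc x"] Suc.prems by (simp add: add.commute)
  from abs_mult_pow2[OF Suc.IH abs_mult_pow2[OF this p_bound]] Suc.prems
  show ?case by (simp add: algebra_simps)
qed simp

lemma Fv_le_b: "x \<le> L \<Longrightarrow> \<bar>Fv x\<bar> \<le> 2 ^ b"
proof -
  assume x: "x \<le> L"
  have "x \<le> z" using x L_le n_le_z by linarith
  moreover have "2 * (z * x) \<le> b" using le_zz[OF x] zz_le_b by linarith
  ultimately show ?thesis using Fv_bound by (blast intro: small_le_pow2)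
qed

lemma A_pow_le_b: "x \<le> L \<Longrightarrow> \<bar>A ^ x\<bar> \<le> 2 ^ b"
proof -
  assume x: "x \<le> L"
  have "z * x \<le> b" using le_zz[OF x] zz_le_b by linarith
  with pow_bound[OF basic_bounds(6), of x] show ?thesis by (rule small_le_pow2)
qed

lemma s_pow_le_b: "i \<le> 2 * s \<Longrightarrow> \<bar>int s ^ i\<bar> \<le> 2 ^ b"
proof -
  assume "i \<le> 2 * s"
  then have "z * i \<le> z * (2 * s)" by (rule mult_left_mono) simp
  then have "z * i \<le> b" using two_s zz_le_b by linarith
  then show ?thesis using pow_bound[OF basic_bounds(2), of i] by (rule small_le_pow2[rotated])
qed

lemma c0_le_b: "i \<le> 2 * s \<Longrightarrow> \<bar>c0 j i\<bar> \<le> 2 ^ b"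
proof -
  assume "i \<le> 2 * s"
  then have "z * i \<le> z * (2 * s)" by (rule mult_left_mono) simp
  then have "z * i \<le> b" using two_s zz_le_b by linarith
  then show ?thesis using c0_bound[of j i] by (rule small_le_pow2[rotated])
qed

lemma int_le_b: "x \<le> 2 * z \<Longrightarrow> int x \<le> 2 ^ b"
proof -
  assume "x \<le> 2 * z"
  also have "2 * z \<le> b" using z_le_b(1)[of 2] by simp
  also have "b < 2 ^ b" by (rule less_exp)
  finally have "int x \<le> int (2 ^ b)" by (simp only: of_nat_le_iff)
  then show ?thesis by simp
qed

definition ok0 :: bool where "ok0 \<longleftrightarrow> (\<forall>i<n. t1 i)"

definition st5 :: "memory \<Rightarrow> bool" where
  "st5 \<sigma> \<longleftrightarrow> st3 \<sigma> \<and> \<sigma> ''accept'' 0 = of_bool ok0 \<and> \<sigma> ''D'' 0 = Dv"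

definition st6 :: "nat \<Rightarrow> memory \<Rightarrow> bool" where
  "st6 j \<sigma> \<longleftrightarrow> st5 \<sigma> \<and> \<sigma> ''T'' 0 = Mv 0 j \<and> (\<forall>i<j. \<sigma> ''c'' (int i) = cc i 0)"

lemmas st_simps = upd_def st6_def st5_def st4_def st3_def st2_def st1_def base_def

lemma prog_small_init:
  "st4 n \<sigma> \<Longrightarrow> ends \<rho> b u prog_small_init
     (1 + ((1 + (2 * s * (1 + 1 + 1) + 1)) + (1 + (1 + (n *
         ((1 + ((1 + (2 * s * (1 + 1 + 1) + 1)) + 1)) + 1 + 1) + 1))))) (st6 n) \<sigma>"
  unfolding prog_small_init_def
proof (rule ends_Seq, rule ends_Store, rule ends_Seq,
    rule ends_For[where I = "\<lambda>i \<sigma>. st3 \<sigma> \<and> \<sigma> ''accept'' 0 = of_bool ok0 \<and> \<sigma> ''D'' 0 = int s ^ i" and N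
        = "2 * s"])
  show "int (2 * s) \<le> 2 ^ b" using z(2) by (intro int_le_b) simp
  fix i \<sigma> assume i: "i < 2 * s" and I: "st3 \<sigma> \<and> \<sigma> ''accept'' 0 = of_bool ok0 \<and> \<sigma> ''D'' 0
      = int s ^ i" "\<sigma> ''i'' 0 = int i"
  have "\<bar>int s ^ i * int s\<bar> \<le> 2 ^ b" using s_pow_le_b[of "Suc i"] i by (simp add: mult.commute)
  then show "ends \<rho> b u (Set ''D'' (Times (Var ''D'') sV)) 1
     (\<lambda>\<sigma>'. \<sigma>' ''i'' 0 = int i \<and> (st3 \<sigma>' \<and> \<sigma>' ''accept'' 0 = of_bool ok0 \<and> \<sigma>' ''D'' 0 = int s ^ Suc i)) \<sigma>"
    by (intro ends_Store) (use I in \<open>auto simp: st_simps\<close>)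
next
  fix \<sigma> assume I: "st3 \<sigma> \<and> \<sigma> ''accept'' 0 = of_bool ok0 \<and> \<sigma> ''D'' 0 = int s ^ (2 * s)"
  show "ends \<rho> b u (Seq (Set ''T'' (Lit 0))
       (For ''j'' nV (Seq (Store ''c'' (Var ''j'') (Lit 1))
          (Seq (For ''i'' (Times (Lit 2) sV)
             (Store ''c'' (Var ''j'') (Times (Cell ''c'' (Var ''j'')) (Minus sV (Less (Var ''i'') yj)))))
          (Set ''T'' (Plus (Var ''T'') (Cell ''c'' (Var ''j''))))))))
              (1 + (1 + (n * ((1 + ((1 + (2 * s * (1 + 1 + 1) + 1)) + 1)) + 1 + 1) + 1))) (st6 n) \<sigma>"
  proof (rule ends_Seq, rule ends_Store, rule ends_For[where I = st6 and N = n])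
    show "int n \<le> 2 ^ b" using n_le_z by (intro int_le_b) simp
    fix j \<sigma> assume j: "j < n" and J: "st6 j \<sigma>" "\<sigma> ''j'' 0 = int j"
    show "ends \<rho> b u (Seq (Store ''c'' (Var ''j'') (Lit 1))
          (Seq (For ''i'' (Times (Lit 2) sV)
             (Store ''c'' (Var ''j'') (Times (Cell ''c'' (Var ''j'')) (Minus sV (Less (Var ''i'') yj)))))
          (Set ''T'' (Plus (Var ''T'') (Cell ''c'' (Var ''j'')))))) (1 + ((1 + (2 * s * (1 + 1 + 1) + 1)) + 1))
        (\<lambda>\<sigma>'. \<sigma>' ''j'' 0 = int j \<and> st6 (Suc j) \<sigma>') \<sigma>"
    proof (rule ends_Seq, rule ends_Store, rule ends_Seq,
        rule ends_For[where I = "\<lambda>i \<sigma>. st6 j \<sigma> \<and> \<sigma> ''j'' 0 = int j \<and> \<sigma> ''c'' (int j) = c0 j i" and N = "2 * s"])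
      show "int (2 * s) \<le> 2 ^ b" using z(2) by (intro int_le_b) simp
      fix i \<sigma> assume i: "i < 2 * s" and I: "st6 j \<sigma> \<and> \<sigma> ''j'' 0 = int j \<and> \<sigma> ''c'' (int j)
          = c0 j i" "\<sigma> ''i'' 0 = int i"
      have "\<bar>c0 j (Suc i)\<bar> \<le> 2 ^ b" using i by (intro c0_le_b) simp
      then show "ends \<rho> b u (Store ''c'' (Var ''j'') (Times (Cell ''c'' (Var ''j''))
          (Minus sV (Less (Var ''i'') yj)))) 1
         (\<lambda>\<sigma>'. \<sigma>' ''i'' 0 = int i \<and> (st6 j \<sigma>' \<and> \<sigma>' ''j'' 0 = int j \<and> \<sigma>' ''c'' (int j) = c0 j (Suc i))) \<sigma>"
        by (intro ends_Store) (use I j in \<open>auto simp: st_simps c0_def\<close>)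
    next
      fix \<sigma> assume I: "st6 j \<sigma> \<and> \<sigma> ''j'' 0 = int j \<and> \<sigma> ''c'' (int j) = c0 j (2 * s)"
      have "\<bar>Mv 0 (Suc j)\<bar> \<le> 2 ^ b" using j by (intro Mv_le_b) auto
      then show "ends \<rho> b u (Set ''T'' (Plus (Var ''T'') (Cell ''c'' (Var ''j'')))) 1
          (\<lambda>\<sigma>'. \<sigma>' ''j'' 0 = int j \<and> st6 (Suc j) \<sigma>') \<sigma>"
        by (intro ends_Store) (use I in \<open>auto simp: st_simps Mv_def less_Suc_eq\<close>)
    qed (use J j in \<open>auto simp: st_simps c0_def\<close>)
  qed (use I in \<open>auto simp: st_simps Mv_def Dv_def\<close>)
qed (auto simp: st_simps ok0_def)

definition st7 :: "nat \<Rightarrow> memory \<Rightarrow> bool" where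
  "st7 x \<sigma> \<longleftrightarrow> st3 \<sigma> \<and> \<sigma> ''D'' 0 = Dv \<and> \<sigma> ''T'' 0 = Mv 0 n \<and> \<sigma> ''P'' 0 = A ^ x \<and> \<sigma> ''F'' 0 = Fv x"

definition st8 :: "nat \<Rightarrow> memory \<Rightarrow> bool" where
  "st8 x \<sigma> \<longleftrightarrow> st7 x \<sigma> \<and> (\<forall>j<n. \<sigma> ''c'' (int j) = cc j x) \<and> \<sigma> ''accept'' 0 = of_bool (ok0 \<and> (\<forall>x'<x. t4 (Suc x')))"

definition st9 :: "nat \<Rightarrow> nat \<Rightarrow> memory \<Rightarrow> bool" where
  "st9 x j \<sigma> \<longleftrightarrow> st7 (Suc x) \<sigma> \<and> \<sigma> ''x'' 0 = int x \<and> (\<forall>i<j. \<sigma> ''c'' (int i) = cc i (Suc x)) \<and>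
     (\<forall>i<n. j \<le> i \<longrightarrow> \<sigma> ''c'' (int i) = cc i x) \<and> \<sigma> ''accept'' 0 = of_bool (ok0 \<and> (\<forall>x'<x. t4 (Suc x')))
         \<and> \<sigma> ''M'' 0 = Mv (Suc x) j"

lemma prog_small_moments:
  "st6 n \<sigma> \<Longrightarrow> ends \<rho> b u prog_small_moments
     (1 + (1 + (1 + (L * ((1 + (1 + (1 + ((1 + (n * ((1 + 1) + 1 + 1) + 1)) + 1)))) + 1 + 1) + 1)))) (st8 L) \<sigma>"
  unfolding prog_small_moments_def Let_def
proof (rule ends_Seq, rule ends_Store, rule ends_Seq, rule ends_Store, rule ends_For[where I = st8 and N = L])
  show "int L \<le> 2 ^ b" using n_le_z L_le by (intro int_le_b) simp
  fix x \<sigma> assume x: "x < L" and I: "st8 x \<sigma>" "\<sigma> ''x'' 0 = int x"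
  have bd: "\<bar>A ^ Suc x\<bar> \<le> 2 ^ b" "\<bar>Fv (Suc x)\<bar> \<le> 2 ^ b"
    using x by (intro A_pow_le_b Fv_le_b; simp)+
  show "ends \<rho> b u
        (Seq (Set ''P'' (Times (Var ''P'') AV))
        (Seq (Set ''F'' (Times (Var ''F'') (Times (Plus (Var ''x'') (Lit 1)) pV)))
        (Seq (Set ''M'' (Lit 0))
        (Seq (For ''j'' nV
           (Seq (Store ''c'' (Var ''j'') (Quot (Times (Cell ''c'' (Var ''j'')) (Minus yj (Var ''x'')))
                    (Times (Plus (Var ''x'') (Lit 1)) (Minus sV (Lit 1)))))
             (Set ''M'' (Plus (Var ''M'') (Cell ''c'' (Var ''j''))))))
        (Set ''accept'' (Times okV (Less (Times (Times (Minus (Times (Var ''M'') (Var ''F''))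
            (Times (Var ''T'') (Var ''P''))) (Minus (Times (Var ''M'') (Var ''F''))
            (Times (Var ''T'') (Var ''P'')))) (Times NV NV))
            (Plus (Times (Times (Lit 64) (Times (Var ''D'') (Var ''D'')))
                (Plus (Times (Times NV nV) (Times (Var ''P'') (Var ''F'')))
                    (Times (Var ''F'') (Var ''F'')))) (Lit 1))))))))
     ) (1 + (1 + (1 + ((1 + (n * ((1 + 1) + 1 + 1) + 1)) + 1))))
     (\<lambda>\<sigma>'. \<sigma>' ''x'' 0 = int x \<and> st8 (Suc x) \<sigma>') \<sigma>"
  proof (rule ends_Seq, rule ends_Store, rule ends_Seq, rule ends_Store, rule ends_Seq, rule ends_Store,
      rule ends_Seq,
      rule ends_For[where I = "st9 x" and N = n])
    show "int n \<le> 2 ^ b" using n_le_z by (intro int_le_b) simp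
    fix j \<sigma> assume j: "j < n" and J: "st9 x j \<sigma>" "\<sigma> ''j'' 0 = int j"
    have bd: "\<bar>cc j (Suc x)\<bar> \<le> 2 ^ b" "\<bar>Mv (Suc x) (Suc j)\<bar> \<le> 2 ^ b"
      using x j by (intro cc_le_b Mv_le_b; simp)+
    show "ends \<rho> b u (Seq (Store ''c'' (Var ''j'') (Quot (Times (Cell ''c'' (Var ''j'')) (Minus yj (Var ''x'')))
                    (Times (Plus (Var ''x'') (Lit 1)) (Minus sV (Lit 1)))))
             (Set ''M'' (Plus (Var ''M'') (Cell ''c'' (Var ''j''))))) (1 + 1)
       (\<lambda>\<sigma>'. \<sigma>' ''j'' 0 = int j \<and> st9 x (Suc j) \<sigma>') \<sigma>"
      by (rule ends_Seq, rule ends_Store, rule ends_Store)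
         (use J j bd in \<open>auto simp: st_simps st9_def st7_def Mv_def less_Suc_eq\<close>)
  next
    fix \<sigma> assume J: "st9 x n \<sigma>"
    show "ends \<rho> b u (Set ''accept'' (Times okV (Less (Times
        (Times (Minus (Times (Var ''M'') (Var ''F'')) (Times (Var ''T'') (Var ''P'')))
        (Minus (Times (Var ''M'') (Var ''F'')) (Times (Var ''T'') (Var ''P'')))) (Times NV NV))
            (Plus (Times (Times (Lit 64) (Times (Var ''D'') (Var ''D'')))
                (Plus (Times (Times NV nV) (Times (Var ''P'') (Var ''F'')))
                    (Times (Var ''F'') (Var ''F'')))) (Lit 1))))) 1
        (\<lambda>\<sigma>'. \<sigma>' ''x'' 0 = int x \<and> st8 (Suc x) \<sigma>') \<sigma>"
      by (intro ends_Store)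
         (use J in \<open>auto simp: st_simps st9_def st8_def st7_def t4_def d4_def less_Suc_eq simp del: cc.simps
             Fv.simps power_Suc\<close>)
  qed (use I bd in \<open>auto simp: st_simps st9_def st8_def st7_def Mv_def p_def[symmetric] mult_ac\<close>)
qed (auto simp: st_simps st8_def st7_def)

definition accepted :: bool where
  "accepted \<longleftrightarrow> (\<forall>i<n. t1 i) \<and> (if 1024 * p < A * Nv + 1 then t2 \<and> t3 else (\<forall>x<L. t4 (Suc x)))"

lemma tester_ends: "base \<sigma> \<Longrightarrow> ends \<rho> b u tester (100 * (z * z)) (\<lambda>\<sigma>. \<sigma> ''accept'' 0 = of_bool accepted) \<sigma>"
proof -
  assume base: "base \<sigma>"
  define m where "m = 100 * (z * z)"
  have small: "ends \<rho> b u (Seq prog_small_init prog_small_moments)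
      ((1 + ((1 + (2 * s * (1 + 1 + 1) + 1)) + (1 + (1 +
          (n * ((1 + ((1 + (2 * s * (1 + 1 + 1) + 1)) + 1)) + 1 + 1) + 1))))) +
       (1 + (1 + (1 + (L * ((1 + (1 + (1 + ((1 + (n * ((1 + 1) + 1 + 1) + 1)) + 1)))) + 1 + 1) + 1)))))
           (st8 L) \<sigma>" if "st4 n \<sigma>" for \<sigma>
    by (rule ends_Seq, rule ends_mono[OF prog_small_init[OF that] order.refl], rule prog_small_moments)
  have steps: "(1 + ((1 + (2 * s * (1 + 1 + 1) + 1)) + (1
      + (1 + (n * ((1 + ((1 + (2 * s * (1 + 1 + 1) + 1)) + 1)) + 1 + 1) + 1))))) +
       (1 + (1 + (1 + (L * ((1 + (1 + (1 + ((1 + (n * ((1 + 1) + 1 + 1) + 1)) + 1)))) + 1 + 1) + 1))))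
           \<le> 50 * (z * z)"
  proof -
    have "n * s \<le> z * z" "L * n \<le> z * z" using n_le_z z(2) L_le by (auto intro!: mult_mono)
    moreover have "96 * z \<le> z * z" by (rule zz) simp
    moreover have "s \<le> z" "n \<le> z" "L \<le> z" "96 \<le> z" using n_le_z z(2) L_le z96 by auto
    ultimately have "10 + 6 * s + 6 * n + 6 * (n * s) + 8 * L + 4 * (L * n) \<le> 50 * (z * z)" by linarith
    moreover have "(1 + ((1 + (2 * s * (1 + 1 + 1) + 1))
        + (1 + (1 + (n * ((1 + ((1 + (2 * s * (1 + 1 + 1) + 1)) + 1)) + 1 + 1) + 1))))) +
       (1 + (1 + (1 + (L * ((1 + (1 + (1 + ((1 + (n * ((1 + 1) + 1 + 1) + 1)) + 1)))) + 1 + 1) + 1))))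
       = 10 + 6 * s + 6 * n + 6 * (n * s) + 8 * L + 4 * (L * n)"
      by (simp add: algebra_simps)
    ultimately show ?thesis by linarith
  qed
  have large: "ends \<rho> b u (Cond (Less (Times (Lit 1024) pV) (Plus (Times AV NV) (Lit 1))) prog_large
        (Seq prog_small_init prog_small_moments)) (1 + 50 * (z * z)) (\<lambda>\<sigma>. \<sigma> ''accept'' 0 = of_bool accepted) \<sigma>"
    if st: "st4 n \<sigma>" for \<sigma>
  proof -
    have ev: "eval \<rho> \<sigma> (Less (Times (Lit 1024) pV) (Plus (Times AV NV) (Lit 1)))
        = (if 1024 * p < A * Nv + 1 then 1 else 0)"
      using st by (simp add: st_simps p_def)
    show ?thesis
    proof (rule ends_Cond)
      assume "eval \<rho> \<sigma> (Less (Times (Lit 1024) pV) (Plus (Times AV NV) (Lit 1))) \<noteq> 0"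
      then have c: "1024 * p < A * Nv + 1" unfolding ev by (auto split: if_splits)
      show "ends \<rho> b u prog_large (50 * (z * z)) (\<lambda>\<sigma>. \<sigma> ''accept'' 0 = of_bool accepted) \<sigma>"
        by (rule ends_mono[OF prog_large[OF st]]) (use steps c in \<open>auto simp: accepted_def\<close>)
    next
      assume "eval \<rho> \<sigma> (Less (Times (Lit 1024) pV) (Plus (Times AV NV) (Lit 1))) = 0"
      then have c: "\<not> 1024 * p < A * Nv + 1" unfolding ev by (auto split: if_splits)
      show "ends \<rho> b u (Seq prog_small_init prog_small_moments) (50 * (z * z))
          (\<lambda>\<sigma>. \<sigma> ''accept'' 0 = of_bool accepted) \<sigma>"
        by (rule ends_mono[OF small[OF st] steps]) (use c in \<open>auto simp: accepted_def st8_def ok0_def\<close>)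
    qed auto
  qed
  have "ends \<rho> b u tester ((1 + (1 + (L * (1 + 1 + 1) + 1))) + ((1 + (10 + (1 + (1 + (k * (1 + 1 + 1) + 1))))) +
      ((1 + (1 + (1 + (1 + (1 + (n * (1 + (1 + 1) + 1 + 1) + 1)))))) + (1 + 50 * (z * z)))))
          (\<lambda>\<sigma>. \<sigma> ''accept'' 0 = of_bool accepted) \<sigma>"
    unfolding tester_def
    by (rule ends_Seq, rule ends_mono[OF prog_log[OF base] order.refl],
        rule ends_Seq, rule ends_mono[OF prog_digits order.refl], assumption,
        rule ends_Seq, rule ends_mono[OF prog_coords order.refl], assumption, rule large)
  then show ?thesis
  proof (rule ends_mono)
    have "96 * z \<le> z * z" by (rule zz) simp
    moreover have "n \<le> z" "L \<le> z" "96 \<le> z" "k \<le> z" using n_le_z z(1) L_le z96 by auto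
    ultimately have "24 + (3 * L + (3 * k + 5 * n)) \<le> 50 * (z * z)" by linarith
    then show "(1 + (1 + (L * (1 + 1 + 1) + 1))) + ((1 + (10 + (1 + (1 + (k * (1 + 1 + 1) + 1))))) +
      ((1 + (1 + (1 + (1 + (1 + (n * (1 + (1 + 1) + 1 + 1) + 1)))))) + (1 + 50 * (z * z)))) \<le> 100 * (z * z)"
          by simp
  qed
qed

end

section \<open>Equivalence of the integer tests with the real ones\<close>

lemma divide_le_cancel_pos: "c > 0 \<Longrightarrow> a / c \<le> b / c \<longleftrightarrow> a \<le> b" for a b c :: real
  by (simp add: divide_le_cancel)

lemma deviation_iff:
  fixes P S N v a :: real
  assumes "P > 0" "S > 0" "N > 0"
  shows "(v / S - a / P)\<^sup>2 \<le> 32 * (a / P * (1 / N) + (1 / N)\<^sup>2) \<longleftrightarrow>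
    (P * v - S * a) * (P * v - S * a) * (N * N) \<le> 32 * (S * S * (P * a * N + P * P))"
proof -
  have 1: "(v / S - a / P)\<^sup>2 = (P * v - S * a) * (P * v - S * a) * (N * N) / (S * S * (P * P) * (N * N))"
    using assms by (simp add: divide_simps power2_eq_square) (simp add: algebra_simps)
  have 2: "32 * (a / P * (1 / N) + (1 / N)\<^sup>2) = 32 * (S * S * (P * a * N + P * P)) /
      (S * S * (P * P) * (N * N))"
    using assms by (simp add: divide_simps power2_eq_square) (simp add: algebra_simps)
  show ?thesis unfolding 1 2 by (rule divide_le_cancel_pos) (use assms in simp)
qed

lemma sum_deviation_iff:
  fixes P S N v a h :: real
  assumes "P > 0" "S > 0" "N > 0"
  shows "(v / S - h * (a / P))\<^sup>2 \<le> 16 * h * (a / P) * (1 / N) \<longleftrightarrow>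
    (P * v - S * h * a) * (P * v - S * h * a) * N \<le> 16 * h * (a * P) * (S * S)"
proof -
  have 1: "(v / S - h * (a / P))\<^sup>2 = (P * v - S * h * a) * (P * v - S * h * a) * N / (S * S * (P * P) * N)"
    using assms by (simp add: divide_simps power2_eq_square) (simp add: algebra_simps)
  have 2: "16 * h * (a / P) * (1 / N) = 16 * h * (a * P) * (S * S) / (S * S * (P * P) * N)"
    using assms by (simp add: divide_simps power2_eq_square)
  show ?thesis unfolding 1 2 by (rule divide_le_cancel_pos) (use assms in simp)
qed

lemma second_moment_iff:
  fixes P S W a h :: real
  assumes "P > 0" "S > 0"
  shows "1024 * (W / (S * S * (P * P)))\<^sup>2 \<le> h * (a / P)\<^sup>2 \<longleftrightarrow>
    1024 * (W * W) \<le> h * (a * a) * (S * S * (S * S) * (P * P))"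
proof -
  have 1: "1024 * (W / (S * S * (P * P)))\<^sup>2 = 1024 * (W * W) / ((S * S * (P * P)) * (S * S * (P * P)))"
    by (simp add: power2_eq_square)
  have 2: "h * (a / P)\<^sup>2 = h * (a * a) * (S * S * (S * S) * (P * P)) / ((S * S * (P * P)) * (S * S * (P * P)))"
    using assms by (simp add: power2_eq_square)
  show ?thesis unfolding 1 2 by (rule divide_le_cancel_pos) (use assms in simp)
qed

lemma moment_deviation_iff:
  fixes D F N M T G h :: real
  assumes "D > 0" "F > 0" "N > 0"
  shows "(M / D - T / D * (G / F))\<^sup>2 \<le> 64 * (h * (G / F) * (1 / N) + (1 / N)\<^sup>2) \<longleftrightarrow>
    (M * F - T * G) * (M * F - T * G) * (N * N) \<le> 64 * (D * D) * (N * h * (G * F) + F * F)"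
proof -
  have 1: "(M / D - T / D * (G / F))\<^sup>2 = (M * F - T * G) * (M * F - T * G) * (N * N) /
      (D * D * (F * F) * (N * N))"
    using assms by (simp add: divide_simps power2_eq_square)
  have 2: "64 * (h * (G / F) * (1 / N) + (1 / N)\<^sup>2) = 64 * (D * D) * (N * h * (G * F) + F * F) /
      (D * D * (F * F) * (N * N))"
    using assms by (simp add: divide_simps power2_eq_square) (simp add: algebra_simps)
  show ?thesis unfolding 1 2 by (rule divide_le_cancel_pos) (use assms in simp)
qed

lemma int_less_Suc_iff_real: "x < y + 1 \<longleftrightarrow> real_of_int x \<le> real_of_int y"
  by linarith

context tester_run
begin

definition eta :: real where "eta = 1 / real_of_int Nv"
definition rate :: real where "rate = real_of_int A / 2 ^ k"

lemma Nv_ge: "real_of_int Nv \<ge> 2 ^ 48"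
proof -
  have "1 * 1 \<le> int L * int L" using L_le(2) by (intro mult_mono) auto
  then have "Nv \<ge> 2 ^ 48" unfolding Nv_def by simp
  then have "real_of_int Nv \<ge> real_of_int (2 ^ 48)" by (simp only: of_int_le_iff)
  then show ?thesis by simp
qed

lemma c0_eq: "c0 j i = (int s - 1) ^ min i (y j) * int s ^ (i - y j)"
proof (induction i)
  case (Suc i)
  have "c0 j (Suc i) = c0 j i * (int s - (if i < y j then 1 else 0))" by (simp add: c0_def)
  also have "\<dots> = (int s - 1) ^ min (Suc i) (y j) * int s ^ (Suc i - y j)"
    unfolding Suc by (cases "i < y j") (simp_all add: min_def Suc_diff_le)
  finally show ?case .
qed (simp add: c0_def)

text \<open>The division is exact because of (y - x) * binomial (y, x) = (x + 1) * binomial (y, x +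
  1). The bound on \<open>y j\<close> ensures that all its factors s - 1 occur among the
  \<open>2 * s\<close> factors of \<open>c0\<close>, and \<open>s \<ge> 2\<close> keeps the divisor
  nonzero.\<close>

lemma cc_eq:
  assumes "s \<ge> 2" "y j \<le> 2 * s"
  shows "cc j x = int (y j choose x) * (int s - 1) ^ (y j - x) * int s ^ (2 * s - y j)"
proof (induction x)
  case 0
  show ?case using assms by (simp add: c0_eq)
next
  case (Suc x)
  define R where "R = int s ^ (2 * s - y j)"
  have pos: "(int x + 1) * (int s - 1) \<noteq> 0" using assms by simp
  have num: "cc j x * (int (y j) - int x) =
      (int (y j choose Suc x) * (int s - 1) ^ (y j - Suc x) * R) * ((int x + 1) * (int s - 1))"
  proof (cases "x < y j")
    case True
    have "(y j choose x) * (y j - x) = Suc x * (y j choose Suc x)"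
      using True by (metis Suc_times_binomial_eq binomial_absorb_comp binomial_absorption mult.commute)
    then have "int ((y j choose x) * (y j - x)) = int (Suc x * (y j choose Suc x))" by (simp only:)
    then have 1: "int (y j choose x) * (int (y j) - int x) = (int x + 1) * int (y j choose Suc x)"
      using True unfolding of_nat_mult of_nat_diff[OF less_imp_le[OF True]] by simp
    have "(int s - 1) ^ (y j - x) = (int s - 1) * (int s - 1) ^ (y j - Suc x)"
      using True by (metis Suc_diff_Suc power_Suc)
    then have "cc j x * (int (y j) - int x) =
        (int (y j choose x) * (int (y j) - int x)) * ((int s - 1) * (int s - 1) ^ (y j - Suc x)) * R"
      unfolding Suc R_def by (simp only: mult_ac)
    then show ?thesis unfolding 1 by (simp only: mult_ac)
  next
    case False
    then have "(y j choose x) = 0 \<or> y j = x" by (auto simp: binomial_eq_0)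
    then show ?thesis using False unfolding Suc by (auto simp: binomial_eq_0)
  qed
  show ?case unfolding cc.simps num R_def[symmetric] using pos by (rule nonzero_mult_div_cancel_right)
qed

lemma cc_thin:
  assumes "s \<ge> 2" "y j \<le> 2 * s"
  shows "thin s x (y j) = real_of_int (cc j x) / real_of_int Dv"
proof -
  have "real s ^ (2 * s) = real s ^ (2 * s - y j) * real s ^ y j"
    using assms by (simp add: power_add[symmetric])
  then show ?thesis unfolding cc_eq[OF assms] thin_def Dv_def using assms by simp
qed

lemma Fv_eq: "Fv x = fact x * p ^ x"
  by (induction x) (simp_all add: algebra_simps)

lemma accepted_iff:
  assumes s: "s \<ge> 2" and A0: "A \<ge> 0"
  shows "accepted \<longleftrightarrow> accepts n s L eta rate y"
proof -
  define P N S a where "P = (2 :: real) ^ k" and "N = real_of_int Nv" and "S = real s" and "a = real_of_int A"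
  have pos: "P > 0" "N > 0" "S > 0" "a \<ge> 0" using Nv_ge s A0 by (auto simp: P_def N_def S_def a_def)
  have eta: "eta = 1 / N" and rate: "rate = a / P" by (auto simp: eta_def rate_def P_def N_def a_def)
  have rp: "real_of_int p = P" by (simp add: p_def P_def)
  have rq: "real_of_int (q j) = P * real (y j) - S * a" for j by (simp add: q_def rp S_def a_def)
  have t1: "t1 j \<longleftrightarrow> (y j / S - rate)\<^sup>2 \<le> 32 * (rate * eta + eta\<^sup>2)" for j
    unfolding eta rate deviation_iff[OF pos(1,3,2)] t1_def int_less_Suc_iff_real
    by (simp add: rq rp N_def S_def a_def)
  have branch: "1024 * p < A * Nv + 1 \<longleftrightarrow> 1024 * eta \<le> rate"
  proof -
    have "1024 * p < A * Nv + 1 \<longleftrightarrow> 1024 * P \<le> a * N"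
      unfolding int_less_Suc_iff_real by (simp add: rp N_def a_def)
    then show ?thesis unfolding eta rate using pos by (simp add: field_simps)
  qed
  have t2: "t2 \<longleftrightarrow> ((\<Sum>j<n. real (y j)) / S - real n * rate)\<^sup>2 \<le> 16 * real n * rate * eta"
  proof -
    have "real_of_int d2 = P * (\<Sum>j<n. real (y j)) - S * real n * a"
      by (simp add: d2_def Yv_def rp S_def a_def)
    then show ?thesis unfolding eta rate sum_deviation_iff[OF pos(1,3,2)] t2_def int_less_Suc_iff_real
      by (simp add: rp N_def S_def a_def)
  qed
  define W where "W = (\<Sum>j<n. (y j / S - rate)\<^sup>2 - y j / S\<^sup>2)"
  have W: "W = real_of_int (Wv n) / (S * S * (P * P))"
  proof -
    have "(y j / S - rate)\<^sup>2 - y j / S\<^sup>2 = (real_of_int (q j) * real_of_int (q j) - P * P * y j) /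
        (S * S * (P * P))" for j
      unfolding rq rate using pos by (simp add: divide_simps power2_eq_square) (simp add: algebra_simps)
    then show ?thesis unfolding W_def Wv_def by (simp add: sum_divide_distrib rp)
  qed
  have t3: "t3 \<longleftrightarrow> W \<le> 0 \<or> 1024 * W\<^sup>2 \<le> n * rate\<^sup>2"
  proof -
    have "S * S * (P * P) > 0" using pos by simp
    then have "W \<le> 0 \<longleftrightarrow> \<not> 0 < Wv n" unfolding W by (simp only: divide_le_0_iff not_less of_int_le_0_iff) linarith
    moreover have "1024 * W\<^sup>2 \<le> n * rate\<^sup>2 \<longleftrightarrow>
      real_of_int (1024 * (Wv n * Wv n)) \<le> real_of_int (int n * (A * A) *
          (int s * int s * (int s * int s) * (p * p)))"
      unfolding W rate second_moment_iff[OF pos(1,3)] by (simp add: rp S_def a_def)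
    ultimately show ?thesis unfolding t3_def of_int_le_iff by auto
  qed
  have t4: "t4 x \<longleftrightarrow> ((\<Sum>j<n. thin s x (y j)) - (\<Sum>j<n. thin s 0 (y j)) * (rate ^ x / fact x))\<^sup>2
           \<le> 64 * (n * (rate ^ x / fact x) * eta + eta\<^sup>2)"
    if "\<forall>j<n. t1 j" "\<not> 1024 * eta \<le> rate" for x
  proof -
    \<comment> \<open>In this branch the rate and the radius of the coordinatewise test are both at
      most 1, so a passed test bounds \<open>y j / s\<close> by 2.\<close>
    have y: "y j \<le> 2 * s" if j: "j < n" for j
    proof -
      have e: "0 < eta" "eta \<le> 1 / 2 ^ 48" unfolding eta using pos(2) Nv_ge by (auto simp: N_def field_simps)
      have "rate * eta \<le> 1 / 1000 * (1 / 1000)" "eta * eta \<le> 1 / 1000 * (1 / 1000)"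
        using e \<open>\<not> 1024 * eta \<le> rate\<close> by (intro mult_mono; simp)+
      then have "32 * (rate * eta + eta\<^sup>2) \<le> 1\<^sup>2" by (simp add: power2_eq_square)
      then have "(y j / S - rate)\<^sup>2 \<le> 1\<^sup>2" using \<open>\<forall>j<n. t1 j\<close> j t1[of j] by force
      then have "\<bar>y j / S - rate\<bar> \<le> 1" by (simp only: abs_le_square_iff[symmetric] abs_one)
      moreover have "rate \<le> 1" using \<open>\<not> 1024 * eta \<le> rate\<close> e by simp
      ultimately have "y j / S \<le> 2" by linarith
      then have "real (y j) \<le> 2 * S" using pos by (simp add: divide_le_eq)
      then show ?thesis unfolding S_def by linarith
    qed
    define D F M T G where "D = real_of_int Dv" and "F = real_of_int (Fv x)" and "M = real_of_int (Mv x n)"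
      and "T = real_of_int (Mv 0 n)" and "G = a ^ x"
    have D: "D > 0" using s by (simp add: D_def Dv_def)
    have F: "F = fact x * P ^ x" unfolding F_def Fv_eq by (simp add: rp)
    have F0: "F > 0" unfolding F using pos by simp
    have th: "(\<Sum>j<n. thin s x' (y j)) = real_of_int (Mv x' n) / D" for x'
      unfolding Mv_def D_def by (simp add: cc_thin[OF s y] sum_divide_distrib)
    have G: "rate ^ x / fact x = G / F" unfolding rate G_def F by (simp add: power_divide mult.commute)
    show ?thesis unfolding th G eta M_def[symmetric] T_def[symmetric] moment_deviation_iff[OF D F0 pos(2)]
        t4_def int_less_Suc_iff_real
      by (simp add: D_def F_def M_def T_def G_def d4_def a_def N_def)
  qed
  have "(\<forall>x<L. t4 (Suc x)) \<longleftrightarrow> (\<forall>x. 1 \<le> x \<and> x \<le> L \<longrightarrow> t4 x)"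
    by (metis Suc_le_eq One_nat_def Suc_pred zero_less_Suc)
  then show ?thesis unfolding accepted_def accepts_def branch Let_def
    using t1 t2 t3 t4 unfolding S_def W_def by auto
qed

end

section \<open>Running time and parameters\<close>

context tester_run
begin

lemma base_input: "base (input_memory n s y)"
  by (auto simp: base_def input_memory_def)

lemma bounded_input: "bounded_memory b (input_memory n s y)"
proof -
  have zb: "z \<le> b" using z_le_b(1)[of 1] by simp
  have "\<bar>input_memory n s y x i\<bar> \<le> 2 ^ z" for x i
    using basic_bounds(4)[of "nat i"] basic_bounds(1,2) by (auto simp: input_memory_def nat_less_iff)
  then have "\<bar>input_memory n s y x i\<bar> \<le> 2 ^ b" for x i using zb by (rule abs_le_pow2_mono)
  then show ?thesis by (simp add: bounded_memory_def)
qed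

lemma tester_exec:
  assumes "pcost tester \<le> u"
  shows "\<exists>\<sigma> t. exec \<rho> tester (input_memory n s y, 0) = return_spmf (\<sigma>, t) \<and>
     t \<le> 100 * (z * z) * (u * (b + 1)) \<and> \<sigma> ''accept'' 0 = of_bool accepted"
  using tester_ends[OF base_input] bounded_input assms unfolding ends_def by (metis add_0)

end

definition grid_rate :: "nat \<Rightarrow> real \<Rightarrow> real" where
  "grid_rate n \<mu> = real_of_int \<lfloor>2 ^ (8 * n + 96) * \<mu>\<rfloor> / 2 ^ (8 * n + 96)"

text \<open>The power 2^48 leaves room for the two smallness conditions on \<eta> of the analysis,
  where (L + 1)^2 costs at most a factor of 4 over L^2.\<close>

definition tolerance :: "nat \<Rightarrow> real" where
  "tolerance n = 1 / (2 ^ 48 * (real (floorlog 2 n))\<^sup>2)"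

definition tester_accepts :: "nat \<Rightarrow> nat \<Rightarrow> real \<Rightarrow> (nat \<Rightarrow> nat) \<Rightarrow> bool" where
  "tester_accepts n s \<mu> = accepts n s (floorlog 2 n) (tolerance n) (grid_rate n \<mu>)"

lemma input_size_bounds:
  assumes "\<mu> > 0" "0 < \<delta>" "\<delta> < 1"
  shows "real n + log 2 (1 + \<mu>) + log 2 (1 / \<delta>) \<le> input_size \<mu> \<delta> n y" "0 \<le> log 2 (1 + \<mu>)" "0 \<le> log 2 (1 / \<delta>)"
    "j < n \<Longrightarrow> real (bits (int (y j))) \<le> input_size \<mu> \<delta> n y"
proof -
  have S: "0 \<le> (\<Sum>i<n. real (bits (int (y i))))" by (rule sum_nonneg) simp
  show nn: "0 \<le> log 2 (1 + \<mu>)" "0 \<le> log 2 (1 / \<delta>)" using assms by simp_all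
  show "real n + log 2 (1 + \<mu>) + log 2 (1 / \<delta>) \<le> input_size \<mu> \<delta> n y" unfolding input_size_def using S by simp
  assume "j < n"
  then have "real (bits (int (y j))) \<le> (\<Sum>i<n. real (bits (int (y i))))" by (intro member_le_sum) auto
  then show "real (bits (int (y j))) \<le> input_size \<mu> \<delta> n y" unfolding input_size_def using nn by linarith
qed

lemma ln_le_log2: "x \<ge> 1 \<Longrightarrow> ln x \<le> log 2 (x :: real)"
proof -
  assume x: "x \<ge> 1"
  have "ln 2 \<le> (1 :: real)" using ln_le_minus_one[of "2 :: real"] by simp
  then have "ln x * ln 2 \<le> ln x * 1" using x by (intro mult_left_mono) auto
  then show ?thesis unfolding log_def by (simp add: le_divide_eq)
qed

lemma run_tester:
  fixes C \<mu> \<delta> :: real and n s :: nat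
  defines "I \<equiv> \<lambda>y. input_size \<mu> \<delta> n y"
  assumes \<mu>: "\<mu> > 0" and \<delta>: "0 < \<delta>" "\<delta> < 1" and n: "n \<ge> 2" and s: "s \<ge> 2" and C: "C \<ge> 0"
    and s_le: "real s \<le> C * (ln (real n))\<^sup>2 * (ln (real n) + ln (1 + \<mu>) + ln (1 / \<delta>)) + 1"
  shows "\<exists>\<sigma> t. run tester \<mu> \<delta> n s y = return_spmf (\<sigma>, t) \<and>
     real t \<le> 600 * real (pcost tester) * (C + 101) ^ 4 * I y ^ 12
         \<and> (\<sigma> ''accept'' 0 \<noteq> 0 \<longleftrightarrow> tester_accepts n s \<mu> y)"
proof -
  define J where "J = I y"
  have sz: "real n + log 2 (1 + \<mu>) + log 2 (1 / \<delta>) \<le> J" "0 \<le> log 2 (1 + \<mu>)" "0 \<le> log 2 (1 / \<delta>)"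
    "\<And>j. j < n \<Longrightarrow> real (bits (int (y j))) \<le> J"
    unfolding J_def I_def by (intro input_size_bounds[OF \<mu> \<delta>]; assumption)+
  define k where "k = 8 * n + 96"
  define A where "A = \<lfloor>2 ^ k * \<mu>\<rfloor>"
  \<comment> \<open>Cubic because \<open>s\<close> is at most \<open>C * J ^ 3 + 1\<close>; the 100
    covers the number of digits and the lengths of the inputs. There are about \<open>z ^ 2\<close>
    steps on numbers of about \<open>z ^ 2\<close> bits, which gives the degree 12.\<close>
  define z where "z = nat \<lceil>(C + 100) * J ^ 3\<rceil>"
  define b where "b = 5 * z * z"
  have J: "J \<ge> real n" "J \<ge> 2" using sz(1-3) n by auto
  have J3: "J \<le> J ^ 3" "8 \<le> J ^ 3" "J * J\<^sup>2 = J ^ 3"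
    using J power_increasing[of 1 3 J] power_mono[of 2 J 3] by (auto simp: power2_eq_square power3_eq_cube)
  have z_ge: "(C + 100) * J ^ 3 \<le> real z" unfolding z_def by linarith
  have z_le: "real z \<le> (C + 101) * J ^ 3"
  proof -
    have "0 \<le> (C + 100) * J ^ 3" using C J by simp
    then have "real z \<le> (C + 100) * J ^ 3 + 1" unfolding z_def by linarith
    also have "\<dots> \<le> (C + 101) * J ^ 3" using J3 by (simp add: algebra_simps)
    finally show ?thesis .
  qed
  have CJ: "0 \<le> C * J ^ 3" using C J by simp
  have k_le: "real k + log 2 (1 + \<mu>) \<le> real z"
  proof -
    have "real k + log 2 (1 + \<mu>) \<le> 9 * J + 96" using sz J unfolding k_def by simp
    also have "\<dots> \<le> C * J ^ 3 + 100 * J ^ 3" using J3 CJ by linarith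
    also have "\<dots> \<le> real z" using z_ge by (simp add: algebra_simps)
    finally show ?thesis .
  qed
  have "k \<le> z" using k_le sz(2) by linarith
  have "s \<le> z"
  proof -
    have l: "0 \<le> ln (real n)" "ln (real n) \<le> J"
      using n J ln_le_minus_one[of "real n"] by auto
    have "ln (real n) + ln (1 + \<mu>) + ln (1 / \<delta>) \<le> J"
      using sz(1) ln_le_log2[of "1 + \<mu>"] ln_le_log2[of "1 / \<delta>"] ln_le_minus_one[of "real n"] \<mu> \<delta> n by auto
    moreover have "0 \<le> ln (real n) + ln (1 + \<mu>) + ln (1 / \<delta>)"
    proof -
      have "0 \<le> ln (1 + \<mu>)" "0 \<le> ln (1 / \<delta>)" using \<mu> \<delta> by simp_all
      then show ?thesis using l by linarith
    qed
    ultimately have "C * (ln (real n))\<^sup>2 * (ln (real n) + ln (1 + \<mu>) + ln (1 / \<delta>)) \<le> C * J\<^sup>2 * J"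
      using l C by (intro mult_mono power_mono) auto
    then have "real s \<le> C * J ^ 3 + 1" using s_le J3(3) by (simp add: mult_ac)
    also have "\<dots> \<le> C * J ^ 3 + 100 * J ^ 3" using J3 by linarith
    also have "\<dots> \<le> real z" using z_ge by (simp add: algebra_simps)
    finally show ?thesis by simp
  qed
  have A0: "A \<ge> 0" unfolding A_def using \<mu> by simp
  have A_le: "\<bar>A\<bar> \<le> 2 ^ z"
  proof -
    have "real_of_int A \<le> 2 ^ k * \<mu>" unfolding A_def by simp
    also have "\<dots> \<le> 2 ^ k * (1 + \<mu>)" by simp
    also have "\<dots> = 2 powr (real k + log 2 (1 + \<mu>))" using \<mu> by (simp add: powr_add powr_realpow)
    also have "\<dots> \<le> 2 powr real z" using k_le by simp
    also have "\<dots> = real_of_int (2 ^ z)" by (simp add: powr_realpow)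
    finally show ?thesis using A0 by (simp only: of_int_le_iff abs_of_nonneg)
  qed
  have y_le: "y j \<le> 2 ^ z" if "j < n" for j
  proof -
    have "real (bits (int (y j))) \<le> real z"
    proof -
      have "real (bits (int (y j))) \<le> C * J ^ 3 + 100 * J ^ 3" using sz(4)[OF that] J3 CJ by linarith
      also have "\<dots> \<le> real z" using z_ge by (simp add: algebra_simps)
      finally show ?thesis .
    qed
    then have "(2 :: nat) ^ bits (int (y j)) \<le> 2 ^ z" by (intro power_increasing) auto
    moreover have "y j < 2 ^ bits (int (y j))" using bits_less[of "int (y j)"] by simp
    ultimately show ?thesis by linarith
  qed
  interpret tester_run "input_reals \<mu> \<delta>" b "pcost tester" z n s "floorlog 2 n" k y A
    by unfold_locales (use n \<open>k \<le> z\<close> \<open>s \<le> z\<close> A_le y_le in \<open>auto simp: k_def A_def b_def input_reals_def\<close>)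
  obtain \<sigma> t where run: "run tester \<mu> \<delta> n s y = return_spmf (\<sigma>, t)"
    and t: "t \<le> 100 * (z * z) * (pcost tester * (b + 1))" and acc: "\<sigma> ''accept'' 0 = of_bool accepted"
    using tester_exec[OF order.refl] unfolding run_def by blast
  have "accepted \<longleftrightarrow> tester_accepts n s \<mu> y"
  proof -
    have "eta = tolerance n" "rate = grid_rate n \<mu>"
      unfolding eta_def rate_def by (simp_all add: Nv_def tolerance_def power2_eq_square A_def k_def
          grid_rate_def)
    then show ?thesis unfolding accepted_iff[OF s A0] tester_accepts_def by simp
  qed
  moreover have "real t \<le> 600 * real (pcost tester) * (C + 101) ^ 4 * J ^ 12"
  proof -
    have "1 \<le> z * z" using z96 by (cases z) auto
    then have "100 * (z * z) * (pcost tester * (b + 1)) \<le> 100 * (z * z) * (pcost tester * (6 * (z * z)))"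
      by (intro mult_left_mono) (auto simp: b_def)
    also have "\<dots> = 600 * pcost tester * z ^ 4" by (simp add: power4_eq_xxxx)
    finally have "real t \<le> real (600 * pcost tester * z ^ 4)" using t by linarith
    also have "\<dots> = 600 * real (pcost tester) * real z ^ 4" by simp
    also have "\<dots> \<le> 600 * real (pcost tester) * ((C + 101) * J ^ 3) ^ 4"
      using z_le by (intro mult_left_mono power_mono) auto
    also have "\<dots> = 600 * real (pcost tester) * (C + 101) ^ 4 * J ^ 12"
      by (simp add: power_mult_distrib power_mult[symmetric])
    finally show ?thesis .
  qed
  ultimately show ?thesis using run acc unfolding J_def by auto
qed

lemma floorlog_le_ln:
  assumes "n \<ge> 2"
  shows "real (floorlog 2 n) \<le> 3 * ln (real n)"
proof -
  define L where "L = floorlog 2 n"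
  have "L \<ge> 1" "2 ^ (L - 1) \<le> n" unfolding L_def using floorlog_2_bounds[OF assms] by auto
  have ln2: "2 / 3 \<le> ln (2 :: real)" by (rule ln2_ge_two_thirds)
  have "real (2 ^ (L - 1)) \<le> real n" using \<open>2 ^ (L - 1) \<le> n\<close> by (simp only: of_nat_le_iff)
  then have "ln (2 ^ (L - 1)) \<le> ln (real n)" using assms by (subst ln_le_cancel_iff) auto
  then have "real (L - 1) * ln 2 \<le> ln (real n)" by (simp add: ln_realpow)
  moreover have "real (L - 1) * (2 / 3) \<le> real (L - 1) * ln 2" using ln2 by (intro mult_left_mono) auto
  moreover have "ln 2 \<le> ln (real n)" using assms by simp
  moreover have "real (L - 1) = real L - 1" using \<open>L \<ge> 1\<close> by simp
  ultimately have "real L \<le> 3 * ln (real n)" using ln2 by linarith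
  then show ?thesis unfolding L_def .
qed

section \<open>Choice of the absolute constant\<close>

locale tester_setup =
  fixes \<mu> \<delta> :: real and n s :: nat
  assumes \<mu>: "\<mu> > 0" and \<delta>: "0 < \<delta>" "\<delta> < 1" and n: "n \<ge> 2"
    and s: "90 * 2 ^ 48 * (ln (real n))\<^sup>2 * (ln (real n) + ln (1 + \<mu>) + ln (1 / \<delta>)) \<le> real s"
begin

abbreviation "L \<equiv> floorlog 2 n"
abbreviation "\<eta> \<equiv> tolerance n"

lemmas L = floorlog_2_bounds(2,1,4)[OF n]

lemma tolerance_bounds: "0 < \<eta>" "\<eta> \<le> 1 / 2 ^ 48" "(real L + 1)\<^sup>2 * \<eta> \<le> 1 / 2 ^ 40"
proof -
  have "1\<^sup>2 \<le> (real L)\<^sup>2" using L by (intro power_mono) auto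
  then show "0 < \<eta>" "\<eta> \<le> 1 / 2 ^ 48" using L by (auto simp: tolerance_def divide_simps)
  have "(real L + 1)\<^sup>2 \<le> (2 * real L)\<^sup>2" using L by (intro power_mono) auto
  then have "(real L + 1)\<^sup>2 * \<eta> \<le> (2 * real L)\<^sup>2 * \<eta>" using \<open>0 < \<eta>\<close> by (intro mult_right_mono) auto
  also have "\<dots> = 4 / 2 ^ 48" using L by (simp add: tolerance_def power_mult_distrib)
  also have "\<dots> \<le> 1 / 2 ^ 40" by simp
  finally show "(real L + 1)\<^sup>2 * \<eta> \<le> 1 / 2 ^ 40" .
qed

text \<open>The factor 90 is 10 * 9: \<open>L \<le> 3 * ln n\<close> costs 9, and 10 is the exponent
  of the power of n that dominates the number of events in the union bounds.\<close>

lemma exponent: "10 * ln (real n) + ln (1 / \<delta>) \<le> real s * \<eta>"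
proof -
  define l where "l = ln (real n)"
  have l: "l > 0" using n by (simp add: l_def)
  have "0 \<le> ln (1 + \<mu>)" "0 \<le> ln (1 / \<delta>)" using \<mu> \<delta> by simp_all
  then have "10 * l + ln (1 / \<delta>) \<le> 10 * (l + ln (1 + \<mu>) + ln (1 / \<delta>))" by simp
  also have "\<dots> = 90 * 2 ^ 48 * l\<^sup>2 * (l + ln (1 + \<mu>) + ln (1 / \<delta>)) * (1 / (2 ^ 48 * (3 * l)\<^sup>2))"
    using l by (simp add: power_mult_distrib)
  also have "\<dots> \<le> real s * (1 / (2 ^ 48 * (real L)\<^sup>2))"
  proof (rule mult_mono)
    show "90 * 2 ^ 48 * l\<^sup>2 * (l + ln (1 + \<mu>) + ln (1 / \<delta>)) \<le> real s" using s by (simp add: l_def)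
    have "(real L)\<^sup>2 \<le> (3 * l)\<^sup>2" unfolding l_def using floorlog_le_ln[OF n] by (intro power_mono) auto
    then show "1 / (2 ^ 48 * (3 * l)\<^sup>2) \<le> 1 / (2 ^ 48 * (real L)\<^sup>2)" using L l
        by (intro divide_left_mono mult_left_mono) auto
  qed (use l in auto)
  finally show ?thesis unfolding l_def tolerance_def .
qed

lemma n_powers: "2 * real n + 2 * real L + 3 \<le> real n ^ 10" "4 \<le> real n ^ 10"
proof -
  have "2 ^ 9 \<le> real n ^ 9" using n by (intro power_mono) auto
  then have "2 ^ 9 * real n \<le> real n ^ 9 * real n" by (rule mult_right_mono) simp
  also have "\<dots> = real n ^ 10" by (simp add: power_Suc2[symmetric])
  finally have "512 * real n \<le> real n ^ 10" by simp
  moreover have "real L \<le> real n" "2 \<le> real n" using L n by auto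
  ultimately show "2 * real n + 2 * real L + 3 \<le> real n ^ 10" "4 \<le> real n ^ 10" by linarith+
qed

lemma exp_le: "real n ^ 10 * exp (- (real s * \<eta>)) \<le> \<delta>"
proof -
  have e: "real n ^ 10 = exp (10 * ln (real n))" using exp_of_nat_mult[of 10 "ln (real n)"] n by simp
  have "real n ^ 10 * exp (- (real s * \<eta>)) = exp (10 * ln (real n) - real s * \<eta>)"
    unfolding e by (simp add: exp_add[symmetric])
  also have "\<dots> \<le> exp (ln \<delta>)" unfolding exp_le_cancel_iff using exponent \<delta> by (simp add: ln_div)
  finally show ?thesis using \<delta> by simp
qed

lemma K: "real s * \<eta> \<ge> 1"
proof -
  have "2 / 3 \<le> ln (2 :: real)" by (rule ln2_ge_two_thirds)
  also have "\<dots> \<le> ln (real n)" using n by simp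
  finally have "2 / 3 \<le> ln (real n)" .
  moreover have "0 \<le> ln (1 / \<delta>)" using \<delta> by simp
  ultimately show ?thesis using exponent by linarith
qed

lemma s_ge_2: "s \<ge> 2"
proof -
  have "real s * \<eta> \<le> real s * (1 / 2 ^ 48)" using tolerance_bounds by (intro mult_left_mono) auto
  then have "real s \<ge> 2" using K by simp
  then show ?thesis by simp
qed

sublocale tester_analysis n s L \<mu> "grid_rate n \<mu>" \<eta> "1 / 2 ^ (8 * n + 96)"
proof
  define k where "k = 8 * n + 96"
  have "real_of_int \<lfloor>2 ^ k * \<mu>\<rfloor> \<le> 2 ^ k * \<mu>" "2 ^ k * \<mu> \<le> real_of_int \<lfloor>2 ^ k * \<mu>\<rfloor> + 1" by linarith+
  then show "grid_rate n \<mu> \<le> \<mu>" "\<mu> \<le> grid_rate n \<mu> + 1 / 2 ^ (8 * n + 96)"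
    unfolding grid_rate_def k_def[symmetric] by (simp_all add: field_simps)
  show "0 \<le> grid_rate n \<mu>" unfolding grid_rate_def using \<mu> by simp
  \<comment> \<open>This is the rounding condition: \<open>\<eta>\<^sup>2\<close> equals 1 / (2^96
    L^4).\<close>
  have "n * L ^ 4 \<le> 2 ^ n * (2 ^ n) ^ 4"
    using L(2) less_exp[of n] by (intro mult_mono power_mono; linarith)
  also have "\<dots> = 2 ^ (n + n * 4)" unfolding power_add power_mult ..
  also have "\<dots> \<le> 2 ^ (8 * n)" by (intro power_increasing) auto
  finally have "real (n * L ^ 4) \<le> real (2 ^ (8 * n))" by (simp only: of_nat_le_iff)
  then have "real n * real L ^ 4 * 2 ^ 96 \<le> 2 ^ k" unfolding k_def power_add by simp
  then have "real n * (1 / 2 ^ k) \<le> 1 / (2 ^ 96 * real L ^ 4)" using L by (simp add: divide_simps mult_ac)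
  also have "\<dots> = \<eta>\<^sup>2" by (simp add: tolerance_def power2_eq_square power4_eq_xxxx)
  finally show "real n * (1 / 2 ^ (8 * n + 96)) \<le> \<eta>\<^sup>2" unfolding k_def .
  show "\<eta> \<le> 1 / 2 ^ 44" using tolerance_bounds(2) by simp
qed (use n s_ge_2 \<mu> tolerance_bounds L K in auto)

lemma null_accepted': "measure_pmf.prob (Prod_dist n (\<lambda>_. Poi (real s * \<mu>))) {y. \<not> tester_accepts n s \<mu> y} \<le> \<delta>"
proof -
  have "(2 * real n + 2 * real L + 3) * exp (- (real s * \<eta>)) \<le> real n ^ 10 * exp (- (real s * \<eta>))"
    using n_powers by (intro mult_right_mono) auto
  then show ?thesis using null_accepted exp_le unfolding tester_accepts_def by linarith
qed

lemma alternative_rejected':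
  assumes "\<And>j. j < n \<Longrightarrow> r j \<ge> 0"
    and "d_TV (Prod_dist n (\<lambda>_. Poi \<mu>)) (Perm_dist n (\<lambda>i. Poi (r i))) \<ge> 1 / 2"
  shows "measure_pmf.prob (Prod_dist n (\<lambda>j. Poi (real s * r j))) {y. tester_accepts n s \<mu> y} \<le> \<delta>"
proof -
  have "4 * exp (- (real s * \<eta>)) \<le> real n ^ 10 * exp (- (real s * \<eta>))"
    using n_powers by (intro mult_right_mono) auto
  then show ?thesis using alternative_rejected[OF assms] exp_le unfolding tester_accepts_def by linarith
qed

end

section \<open>From rates in a fixed order to a random permutation\<close>

lemma Perm_dist_permute:
  assumes \<pi>: "\<pi> permutes {..<n}"
  shows "Perm_dist n (\<lambda>i. p (\<pi> i)) = Perm_dist n p"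
proof -
  have "pmf_of_set {\<sigma>. \<sigma> permutes {..<n}} = map_pmf ((\<circ>) \<pi>) (pmf_of_set {\<sigma>. \<sigma> permutes {..<n}})"
  proof (subst map_pmf_of_set_inj)
    show "inj_on ((\<circ>) \<pi>) {\<sigma>. \<sigma> permutes {..<n}}"
      using permutes_inj[OF \<pi>] by (auto simp: inj_on_def fun_eq_iff inj_def)
    show "{\<sigma>. \<sigma> permutes {..<n}} \<noteq> {}" using permutes_id by blast
    show "finite {\<sigma>. \<sigma> permutes {..<n}}" by (rule finite_permutes_lessThan)
    have "(\<circ>) \<pi> ` {\<sigma>. \<sigma> permutes {..<n}} = {\<sigma>. \<sigma> permutes {..<n}}"
    proof safe
      fix \<sigma> assume "\<sigma> permutes {..<n}"
      then show "\<pi> \<circ> \<sigma> permutes {..<n}" using \<pi> by (intro permutes_compose)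
    next
      fix \<sigma> assume "\<sigma> permutes {..<n}"
      then have "inv \<pi> \<circ> \<sigma> permutes {..<n}" by (intro permutes_compose permutes_inv \<pi>)
      moreover have "\<sigma> = \<pi> \<circ> (inv \<pi> \<circ> \<sigma>)" using permutes_inv_o(1)[OF \<pi>] by (metis comp_assoc id_comp)
      ultimately show "\<sigma> \<in> (\<circ>) \<pi> ` {\<sigma>. \<sigma> permutes {..<n}}" by blast
    qed
    then show "pmf_of_set {\<sigma>. \<sigma> permutes {..<n}} = pmf_of_set ((\<circ>) \<pi> ` {\<sigma>. \<sigma> permutes {..<n}})" by simp
  qed
  then have "Perm_dist n p = bind_pmf (map_pmf ((\<circ>) \<pi>) (pmf_of_set {\<sigma>. \<sigma> permutes {..<n}}))
      (\<lambda>\<sigma>. Prod_dist n (\<lambda>j. p (\<sigma> j)))"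
    unfolding Perm_dist_def by simp
  then show ?thesis unfolding Perm_dist_def bind_map_pmf by simp
qed

lemma prob_Perm_dist:
  "measure_pmf.prob (Perm_dist n p) E =
    (\<Sum>\<pi> | \<pi> permutes {..<n}. measure_pmf.prob (Prod_dist n (\<lambda>j. p (\<pi> j))) E) / fact n"
proof -
  have "\<bar>indicator E y :: real\<bar> \<le> 1" for y by (simp add: indicator_def)
  from expectation_Perm_dist[of "indicator E", OF this, of n p] show ?thesis by simp
qed

context tester_setup
begin

text \<open>Given the permutation \<pi>, the counts are independent with rates
  \<open>s * lam (\<pi> j)\<close>, and the permuted rates are as far from \<mu> as the original
  ones. The bound for each fixed order is averaged over \<pi>.\<close>

lemma alternative_rejected_Perm:
  assumes lam: "\<And>i. i < n \<Longrightarrow> lam i \<ge> 0"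
    and far: "d_TV (Prod_dist n (\<lambda>_. Poi \<mu>)) (Perm_dist n (\<lambda>i. Poi (lam i))) \<ge> 1 / 2"
  shows "measure_pmf.prob (Perm_dist n (\<lambda>i. Poi (real s * lam i))) {y. tester_accepts n s \<mu> y} \<le> \<delta>"
proof -
  have "measure_pmf.prob (Prod_dist n (\<lambda>j. Poi (real s * lam (\<pi> j)))) {y. tester_accepts n s \<mu> y} \<le> \<delta>"
    if \<pi>: "\<pi> permutes {..<n}" for \<pi>
  proof (rule alternative_rejected')
    show "lam (\<pi> j) \<ge> 0" if "j < n" for j using lam permutes_in_image[OF \<pi>, of j] that by simp
    show "d_TV (Prod_dist n (\<lambda>_. Poi \<mu>)) (Perm_dist n (\<lambda>i. Poi (lam (\<pi> i)))) \<ge> 1 / 2"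
      using far Perm_dist_permute[OF \<pi>, of "\<lambda>i. Poi (lam i)"] by simp
  qed
  then have "(\<Sum>\<pi> | \<pi> permutes {..<n}. measure_pmf.prob (Prod_dist n (\<lambda>j. Poi (real s * lam (\<pi> j))))
      {y. tester_accepts n s \<mu> y})
      \<le> (\<Sum>\<pi> | \<pi> permutes {..<n}. \<delta>)"
    by (intro sum_mono) simp
  also have "\<dots> = fact n * \<delta>" by (simp add: card_permutations[of _ n])
  finally show ?thesis unfolding prob_Perm_dist by (simp add: divide_le_eq mult.commute)
qed

end

lemma prob_not: "measure_pmf.prob D {y. \<not> P y} = 1 - measure_pmf.prob D {y. P y}"
proof -
  have "{y. \<not> P y} = UNIV - {y. P y}" by auto
  then show ?thesis using measure_pmf.prob_compl[of "{y. P y}" D] by simp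
qed

text \<open>For a deterministic answer all randomness is that of the input.\<close>

lemma spmf_answer_on:
  assumes "\<And>y. answer T \<mu> \<delta> n s y = return_spmf (P y)"
  shows "spmf (answer_on T \<mu> \<delta> n s D) v = measure_pmf.prob D {y. P y = v}"
proof -
  have "answer_on T \<mu> \<delta> n s D = spmf_of_pmf (map_pmf P D)"
    unfolding answer_on_def assms by (simp add: map_spmf_conv_bind_spmf[symmetric] map_spmf_of_pmf)
  then show ?thesis by (simp add: pmf_map vimage_def)
qed

theorem theorem5p1:
  shows "\<exists>C::real. C > 0 \<and> (\<exists>(T::prog) (c::real) (d::nat).
    \<forall>(\<mu>::real) (\<delta>::real) (n::nat). \<mu> > 0 \<longrightarrow> 0 < \<delta> \<longrightarrow> \<delta> < 1 \<longrightarrow> n \<ge> 2 \<longrightarrow>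
      (let s = nat \<lceil>C * (ln (real n))\<^sup>2 * (ln (real n) + ln (1 + \<mu>) + ln (1 / \<delta>))\<rceil> in
        (\<forall>y::nat \<Rightarrow> nat. runs_within T \<mu> \<delta> n s y (c * input_size \<mu> \<delta> n y ^ d)) \<and>
        spmf (answer_on T \<mu> \<delta> n s (Prod_dist n (\<lambda>_. Poi (real s * \<mu>)))) True \<ge> 1 - \<delta> \<and>
        (\<forall>lam::nat \<Rightarrow> real.
          (\<forall>i<n. lam i \<ge> 0) \<longrightarrow>
          d_TV (Prod_dist n (\<lambda>_. Poi \<mu>)) (Perm_dist n (\<lambda>i. Poi (lam i))) \<ge> 1 / 2 \<longrightarrow>
          spmf (answer_on T \<mu> \<delta> n s (Perm_dist n (\<lambda>i. Poi (real s * lam i)))) False \<ge> 1 - \<delta>)))"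
proof -
  define C :: real where "C = 90 * 2 ^ 48"
  define c where "c = 600 * real (pcost tester) * (C + 101) ^ 4"
  have "let s = nat \<lceil>C * (ln (real n))\<^sup>2 * (ln (real n) + ln (1 + \<mu>) + ln (1 / \<delta>))\<rceil> in
        (\<forall>y::nat \<Rightarrow> nat. runs_within tester \<mu> \<delta> n s y (c * input_size \<mu> \<delta> n y ^ 12)) \<and>
        spmf (answer_on tester \<mu> \<delta> n s (Prod_dist n (\<lambda>_. Poi (real s * \<mu>)))) True \<ge> 1 - \<delta> \<and>
        (\<forall>lam::nat \<Rightarrow> real.
          (\<forall>i<n. lam i \<ge> 0) \<longrightarrow>
          d_TV (Prod_dist n (\<lambda>_. Poi \<mu>)) (Perm_dist n (\<lambda>i. Poi (lam i))) \<ge> 1 / 2 \<longrightarrow>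
          spmf (answer_on tester \<mu> \<delta> n s (Perm_dist n (\<lambda>i. Poi (real s * lam i)))) False \<ge> 1 - \<delta>)"
    if \<mu>: "\<mu> > 0" and \<delta>: "0 < \<delta>" "\<delta> < 1" and n: "n \<ge> 2" for \<mu> \<delta> :: real and n :: nat
  proof -
    define v where "v = C * (ln (real n))\<^sup>2 * (ln (real n) + ln (1 + \<mu>) + ln (1 / \<delta>))"
    define s where "s = nat \<lceil>v\<rceil>"
    have "v \<ge> 0"
    proof -
      have "0 \<le> ln (real n)" "0 \<le> ln (1 + \<mu>)" "0 \<le> ln (1 / \<delta>)" using \<mu> \<delta> n by simp_all
      then show ?thesis unfolding v_def C_def by simp
    qed
    then have sv: "v \<le> real s" "real s \<le> v + 1" unfolding s_def by linarith+
    interpret tester_setup \<mu> \<delta> n s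
      by unfold_locales (use \<mu> \<delta> n sv(1) in \<open>auto simp: v_def C_def\<close>)
    have run: "\<exists>\<sigma> t. run tester \<mu> \<delta> n s y = return_spmf (\<sigma>, t) \<and>
       real t \<le> c * input_size \<mu> \<delta> n y ^ 12 \<and> (\<sigma> ''accept'' 0 \<noteq> 0 \<longleftrightarrow> tester_accepts n s \<mu> y)" for y
      unfolding c_def by (rule run_tester) (use \<mu> \<delta> n s_ge_2 sv(2) in \<open>auto simp: v_def C_def\<close>)
    have "runs_within tester \<mu> \<delta> n s y (c * input_size \<mu> \<delta> n y ^ 12)" for y
      using run[of y] by (auto simp: runs_within_def)
    moreover have answer: "answer tester \<mu> \<delta> n s y = return_spmf (tester_accepts n s \<mu> y)" for y
      using run[of y] by (auto simp: answer_def)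
    note spmf_eq = spmf_answer_on[OF answer]
    have "spmf (answer_on tester \<mu> \<delta> n s (Prod_dist n (\<lambda>_. Poi (real s * \<mu>)))) True \<ge> 1 - \<delta>"
      using null_accepted' unfolding prob_not spmf_eq by simp
    moreover have "spmf (answer_on tester \<mu> \<delta> n s (Perm_dist n (\<lambda>i. Poi (real s * lam i)))) False \<ge> 1 - \<delta>"
      if "\<forall>i<n. lam i \<ge> 0" "d_TV (Prod_dist n (\<lambda>_. Poi \<mu>)) (Perm_dist n (\<lambda>i. Poi (lam i))) \<ge> 1 / 2" for lam
      using alternative_rejected_Perm[of lam] that unfolding spmf_eq by (simp add: prob_not)
    ultimately show ?thesis unfolding v_def[symmetric] s_def[symmetric] Let_def by blast
  qed
  moreover have "C > 0" by (simp add: C_def)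
  ultimately show ?thesis by blast
qed

end
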